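(* Let $m$ be a positive integer, let $b\in BMO(\mathbb{R}^n)$, let $T$ be a Calderón–Zygmund operator on $\mathbb{R}^n$, let $w$ be a weight on $\mathbb{R}^n$, and let $\varepsilon:[1,\infty)\to[1,\infty)$ be an increasing function. Then there is a constant $c_{n,T,m}>0$ depending only on $n$, $T$ and $m$ such that for every $t>0$ and every bounded compactly supported function $f$, \[ w\left(\left\{x\in\mathbb{R}^n:\ |T_b^m f(x)|>t\right\}\right)\le \kappa_\varepsilon\int_{\mathbb{R}^n}\Phi_m\!\left(\frac{\|b\|_{BMO}^m|f(x)|}{t}\right)M_{\varepsilon,L(\log L)^m,m+1}w(x)\,dx, \] where $\kappa_\varepsilon=c_{n,T,m}\max\left\{\sum_{r=0}^\infty\frac{1}{\varepsilon(2^{2^r})},\,1\right\}$ (the inequality being trivial if the series diverges).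
   Context: A weight is a non-negative locally integrable function. Cubes have sides parallel to the axes; $\langle w\rangle_Q=\frac{1}{|Q|}\int_Q w$. For a Young function $A$ (convex, $A(0)=0$, $A(t)/t\to\infty$) and a cube $Q$, $\|f\|_{A,Q}=\inf\{\lambda>0:\frac{1}{|Q|}\int_Q A(|f|/\lambda)\le 1\}$; $\|f\|_{L(\log L)^k,Q}$ denotes this with $A(t)=t\log^k(e+t)$, and $\|f\|_{A,Q}$ with $A(t)=t$ is just $\langle |f|\rangle_Q$. For a positive integer $k$ and a cube $Q$, $\rho_{k,w}(Q)=\|w\|_{L(\log L)^k,Q}/\langle w\rangle_Q$. Given a Young function $A$, a positive integer $k$ and an increasing $\varepsilon:[1,\infty)\to[1,\infty)$, \[ M_{\varepsilon,A,k}w(x)=\sup_{Q\ni x}\|w\|_{A,Q}\,\log_2\!\big(2+\rho_{k,w}(Q)\big)\,\varepsilon\big(\rho_{k,w}(Q)\big). \] $\Phi_m(t)=t\log^m(e+t)$. The iterated commutator is defined by $T_b^1f=bTf-T(bf)$ and $T_b^mf=b\,T_b^{m-1}f-T_b^{m-1}(bf)$ for $m\ge2$. A Calderón–Zygmund operator is an $L^2$-bounded linear operator with a standard Calderón–Zygmund kernel. *)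

theory Defs
  imports "HOL-Analysis.Analysis"
begin

text \<open>Cubes with sides parallel to the axes (closed; boundaries are null sets).\<close>
definition cube :: "'a::euclidean_space set \<Rightarrow> bool" where
  "cube Q \<longleftrightarrow> (\<exists>a l. l > 0 \<and> Q = cbox a (a + l *\<^sub>R One))"

definition locally_integrable :: "('a::euclidean_space \<Rightarrow> real) \<Rightarrow> bool" where
  "locally_integrable w \<longleftrightarrow> w \<in> borel_measurable lebesgue \<and>
     (\<forall>K. compact K \<longrightarrow> set_integrable lebesgue K w)"

definition weight :: "('a::euclidean_space \<Rightarrow> real) \<Rightarrow> bool" where
  "weight w \<longleftrightarrow> (\<forall>x. 0 \<le> w x) \<and> locally_integrable w"

definition avg :: "('a::euclidean_space \<Rightarrow> real) \<Rightarrow> 'a set \<Rightarrow> real" where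
  "avg w Q = set_lebesgue_integral lebesgue Q w / measure lebesgue Q"

definition bmo_norm :: "('a::euclidean_space \<Rightarrow> real) \<Rightarrow> ennreal" where
  "bmo_norm b = (SUP Q\<in>{Q. cube Q}. ennreal (avg (\<lambda>x. \<bar>b x - avg b Q\<bar>) Q))"

definition BMO :: "('a::euclidean_space \<Rightarrow> real) set" where
  "BMO = {b. locally_integrable b \<and> bmo_norm b < \<infinity>}"

text \<open>Luxemburg norm on a cube, with value \<infinity> if no admissible \<lambda> exists.\<close>
definition lux_norm :: "(real \<Rightarrow> real) \<Rightarrow> ('a::euclidean_space \<Rightarrow> real) \<Rightarrow> 'a set \<Rightarrow> ennreal" where
  "lux_norm A f Q = Inf {ennreal lam | lam. lam > 0 \<and>
      ennreal (1 / measure lebesgue Q) * (\<integral>\<^sup>+ x \<in> Q. ennreal (A (\<bar>f x\<bar> / lam)) \<partial>lebesgue) \<le> 1}"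

text \<open>\<Phi>_m(t) = t log^m(e+t); this is also the Young function of L(log L)^m.\<close>
definition Phi :: "nat \<Rightarrow> real \<Rightarrow> real" where
  "Phi m t = t * (ln (exp 1 + t)) ^ m"

definition rho :: "nat \<Rightarrow> ('a::euclidean_space \<Rightarrow> real) \<Rightarrow> 'a set \<Rightarrow> real" where
  "rho k w Q = enn2real (lux_norm (Phi k) w Q) / avg w Q"

text \<open>The quantity inside the supremum defining M_{\<epsilon>,A,k} w; convention: it is 0
  when the average of w on Q vanishes (then w = 0 a.e. on Q), and \<infinity> when
  the L(log L)^k norm is infinite.\<close>
definition Mterm :: "(real \<Rightarrow> real) \<Rightarrow> (real \<Rightarrow> real) \<Rightarrow> nat \<Rightarrow> ('a::euclidean_space \<Rightarrow> real)
    \<Rightarrow> 'a set \<Rightarrow> ennreal" where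
  "Mterm eps A k w Q =
     (if avg w Q = 0 then 0
      else if lux_norm (Phi k) w Q = \<infinity> then \<infinity>
      else lux_norm A w Q * ennreal (log 2 (2 + rho k w Q) * eps (rho k w Q)))"

definition M_eps :: "(real \<Rightarrow> real) \<Rightarrow> (real \<Rightarrow> real) \<Rightarrow> nat \<Rightarrow> ('a::euclidean_space \<Rightarrow> real)
    \<Rightarrow> 'a \<Rightarrow> ennreal" where
  "M_eps eps A k w x = (SUP Q\<in>{Q. cube Q \<and> x \<in> Q}. Mterm eps A k w Q)"

fun iter_comm :: "(('a \<Rightarrow> complex) \<Rightarrow> ('a \<Rightarrow> complex)) \<Rightarrow> ('a \<Rightarrow> real) \<Rightarrow> nat
    \<Rightarrow> ('a \<Rightarrow> complex) \<Rightarrow> ('a \<Rightarrow> complex)" where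
  "iter_comm T b 0 = T"
| "iter_comm T b (Suc m) = (\<lambda>f x. of_real (b x) * iter_comm T b m f x
      - iter_comm T b m (\<lambda>y. of_real (b y) * f y) x)"

definition L2 :: "('a::euclidean_space \<Rightarrow> complex) \<Rightarrow> bool" where
  "L2 f \<longleftrightarrow> f \<in> borel_measurable lebesgue \<and> integrable lebesgue (\<lambda>x. (norm (f x))\<^sup>2)"

definition CZ_kernel :: "('a::euclidean_space \<Rightarrow> 'a \<Rightarrow> complex) \<Rightarrow> bool" where
  "CZ_kernel K \<longleftrightarrow> (\<exists>C \<delta>. C > 0 \<and> 0 < \<delta> \<and> \<delta> \<le> 1 \<and>
     (\<forall>x y. x \<noteq> y \<longrightarrow> norm (K x y) \<le> C / dist x y ^ DIM('a)) \<and>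
     (\<forall>x x' y. x \<noteq> y \<and> 2 * dist x x' \<le> dist x y \<longrightarrow>
        norm (K x y - K x' y) + norm (K y x - K y x')
          \<le> C * dist x x' powr \<delta> / dist x y powr (real DIM('a) + \<delta>)))"

definition CZO :: "(('a::euclidean_space \<Rightarrow> complex) \<Rightarrow> ('a \<Rightarrow> complex)) \<Rightarrow> bool" where
  "CZO T \<longleftrightarrow> (\<exists>K. CZ_kernel K \<and>
     (\<forall>f. L2 f \<longrightarrow> L2 (T f)) \<and>
     (\<forall>f g. L2 f \<and> (AE x in lebesgue. f x = g x) \<longrightarrow> (AE x in lebesgue. T f x = T g x)) \<and>
     (\<forall>f g c. L2 f \<and> L2 g \<longrightarrow>
        (AE x in lebesgue. T (\<lambda>y. c * f y + g y) x = c * T f x + T g x)) \<and>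
     (\<exists>C. \<forall>f. L2 f \<longrightarrow>
        (\<integral>x. (norm (T f x))\<^sup>2 \<partial>lebesgue) \<le> C * (\<integral>x. (norm (f x))\<^sup>2 \<partial>lebesgue)) \<and>
     (\<forall>f S. L2 f \<and> compact S \<and> (\<forall>y. y \<notin> S \<longrightarrow> f y = 0) \<longrightarrow>
        (AE x in lebesgue. x \<notin> S \<longrightarrow> T f x = (\<integral>y. K x y * f y \<partial>lebesgue))))"

end

theory Submission
  imports Defs
begin

text \<open>
  \<open>T\<close> is of weak type (1,1) by the Calderon-Zygmund decomposition. Kernel regularity bounds the
  oscillation on a cube \<open>P\<close> of \<open>T\<close> applied to the part of a function far from \<open>P\<close> by the
  Hardy-Littlewood maximal function, so a stopping-time argument dominates the iterated commutator almost
  everywhere on a large cube by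
  \[ \sum_Q \Big( \langle |f| \rangle_R \, |b - b_R|^m + \langle |f| \, |b - b_R|^m \rangle_R \Big) 1_Q , \]
  where \<open>Q\<close> runs over a sparse family and \<open>R\<close> is a fixed dilate of \<open>Q\<close>.

  The cubes are sorted by the size \<open>L^(-k)\<close> of the average of \<open>f\<close>. On the complement of a
  subset of \<open>Q\<close> of measure at most \<open>exp (- c 2^k) |Q|\<close> the \<open>k\<close>-th layer is pointwise bounded by
  a small multiple of \<open>2^(-k)\<close>. On that subset, John-Nirenberg and a pointwise Young inequality bound the
  integral of \<open>|b - b_R|^m w\<close> by \<open>|R| min (||w||_m, 2^(-k) ||w||_(m+1))\<close>, with \<open>||w||_j\<close> the
  \<open>L (log L)^j\<close> norm on \<open>R\<close>; hence layer \<open>k\<close> matters only for cubes whose entropy ratio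
  exceeds \<open>2^(k/2)\<close>, and the sum over \<open>k\<close> is the condensed series of \<open>1 / eps (2^(2^r))\<close>.
  Packing of the sparse family together with Vitali's covering lemma turns each layer into an integral of
  \<open>f\<close> against the maximal function.
\<close>

section \<open>Half-open cubes and stopping cubes\<close>

text \<open>The obstacle is that \<open>w\<close> satisfies no doubling or A_p condition, so a layer
  of the sparse sum can be paid for only through the smallness of the exceptional subset of each
  cube. On a subset of measure about exp(-tau 2^k) |R| the constant v = kap 2^k is as exponentially
  integrable as |b - b_R| itself. Multiplying |b - b_R|^m by max(|b - b_R|, v) / v therefore costs
  one logarithm on the weight and gains 2^(-k): this is why the entropy ratio has order m + 1 while
  the norm in front has order m. When the ratio is small that gain wins outright; when it is large,
  the factor log_2(2 + r) of the maximal function supplies exactly the 1/k that Cauchy condensation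
  needs to reach the double exponentials 2^(2^r). The base of the layers is 4^(m+1), because off the
  exceptional subset a layer contributes average times oscillation power times overlap, that is
  4^(-(m+1)k) * 2^(km) * 2^k, and this must be summable. Homogeneity reduces to the unit ball of BMO
  and to height 1, so constants involve only \<open>T\<close>, the dimension and
  \<open>m\<close>.\<close>

declare emeasure_completion [simp del]

text \<open>A cube is stored as corner and side length. Half-open cubes tile space exactly, whereas
  averages and norms live on closed cubes; the two differ by a null set.\<close>

definition hcube :: "'a::euclidean_space \<times> real \<Rightarrow> 'a set" where
  "hcube q = {y. \<forall>i\<in>Basis. fst q \<bullet> i \<le> y \<bullet> i \<and> y \<bullet> i < fst q \<bullet> i + snd q}"

text \<open>The cell of generation \<open>j\<close> around \<open>x\<close> in the dyadic grid
  generated by \<open>q\<close>. The floor extends the grid beyond \<open>q\<close>, so the cell is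
  defined for every \<open>x\<close>.\<close>

definition dyad :: "'a::euclidean_space \<times> real \<Rightarrow> nat \<Rightarrow> 'a \<Rightarrow> 'a \<times> real" where
  "dyad q j x = (fst q + (\<Sum>i\<in>Basis. (snd q / 2 ^ j * \<lfloor>2 ^ j * ((x - fst q) \<bullet> i) / snd q\<rfloor>) *\<^sub>R i), snd q / 2 ^ j)"

lemma box_hcube_cbox:
  "box (fst q) (fst q + snd q *\<^sub>R One) \<subseteq> hcube q" "hcube q \<subseteq> cbox (fst q) (fst q + snd q *\<^sub>R One)"
  by (auto simp: hcube_def mem_box inner_add_left less_imp_le)

lemma AE_hcube_cbox: "AE x in lebesgue. x \<in> hcube q \<longleftrightarrow> x \<in> cbox (fst q) (fst q + snd q *\<^sub>R One)"
proof -
  have "negligible (cbox (fst q) (fst q + snd q *\<^sub>R One) - box (fst q) (fst q + snd q *\<^sub>R One))"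
    by (rule negligible_frontier_interval)
  then have "AE x in lebesgue. x \<notin> cbox (fst q) (fst q + snd q *\<^sub>R One) - box (fst q) (fst q + snd q *\<^sub>R One)"
    using negligible_iff_null_sets AE_not_in by blast
  then show ?thesis
    by eventually_elim (use box_hcube_cbox in blast)
qed

lemma hcube_borel [measurable]: "hcube q \<in> sets borel"
proof -
  have "hcube q = (\<Inter>i\<in>Basis. {y. fst q \<bullet> i \<le> y \<bullet> i} \<inter> {y. y \<bullet> i < fst q \<bullet> i + snd q})"
    by (auto simp: hcube_def)
  also have "\<dots> \<in> sets borel"
    by (intro sets.finite_INT sets.Int borel_closed borel_open closed_halfspace_component_ge open_halfspace_component_lt) auto
  finally show ?thesis .
qed

lemma hcube_lebesgue [measurable]: "hcube q \<in> sets lebesgue"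
  using hcube_borel by (simp add: sets_completionI_sets)

lemma emeasure_cube:
  fixes p :: "'a::euclidean_space"
  assumes "s \<ge> 0"
  shows "emeasure lebesgue (cbox p (p + s *\<^sub>R One)) = ennreal (s ^ DIM('a))"
  using assms by (simp add: emeasure_completion emeasure_lborel_cbox_eq inner_add_left)

lemma measure_cube:
  fixes p :: "'a::euclidean_space"
  assumes "s \<ge> 0"
  shows "measure lebesgue (cbox p (p + s *\<^sub>R One)) = s ^ DIM('a)"
  using emeasure_cube[OF assms, of p] assms by (simp add: measure_def)

lemma emeasure_hcube:
  assumes "snd q \<ge> 0"
  shows "emeasure lebesgue (hcube (q::'a::euclidean_space \<times> real)) = ennreal (snd q ^ DIM('a))"
proof -
  have "emeasure lebesgue (hcube q) = emeasure lebesgue (cbox (fst q) (fst q + snd q *\<^sub>R One))"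
    by (rule emeasure_eq_AE) (use AE_hcube_cbox[of q] in auto)
  then show ?thesis
    using emeasure_cube[OF assms] by simp
qed

text \<open>Membership becomes equality of integer coordinate vectors. Disjointness of cells is then
  immediate and nesting of generations is halving of floors.\<close>

lemma mem_hcube_dyad:
  assumes "snd q > 0"
  shows "y \<in> hcube (dyad q j x) \<longleftrightarrow>
    (\<forall>i\<in>Basis. \<lfloor>2 ^ j * ((y - fst q) \<bullet> i) / snd q\<rfloor> = \<lfloor>2 ^ j * ((x - fst q) \<bullet> i) / snd q\<rfloor>)"
proof -
  have "(fst (dyad q j x) \<bullet> i \<le> y \<bullet> i \<and> y \<bullet> i < fst (dyad q j x) \<bullet> i + snd (dyad q j x)) \<longleftrightarrow>
     \<lfloor>2 ^ j * ((y - fst q) \<bullet> i) / snd q\<rfloor> = \<lfloor>2 ^ j * ((x - fst q) \<bullet> i) / snd q\<rfloor>" if "i \<in> Basis" for i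
  proof -
    define k where "k = \<lfloor>2 ^ j * ((x - fst q) \<bullet> i) / snd q\<rfloor>"
    define t where "t = (2::real) ^ j"
    have t: "t > 0" by (simp add: t_def)
    have "fst (dyad q j x) \<bullet> i = fst q \<bullet> i + snd q / t * k"
      using that by (simp add: dyad_def inner_add_left inner_sum_left_Basis k_def t_def)
    moreover have "snd (dyad q j x) = snd q / t"
      by (simp add: dyad_def t_def)
    moreover have "\<lfloor>t * ((y - fst q) \<bullet> i) / snd q\<rfloor> = k \<longleftrightarrow>
       k \<le> t * ((y - fst q) \<bullet> i) / snd q \<and> t * ((y - fst q) \<bullet> i) / snd q < k + 1"
      by (simp add: floor_eq_iff)
    moreover have "k \<le> t * ((y - fst q) \<bullet> i) / snd q \<longleftrightarrow> fst q \<bullet> i + snd q / t * k \<le> y \<bullet> i"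
      using t assms by (simp add: field_simps inner_diff_left)
    moreover have "t * ((y - fst q) \<bullet> i) / snd q < k + 1 \<longleftrightarrow> y \<bullet> i < fst q \<bullet> i + snd q / t * k + snd q / t"
      using t assms by (simp add: field_simps inner_diff_left)
    ultimately show ?thesis by (simp add: k_def t_def)
  qed
  then show ?thesis by (auto simp: hcube_def)
qed

lemma self_dyad: "snd q > 0 \<Longrightarrow> x \<in> hcube (dyad q j x)"
  by (simp add: mem_hcube_dyad)

lemma dyad_eq: "snd q > 0 \<Longrightarrow> y \<in> hcube (dyad q j x) \<Longrightarrow> dyad q j y = dyad q j x"
  by (simp add: mem_hcube_dyad) (simp add: dyad_def)

lemma dyad_Suc_subset: assumes "snd q > 0" shows "hcube (dyad q (Suc j) x) \<subseteq> hcube (dyad q j x)"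
proof -
  have "\<lfloor>2 ^ j * z / s\<rfloor> = \<lfloor>2 ^ Suc j * z / s\<rfloor> div 2" for z s :: real
  proof -
    have "\<lfloor>(2 ^ Suc j * z / s) / real_of_int 2\<rfloor> = \<lfloor>2 ^ Suc j * z / s\<rfloor> div 2"
      by (rule floor_divide_real_eq_div) simp
    then show ?thesis by simp
  qed
  then show ?thesis
    using assms by (auto simp: mem_hcube_dyad simp del: power_Suc)
qed

lemma dyad_mono: assumes "snd q > 0" "i \<le> j" shows "hcube (dyad q j x) \<subseteq> hcube (dyad q i x)"
  using assms(2) by (induction j rule: dec_induct) (use dyad_Suc_subset[OF assms(1)] in blast)+

lemma dyad_0: assumes "snd q > 0" "x \<in> hcube q" shows "dyad q 0 x = q"
proof -
  have "\<lfloor>(x - fst q) \<bullet> i / snd q\<rfloor> = 0" if "i \<in> Basis" for i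
    using assms that by (auto simp: floor_eq_iff hcube_def inner_diff_left)
  then show ?thesis by (simp add: dyad_def)
qed

lemma snd_dyad: "snd (dyad q j x) = snd q / 2 ^ j"
  by (simp add: dyad_def)

text \<open>The crude l1 bound n s on the diameter of a cube is the unit in which the margin 2 n s
  of \<open>dilate\<close> and the ball radii are measured.\<close>

lemma dist_le_hcube:
  assumes "x \<in> cbox p (p + s *\<^sub>R One)" "y \<in> cbox p (p + s *\<^sub>R One)"
  shows "dist x (y::'a::euclidean_space) \<le> real DIM('a) * s"
proof -
  have "norm (x - y) \<le> (\<Sum>i\<in>Basis. \<bar>(x - y) \<bullet> i\<bar>)"
    by (rule norm_le_l1)
  also have "\<dots> \<le> (\<Sum>i\<in>(Basis::'a set). s)"
    by (rule sum_mono) (use assms in \<open>force simp: mem_box inner_diff_left inner_add_left abs_le_iff\<close>)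
  finally show ?thesis by (simp add: dist_norm)
qed

lemma dyad_in_open:
  assumes "snd q > 0" "open U" "x \<in> U"
  obtains j where "hcube (dyad q j x) \<subseteq> (U :: 'a::euclidean_space set)"
proof -
  obtain e where e: "e > 0" "ball x e \<subseteq> U"
    using assms openE by blast
  obtain j where j: "real DIM('a) * snd q / e < 2 ^ j"
    using real_arch_pow[of 2] by auto
  have "hcube (dyad q j x) \<subseteq> ball x e"
  proof
    fix y assume y: "y \<in> hcube (dyad q j x)"
    have "dist x y \<le> real DIM('a) * snd (dyad q j x)"
      using box_hcube_cbox(2) self_dyad[OF assms(1)] y by (intro dist_le_hcube) blast+
    also have "\<dots> < e"
      using j e by (simp add: snd_dyad field_simps)
    finally show "y \<in> ball x e" by simp
  qed
  with e that show ?thesis by blast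
qed

lemma countable_dyad: "countable (\<Union>j. range (dyad q j))"
proof -
  have "range (dyad q j) \<subseteq> (\<lambda>f. (fst q + (\<Sum>i\<in>Basis. (snd q / 2 ^ j * of_int (f i)) *\<^sub>R i), snd q / 2 ^ j)) ` (PiE Basis (\<lambda>_. UNIV))" for j
  proof
    fix z assume "z \<in> range (dyad q j)"
    then obtain x where "z = dyad q j x" by blast
    then show "z \<in> (\<lambda>f. (fst q + (\<Sum>i\<in>Basis. (snd q / 2 ^ j * of_int (f i)) *\<^sub>R i), snd q / 2 ^ j)) ` (PiE Basis (\<lambda>_. UNIV))"
      by (intro image_eqI[of _ _ "restrict (\<lambda>i. \<lfloor>2 ^ j * ((x - fst q) \<bullet> i) / snd q\<rfloor>) Basis"]) (auto simp: dyad_def)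
  qed
  moreover have "countable (PiE (Basis::'a set) (\<lambda>_. UNIV :: int set))"
    by (intro countable_PiE) auto
  ultimately have "countable (range (dyad q j))" for j
    by (meson countable_image countable_subset)
  then show ?thesis by blast
qed

text \<open>Maximal dyadic cubes: each point takes the first generation whose cell has the property,
  and a first cell cannot sit strictly inside another cell with the property. Applied both to a
  lower bound on averages and to containment in an open set.\<close>

lemma first_dyad_family:
  assumes q: "snd q > 0" and A: "A \<subseteq> hcube q"
    and ex: "\<And>x. x \<in> A \<Longrightarrow> \<exists>j. p (dyad q j x)"
  obtains P where "countable P" "disjoint_family_on hcube P" "A \<subseteq> (\<Union>r\<in>P. hcube r)"
    "\<And>r. r \<in> P \<Longrightarrow> \<exists>j x. x \<in> A \<and> r = dyad q j x \<and> p r \<and> (\<forall>i<j. \<not> p (dyad q i x))"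
proof -
  define P where "P = {dyad q j x | j x. x \<in> A \<and> p (dyad q j x) \<and> (\<forall>i<j. \<not> p (dyad q i x))}"
  have c: "countable P"
    by (rule countable_subset[OF _ countable_dyad[of q]]) (auto simp: P_def)
  have le: "j \<le> k" if "z \<in> hcube (dyad q j x)" "z \<in> hcube (dyad q k y)" "p (dyad q k y)"
     "\<forall>i<j. \<not> p (dyad q i x)" for j k x y z
  proof (rule ccontr)
    assume "\<not> j \<le> k"
    then have "z \<in> hcube (dyad q k x)" using dyad_mono[OF q, of k j x] that by auto
    then have "dyad q k x = dyad q k y"
      using dyad_eq[OF q] that(2) by metis
    with that \<open>\<not> j \<le> k\<close> show False by (metis not_le)
  qed
  have "disjoint_family_on hcube P"
    unfolding disjoint_family_on_def
  proof (intro ballI impI, rule ccontr)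
    fix r t assume rt: "r \<in> P" "t \<in> P" "r \<noteq> t" "hcube r \<inter> hcube t \<noteq> {}"
    then obtain z where z: "z \<in> hcube r" "z \<in> hcube t" by blast
    obtain j x where x: "r = dyad q j x" "p (dyad q j x)" "\<forall>i<j. \<not> p (dyad q i x)" using rt P_def by auto
    obtain k y where y: "t = dyad q k y" "p (dyad q k y)" "\<forall>i<k. \<not> p (dyad q i y)" using rt P_def by auto
    have "j = k" using le x y z by (metis le_antisym)
    then show False using dyad_eq[OF q] x y z rt(3) by metis
  qed
  moreover have "A \<subseteq> (\<Union>r\<in>P. hcube r)"
  proof
    fix x assume x: "x \<in> A"
    define j where "j = (LEAST j. p (dyad q j x))"
    have "p (dyad q j x)" unfolding j_def using ex[OF x] by (rule LeastI_ex)
    moreover have "\<forall>i<j. \<not> p (dyad q i x)" unfolding j_def using not_less_Least by blast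
    ultimately have "dyad q j x \<in> P" using x P_def by blast
    then show "x \<in> (\<Union>r\<in>P. hcube r)" using self_dyad[OF q] by blast
  qed
  moreover have "\<exists>j x. x \<in> A \<and> r = dyad q j x \<and> p r \<and> (\<forall>i<j. \<not> p (dyad q i x))" if "r \<in> P" for r
    using that unfolding P_def by blast
  ultimately show ?thesis using that c by blast
qed

section \<open>Sums over countable families as integrals over counting measure\<close>

lemma nn_integral_disjoint_UN:
  assumes "countable P" "disjoint_family_on A P" "g \<in> borel_measurable M"
    and "\<And>r. r \<in> P \<Longrightarrow> A r \<in> sets M"
  shows "(\<integral>\<^sup>+x\<in>(\<Union>r\<in>P. A r). g x \<partial>M) = (\<integral>\<^sup>+r. (\<integral>\<^sup>+x\<in>A r. g x \<partial>M) \<partial>count_space P)"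
proof -
  have "(\<integral>\<^sup>+r. (\<integral>\<^sup>+x. g x * indicator (A r) x \<partial>M) \<partial>count_space P) =
     (\<integral>\<^sup>+x. (\<integral>\<^sup>+r. g x * indicator (A r) x \<partial>count_space P) \<partial>M)"
    using assms by (intro nn_integral_count_space_nn_integral[symmetric]) auto
  also have "\<dots> = (\<integral>\<^sup>+x. g x * indicator (\<Union>r\<in>P. A r) x \<partial>M)"
  proof (rule nn_integral_cong)
    fix x
    have "(\<integral>\<^sup>+r. g x * indicator (A r) x \<partial>count_space P) = g x * (\<integral>\<^sup>+r. indicator (A r) x \<partial>count_space P)"
      by (rule nn_integral_cmult) auto
    also have "(\<integral>\<^sup>+r. indicator (A r) x \<partial>count_space P) = indicator (\<Union>r\<in>P. A r) x"
    proof (cases "x \<in> (\<Union>r\<in>P. A r)")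
      case True
      then obtain r where r: "r \<in> P" "x \<in> A r" by blast
      have "(\<integral>\<^sup>+t. indicator (A t) x \<partial>count_space P) = (\<integral>\<^sup>+t. indicator {r} t \<partial>count_space P)"
        using r assms(2) by (intro nn_integral_cong) (auto simp: indicator_def disjoint_family_on_def)
      also have "\<dots> = 1" using r by (simp add: one_ennreal_def)
      finally show ?thesis using True by simp
    next
      case False
      then have "(\<integral>\<^sup>+t. indicator (A t) x \<partial>count_space P) = (\<integral>\<^sup>+t. 0 \<partial>count_space P)"
        by (intro nn_integral_cong) (auto simp: indicator_def)
      then show ?thesis using False by simp
    qed
    finally show "(\<integral>\<^sup>+r. g x * indicator (A r) x \<partial>count_space P) = g x * indicator (\<Union>r\<in>P. A r) x" .
  qed
  finally show ?thesis by simp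
qed

lemma nn_integral_disjoint_hcube:
  assumes "countable P" "disjoint_family_on hcube P" "g \<in> borel_measurable lebesgue"
  shows "(\<integral>\<^sup>+x\<in>(\<Union>r\<in>P. hcube r). g x \<partial>lebesgue) = (\<integral>\<^sup>+r. (\<integral>\<^sup>+x\<in>hcube r. g x \<partial>lebesgue) \<partial>count_space P)"
  using assms by (intro nn_integral_disjoint_UN) auto

lemma emeasure_UN_le_count_space:
  assumes "countable P" "\<And>r. r \<in> P \<Longrightarrow> A r \<in> sets M"
  shows "emeasure M (\<Union>r\<in>P. A r) \<le> (\<integral>\<^sup>+r. emeasure M (A r) \<partial>count_space P)"
proof -
  have U: "(\<Union>r\<in>P. A r) \<in> sets M" using assms by (intro sets.countable_UN') auto
  have "emeasure M (\<Union>r\<in>P. A r) = (\<integral>\<^sup>+x. indicator (\<Union>r\<in>P. A r) x \<partial>M)" using U by simp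
  also have "\<dots> \<le> (\<integral>\<^sup>+x. (\<integral>\<^sup>+r. indicator (A r) x \<partial>count_space P) \<partial>M)"
  proof (rule nn_integral_mono)
    fix x
    show "indicator (\<Union>r\<in>P. A r) x \<le> (\<integral>\<^sup>+r. indicator (A r) x \<partial>count_space P)"
    proof (cases "x \<in> (\<Union>r\<in>P. A r)")
      case True
      then obtain r where r: "r \<in> P" "x \<in> A r" by blast
      then have "indicator (A r) x \<le> (\<integral>\<^sup>+r. indicator (A r) x \<partial>count_space P)"
        by (intro nn_integral_ge_point)
      then show ?thesis using True r by simp
    qed simp
  qed
  also have "\<dots> = (\<integral>\<^sup>+r. (\<integral>\<^sup>+x. indicator (A r) x \<partial>M) \<partial>count_space P)"
    using assms by (intro nn_integral_count_space_nn_integral) auto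
  also have "\<dots> = (\<integral>\<^sup>+r. emeasure M (A r) \<partial>count_space P)"
    using assms by (intro nn_integral_cong) auto
  finally show ?thesis .
qed

text \<open>The Calderon-Zygmund cubes at height \<open>lam\<close>: maximal cubes with larger
  average, where comparison with the rejected parent costs 2^n. The almost everywhere bound off the
  cubes comes from outer regularity of Lebesgue measure in place of the differentiation
  theorem.\<close>

lemma stopping_cubes:
  fixes g :: "'a::euclidean_space \<Rightarrow> ennreal"
  assumes q: "snd q > 0" and g [measurable]: "g \<in> borel_measurable lebesgue" and lam: "lam > 0"
    and le: "(\<integral>\<^sup>+x\<in>hcube q. g x \<partial>lebesgue) \<le> ennreal lam * emeasure lebesgue (hcube q)"
  obtains P where "countable P" "disjoint_family_on hcube P" "\<And>r. r \<in> P \<Longrightarrow> snd r > 0 \<and> hcube r \<subseteq> hcube q"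
    "\<And>r. r \<in> P \<Longrightarrow> ennreal lam * emeasure lebesgue (hcube r) \<le> (\<integral>\<^sup>+x\<in>hcube r. g x \<partial>lebesgue)"
    "\<And>r. r \<in> P \<Longrightarrow> (\<integral>\<^sup>+x\<in>hcube r. g x \<partial>lebesgue) \<le> ennreal (2 ^ DIM('a) * lam) * emeasure lebesgue (hcube r)"
    "AE x in lebesgue. x \<in> hcube q \<longrightarrow> x \<notin> (\<Union>r\<in>P. hcube r) \<longrightarrow> g x \<le> ennreal lam"
    "ennreal lam * emeasure lebesgue (\<Union>r\<in>P. hcube r) \<le> (\<integral>\<^sup>+x\<in>hcube q. g x \<partial>lebesgue)"
proof -
  let ?I = "\<lambda>r. \<integral>\<^sup>+x\<in>hcube r. g x \<partial>lebesgue"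
  define p where "p r \<longleftrightarrow> ennreal lam * emeasure lebesgue (hcube r) < ?I r" for r
  define A where "A = {x \<in> hcube q. \<exists>j. p (dyad q j x)}"
  obtain P where P: "countable P" "disjoint_family_on hcube P" "A \<subseteq> (\<Union>r\<in>P. hcube r)"
    and PP: "\<And>r. r \<in> P \<Longrightarrow> \<exists>j x. x \<in> A \<and> r = dyad q j x \<and> p r \<and> (\<forall>i<j. \<not> p (dyad q i x))"
    by (rule first_dyad_family[OF q, of A p]) (auto simp: A_def)
  have sub: "hcube (dyad q j x) \<subseteq> hcube q" if "x \<in> hcube q" for j x
    using dyad_mono[OF q, of 0 j x] dyad_0[OF q that] by simp
  have subP: "snd r > 0 \<and> hcube r \<subseteq> hcube q" if "r \<in> P" for r
    using PP[OF that] sub q by (auto simp: A_def snd_dyad)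
  have up: "?I r \<le> ennreal (2 ^ DIM('a) * lam) * emeasure lebesgue (hcube r)" if r: "r \<in> P" for r
  proof -
    obtain j x where x: "x \<in> hcube q" "r = dyad q j x" "p r" "\<forall>i<j. \<not> p (dyad q i x)"
      using PP[OF r] A_def by blast
    \<comment> \<open>The cube \<open>q\<close> itself fails the stopping criterion, so every chosen
      cube has a parent that was rejected.\<close>
    have "j \<noteq> 0"
    proof
      assume "j = 0"
      then have "r = q" using x dyad_0[OF q] by simp
      then show False using x(3) le by (simp add: p_def)
    qed
    then obtain i where i: "j = Suc i" using not0_implies_Suc by blast
    have "?I r \<le> ?I (dyad q i x)"
      using dyad_Suc_subset[OF q, of i x] x(2) i by (intro nn_integral_mono) (auto simp: indicator_def)
    also have "\<dots> \<le> ennreal lam * emeasure lebesgue (hcube (dyad q i x))"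
      using x(4) i by (auto simp: p_def not_less)
    also have "\<dots> = ennreal (2 ^ DIM('a) * lam) * emeasure lebesgue (hcube r)"
      using q lam i x(2) by (simp add: emeasure_hcube snd_dyad ennreal_mult[symmetric] power_divide power_mult_distrib)
    finally show ?thesis .
  qed
  have low: "ennreal lam * emeasure lebesgue (hcube r) \<le> ?I r" if "r \<in> P" for r
    using PP[OF that] by (auto simp: p_def)
  have UP: "(\<Union>r\<in>P. hcube r) \<in> sets lebesgue"
    using P(1) by (intro sets.countable_UN') auto
  have "ennreal lam * emeasure lebesgue (\<Union>r\<in>P. hcube r) = (\<integral>\<^sup>+x\<in>(\<Union>r\<in>P. hcube r). ennreal lam \<partial>lebesgue)"
    using UP by (simp add: nn_integral_cmult_indicator)
  also have "\<dots> = (\<integral>\<^sup>+r. (\<integral>\<^sup>+x\<in>hcube r. ennreal lam \<partial>lebesgue) \<partial>count_space P)"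
    using P by (intro nn_integral_disjoint_hcube) auto
  also have "\<dots> \<le> (\<integral>\<^sup>+r. ?I r \<partial>count_space P)"
    by (rule nn_integral_mono) (use low in \<open>auto simp: nn_integral_cmult_indicator\<close>)
  also have "\<dots> = (\<integral>\<^sup>+x\<in>(\<Union>r\<in>P. hcube r). g x \<partial>lebesgue)"
    using P by (intro nn_integral_disjoint_hcube[symmetric]) auto
  also have "\<dots> \<le> ?I q"
    using subP by (intro nn_integral_mono) (auto simp: indicator_def)
  finally have tot: "ennreal lam * emeasure lebesgue (\<Union>r\<in>P. hcube r) \<le> ?I q" .
  \<comment> \<open>The points violating the bound. The integral of \<open>g\<close> over
    \<open>B\<close> turns out to be at most \<open>lam\<close> times the measure of
    \<open>B\<close>, although \<open>g\<close> exceeds \<open>lam\<close> there; hence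
    \<open>B\<close> is null.\<close>
  define B where "B = {x \<in> hcube q - (\<Union>r\<in>P. hcube r). ennreal lam < g x}"
  have B [measurable]: "B \<in> sets lebesgue"
  proof -
    have "{x \<in> space lebesgue. ennreal lam < g x} \<in> sets lebesgue" by measurable
    then have "(hcube q - (\<Union>r\<in>P. hcube r)) \<inter> {x. ennreal lam < g x} \<in> sets lebesgue" using UP by auto
    moreover have "(hcube q - (\<Union>r\<in>P. hcube r)) \<inter> {x. ennreal lam < g x} = B" by (auto simp: B_def)
    ultimately show ?thesis by simp
  qed
  have Bfin: "emeasure lebesgue B < \<infinity>"
  proof -
    have "emeasure lebesgue B \<le> emeasure lebesgue (hcube q)" by (rule emeasure_mono) (auto simp: B_def)
    then show ?thesis using q by (simp add: emeasure_hcube le_less_trans)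
  qed
  have bound: "(\<integral>\<^sup>+x\<in>B. g x \<partial>lebesgue) \<le> ennreal lam * emeasure lebesgue B + ennreal lam * ennreal e"
    if e: "e > 0" for e
  proof -
    obtain U where U: "open U" "B \<subseteq> U" "U - B \<in> lmeasurable" "emeasure lebesgue (U - B) < ennreal e"
      using sets_lebesgue_outer_open[OF B e] by metis
    \<comment> \<open>Cover \<open>B\<close> by maximal dyadic cells inside the open set
      \<open>U\<close>. Each contains a point of \<open>B\<close>, so it fails the stopping
      criterion and has average at most \<open>lam\<close>.\<close>
    have notp: "\<not> p (dyad q j x)" if "x \<in> B" for j x
      using that P(3) by (auto simp: A_def B_def)
    obtain R where R: "countable R" "disjoint_family_on hcube R" "B \<subseteq> (\<Union>r\<in>R. hcube r)"
      and RR: "\<And>r. r \<in> R \<Longrightarrow> \<exists>j x. x \<in> B \<and> r = dyad q j x \<and> hcube r \<subseteq> U \<and> (\<forall>i<j. \<not> hcube (dyad q i x) \<subseteq> U)"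
    proof (rule first_dyad_family[OF q, of B "\<lambda>r. hcube r \<subseteq> U"])
      show "B \<subseteq> hcube q" by (auto simp: B_def)
      show "\<exists>j. hcube (dyad q j x) \<subseteq> U" if "x \<in> B" for x
        using dyad_in_open[OF q U(1)] U(2) that by blast
    qed blast
    have Um: "U \<in> sets lebesgue" using U(1) by simp
    have RU: "(\<Union>r\<in>R. hcube r) \<subseteq> U" using RR by blast
    have UR: "(\<Union>r\<in>R. hcube r) \<in> sets lebesgue" using R(1) by (intro sets.countable_UN') auto
    have "(\<integral>\<^sup>+x\<in>B. g x \<partial>lebesgue) \<le> (\<integral>\<^sup>+x\<in>(\<Union>r\<in>R. hcube r). g x \<partial>lebesgue)"
      using R(3) by (intro nn_integral_mono) (auto simp: indicator_def)
    also have "\<dots> = (\<integral>\<^sup>+r. ?I r \<partial>count_space R)"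
      using R by (intro nn_integral_disjoint_hcube) auto
    also have "\<dots> \<le> (\<integral>\<^sup>+r. (\<integral>\<^sup>+x\<in>hcube r. ennreal lam \<partial>lebesgue) \<partial>count_space R)"
      by (rule nn_integral_mono) (use RR notp in \<open>fastforce simp: nn_integral_cmult_indicator p_def not_less\<close>)
    also have "\<dots> = (\<integral>\<^sup>+x\<in>(\<Union>r\<in>R. hcube r). ennreal lam \<partial>lebesgue)"
      using R by (intro nn_integral_disjoint_hcube[symmetric]) auto
    also have "\<dots> = ennreal lam * emeasure lebesgue (\<Union>r\<in>R. hcube r)"
      using UR by (simp add: nn_integral_cmult_indicator)
    also have "\<dots> \<le> ennreal lam * emeasure lebesgue U"
      using RU Um by (intro mult_left_mono emeasure_mono) auto
    also have "emeasure lebesgue U \<le> emeasure lebesgue B + emeasure lebesgue (U - B)"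
      using emeasure_subadditive[OF B, of "U - B"] U Um by (simp add: Un_absorb1)
    also have "\<dots> \<le> emeasure lebesgue B + ennreal e"
      using U(4) by (intro add_left_mono) simp
    finally show ?thesis by (simp add: distrib_left mult_left_mono)
  qed
  have le2: "(\<integral>\<^sup>+x\<in>B. g x \<partial>lebesgue) \<le> ennreal lam * emeasure lebesgue B"
  proof (rule ennreal_le_epsilon)
    fix e :: real assume "e > 0"
    then show "(\<integral>\<^sup>+x\<in>B. g x \<partial>lebesgue) \<le> ennreal lam * emeasure lebesgue B + ennreal e"
      using bound[of "e / lam"] lam by (simp add: ennreal_mult[symmetric])
  qed
  have Ble: "ennreal lam \<le> g x" if "x \<in> B" for x using that by (auto simp: B_def)
  have "AE x in lebesgue. x \<notin> B"
  proof -
    have f: "(\<integral>\<^sup>+x\<in>B. ennreal lam \<partial>lebesgue) < \<infinity>"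
      using Bfin by (simp add: nn_integral_cmult_indicator ennreal_mult_less_top)
    have "(\<integral>\<^sup>+x. g x * indicator B x - ennreal lam * indicator B x \<partial>lebesgue) =
       (\<integral>\<^sup>+x\<in>B. g x \<partial>lebesgue) - (\<integral>\<^sup>+x\<in>B. ennreal lam \<partial>lebesgue)"
      using f by (intro nn_integral_diff) (auto simp: Ble split: split_indicator)
    also have "\<dots> = 0"
      using le2 f by (simp add: nn_integral_cmult_indicator diff_eq_0_iff_ennreal top.not_eq_extremum)
    finally have "AE x in lebesgue. g x * indicator B x - ennreal lam * indicator B x = 0"
      by (subst (asm) nn_integral_0_iff_AE) auto
    then show ?thesis
    proof eventually_elim
      case (elim x)
      show ?case
      proof
        assume "x \<in> B"
        then have "ennreal lam < g x" "g x - ennreal lam = 0" using elim by (auto simp: B_def)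
        then show False by (auto simp: diff_eq_0_iff_ennreal dest: leD)
      qed
    qed
  qed
  then have "AE x in lebesgue. x \<in> hcube q \<longrightarrow> x \<notin> (\<Union>r\<in>P. hcube r) \<longrightarrow> g x \<le> ennreal lam"
    by eventually_elim (auto simp: B_def not_less)
  with that P(1,2) subP low up tot show ?thesis by blast
qed

section \<open>The John-Nirenberg inequality\<close>

text \<open>The unit ball of BMO written with real inequalities. With this normalisation the
  John-Nirenberg constants depend on the dimension alone.\<close>

definition bmo1 :: "('a::euclidean_space \<Rightarrow> real) \<Rightarrow> bool" where
  "bmo1 b \<longleftrightarrow> locally_integrable b \<and> (\<forall>Q. cube Q \<longrightarrow> avg (\<lambda>x. \<bar>b x - avg b Q\<bar>) Q \<le> 1)"

abbreviation ccube :: "'a::euclidean_space \<times> real \<Rightarrow> 'a set" where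
  "ccube q \<equiv> cbox (fst q) (fst q + snd q *\<^sub>R One)"

lemma le_suminf_ennreal: "f k \<le> suminf (f :: nat \<Rightarrow> ennreal)"
  using sum_le_suminf[of f "{k}"] by simp

lemma emeasure_Int_eq_nn_integral:
  assumes "A \<in> sets M" "B \<in> sets M"
  shows "emeasure M (A \<inter> B) = (\<integral>\<^sup>+x\<in>B. indicator A x \<partial>M)"
proof -
  have "(\<integral>\<^sup>+x\<in>B. indicator A x \<partial>M) = (\<integral>\<^sup>+x. indicator (A \<inter> B) x \<partial>M)"
    by (rule nn_integral_cong) (auto split: split_indicator)
  then show ?thesis using assms by simp
qed

lemma cube_ccube: "snd q > 0 \<Longrightarrow> cube (ccube q)"
  by (auto simp: cube_def)

lemma cubeE:
  assumes "cube Q" obtains q where "snd q > 0" "Q = ccube q"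
  using assms unfolding cube_def by (metis fst_conv snd_conv)

lemma cube_measure:
  assumes "cube Q"
  shows "0 < measure lebesgue Q" "emeasure lebesgue Q = ennreal (measure lebesgue Q)"
    "emeasure lebesgue Q < \<infinity>" "Q \<in> sets lebesgue" "compact Q"
proof -
  obtain q where q: "snd q > 0" "Q = ccube q" using assms cubeE by metis
  then show "0 < measure lebesgue Q" "emeasure lebesgue Q = ennreal (measure lebesgue Q)"
    "emeasure lebesgue Q < \<infinity>" "Q \<in> sets lebesgue" "compact Q"
    using measure_cube[of "snd q" "fst q"] emeasure_cube[of "snd q" "fst q"] by auto
qed

lemma set_nn_integral_hcube_ccube:
  "(\<integral>\<^sup>+x\<in>hcube q. g x \<partial>lebesgue) = (\<integral>\<^sup>+x\<in>ccube q. g x \<partial>lebesgue)"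
  by (rule nn_integral_cong_AE) (use AE_hcube_cbox[of q] in \<open>auto split: split_indicator\<close>)

lemma emeasure_hcube_ccube: "emeasure lebesgue (hcube q) = emeasure lebesgue (ccube q)"
  by (rule emeasure_eq_AE) (use AE_hcube_cbox[of q] in auto)

lemma locally_integrable_cube:
  assumes "locally_integrable b" "cube Q"
  shows "set_integrable lebesgue Q b"
  using assms cube_measure(5) by (auto simp: locally_integrable_def)

lemma set_integrable_const_cube: "cube Q \<Longrightarrow> set_integrable lebesgue Q (\<lambda>x. c::real)"
  using cube_measure[of Q] by (simp add: set_integrable_def)

lemma avg_diff_le:
  assumes "locally_integrable b" "cube Q"
  shows "ennreal \<bar>avg b Q - c\<bar> * emeasure lebesgue Q \<le> (\<integral>\<^sup>+x\<in>Q. ennreal \<bar>b x - c\<bar> \<partial>lebesgue)"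
proof -
  note b = locally_integrable_cube[OF assms] and cst = set_integrable_const_cube[OF assms(2)]
  note m = cube_measure[OF assms(2)]
  have i: "set_integrable lebesgue Q (\<lambda>x. b x - c)" using b cst by (rule set_integral_diff)
  have "(LINT x:Q|lebesgue. b x - c) = (LINT x:Q|lebesgue. b x) - (LINT x:Q|lebesgue. c)"
    using b cst by (rule set_integral_diff)
  also have "(LINT x:Q|lebesgue. c) = c * measure lebesgue Q"
    using m by (subst set_integral_const) (auto simp: mult.commute)
  finally have "(avg b Q - c) * measure lebesgue Q = (LINT x:Q|lebesgue. b x - c)"
    using m(1) by (simp add: avg_def left_diff_distrib)
  then have "\<bar>avg b Q - c\<bar> * measure lebesgue Q = norm (LINT x:Q|lebesgue. b x - c)"
    using m(1) by (metis abs_mult abs_of_pos real_norm_def)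
  then have "ennreal \<bar>avg b Q - c\<bar> * emeasure lebesgue Q = ennreal (norm (LINT x:Q|lebesgue. b x - c))"
    using m(2) by (metis abs_ge_zero ennreal_mult measure_nonneg)
  also have "\<dots> \<le> (\<integral>\<^sup>+x. ennreal (norm (indicator Q x *\<^sub>R (b x - c))) \<partial>lebesgue)"
    using i unfolding set_lebesgue_integral_def set_integrable_def
    by (rule integral_norm_bound_ennreal)
  also have "\<dots> = (\<integral>\<^sup>+x\<in>Q. ennreal \<bar>b x - c\<bar> \<partial>lebesgue)"
    by (rule nn_integral_cong) (auto split: split_indicator)
  finally show ?thesis .
qed

lemma bmo1_nn:
  assumes "bmo1 b" "cube Q"
  shows "(\<integral>\<^sup>+x\<in>Q. ennreal \<bar>b x - avg b Q\<bar> \<partial>lebesgue) \<le> emeasure lebesgue Q"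
proof -
  have lb: "locally_integrable b" and le: "avg (\<lambda>x. \<bar>b x - avg b Q\<bar>) Q \<le> 1"
    using assms by (auto simp: bmo1_def)
  note m = cube_measure[OF assms(2)]
  have i: "set_integrable lebesgue Q (\<lambda>x. \<bar>b x - avg b Q\<bar>)"
    using locally_integrable_cube[OF lb assms(2)] set_integrable_const_cube[OF assms(2)]
    by (intro set_integrable_abs set_integral_diff)
  have "(\<integral>\<^sup>+x\<in>Q. ennreal \<bar>b x - avg b Q\<bar> \<partial>lebesgue) = (\<integral>\<^sup>+x. ennreal (indicator Q x *\<^sub>R \<bar>b x - avg b Q\<bar>) \<partial>lebesgue)"
    by (rule nn_integral_cong) (auto split: split_indicator)
  also have "\<dots> = ennreal (LINT x:Q|lebesgue. \<bar>b x - avg b Q\<bar>)"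
    using i unfolding set_lebesgue_integral_def set_integrable_def by (intro nn_integral_eq_integral) auto
  also have "\<dots> \<le> ennreal (measure lebesgue Q)"
    using le m(1) by (intro ennreal_leI) (simp add: avg_def field_simps)
  finally show ?thesis using m by simp
qed

lemma bmo1_measurable: "bmo1 b \<Longrightarrow> b \<in> borel_measurable lebesgue"
  by (simp add: bmo1_def locally_integrable_def)

text \<open>Stopping |b - b_q| at height 2 leaves cubes of total measure at most half, over which
  the average of \<open>b\<close> moves by at most 2^(n+1). A point oscillating by more than (k + 1)
  2^(n+1) lies in one of them, up to a null set, and still oscillates there by more than k
  2^(n+1).\<close>

lemma John_Nirenberg_level:
  fixes b :: "'a::euclidean_space \<Rightarrow> real"
  assumes b: "bmo1 b" and q: "snd q > 0"
  shows "emeasure lebesgue {x \<in> hcube q. \<bar>b x - avg b (ccube q)\<bar> > real k * 2 ^ (DIM('a) + 1)}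
     \<le> ennreal ((1/2) ^ k) * emeasure lebesgue (hcube q)"
  using q
proof (induction k arbitrary: q)
  case 0
  have "emeasure lebesgue {x \<in> hcube q. \<bar>b x - avg b (ccube q)\<bar> > real 0 * 2 ^ (DIM('a) + 1)} \<le> emeasure lebesgue (hcube q)"
    by (rule emeasure_mono) auto
  then show ?case by simp
next
  case (Suc k)
  note [measurable] = bmo1_measurable[OF b]
  define L where "L = (2::real) ^ (DIM('a) + 1)"
  have L: "L \<ge> 2" by (simp add: L_def)
  define g where "g x = ennreal \<bar>b x - avg b (ccube q)\<bar>" for x
  have gm [measurable]: "g \<in> borel_measurable lebesgue" unfolding g_def by measurable
  have gq: "(\<integral>\<^sup>+x\<in>hcube q. g x \<partial>lebesgue) \<le> emeasure lebesgue (hcube q)"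
    using bmo1_nn[OF b cube_ccube[OF Suc.prems]] by (simp add: set_nn_integral_hcube_ccube emeasure_hcube_ccube g_def)
  also have "\<dots> \<le> ennreal 2 * emeasure lebesgue (hcube q)"
    using mult_right_mono[of 1 "2::ennreal" "emeasure lebesgue (hcube q)"] by simp
  finally have le2: "(\<integral>\<^sup>+x\<in>hcube q. g x \<partial>lebesgue) \<le> ennreal 2 * emeasure lebesgue (hcube q)" .
  obtain P where P: "countable P" "disjoint_family_on hcube P" "\<And>r. r \<in> P \<Longrightarrow> snd r > 0 \<and> hcube r \<subseteq> hcube q"
    "\<And>r. r \<in> P \<Longrightarrow> (\<integral>\<^sup>+x\<in>hcube r. g x \<partial>lebesgue) \<le> ennreal (2 ^ DIM('a) * 2) * emeasure lebesgue (hcube r)"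
    "AE x in lebesgue. x \<in> hcube q \<longrightarrow> x \<notin> (\<Union>r\<in>P. hcube r) \<longrightarrow> g x \<le> ennreal 2"
    "ennreal 2 * emeasure lebesgue (\<Union>r\<in>P. hcube r) \<le> (\<integral>\<^sup>+x\<in>hcube q. g x \<partial>lebesgue)"
    by (rule stopping_cubes[OF Suc.prems gm _ le2]) auto
  \<comment> \<open>The jump of averages is bounded by the average of |b - b_q| over the child,
    which the stopping rule caps at 2^n * 2.\<close>
  have dr: "\<bar>avg b (ccube r) - avg b (ccube q)\<bar> \<le> L" if r: "r \<in> P" for r
  proof -
    have cr: "cube (ccube r)" using P(3)[OF r] cube_ccube by blast
    have lb: "locally_integrable b" using b by (simp add: bmo1_def)
    have "ennreal \<bar>avg b (ccube r) - avg b (ccube q)\<bar> * emeasure lebesgue (ccube r) \<le> (\<integral>\<^sup>+x\<in>hcube r. g x \<partial>lebesgue)"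
      using avg_diff_le[OF lb cr, of "avg b (ccube q)"] by (simp add: set_nn_integral_hcube_ccube g_def)
    also have "\<dots> \<le> ennreal L * emeasure lebesgue (ccube r)"
      using P(4)[OF r] by (simp add: L_def emeasure_hcube_ccube mult.commute)
    finally have "ennreal (\<bar>avg b (ccube r) - avg b (ccube q)\<bar> * measure lebesgue (ccube r)) \<le> ennreal (L * measure lebesgue (ccube r))"
      using L by (simp add: cube_measure(2)[OF cr] ennreal_mult)
    then have "\<bar>avg b (ccube r) - avg b (ccube q)\<bar> * measure lebesgue (ccube r) \<le> L * measure lebesgue (ccube r)"
      using L by (subst (asm) ennreal_le_iff) auto
    then show ?thesis using cube_measure(1)[OF cr] by simp
  qed
  let ?E = "{x. \<bar>b x - avg b (ccube q)\<bar> > real (Suc k) * L}"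
  have "{x \<in> space lebesgue. \<bar>b x - avg b (ccube q)\<bar> > real (Suc k) * L} \<in> sets lebesgue" by measurable
  then have Em: "?E \<in> sets lebesgue" by simp
  have UP: "(\<Union>r\<in>P. hcube r) \<in> sets lebesgue"
    using P(1) by (intro sets.countable_UN') auto
  have "emeasure lebesgue {x \<in> hcube q. \<bar>b x - avg b (ccube q)\<bar> > real (Suc k) * L} \<le> emeasure lebesgue (?E \<inter> (\<Union>r\<in>P. hcube r))"
  proof (rule emeasure_mono_AE)
    show "AE x in lebesgue. x \<in> {x \<in> hcube q. \<bar>b x - avg b (ccube q)\<bar> > real (Suc k) * L} \<longrightarrow> x \<in> ?E \<inter> (\<Union>r\<in>P. hcube r)"
      using P(5)
    proof eventually_elim
      case (elim x)
      \<comment> \<open>Off the stopping cubes the oscillation is at most 2, which does not exceed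
        the threshold even for k = 0.\<close>
      have "2 \<le> real (Suc k) * L" using L mult_mono[of 1 "real (Suc k)" 2 L] by simp
      then show ?case using elim by (auto simp: g_def simp del: ennreal_numeral)
    qed
    show "?E \<inter> (\<Union>r\<in>P. hcube r) \<in> sets lebesgue" using Em UP by auto
  qed
  also have "\<dots> = (\<integral>\<^sup>+x\<in>(\<Union>r\<in>P. hcube r). indicator ?E x \<partial>lebesgue)"
    using Em UP by (rule emeasure_Int_eq_nn_integral)
  also have "\<dots> = (\<integral>\<^sup>+r. (\<integral>\<^sup>+x\<in>hcube r. indicator ?E x \<partial>lebesgue) \<partial>count_space P)"
    using P Em by (intro nn_integral_disjoint_hcube) auto
  also have "\<dots> \<le> (\<integral>\<^sup>+r. (\<integral>\<^sup>+x\<in>hcube r. ennreal ((1/2) ^ k) \<partial>lebesgue) \<partial>count_space P)"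
  proof (rule nn_integral_mono)
    fix r assume "r \<in> space (count_space P)"
    then have r: "r \<in> P" by simp
    have m: "{x \<in> hcube r. \<bar>b x - avg b (ccube r)\<bar> > real k * L} \<in> sets lebesgue"
    proof -
      have "hcube r \<inter> {x. \<bar>b x - avg b (ccube r)\<bar> > real k * L} \<in> sets lebesgue" by measurable
      moreover have "hcube r \<inter> {x. \<bar>b x - avg b (ccube r)\<bar> > real k * L} = {x \<in> hcube r. \<bar>b x - avg b (ccube r)\<bar> > real k * L}" by auto
      ultimately show ?thesis by simp
    qed
    have "(\<integral>\<^sup>+x\<in>hcube r. indicator ?E x \<partial>lebesgue) \<le> (\<integral>\<^sup>+x. indicator {x \<in> hcube r. \<bar>b x - avg b (ccube r)\<bar> > real k * L} x \<partial>lebesgue)"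
      using dr[OF r] by (intro nn_integral_mono) (auto simp: algebra_simps split: split_indicator)
    also have "\<dots> = emeasure lebesgue {x \<in> hcube r. \<bar>b x - avg b (ccube r)\<bar> > real k * L}"
      using m by simp
    also have "\<dots> \<le> ennreal ((1/2) ^ k) * emeasure lebesgue (hcube r)"
      using Suc.IH[of r] P(3)[OF r] by (simp add: L_def)
    finally show "(\<integral>\<^sup>+x\<in>hcube r. indicator ?E x \<partial>lebesgue) \<le> (\<integral>\<^sup>+x\<in>hcube r. ennreal ((1/2) ^ k) \<partial>lebesgue)"
      by (simp add: nn_integral_cmult_indicator)
  qed
  also have "\<dots> = (\<integral>\<^sup>+x\<in>(\<Union>r\<in>P. hcube r). ennreal ((1/2) ^ k) \<partial>lebesgue)"
    using P by (intro nn_integral_disjoint_hcube[symmetric]) auto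
  also have "\<dots> = ennreal ((1/2) ^ Suc k) * (ennreal 2 * emeasure lebesgue (\<Union>r\<in>P. hcube r))"
    using UP by (subst nn_integral_cmult_indicator) (simp_all add: mult.assoc[symmetric] ennreal_mult'[symmetric] del: ennreal_numeral)
  also have "\<dots> \<le> ennreal ((1/2) ^ Suc k) * emeasure lebesgue (hcube q)"
    using P(6) gq by (intro mult_left_mono) auto
  finally show ?case by (simp add: L_def)
qed

text \<open>The exponent is chosen so that a step of length 2^(n+1) multiplies the exponential by
  3/2 while the measure of the level set halves: the series 3/2 * (3/4)^k sums to 6, and points of
  zero oscillation account for the remaining 1.\<close>

lemma John_Nirenberg:
  fixes b :: "'a::euclidean_space \<Rightarrow> real"
  assumes b: "bmo1 b" and Q: "cube Q"
  shows "(\<integral>\<^sup>+x\<in>Q. ennreal (exp (ln (3/2) / 2 ^ (DIM('a) + 1) * \<bar>b x - avg b Q\<bar>)) \<partial>lebesgue) \<le> 7 * emeasure lebesgue Q"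
proof -
  note [measurable] = bmo1_measurable[OF b]
  obtain q where q: "snd q > 0" "Q = ccube q" using Q cubeE by metis
  define L where "L = (2::real) ^ (DIM('a) + 1)"
  have L: "L > 0" by (simp add: L_def)
  define X where "X x = \<bar>b x - avg b Q\<bar>" for x
  have Xm [measurable]: "X \<in> borel_measurable lebesgue" unfolding X_def by measurable
  have pt: "ennreal (exp (ln (3/2) / L * X x)) \<le> 1 + (\<Sum>k. ennreal ((3/2) ^ Suc k) * indicator {x. X x > real k * L} x)" for x
  proof (cases "X x = 0")
    case False
    then have X: "X x > 0" by (simp add: X_def)
    \<comment> \<open>Ceiling minus one and not the floor: level sets are strict, so
      \<open>k\<close> must satisfy k L < X x \<le> (k + 1) L.\<close>
    define k where "k = nat (\<lceil>X x / L\<rceil> - 1)"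
    have c: "\<lceil>X x / L\<rceil> \<ge> 1" using X L by simp
    then have k: "real k = of_int \<lceil>X x / L\<rceil> - 1" by (simp add: k_def of_nat_diff)
    have "real k < X x / L" "X x / L \<le> real k + 1"
      using k ceiling_correct[of "X x / L"] by linarith+
    then have kk: "real k * L < X x" "X x \<le> (real k + 1) * L" using L by (simp_all add: field_simps)
    have "ln (3/2) / L * X x \<le> ln (3/2) / L * ((real k + 1) * L)"
      using kk L by (intro mult_left_mono) auto
    also have "\<dots> = real (Suc k) * ln (3/2)" using L by (simp add: field_simps)
    finally have "exp (ln (3/2) / L * X x) \<le> exp (real (Suc k) * ln (3/2))" by simp
    also have "\<dots> = (3/2) ^ Suc k" by (subst exp_of_nat_mult) simp
    finally have "ennreal (exp (ln (3/2) / L * X x)) \<le> ennreal ((3/2) ^ Suc k) * indicator {x. X x > real k * L} x"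
      using kk by (simp add: ennreal_leI)
    also have "\<dots> \<le> (\<Sum>k. ennreal ((3/2) ^ Suc k) * indicator {x. X x > real k * L} x)"
      by (rule le_suminf_ennreal)
    also have "\<dots> \<le> 1 + \<dots>" by simp
    finally show ?thesis .
  qed auto
  have "(\<integral>\<^sup>+x\<in>hcube q. ennreal (exp (ln (3/2) / L * X x)) \<partial>lebesgue)
     \<le> (\<integral>\<^sup>+x. indicator (hcube q) x + (\<Sum>k. ennreal ((3/2) ^ Suc k) * indicator {x. X x > real k * L} x * indicator (hcube q) x) \<partial>lebesgue)"
    using pt by (intro nn_integral_mono) (auto split: split_indicator)
  also have "\<dots> = emeasure lebesgue (hcube q) + (\<integral>\<^sup>+x. (\<Sum>k. ennreal ((3/2) ^ Suc k) * indicator {x. X x > real k * L} x * indicator (hcube q) x) \<partial>lebesgue)"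
    by (subst nn_integral_add) auto
  also have "(\<integral>\<^sup>+x. (\<Sum>k. ennreal ((3/2) ^ Suc k) * indicator {x. X x > real k * L} x * indicator (hcube q) x) \<partial>lebesgue)
     = (\<Sum>k. \<integral>\<^sup>+x. ennreal ((3/2) ^ Suc k) * indicator {x. X x > real k * L} x * indicator (hcube q) x \<partial>lebesgue)"
    by (rule nn_integral_suminf) measurable
  also have "\<dots> \<le> (\<Sum>k. ennreal (3/2 * (3/4) ^ k) * emeasure lebesgue (hcube q))"
  proof (intro suminf_le summableI)
    fix k
    have "hcube q \<inter> {x. X x > real k * L} \<in> sets lebesgue" by measurable
    moreover have eq: "hcube q \<inter> {x. X x > real k * L} = {x \<in> hcube q. X x > real k * L}" by auto
    ultimately have m: "{x \<in> hcube q. X x > real k * L} \<in> sets lebesgue" by simp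
    have "(\<integral>\<^sup>+x. ennreal ((3/2) ^ Suc k) * indicator {x. X x > real k * L} x * indicator (hcube q) x \<partial>lebesgue)
       = (\<integral>\<^sup>+x. ennreal ((3/2) ^ Suc k) * indicator {x \<in> hcube q. X x > real k * L} x \<partial>lebesgue)"
      by (intro nn_integral_cong) (auto split: split_indicator)
    also have "\<dots> = ennreal ((3/2) ^ Suc k) * emeasure lebesgue {x \<in> hcube q. X x > real k * L}"
      using m by (rule nn_integral_cmult_indicator)
    also have "\<dots> \<le> ennreal ((3/2) ^ Suc k) * (ennreal ((1/2) ^ k) * emeasure lebesgue (hcube q))"
      using John_Nirenberg_level[OF b q(1), of k] q by (intro mult_left_mono) (auto simp: X_def L_def)
    also have "\<dots> = ennreal (3/2 * (3/4) ^ k) * emeasure lebesgue (hcube q)"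
      using power_mult_distrib[of "3/2" "1/2::real" k]
      by (simp add: mult.assoc[symmetric] ennreal_mult'[symmetric])
    finally show "(\<integral>\<^sup>+x. ennreal ((3/2) ^ Suc k) * indicator {x. X x > real k * L} x * indicator (hcube q) x \<partial>lebesgue)
      \<le> ennreal (3/2 * (3/4) ^ k) * emeasure lebesgue (hcube q)" .
  qed
  also have "\<dots> = (\<Sum>k. ennreal (3/2 * (3/4) ^ k)) * emeasure lebesgue (hcube q)"
    by (rule ennreal_suminf_multc)
  also have "(\<Sum>k. ennreal (3/2 * (3/4) ^ k)) = ennreal 6"
  proof (rule suminf_ennreal_eq)
    show "(\<lambda>k. 3/2 * (3/4) ^ k) sums (6::real)"
      using sums_mult[OF geometric_sums[of "3/4::real"], of "3/2"] by simp
  qed simp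
  also have "emeasure lebesgue (hcube q) + ennreal 6 * emeasure lebesgue (hcube q) = 7 * emeasure lebesgue (hcube q)"
    using distrib_right[of 1 6 "emeasure lebesgue (hcube q)"] by simp
  finally show ?thesis
    using q by (simp add: set_nn_integral_hcube_ccube emeasure_hcube_ccube X_def L_def)
qed

section \<open>Young functions and Luxemburg norms\<close>

lemma power_le_exp_mult:
  assumes "(c::real) > 0"
  obtains K where "K > 0" "\<And>y. y \<ge> 0 \<Longrightarrow> y ^ k \<le> K * exp (c * y)"
proof (cases "k = 0")
  case True
  then show ?thesis using that[of 1] assms by simp
next
  case False
  have "y ^ k \<le> (real k / c) ^ k * exp (c * y)" if y: "y \<ge> 0" for y
  proof -
    have "c * y / real k \<le> exp (c * y / real k)"
      using exp_ge_add_one_self[of "c * y / real k"] by linarith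
    then have "(c * y / real k) ^ k \<le> exp (c * y / real k) ^ k"
      using assms y by (intro power_mono) auto
    also have "\<dots> = exp (c * y)" using False by (simp add: exp_of_nat_mult[symmetric])
    finally have "(real k / c) ^ k * (c * y / real k) ^ k \<le> (real k / c) ^ k * exp (c * y)"
      using assms by (intro mult_left_mono) auto
    then show ?thesis using assms False by (simp add: power_mult_distrib[symmetric])
  qed
  then show ?thesis using that[of "(real k / c) ^ k"] False assms by simp
qed

lemma ln_e_plus_ge_1: "s \<ge> 0 \<Longrightarrow> 1 \<le> ln (exp 1 + s)" for s :: real
proof -
  assume "s \<ge> 0"
  then have "ln (exp 1) \<le> ln (exp 1 + s)" by (subst ln_le_cancel_iff) (auto simp: add_pos_nonneg)
  then show ?thesis by simp
qed

lemma Phi_nonneg: "s \<ge> 0 \<Longrightarrow> 0 \<le> Phi k s"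
  using ln_e_plus_ge_1[of s] by (simp add: Phi_def)

lemma Phi_ge: "s \<ge> 0 \<Longrightarrow> s \<le> Phi k s"
  using mult_left_mono[OF one_le_power[OF ln_e_plus_ge_1[of s], of k], of s] by (simp add: Phi_def)

text \<open>Young's inequality between t log^k t and its exponential dual, with a tunable
  exponential term. If \<open>y\<close> is at most a multiple of A (q + 1) + log(e + s), the product
  is absorbed by \<open>Phi\<close>; otherwise \<open>s\<close> lies below exp(c y / 2 - A (q + 1))
  and a geometric factor comes out. The gain B^(-q) costs only the polynomial (q + 1)^k.\<close>

lemma Young_pointwise:
  assumes c: "(c::real) > 0" and th: "th > 0" and B: "B > 1"
  obtains C where "C > 0" "\<And>(q::nat) s y. s \<ge> 0 \<Longrightarrow> y \<ge> 0 \<Longrightarrow>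
     s * y ^ k \<le> C * (real q + 1) ^ k * Phi k s + th * (1 / B) ^ q * exp (c * y)"
proof -
  obtain K where K: "K > 0" "\<And>y. y \<ge> 0 \<Longrightarrow> y ^ k \<le> K * exp (c / 2 * y)"
    using power_le_exp_mult[of "c / 2" k] c by auto
  \<comment> \<open>Two demands on \<open>A\<close>: exp(-A) \<le> 1 / B for the geometric factor
    and K exp(-A) \<le> th for the constant.\<close>
  define A where "A = max (ln B) (ln (K / th))"
  have A0: "A > 0" using B by (simp add: A_def less_max_iff_disj)
  have "exp (- A) \<le> exp (- ln B)" by (simp add: A_def)
  then have AB: "exp (- A) \<le> 1 / B" using B by (simp add: exp_minus inverse_eq_divide)
  have "exp (- A) \<le> exp (- ln (K / th))" by (simp add: A_def)
  also have "\<dots> = th / K" using K th by (subst exp_minus) (simp add: inverse_eq_divide)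
  finally have AK: "K * exp (- A) \<le> th" using K by (simp add: field_simps)
  define C where "C = (2 / c * (A + 1)) ^ k"
  have "s * y ^ k \<le> C * (real q + 1) ^ k * Phi k s + th * (1 / B) ^ q * exp (c * y)"
    if s: "s \<ge> 0" and y: "y \<ge> 0" for q :: nat and s y
  proof -
    define l where "l = ln (exp 1 + s)"
    have l1: "l \<ge> 1" using ln_e_plus_ge_1[OF s] by (simp add: l_def)
    show ?thesis
    proof (cases "y \<le> 2 / c * (A * (real q + 1) + l)")
      case True
      have "A * (real q + 1) + l \<le> A * (real q + 1) * l + (real q + 1) * l"
      proof (rule add_mono)
        show "A * (real q + 1) \<le> A * (real q + 1) * l"
          using mult_left_mono[OF l1, of "A * (real q + 1)"] A0 by simp
        show "l \<le> (real q + 1) * l" using mult_right_mono[of 1 "real q + 1" l] l1 by simp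
      qed
      also have "\<dots> = (A + 1) * (real q + 1) * l" by (simp add: algebra_simps)
      finally have "2 / c * (A * (real q + 1) + l) \<le> 2 / c * ((A + 1) * (real q + 1) * l)"
        using c by (intro mult_left_mono) auto
      with True have "y \<le> 2 / c * ((A + 1) * (real q + 1) * l)" by linarith
      then have "y ^ k \<le> (2 / c * ((A + 1) * (real q + 1) * l)) ^ k" using y by (intro power_mono)
      also have "\<dots> = C * (real q + 1) ^ k * l ^ k"
        by (simp only: C_def power_mult_distrib mult.assoc)
      finally have "s * y ^ k \<le> s * (C * (real q + 1) ^ k * l ^ k)" using s by (intro mult_left_mono)
      also have "\<dots> = C * (real q + 1) ^ k * Phi k s" by (simp add: Phi_def l_def)
      also have "\<dots> \<le> \<dots> + th * (1 / B) ^ q * exp (c * y)" using th B by simp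
      finally show ?thesis .
    next
      case False
      then have "A * (real q + 1) + l < c / 2 * y" using c by (simp add: field_simps)
      then have "l \<le> c / 2 * y - A * (real q + 1)" by linarith
      then have "exp l \<le> exp (c / 2 * y - A * (real q + 1))" by simp
      moreover have "exp l = exp 1 + s" using s by (simp add: l_def add_pos_nonneg)
      moreover have "exp (1::real) > 0" by simp
      ultimately have "s \<le> exp (c / 2 * y - A * (real q + 1))" by linarith
      then have "s * y ^ k \<le> exp (c / 2 * y - A * (real q + 1)) * (K * exp (c / 2 * y))"
        using K(2)[OF y] s y by (intro mult_mono) auto
      also have "exp (c / 2 * y - A * (real q + 1)) = exp (c / 2 * y) * (exp (- A) ^ q * exp (- A))"
      proof -
        have "c / 2 * y - A * (real q + 1) = c / 2 * y + (real q * (- A) + (- A))" by (simp add: algebra_simps)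
        then show ?thesis by (simp only: exp_add exp_of_nat_mult)
      qed
      also have "exp (c / 2 * y) * (exp (- A) ^ q * exp (- A)) * (K * exp (c / 2 * y)) =
         (K * exp (- A)) * exp (- A) ^ q * (exp (c / 2 * y) * exp (c / 2 * y))" by (simp add: algebra_simps)
      also have "exp (c / 2 * y) * exp (c / 2 * y) = exp (c * y)" by (simp add: exp_add[symmetric])
      also have "K * exp (- A) * exp (- A) ^ q * exp (c * y) \<le> th * (1 / B) ^ q * exp (c * y)"
        using AK AB th B by (intro mult_right_mono mult_mono power_mono) auto
      also have "\<dots> \<le> C * (real q + 1) ^ k * Phi k s + \<dots>"
        using Phi_nonneg[OF s] A0 c by (simp add: C_def)
      finally show ?thesis .
    qed
  qed
  moreover have "C > 0" using c A0 by (simp add: C_def)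
  ultimately show ?thesis using that by blast
qed

lemma Phi_measurable [measurable]: "Phi k \<in> borel_measurable borel"
  unfolding Phi_def by measurable

text \<open>A bound linear in each admissible lambda passes to the infimum; positivity and
  finiteness of \<open>K\<close> permit dividing by it in the extended reals. Without an admissible
  lambda the norm is infinite and the claim is trivial.\<close>

lemma lux_norm_bound:
  assumes "cube R" "K > 0" "K < \<infinity>"
    and "\<And>lam. lam > 0 \<Longrightarrow> (\<integral>\<^sup>+ x \<in> R. ennreal (A (\<bar>f x\<bar> / lam)) \<partial>lebesgue) \<le> emeasure lebesgue R \<Longrightarrow> X \<le> K * ennreal lam"
  shows "X \<le> K * lux_norm A f R"
proof -
  have "X / K \<le> lux_norm A f R"
    unfolding lux_norm_def
  proof (rule Inf_greatest, clarsimp)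
    fix lam :: real assume lam: "lam > 0"
      and le: "ennreal (1 / measure lebesgue R) * (\<integral>\<^sup>+ x \<in> R. ennreal (A (\<bar>f x\<bar> / lam)) \<partial>lebesgue) \<le> 1"
    note m = cube_measure[OF assms(1)]
    have "ennreal (measure lebesgue R) * (ennreal (1 / measure lebesgue R) * (\<integral>\<^sup>+ x \<in> R. ennreal (A (\<bar>f x\<bar> / lam)) \<partial>lebesgue))
        \<le> ennreal (measure lebesgue R) * 1"
      using le by (intro mult_left_mono) auto
    moreover have "ennreal (measure lebesgue R) * ennreal (1 / measure lebesgue R) = 1"
      using m(1) by (simp add: ennreal_mult[symmetric] del: measure_completion)
    ultimately have "(\<integral>\<^sup>+ x \<in> R. ennreal (A (\<bar>f x\<bar> / lam)) \<partial>lebesgue) \<le> emeasure lebesgue R"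
      using m(2) by (simp add: mult.assoc[symmetric] del: measure_completion)
    then have "X \<le> K * ennreal lam" using assms(4) lam by blast
    then show "X / K \<le> ennreal lam"
      using assms(2) by (intro divide_le_posI_ennreal) (auto simp: mult.commute)
  qed
  then have "K * (X / K) \<le> K * lux_norm A f R" by (intro mult_left_mono) auto
  moreover have "K * (X / K) = X"
    using assms(2,3) mult_divide_eq_ennreal[of K X] by (simp add: ennreal_times_divide mult.commute)
  ultimately show ?thesis by simp
qed

text \<open>Hoelder's inequality between L(log L)^k and the exponential class: integrate the
  pointwise Young inequality with q = 0 for w / lam. The constant depends on \<open>c\<close>,
  \<open>B\<close> and \<open>k\<close> but not on the cube or the functions.\<close>

lemma weighted_power_bound:
  assumes c: "(c::real) > 0" and B: "B \<ge> 0"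
  obtains C where "C > 0" "\<And>(w::'a::euclidean_space \<Rightarrow> real) Y R. cube R \<Longrightarrow> (\<And>x. 0 \<le> w x) \<Longrightarrow> w \<in> borel_measurable lebesgue
    \<Longrightarrow> (\<And>x. 0 \<le> Y x) \<Longrightarrow> Y \<in> borel_measurable lebesgue
    \<Longrightarrow> (\<integral>\<^sup>+x\<in>R. ennreal (exp (c * Y x)) \<partial>lebesgue) \<le> ennreal B * emeasure lebesgue R
    \<Longrightarrow> (\<integral>\<^sup>+x\<in>R. ennreal (w x * Y x ^ k) \<partial>lebesgue) \<le> ennreal C * emeasure lebesgue R * lux_norm (Phi k) w R"
proof -
  obtain C where C: "C > 0" "\<And>(q::nat) s y. s \<ge> 0 \<Longrightarrow> y \<ge> 0 \<Longrightarrow>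
     s * y ^ k \<le> C * (real q + 1) ^ k * Phi k s + 1 * (1 / 2) ^ q * exp (c * y)"
    using Young_pointwise[OF c zero_less_one, of 2 k] by auto
  have main: "(\<integral>\<^sup>+x\<in>R. ennreal (w x * Y x ^ k) \<partial>lebesgue) \<le> ennreal (C + B) * emeasure lebesgue R * lux_norm (Phi k) w R"
    if R: "cube R" and w: "\<And>x. 0 \<le> w x" "w \<in> borel_measurable lebesgue"
      and Y: "\<And>x. 0 \<le> Y x" "Y \<in> borel_measurable lebesgue"
      and le: "(\<integral>\<^sup>+x\<in>R. ennreal (exp (c * Y x)) \<partial>lebesgue) \<le> ennreal B * emeasure lebesgue R"
    for w Y :: "'a \<Rightarrow> real" and R
  proof (rule lux_norm_bound[OF R])
    note m = cube_measure[OF R]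
    note [measurable] = w(2) Y(2) m(4)
    show "0 < ennreal (C + B) * emeasure lebesgue R"
      using C(1) B m by (simp add: ennreal_zero_less_mult_iff del: measure_completion ennreal_plus)
    show "ennreal (C + B) * emeasure lebesgue R < \<infinity>"
      using m(3) by (simp add: ennreal_mult_less_top)
    fix lam :: real assume lam: "lam > 0"
      and lam2: "(\<integral>\<^sup>+ x \<in> R. ennreal (Phi k (\<bar>w x\<bar> / lam)) \<partial>lebesgue) \<le> emeasure lebesgue R"
    have "(\<integral>\<^sup>+x\<in>R. ennreal (w x * Y x ^ k) \<partial>lebesgue) \<le>
       (\<integral>\<^sup>+x. ennreal lam * (ennreal C * (ennreal (Phi k (\<bar>w x\<bar> / lam)) * indicator R x) + ennreal (exp (c * Y x)) * indicator R x) \<partial>lebesgue)"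
    proof (rule nn_integral_mono)
      fix x
      have "w x / lam * Y x ^ k \<le> C * Phi k (w x / lam) + exp (c * Y x)"
        using C(2)[of "w x / lam" "Y x" 0] w(1) Y(1) lam by simp
      then have "lam * (w x / lam * Y x ^ k) \<le> lam * (C * Phi k (w x / lam) + exp (c * Y x))"
        using lam by (intro mult_left_mono) auto
      then have "w x * Y x ^ k \<le> lam * (C * Phi k (w x / lam) + exp (c * Y x))" using lam by simp
      then have "ennreal (w x * Y x ^ k) \<le> ennreal (lam * (C * Phi k (w x / lam) + exp (c * Y x)))"
        by (rule ennreal_leI)
      also have "\<dots> = ennreal lam * (ennreal C * ennreal (Phi k (\<bar>w x\<bar> / lam)) + ennreal (exp (c * Y x)))"
        using C(1) lam w(1) by (simp add: ennreal_mult ennreal_plus Phi_nonneg)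
      finally show "ennreal (w x * Y x ^ k) * indicator R x \<le> ennreal lam * (ennreal C * (ennreal (Phi k (\<bar>w x\<bar> / lam)) * indicator R x) + ennreal (exp (c * Y x)) * indicator R x)"
        by (auto split: split_indicator)
    qed
    also have "\<dots> = ennreal lam * (ennreal C * (\<integral>\<^sup>+ x \<in> R. ennreal (Phi k (\<bar>w x\<bar> / lam)) \<partial>lebesgue) + (\<integral>\<^sup>+x\<in>R. ennreal (exp (c * Y x)) \<partial>lebesgue))"
      by (simp add: nn_integral_cmult nn_integral_add)
    also have "\<dots> \<le> ennreal lam * (ennreal C * emeasure lebesgue R + ennreal B * emeasure lebesgue R)"
      using lam2 le by (intro mult_left_mono add_mono) auto
    also have "\<dots> = ennreal (C + B) * emeasure lebesgue R * ennreal lam"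
      using C(1) B by (simp add: distrib_right distrib_left mult_ac)
    finally show "(\<integral>\<^sup>+x\<in>R. ennreal (w x * Y x ^ k) \<partial>lebesgue) \<le> ennreal (C + B) * emeasure lebesgue R * ennreal lam" .
  qed
  show ?thesis by (rule that[of "C + B"], use C(1) B in simp, rule main)
qed

lemma ennreal_add_cancel_le: "a < \<infinity> \<Longrightarrow> a + b \<le> a + c \<Longrightarrow> b \<le> (c::ennreal)"
  by (auto simp: ennreal_add_left_cancel_le)

text \<open>Converts a lower bound on the average of f Y^k into a lower bound on the modular of
  \<open>f\<close>, where a Luxemburg norm would be of no use later. The exponential half of Young's
  inequality is made half of the average and absorbed. The loss is polynomial in the level
  \<open>q\<close>, to be paid by geometric decay.\<close>

lemma level_bound:
  assumes c: "(c::real) > 0" and L: "L > 1"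
  obtains C where "C > 0" "\<And>(f::'a::euclidean_space \<Rightarrow> real) Y R q. cube R \<Longrightarrow> (\<And>x. 0 \<le> f x) \<Longrightarrow> f \<in> borel_measurable lebesgue
    \<Longrightarrow> (\<And>x. 0 \<le> Y x) \<Longrightarrow> Y \<in> borel_measurable lebesgue
    \<Longrightarrow> (\<integral>\<^sup>+x\<in>R. ennreal (exp (c * Y x)) \<partial>lebesgue) \<le> 7 * emeasure lebesgue R
    \<Longrightarrow> ennreal ((1/L) ^ Suc q) * emeasure lebesgue R \<le> (\<integral>\<^sup>+x\<in>R. ennreal (f x * Y x ^ k) \<partial>lebesgue)
    \<Longrightarrow> ennreal ((1/L) ^ q) * emeasure lebesgue R \<le> ennreal (C * (real q + 1) ^ k) * (\<integral>\<^sup>+x\<in>R. ennreal (Phi k (f x)) \<partial>lebesgue)"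
proof -
  \<comment> \<open>14 = 2 * 7: with the John-Nirenberg bound 7 the exponential term becomes exactly
    L^(-q-1) / 2.\<close>
  define th where "th = 1 / (14 * L)"
  have th: "th > 0" using L by (simp add: th_def)
  obtain C where C: "C > 0" "\<And>(q::nat) s y. s \<ge> 0 \<Longrightarrow> y \<ge> 0 \<Longrightarrow>
     s * y ^ k \<le> C * (real q + 1) ^ k * Phi k s + th * (1 / L) ^ q * exp (c * y)"
    using Young_pointwise[OF c th L, of k] by auto
  have main: "ennreal ((1/L) ^ q) * emeasure lebesgue R \<le> ennreal ((2 * L * C) * (real q + 1) ^ k) * (\<integral>\<^sup>+x\<in>R. ennreal (Phi k (f x)) \<partial>lebesgue)"
    if R: "cube R" and f: "\<And>x. 0 \<le> f x" "f \<in> borel_measurable lebesgue"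
      and Y: "\<And>x. 0 \<le> Y x" "Y \<in> borel_measurable lebesgue"
      and le: "(\<integral>\<^sup>+x\<in>R. ennreal (exp (c * Y x)) \<partial>lebesgue) \<le> 7 * emeasure lebesgue R"
      and ge: "ennreal ((1/L) ^ Suc q) * emeasure lebesgue R \<le> (\<integral>\<^sup>+x\<in>R. ennreal (f x * Y x ^ k) \<partial>lebesgue)"
    for f Y :: "'a \<Rightarrow> real" and R q
  proof -
    note m = cube_measure[OF R]
    note [measurable] = f(2) Y(2) m(4)
    let ?C = "C * (real q + 1) ^ k" and ?t = "th * (1 / L) ^ q"
    let ?a = "ennreal ((1/L) ^ Suc q / 2) * emeasure lebesgue R"
    have C0: "?C \<ge> 0" using C(1) by simp
    have t0: "?t \<ge> 0" using th L by simp
    have "(\<integral>\<^sup>+x\<in>R. ennreal (f x * Y x ^ k) \<partial>lebesgue) \<le>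
       (\<integral>\<^sup>+x. ennreal ?C * (ennreal (Phi k (f x)) * indicator R x) + ennreal ?t * (ennreal (exp (c * Y x)) * indicator R x) \<partial>lebesgue)"
    proof (rule nn_integral_mono)
      fix x
      have "ennreal (f x * Y x ^ k) \<le> ennreal (?C * Phi k (f x) + ?t * exp (c * Y x))"
        using C(2)[OF f(1) Y(1), of x x q] by (intro ennreal_leI)
      also have "\<dots> = ennreal ?C * ennreal (Phi k (f x)) + ennreal ?t * ennreal (exp (c * Y x))"
        using C0 t0 by (simp add: ennreal_mult ennreal_plus Phi_nonneg f(1) del: times_divide_eq_right)
      finally show "ennreal (f x * Y x ^ k) * indicator R x \<le> ennreal ?C * (ennreal (Phi k (f x)) * indicator R x) + ennreal ?t * (ennreal (exp (c * Y x)) * indicator R x)"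
        by (auto split: split_indicator)
    qed
    also have "\<dots> = ennreal ?C * (\<integral>\<^sup>+x\<in>R. ennreal (Phi k (f x)) \<partial>lebesgue) + ennreal ?t * (\<integral>\<^sup>+x\<in>R. ennreal (exp (c * Y x)) \<partial>lebesgue)"
      by (simp add: nn_integral_cmult nn_integral_add)
    also have "\<dots> \<le> ennreal ?C * (\<integral>\<^sup>+x\<in>R. ennreal (Phi k (f x)) \<partial>lebesgue) + ennreal ?t * (7 * emeasure lebesgue R)"
      using le by (intro add_mono mult_left_mono) auto
    also have "ennreal ?t * (7 * emeasure lebesgue R) = ?a"
    proof -
      have "ennreal ?t * 7 = ennreal (?t * 7)" using t0 by (simp add: ennreal_mult')
      also have "?t * 7 = (1/L) ^ Suc q / 2" using L by (simp add: th_def)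
      finally show ?thesis by (simp add: mult.assoc[symmetric])
    qed
    finally have h1: "ennreal ((1/L) ^ Suc q) * emeasure lebesgue R \<le> ennreal ?C * (\<integral>\<^sup>+x\<in>R. ennreal (Phi k (f x)) \<partial>lebesgue) + ?a"
      using ge by (rule order_trans[rotated])
    have "ennreal ((1/L) ^ Suc q) = ennreal ((1/L) ^ Suc q / 2) + ennreal ((1/L) ^ Suc q / 2)"
      using L by (subst ennreal_plus[symmetric]) auto
    then have h2: "ennreal ((1/L) ^ Suc q) * emeasure lebesgue R = ?a + ?a" by (simp only: distrib_right)
    \<comment> \<open>Finiteness of half of the left side is what permits the absorption.\<close>
    have "?a < \<infinity>" using m(3) by (simp add: ennreal_mult_less_top)
    moreover have "?a + ?a \<le> ?a + ennreal ?C * (\<integral>\<^sup>+x\<in>R. ennreal (Phi k (f x)) \<partial>lebesgue)"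
      by (rule order_trans[OF h1[unfolded h2] eq_refl[OF add.commute]])
    ultimately have "?a \<le> ennreal ?C * (\<integral>\<^sup>+x\<in>R. ennreal (Phi k (f x)) \<partial>lebesgue)"
      by (rule ennreal_add_cancel_le)
    then have "ennreal (2 * L) * ?a \<le> ennreal (2 * L) * (ennreal ?C * (\<integral>\<^sup>+x\<in>R. ennreal (Phi k (f x)) \<partial>lebesgue))"
      by (intro mult_left_mono) auto
    moreover have "ennreal (2 * L) * ?a = ennreal ((1/L) ^ q) * emeasure lebesgue R"
      using L by (simp add: mult.assoc[symmetric] ennreal_mult'[symmetric])
    moreover have "ennreal (2 * L) * ennreal ?C = ennreal ((2 * L * C) * (real q + 1) ^ k)"
      using L C0 by (simp add: ennreal_mult'[symmetric] mult.assoc)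
    ultimately show ?thesis by (simp add: mult.assoc[symmetric])
  qed
  show ?thesis by (rule that[of "2 * L * C"], use C(1) L in simp, rule main)
qed

section \<open>Maximal function and kernel tails\<close>

lemma emeasure_lebesgue_ball:
  "r \<ge> 0 \<Longrightarrow> emeasure lebesgue (ball c r :: 'a::euclidean_space set) = ennreal (unit_ball_vol (real DIM('a)) * r ^ DIM('a))"
  by (simp add: emeasure_completion emeasure_ball)

lemma ball_lebesgue [measurable]: "ball (x::'a::euclidean_space) r \<in> sets lebesgue"
  by simp

lemma cbox_lebesgue [measurable]: "cbox (x::'a::euclidean_space) y \<in> sets lebesgue"
  by simp

lemma unit_ball_vol_DIM_pos: "0 < unit_ball_vol (real DIM('a::euclidean_space))"
  by (simp add: unit_ball_vol_def)

text \<open>Weak type of the centred maximal function, phrased through a measurable superset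
  \<open>N\<close> of the superlevel set so that measurability of the maximal function does not
  arise. A finite integral of \<open>g\<close> bounds the radii of violating balls, and Vitali then
  selects disjoint ones.\<close>

lemma maximal_weak_type:
  fixes g :: "'a::euclidean_space \<Rightarrow> ennreal"
  assumes g [measurable]: "g \<in> borel_measurable lebesgue" and lam: "lam > 0"
  obtains N where "N \<in> sets lebesgue"
    "\<And>x r. r > 0 \<Longrightarrow> ennreal lam * emeasure lebesgue (ball x r) < (\<integral>\<^sup>+y\<in>ball x r. g y \<partial>lebesgue) \<Longrightarrow> x \<in> N"
    "emeasure lebesgue N \<le> ennreal (5 ^ DIM('a) / lam) * (\<integral>\<^sup>+x. g x \<partial>lebesgue)"
proof (cases "(\<integral>\<^sup>+x. g x \<partial>lebesgue) = \<infinity>")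
  case True
  then show ?thesis using that[of UNIV] lam by (simp add: ennreal_mult_top)
next
  case False
  define v where "v = unit_ball_vol (real DIM('a))"
  have v: "v > 0" unfolding v_def by (rule unit_ball_vol_DIM_pos)
  obtain G where G: "(\<integral>\<^sup>+x. g x \<partial>lebesgue) = ennreal G" "G \<ge> 0" using False by (cases "(\<integral>\<^sup>+x. g x \<partial>lebesgue)") auto
  define K where "K = {(x, r). r > 0 \<and> ennreal lam * emeasure lebesgue (ball x r) < (\<integral>\<^sup>+y\<in>ball x r. g y \<partial>lebesgue)}"
  have B: "0 < snd i \<and> snd i \<le> max 1 (G / (lam * v))" if "i \<in> K" for i
  proof -
    obtain x r where i: "i = (x, r)" by force
    have r: "r > 0" "ennreal lam * emeasure lebesgue (ball x r) < (\<integral>\<^sup>+y\<in>ball x r. g y \<partial>lebesgue)"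
      using that i by (auto simp: K_def)
    have "ennreal (lam * (v * r ^ DIM('a))) = ennreal lam * emeasure lebesgue (ball x r)"
      using r(1) lam v by (simp add: emeasure_lebesgue_ball v_def ennreal_mult)
    also have "\<dots> \<le> (\<integral>\<^sup>+y. g y \<partial>lebesgue)"
      using r(2) by (rule order_trans[OF less_imp_le]) (auto intro!: nn_integral_mono split: split_indicator)
    finally have "lam * (v * r ^ DIM('a)) \<le> G" using G by simp
    then have "r ^ DIM('a) \<le> G / (lam * v)" using lam v by (simp add: field_simps)
    moreover have "r \<le> r ^ DIM('a)" if "r \<ge> 1" using power_increasing[of 1 "DIM('a)" r] that by simp
    ultimately have "r \<le> max 1 (G / (lam * v))" by linarith
    then show ?thesis using r i by simp
  qed
  obtain C where C: "countable C" "C \<subseteq> K" "pairwise (\<lambda>i j. disjnt (ball (fst i) (snd i)) (ball (fst j) (snd j))) C"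
    "(\<Union>i\<in>K. ball (fst i) (snd i)) \<subseteq> (\<Union>i\<in>C. ball (fst i) (5 * snd i))"
    by (rule Vitali_covering_lemma_balls[OF subset_refl B])
  define N where "N = (\<Union>i\<in>C. ball (fst i) (5 * snd i))"
  have "N \<in> sets lebesgue" unfolding N_def using C(1) by (intro sets.countable_UN') auto
  moreover have "x \<in> N" if "r > 0" "ennreal lam * emeasure lebesgue (ball x r) < (\<integral>\<^sup>+y\<in>ball x r. g y \<partial>lebesgue)" for x r
  proof -
    have "(x, r) \<in> K" using that by (simp add: K_def)
    then have "x \<in> (\<Union>i\<in>K. ball (fst i) (snd i))" using that(1) by (intro UN_I[of "(x, r)"]) auto
    then show ?thesis using C(4) unfolding N_def by blast
  qed
  moreover have "emeasure lebesgue N \<le> ennreal (5 ^ DIM('a) / lam) * (\<integral>\<^sup>+x. g x \<partial>lebesgue)"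
  proof -
    have dj: "disjoint_family_on (\<lambda>i. ball (fst i) (snd i)) C"
      using C(3) by (auto simp: disjoint_family_on_def pairwise_def disjnt_def)
    have "emeasure lebesgue N \<le> (\<integral>\<^sup>+i. emeasure lebesgue (ball (fst i) (5 * snd i)) \<partial>count_space C)"
      unfolding N_def using C(1) by (intro emeasure_UN_le_count_space) auto
    also have "\<dots> \<le> (\<integral>\<^sup>+i. ennreal (5 ^ DIM('a) / lam) * (\<integral>\<^sup>+y\<in>ball (fst i) (snd i). g y \<partial>lebesgue) \<partial>count_space C)"
    proof (rule nn_integral_mono)
      fix i assume "i \<in> space (count_space C)"
      then have i: "i \<in> K" using C(2) by auto
      then have r: "snd i > 0" "ennreal lam * emeasure lebesgue (ball (fst i) (snd i)) \<le> (\<integral>\<^sup>+y\<in>ball (fst i) (snd i). g y \<partial>lebesgue)"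
        by (auto simp: K_def)
      have "emeasure lebesgue (ball (fst i) (5 * snd i)) = ennreal (5 ^ DIM('a) / lam) * (ennreal lam * emeasure lebesgue (ball (fst i) (snd i)))"
        using r(1) v lam by (simp add: emeasure_lebesgue_ball v_def[symmetric] ennreal_mult[symmetric] power_mult_distrib)
      also have "\<dots> \<le> ennreal (5 ^ DIM('a) / lam) * (\<integral>\<^sup>+y\<in>ball (fst i) (snd i). g y \<partial>lebesgue)"
        using r(2) by (intro mult_left_mono) auto
      finally show "emeasure lebesgue (ball (fst i) (5 * snd i)) \<le> ennreal (5 ^ DIM('a) / lam) * (\<integral>\<^sup>+y\<in>ball (fst i) (snd i). g y \<partial>lebesgue)" .
    qed
    also have "\<dots> = ennreal (5 ^ DIM('a) / lam) * (\<integral>\<^sup>+i. (\<integral>\<^sup>+y\<in>ball (fst i) (snd i). g y \<partial>lebesgue) \<partial>count_space C)"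
      by (rule nn_integral_cmult) simp
    also have "(\<integral>\<^sup>+i. (\<integral>\<^sup>+y\<in>ball (fst i) (snd i). g y \<partial>lebesgue) \<partial>count_space C) = (\<integral>\<^sup>+y\<in>(\<Union>i\<in>C. ball (fst i) (snd i)). g y \<partial>lebesgue)"
      using C(1) dj by (intro nn_integral_disjoint_UN[symmetric]) auto
    also have "\<dots> \<le> (\<integral>\<^sup>+y. g y \<partial>lebesgue)"
      by (intro nn_integral_mono) (auto split: split_indicator)
    finally show ?thesis by (simp add: mult_left_mono)
  qed
  ultimately show ?thesis using that by blast
qed

text \<open>Split into annuli 2^k l \<le> |x - y| < 2^(k+1) l: each contributes at most a multiple
  of 2^(-k d) A. With g = 1 it bounds the integral of the tail factor itself; with g = |f| it brings
  in the maximal function at \<open>x\<close>.\<close>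

lemma tail_bound:
  assumes d: "(d::real) > 0"
  obtains C where "C > 0" "\<And>(x::'a::euclidean_space) l g A. l > 0 \<Longrightarrow> g \<in> borel_measurable lebesgue
    \<Longrightarrow> (\<And>r. r > 0 \<Longrightarrow> (\<integral>\<^sup>+y\<in>ball x r. g y \<partial>lebesgue) \<le> A * emeasure lebesgue (ball x r))
    \<Longrightarrow> (\<integral>\<^sup>+y\<in>{y. l \<le> dist x y}. ennreal (l powr d / dist x y powr (real DIM('a) + d)) * g y \<partial>lebesgue) \<le> ennreal C * A"
proof -
  define v where "v = unit_ball_vol (real DIM('a))"
  have v: "v > 0" unfolding v_def by (rule unit_ball_vol_DIM_pos)
  define s where "s = 2 powr (- d)"
  have s: "0 < s" "s < 1" using d by (auto simp: s_def powr_less_one)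
  define C where "C = v * 2 ^ DIM('a) * (1 / (1 - s))"
  have main: "(\<integral>\<^sup>+y\<in>{y. l \<le> dist x y}. ennreal (l powr d / dist x y powr (real DIM('a) + d)) * g y \<partial>lebesgue) \<le> ennreal C * A"
    if l: "l > 0" and g [measurable]: "g \<in> borel_measurable lebesgue"
      and A: "\<And>r. r > 0 \<Longrightarrow> (\<integral>\<^sup>+y\<in>ball x r. g y \<partial>lebesgue) \<le> A * emeasure lebesgue (ball x r)"
    for x :: 'a and l g A
  proof -
    let ?a = "\<lambda>k. s ^ k / (2 ^ k * l) ^ DIM('a)"
    have pt: "ennreal (l powr d / dist x y powr (real DIM('a) + d)) * g y * indicator {y. l \<le> dist x y} y
       \<le> (\<Sum>k. ennreal (?a k) * (g y * indicator (ball x (2 ^ Suc k * l)) y))" for y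
    proof (cases "l \<le> dist x y")
      case True
      define D where "D = dist x y"
      have D: "D \<ge> l" "D > 0" using True l by (auto simp: D_def)
      define k where "k = nat \<lfloor>log 2 (D / l)\<rfloor>"
      have "log 2 (D / l) \<ge> 0" using D l by (simp add: zero_le_log_cancel_iff)
      then have k: "real k \<le> log 2 (D / l)" "log 2 (D / l) < real k + 1"
        unfolding k_def by linarith+
      have "2 powr real k \<le> D / l" using k(1) D l by (simp add: le_log_iff)
      then have k1: "2 ^ k * l \<le> D" using l by (simp add: powr_realpow field_simps)
      have "D / l < 2 powr (real k + 1)" using k(2) D l by (simp add: log_less_iff)
      then have k2: "D < 2 ^ Suc k * l" using l by (simp add: powr_add powr_realpow field_simps)
      have "l powr d / D powr (real DIM('a) + d) \<le> l powr d / (2 ^ k * l) powr (real DIM('a) + d)"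
        using k1 l d D by (intro divide_left_mono powr_mono2 mult_pos_pos) auto
      also have "\<dots> = ?a k"
      proof -
        have "(2 ^ k * l) powr (real DIM('a) + d) = (2 ^ k * l) ^ DIM('a) * ((2 ^ k) powr d * l powr d)"
          using l by (simp add: powr_add powr_realpow powr_mult power_mult_distrib)
        moreover have "(2 ^ k) powr d * s ^ k = 1"
        proof -
          have "(2 ^ k) powr d * s ^ k = 2 powr (real k * d) * 2 powr (- d * real k)"
            by (simp add: s_def powr_powr powr_realpow[symmetric])
          also have "\<dots> = 1" by (simp add: powr_add[symmetric])
          finally show ?thesis .
        qed
        moreover have "l powr d > 0" "(2 ^ k) powr d > (0::real)" using l by auto
        ultimately show ?thesis using l by (simp add: field_simps)
      qed
      finally have "l powr d / D powr (real DIM('a) + d) \<le> ?a k" .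
      then have "ennreal (l powr d / dist x y powr (real DIM('a) + d)) * g y * indicator {y. l \<le> dist x y} y
        \<le> ennreal (?a k) * (g y * indicator (ball x (2 ^ Suc k * l)) y)"
        using k2 True by (simp add: D_def[symmetric]) (intro mult_right_mono ennreal_leI, auto)
      also have "\<dots> \<le> (\<Sum>k. ennreal (?a k) * (g y * indicator (ball x (2 ^ Suc k * l)) y))"
        by (rule le_suminf_ennreal)
      finally show ?thesis .
    qed simp
    have "(\<integral>\<^sup>+y\<in>{y. l \<le> dist x y}. ennreal (l powr d / dist x y powr (real DIM('a) + d)) * g y \<partial>lebesgue)
      \<le> (\<integral>\<^sup>+y. (\<Sum>k. ennreal (?a k) * (g y * indicator (ball x (2 ^ Suc k * l)) y)) \<partial>lebesgue)"
      using pt by (intro nn_integral_mono) auto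
    also have "\<dots> = (\<Sum>k. \<integral>\<^sup>+y. ennreal (?a k) * (g y * indicator (ball x (2 ^ Suc k * l)) y) \<partial>lebesgue)"
      by (rule nn_integral_suminf) measurable
    also have "\<dots> \<le> (\<Sum>k. ennreal (v * 2 ^ DIM('a) * s ^ k) * A)"
    proof (intro suminf_le summableI)
      fix k
      have "(\<integral>\<^sup>+y. ennreal (?a k) * (g y * indicator (ball x (2 ^ Suc k * l)) y) \<partial>lebesgue)
         = ennreal (?a k) * (\<integral>\<^sup>+y\<in>ball x (2 ^ Suc k * l). g y \<partial>lebesgue)"
        by (rule nn_integral_cmult) measurable
      also have "\<dots> \<le> ennreal (?a k) * (A * emeasure lebesgue (ball x (2 ^ Suc k * l)))"
        using l by (intro mult_left_mono A) auto
      also have "\<dots> = (ennreal (?a k) * ennreal (v * (2 ^ Suc k * l) ^ DIM('a))) * A"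
        using l by (subst emeasure_lebesgue_ball) (auto simp: v_def mult_ac)
      also have "ennreal (?a k) * ennreal (v * (2 ^ Suc k * l) ^ DIM('a)) = ennreal (?a k * (v * (2 ^ Suc k * l) ^ DIM('a)))"
        using l s by (subst ennreal_mult'[symmetric]) auto
      also have "?a k * (v * (2 ^ Suc k * l) ^ DIM('a)) = v * 2 ^ DIM('a) * s ^ k"
        using l by (simp add: power_mult_distrib mult.assoc)
      finally show "(\<integral>\<^sup>+y. ennreal (?a k) * (g y * indicator (ball x (2 ^ Suc k * l)) y) \<partial>lebesgue) \<le> ennreal (v * 2 ^ DIM('a) * s ^ k) * A" .
    qed
    also have "\<dots> = (\<Sum>k. ennreal (v * 2 ^ DIM('a) * s ^ k)) * A"
      by (rule ennreal_suminf_multc)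
    also have "(\<Sum>k. ennreal (v * 2 ^ DIM('a) * s ^ k)) = ennreal C"
      unfolding C_def using v s by (intro suminf_ennreal_eq sums_mult geometric_sums) auto
    finally show ?thesis .
  qed
  show ?thesis by (rule that[of C], use v s in \<open>simp add: C_def\<close>, rule main)
qed

section \<open>Weak type (1,1) of Calderon-Zygmund operators\<close>

lemma L2_iff: "L2 f \<longleftrightarrow> f \<in> borel_measurable lebesgue \<and> (\<integral>\<^sup>+x. ennreal ((norm (f x))\<^sup>2) \<partial>lebesgue) < \<infinity>"
  unfolding L2_def by (auto simp: integrable_iff_bounded)

lemma L2_measurable [measurable_dest]: "L2 f \<Longrightarrow> f \<in> borel_measurable lebesgue"
  by (simp add: L2_def)

lemma L2_dom:
  assumes "L2 f" "g \<in> borel_measurable lebesgue" "\<And>x. norm (g x) \<le> norm (f x)"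
  shows "L2 g"
proof -
  have "(\<integral>\<^sup>+x. ennreal ((norm (g x))\<^sup>2) \<partial>lebesgue) \<le> (\<integral>\<^sup>+x. ennreal ((norm (f x))\<^sup>2) \<partial>lebesgue)"
    using assms(3) by (intro nn_integral_mono ennreal_leI power_mono) auto
  then show ?thesis using assms(1,2) by (auto simp: L2_iff)
qed

lemma L2_add:
  assumes "L2 f" "L2 g" shows "L2 (\<lambda>x. f x + g x)"
proof -
  note [measurable] = assms[THEN L2_measurable]
  have "(norm (f x + g x))\<^sup>2 \<le> 2 * (norm (f x))\<^sup>2 + 2 * (norm (g x))\<^sup>2" for x
  proof -
    have "(norm (f x + g x))\<^sup>2 \<le> (norm (f x) + norm (g x))\<^sup>2"
      by (intro power_mono norm_triangle_ineq) auto
    also have "\<dots> \<le> 2 * (norm (f x))\<^sup>2 + 2 * (norm (g x))\<^sup>2"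
      using sum_squares_bound[of "norm (f x)" "norm (g x)"] by (simp add: power2_sum)
    finally show ?thesis .
  qed
  then have "(\<integral>\<^sup>+x. ennreal ((norm (f x + g x))\<^sup>2) \<partial>lebesgue) \<le>
     (\<integral>\<^sup>+x. ennreal (2 * (norm (f x))\<^sup>2 + 2 * (norm (g x))\<^sup>2) \<partial>lebesgue)"
    by (intro nn_integral_mono ennreal_leI) auto
  also have "\<dots> = (\<integral>\<^sup>+x. 2 * ennreal ((norm (f x))\<^sup>2) + 2 * ennreal ((norm (g x))\<^sup>2) \<partial>lebesgue)"
    by (intro nn_integral_cong) (simp add: ennreal_mult)
  also have "\<dots> = 2 * (\<integral>\<^sup>+x. ennreal ((norm (f x))\<^sup>2) \<partial>lebesgue) + 2 * (\<integral>\<^sup>+x. ennreal ((norm (g x))\<^sup>2) \<partial>lebesgue)"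
    by (simp add: nn_integral_add nn_integral_cmult)
  also have "\<dots> < \<infinity>" using assms by (auto simp: L2_iff ennreal_mult_less_top)
  finally show ?thesis by (simp add: L2_iff)
qed

lemma L2_cmult:
  assumes "L2 f" shows "L2 (\<lambda>x. c * f x)"
proof -
  note [measurable] = assms[THEN L2_measurable]
  have "(\<integral>\<^sup>+x. ennreal ((norm (c * f x))\<^sup>2) \<partial>lebesgue) = ennreal ((norm c)\<^sup>2) * (\<integral>\<^sup>+x. ennreal ((norm (f x))\<^sup>2) \<partial>lebesgue)"
    by (subst nn_integral_cmult[symmetric]) (auto simp: norm_mult power_mult_distrib ennreal_mult)
  then show ?thesis using assms by (auto simp: L2_iff ennreal_mult_less_top)
qed

lemma L2_zero: "L2 (\<lambda>x. 0)" by (simp add: L2_iff)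

lemma L2_sum: "finite I \<Longrightarrow> (\<And>i. i \<in> I \<Longrightarrow> L2 (f i)) \<Longrightarrow> L2 (\<lambda>x. \<Sum>i\<in>I. f i x)"
  by (induction I rule: finite_induct) (auto simp: L2_zero L2_add)

lemma L2_indicator: "L2 f \<Longrightarrow> S \<in> sets lebesgue \<Longrightarrow> L2 (\<lambda>x. indicator S x * f x)"
  by (rule L2_dom) (auto simp: norm_mult split: split_indicator)

lemma L2_bounded_finite:
  assumes "S \<in> sets lebesgue" "emeasure lebesgue S < \<infinity>" "g \<in> borel_measurable lebesgue" "\<And>x. norm (g x) \<le> c" "\<And>x. x \<notin> S \<Longrightarrow> g x = 0"
  shows "L2 g"
proof -
  have "(\<integral>\<^sup>+x. ennreal ((norm (g x))\<^sup>2) \<partial>lebesgue) \<le> (\<integral>\<^sup>+x. ennreal (c\<^sup>2) * indicator S x \<partial>lebesgue)"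
    using assms(4,5) by (intro nn_integral_mono) (auto intro!: ennreal_leI power_mono split: split_indicator)
  also have "\<dots> < \<infinity>" using assms by (simp add: nn_integral_cmult_indicator ennreal_mult_less_top)
  finally show ?thesis using assms by (simp add: L2_iff)
qed

lemma emeasure_gt_le:
  assumes [measurable]: "u \<in> borel_measurable M" "A \<in> sets M" and "lam > 0"
  shows "emeasure M {x \<in> A. lam < u x} \<le> ennreal (1 / lam) * (\<integral>\<^sup>+x\<in>A. ennreal (u x) \<partial>M)"
proof -
  have m: "{x \<in> A. lam < u x} \<in> sets M"
  proof -
    have "A \<inter> {x \<in> space M. lam < u x} \<in> sets M" by measurable
    moreover have "A \<inter> {x \<in> space M. lam < u x} = {x \<in> A. lam < u x}" using sets.sets_into_space[OF assms(2)] by auto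
    ultimately show ?thesis by simp
  qed
  have "emeasure M {x \<in> A. lam < u x} = (\<integral>\<^sup>+x. indicator {x \<in> A. lam < u x} x \<partial>M)" using m by simp
  also have "\<dots> \<le> (\<integral>\<^sup>+x. ennreal (1 / lam) * (ennreal (u x) * indicator A x) \<partial>M)"
  proof (rule nn_integral_mono)
    fix x
    have "1 \<le> ennreal (1 / lam) * ennreal (u x)" if "lam < u x"
    proof -
      have "1 \<le> (1 / lam) * u x" using that assms(3) by (simp add: field_simps)
      then have "ennreal 1 \<le> ennreal ((1 / lam) * u x)" by (rule ennreal_leI)
      also have "\<dots> = ennreal (1 / lam) * ennreal (u x)" using assms(3) that by (intro ennreal_mult) auto
      finally show ?thesis by simp
    qed
    then show "indicator {x \<in> A. lam < u x} x \<le> ennreal (1 / lam) * (ennreal (u x) * indicator A x)"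
      by (auto split: split_indicator)
  qed
  also have "\<dots> = ennreal (1 / lam) * (\<integral>\<^sup>+x\<in>A. ennreal (u x) \<partial>M)" by (rule nn_integral_cmult) auto
  finally show ?thesis .
qed

lemma sets_Collect_gt_lebesgue:
  "u \<in> borel_measurable lebesgue \<Longrightarrow> {x::'a::euclidean_space. c < (u x::real)} \<in> sets lebesgue"
proof -
  assume [measurable]: "u \<in> borel_measurable lebesgue"
  have "{x \<in> space lebesgue. c < u x} \<in> sets lebesgue" by measurable
  then show ?thesis by simp
qed

lemma integrable_indicator_mult:
  assumes "A \<in> sets M" "emeasure M A < \<infinity>"
  shows "integrable M (\<lambda>y. indicator A y * (z::complex))"
    and integral_indicator_mult: "(\<integral>y. indicator A y * z \<partial>M) = complex_of_real (measure M A) * z"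
proof -
  have eq: "(\<lambda>y. indicator A y * z) = (\<lambda>y. indicator A y *\<^sub>R z)" by (auto split: split_indicator)
  have "integrable M (indicator A :: _ \<Rightarrow> real)" using assms by simp
  then show "integrable M (\<lambda>y. indicator A y * z)" "(\<integral>y. indicator A y * z \<partial>M) = complex_of_real (measure M A) * z"
    using sets.sets_into_space[OF assms(1)] unfolding eq by (auto simp: scaleR_conv_of_real Int_absorb2)
qed

text \<open>Continuity from above for the measure with density \<open>h\<close>: by disjointness,
  removing longer and longer initial segments of an enumeration leaves sets that decrease to the
  empty set.\<close>

lemma finite_subfamily_remainder:
  fixes h :: "'a::euclidean_space \<Rightarrow> ennreal"
  assumes P: "countable P" "disjoint_family_on hcube P" and h [measurable]: "h \<in> borel_measurable lebesgue"
    and fin: "(\<integral>\<^sup>+x. h x \<partial>lebesgue) < \<infinity>" and e: "e > 0"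
  obtains F where "finite F" "F \<subseteq> P" "(\<integral>\<^sup>+x\<in>(\<Union>r\<in>P-F. hcube r). h x \<partial>lebesgue) \<le> ennreal e"
proof (cases "P = {}")
  case True
  then show ?thesis using that[of "{}"] by simp
next
  case False
  define F where "F k = from_nat_into P ` {..<k::nat}" for k
  define A where "A k = (\<Union>r\<in>P - F k. hcube r)" for k
  have Am: "A k \<in> sets lebesgue" for k
    unfolding A_def using P(1) by (intro sets.countable_UN') auto
  have FP: "F k \<subseteq> P" for k unfolding F_def using False by (auto intro: from_nat_into)
  have dec: "decseq A" unfolding decseq_def A_def F_def by (intro allI impI UN_mono) auto
  have "(\<Inter>k. A k) = {}"
  proof (rule ccontr)
    assume "(\<Inter>k. A k) \<noteq> {}"
    then obtain x where x: "\<And>k. x \<in> A k" by blast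
    obtain r where r: "r \<in> P" "x \<in> hcube r" using x[of 0] by (auto simp: A_def)
    obtain i where i: "from_nat_into P i = r" using r(1) P(1) from_nat_into_surj by metis
    obtain t where t: "t \<in> P - F (Suc i)" "x \<in> hcube t" using x[of "Suc i"] by (auto simp: A_def)
    have "r \<in> F (Suc i)" unfolding F_def using i by auto
    moreover have "t = r" using t r P(2) unfolding disjoint_family_on_def by blast
    ultimately show False using t by simp
  qed
  moreover have "(\<lambda>k. emeasure (density lebesgue h) (A k)) \<longlonglongrightarrow> emeasure (density lebesgue h) (\<Inter>k. A k)"
  proof (rule Lim_emeasure_decseq)
    show "range A \<subseteq> sets (density lebesgue h)" using Am by auto
    show "decseq A" by (rule dec)
    fix k
    have "emeasure (density lebesgue h) (A k) = (\<integral>\<^sup>+x\<in>A k. h x \<partial>lebesgue)" using Am by (simp add: emeasure_density)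
    also have "\<dots> \<le> (\<integral>\<^sup>+x. h x \<partial>lebesgue)" by (intro nn_integral_mono) (auto split: split_indicator)
    finally show "emeasure (density lebesgue h) (A k) \<noteq> \<infinity>" using fin by auto
  qed
  ultimately have "(\<lambda>k. emeasure (density lebesgue h) (A k)) \<longlonglongrightarrow> 0" by simp
  then have "\<forall>\<^sub>F k in sequentially. emeasure (density lebesgue h) (A k) < ennreal e"
    using e by (intro order_tendstoD(2)) auto
  then obtain k where "emeasure (density lebesgue h) (A k) < ennreal e"
    by (auto simp: eventually_sequentially)
  then have "(\<integral>\<^sup>+x\<in>A k. h x \<partial>lebesgue) \<le> ennreal e" using Am by (simp add: emeasure_density)
  then show ?thesis using that[of "F k"] FP by (auto simp: F_def A_def)
qed

text \<open>Kernel and constants are parameters, so whatever constant is obtained inside depends on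
  \<open>T\<close> and the dimension only. Linearity and the kernel formula hold almost everywhere
  and for L2 arguments, hence the AE form of the identities that follow.\<close>

locale CZ =
  fixes T :: "('a::euclidean_space \<Rightarrow> complex) \<Rightarrow> 'a \<Rightarrow> complex"
    and K :: "'a \<Rightarrow> 'a \<Rightarrow> complex" and Ck d C2 :: real
  assumes d_pos: "0 < d" and Ck_pos: "0 < Ck" and C2_pos: "0 < C2"
    and K_reg1: "\<And>x x' y. x \<noteq> y \<Longrightarrow> 2 * dist x x' \<le> dist x y \<Longrightarrow>
        norm (K x y - K x' y) \<le> Ck * dist x x' powr d / dist x y powr (real DIM('a) + d)"
    and K_reg2: "\<And>x x' y. x \<noteq> y \<Longrightarrow> 2 * dist x x' \<le> dist x y \<Longrightarrow>
        norm (K y x - K y x') \<le> Ck * dist x x' powr d / dist x y powr (real DIM('a) + d)"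
    and K_size: "\<And>x y. x \<noteq> y \<Longrightarrow> norm (K x y) \<le> Ck / dist x y ^ DIM('a)"
    and T_L2: "\<And>f. L2 f \<Longrightarrow> L2 (T f)"
    and T_cong: "\<And>f g. L2 f \<Longrightarrow> (AE x in lebesgue. f x = g x) \<Longrightarrow> (AE x in lebesgue. T f x = T g x)"
    and T_lin: "\<And>f g c. L2 f \<Longrightarrow> L2 g \<Longrightarrow> (AE x in lebesgue. T (\<lambda>y. c * f y + g y) x = c * T f x + T g x)"
    and T_bd: "\<And>f. L2 f \<Longrightarrow> (\<integral>\<^sup>+x. ennreal ((norm (T f x))\<^sup>2) \<partial>lebesgue) \<le> ennreal C2 * (\<integral>\<^sup>+x. ennreal ((norm (f x))\<^sup>2) \<partial>lebesgue)"
    and T_ker: "\<And>f S. L2 f \<Longrightarrow> compact S \<Longrightarrow> (\<And>y. y \<notin> S \<Longrightarrow> f y = 0) \<Longrightarrow>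
        (AE x in lebesgue. x \<notin> S \<longrightarrow> T f x = (\<integral>y. K x y * f y \<partial>lebesgue))"

lemma CZO_imp_CZ:
  assumes "CZO T" shows "\<exists>K Ck d C2. CZ T K Ck d C2"
proof -
  obtain K where K: "CZ_kernel K" and T: "\<forall>f. L2 f \<longrightarrow> L2 (T f)"
     "\<forall>f g. L2 f \<and> (AE x in lebesgue. f x = g x) \<longrightarrow> (AE x in lebesgue. T f x = T g x)"
     "\<forall>f g c. L2 f \<and> L2 g \<longrightarrow>
        (AE x in lebesgue. T (\<lambda>y. c * f y + g y) x = c * T f x + T g x)"
     "\<exists>C. \<forall>f. L2 f \<longrightarrow>
        (\<integral>x. (norm (T f x))\<^sup>2 \<partial>lebesgue) \<le> C * (\<integral>x. (norm (f x))\<^sup>2 \<partial>lebesgue)"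
     "\<forall>f S. L2 f \<and> compact S \<and> (\<forall>y. y \<notin> S \<longrightarrow> f y = 0) \<longrightarrow>
        (AE x in lebesgue. x \<notin> S \<longrightarrow> T f x = (\<integral>y. K x y * f y \<partial>lebesgue))"
    using assms unfolding CZO_def by (elim exE conjE) (rule that, (assumption | (rule exI, assumption))+)
  obtain C where C: "\<forall>f. L2 f \<longrightarrow> (\<integral>x. (norm (T f x))\<^sup>2 \<partial>lebesgue) \<le> C * (\<integral>x. (norm (f x))\<^sup>2 \<partial>lebesgue)"
    using T(4) by blast
  obtain Ck d where k: "Ck > 0" "0 < d" "\<forall>x y. x \<noteq> y \<longrightarrow> norm (K x y) \<le> Ck / dist x y ^ DIM('a)"
     "\<forall>x x' y. x \<noteq> y \<and> 2 * dist x x' \<le> dist x y \<longrightarrow>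
        norm (K x y - K x' y) + norm (K y x - K y x')
          \<le> Ck * dist x x' powr d / dist x y powr (real DIM('a) + d)"
    using K unfolding CZ_kernel_def by blast
  have bd: "(\<integral>\<^sup>+x. ennreal ((norm (T f x))\<^sup>2) \<partial>lebesgue) \<le> ennreal (max C 1) * (\<integral>\<^sup>+x. ennreal ((norm (f x))\<^sup>2) \<partial>lebesgue)"
    if f: "L2 f" for f
  proof -
    have i: "integrable lebesgue (\<lambda>x. (norm (f x))\<^sup>2)" "integrable lebesgue (\<lambda>x. (norm (T f x))\<^sup>2)"
      using f T(1) by (auto simp: L2_def)
    have "(\<integral>x. (norm (T f x))\<^sup>2 \<partial>lebesgue) \<le> C * (\<integral>x. (norm (f x))\<^sup>2 \<partial>lebesgue)" using C f by blast
    also have "\<dots> \<le> max C 1 * (\<integral>x. (norm (f x))\<^sup>2 \<partial>lebesgue)"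
      by (intro mult_right_mono integral_nonneg_AE) auto
    finally show ?thesis using i by (simp add: nn_integral_eq_integral ennreal_mult'[symmetric])
  qed
  have r1: "norm (K x y - K x' y) \<le> Ck * dist x x' powr d / dist x y powr (real DIM('a) + d)"
    and r2: "norm (K y x - K y x') \<le> Ck * dist x x' powr d / dist x y powr (real DIM('a) + d)"
    if "x \<noteq> y" "2 * dist x x' \<le> dist x y" for x x' y
  proof -
    have *: "norm (K x y - K x' y) + norm (K y x - K y x') \<le> Ck * dist x x' powr d / dist x y powr (real DIM('a) + d)"
      using k(4) that by blast
    show "norm (K x y - K x' y) \<le> Ck * dist x x' powr d / dist x y powr (real DIM('a) + d)"
      using * norm_ge_zero[of "K y x - K y x'"] by linarith
    show "norm (K y x - K y x') \<le> Ck * dist x x' powr d / dist x y powr (real DIM('a) + d)"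
      using * norm_ge_zero[of "K x y - K x' y"] by linarith
  qed
  \<comment> \<open>The given L2 constant may be zero or negative; the maximum with 1 makes it
    positive.\<close>
  have "CZ T K Ck d (max C 1)"
  proof (rule CZ.intro)
    show "0 < d" "0 < Ck" "0 < max C 1" using k(1,2) by auto
    show "\<And>x y. x \<noteq> y \<Longrightarrow> norm (K x y) \<le> Ck / dist x y ^ DIM('a)" using k(3) by blast
    show "\<And>f. L2 f \<Longrightarrow> L2 (T f)" using T(1) by blast
    show "\<And>f g. L2 f \<Longrightarrow> (AE x in lebesgue. f x = g x) \<Longrightarrow> (AE x in lebesgue. T f x = T g x)" using T(2) by blast
    show "\<And>f g c. L2 f \<Longrightarrow> L2 g \<Longrightarrow> (AE x in lebesgue. T (\<lambda>y. c * f y + g y) x = c * T f x + T g x)" using T(3) by blast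
    show "\<And>f S. L2 f \<Longrightarrow> compact S \<Longrightarrow> (\<And>y. y \<notin> S \<Longrightarrow> f y = 0) \<Longrightarrow>
        (AE x in lebesgue. x \<notin> S \<longrightarrow> T f x = (\<integral>y. K x y * f y \<partial>lebesgue))" using T(5) by blast
  qed (rule r1 r2 bd; assumption)+
  then show ?thesis by blast
qed

context CZ begin

lemma T_zero: assumes "f \<in> borel_measurable lebesgue" "AE x in lebesgue. f x = 0"
  shows "AE x in lebesgue. T f x = 0"
proof -
  have 1: "AE x in lebesgue. T (\<lambda>y. 0) x = 0"
    using T_lin[OF L2_zero L2_zero, of "-1"] by simp
  have 2: "AE x in lebesgue. T (\<lambda>y. 0) x = T f x"
    by (rule T_cong[OF L2_zero]) (use assms(2) in auto)
  from 1 2 show ?thesis by eventually_elim simp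
qed

lemma T_add: "L2 f \<Longrightarrow> L2 g \<Longrightarrow> AE x in lebesgue. T (\<lambda>y. f y + g y) x = T f x + T g x"
  using T_lin[of f g 1] by simp

lemma T_cmult: assumes "L2 f" shows "AE x in lebesgue. T (\<lambda>y. c * f y) x = c * T f x"
  using T_lin[OF assms L2_zero, of c] T_zero[of "\<lambda>_. 0"] by (auto elim: eventually_elim2)

lemma T_sum:
  assumes "finite I" "\<And>i. i \<in> I \<Longrightarrow> L2 (f i)"
  shows "AE x in lebesgue. T (\<lambda>y. \<Sum>i\<in>I. f i y) x = (\<Sum>i\<in>I. T (f i) x)"
  using assms
proof (induction I rule: finite_induct)
  case empty
  then show ?case using T_zero[of "\<lambda>_. 0"] by simp
next
  case (insert i I)
  have "AE x in lebesgue. T (\<lambda>y. f i y + (\<Sum>i\<in>I. f i y)) x = T (f i) x + T (\<lambda>y. \<Sum>i\<in>I. f i y) x"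
    using insert by (intro T_add L2_sum) auto
  moreover have "AE x in lebesgue. T (\<lambda>y. \<Sum>i\<in>I. f i y) x = (\<Sum>i\<in>I. T (f i) x)" using insert by auto
  ultimately show ?case by eventually_elim (use insert in simp)
qed

lemma T_strong_weak:
  assumes f: "L2 f" and lam: "lam > 0"
  shows "emeasure lebesgue {x. lam < norm (T f x)} \<le> ennreal (C2 / lam\<^sup>2) * (\<integral>\<^sup>+x. ennreal ((norm (f x))\<^sup>2) \<partial>lebesgue)"
proof -
  note [measurable] = L2_measurable[OF T_L2[OF f]]
  have "{x. lam < norm (T f x)} \<subseteq> {x \<in> UNIV. lam\<^sup>2 < (norm (T f x))\<^sup>2}"
    using lam by (auto intro!: power_strict_mono)
  then have "emeasure lebesgue {x. lam < norm (T f x)} \<le> emeasure lebesgue {x \<in> UNIV. lam\<^sup>2 < (norm (T f x))\<^sup>2}"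
    using sets_Collect_gt_lebesgue[of "\<lambda>x. (norm (T f x))\<^sup>2" "lam\<^sup>2"] by (intro emeasure_mono) auto
  also have "\<dots> \<le> ennreal (1 / lam\<^sup>2) * (\<integral>\<^sup>+x\<in>UNIV. ennreal ((norm (T f x))\<^sup>2) \<partial>lebesgue)"
    using lam by (intro emeasure_gt_le) auto
  also have "\<dots> \<le> ennreal (1 / lam\<^sup>2) * (ennreal C2 * (\<integral>\<^sup>+x. ennreal ((norm (f x))\<^sup>2) \<partial>lebesgue))"
    using T_bd[OF f] by (intro mult_left_mono) auto
  also have "\<dots> = ennreal (C2 / lam\<^sup>2) * (\<integral>\<^sup>+x. ennreal ((norm (f x))\<^sup>2) \<partial>lebesgue)"
    using C2_pos by (simp add: mult.assoc[symmetric] ennreal_mult'[symmetric])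
  finally show ?thesis .
qed

text \<open>Cancellation: since \<open>h\<close> has mean zero, the kernel value at the corner of
  the cube can be subtracted, and \<open>x\<close> is far enough away for regularity in the second
  variable.\<close>

lemma kernel_mean_zero:
  assumes r: "snd r > 0" and h: "integrable lebesgue h" "(\<integral>y. h y \<partial>lebesgue) = 0"
    and supp: "\<And>y. y \<notin> ccube r \<Longrightarrow> h y = 0" and x: "dist (fst r) x \<ge> 2 * real DIM('a) * snd r"
  shows "norm (\<integral>y. K x y * h y \<partial>lebesgue) \<le>
     Ck * (2 * real DIM('a) * snd r) powr d / dist (fst r) x powr (real DIM('a) + d) * (\<integral>y. norm (h y) \<partial>lebesgue)"
\<comment> \<open>A non-integrable product has Bochner integral 0 by convention, and then the bound
  is trivial.\<close>
proof (cases "integrable lebesgue (\<lambda>y. K x y * h y)")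
  case False
  then show ?thesis using Ck_pos by (simp add: not_integrable_integral_eq)
next
  case True
  let ?l = "2 * real DIM('a) * snd r" and ?c = "fst r"
  let ?B = "Ck * ?l powr d / dist ?c x powr (real DIM('a) + d)"
  have xc: "?c \<noteq> x" using x r DIM_positive[where 'a='a] by (auto simp: mult_le_0_iff)
  have B: "norm (K x ?c - K x y) \<le> ?B" if "y \<in> ccube r" for y
  proof -
    have "?c \<in> ccube r" using r by (simp add: mem_box inner_add_left)
    then have dy: "dist ?c y \<le> real DIM('a) * snd r" using that by (intro dist_le_hcube)
    have "0 \<le> real DIM('a) * snd r" using r by simp
    then have dy2: "dist ?c y \<le> ?l" using dy by linarith
    from dy have "norm (K x ?c - K x y) \<le> Ck * dist ?c y powr d / dist ?c x powr (real DIM('a) + d)"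
      using x xc by (intro K_reg2) auto
    also have "\<dots> \<le> ?B"
      using dy2 r Ck_pos d_pos by (intro divide_right_mono mult_left_mono powr_mono2) auto
    finally show ?thesis .
  qed
  have ih: "integrable lebesgue (\<lambda>y. K x ?c * h y)" using h by auto
  have "(\<integral>y. K x y * h y \<partial>lebesgue) = (\<integral>y. K x y * h y \<partial>lebesgue) - (\<integral>y. K x ?c * h y \<partial>lebesgue)"
    using h by simp
  also have "\<dots> = (\<integral>y. K x y * h y - K x ?c * h y \<partial>lebesgue)"
    using True ih by (rule Bochner_Integration.integral_diff[symmetric])
  finally have "norm (\<integral>y. K x y * h y \<partial>lebesgue) = norm (\<integral>y. K x y * h y - K x ?c * h y \<partial>lebesgue)" by simp
  also have "\<dots> \<le> (\<integral>y. ?B * norm (h y) \<partial>lebesgue)"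
  proof (rule order_trans[OF integral_norm_bound integral_mono])
    show "integrable lebesgue (\<lambda>y. norm (K x y * h y - K x ?c * h y))" using True ih by auto
    show "integrable lebesgue (\<lambda>y. ?B * norm (h y))" using h by auto
    fix y
    have "norm (K x y * h y - K x ?c * h y) = norm (K x ?c - K x y) * norm (h y)"
      by (simp add: norm_mult[symmetric] left_diff_distrib[symmetric] norm_minus_commute)
    also have "\<dots> \<le> ?B * norm (h y)"
      using B[of y] supp[of y] by (cases "y \<in> ccube r") (auto intro!: mult_right_mono simp del: times_divide_eq_left)
    finally show "norm (K x y * h y - K x ?c * h y) \<le> ?B * norm (h y)" .
  qed
  also have "\<dots> = ?B * (\<integral>y. norm (h y) \<partial>lebesgue)" by simp
  finally show ?thesis .
qed

text \<open>Only finitely many bad cubes are kept; the remaining bad part is small in L2 and is absorbed by the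
  L2 bound, so \<open>T\<close> is never applied to an infinite sum.\<close>
lemma weak_type_1_1:
  obtains C where "C > 0" "\<And>f lam. L2 f \<Longrightarrow> bounded {x. f x \<noteq> 0} \<Longrightarrow> lam > 0 \<Longrightarrow>
    emeasure lebesgue {x. lam < norm (T f x)} \<le> ennreal (C / lam) * (\<integral>\<^sup>+x. ennreal (norm (f x)) \<partial>lebesgue)"
proof -
  let ?n = "DIM('a)"
  obtain Ct where Ct: "Ct > 0" "\<And>(x::'a) l g A. l > 0 \<Longrightarrow> g \<in> borel_measurable lebesgue
    \<Longrightarrow> (\<And>r. r > 0 \<Longrightarrow> (\<integral>\<^sup>+y\<in>ball x r. g y \<partial>lebesgue) \<le> A * emeasure lebesgue (ball x r))
    \<Longrightarrow> (\<integral>\<^sup>+y\<in>{y. l \<le> dist x y}. ennreal (l powr d / dist x y powr (real ?n + d)) * g y \<partial>lebesgue) \<le> ennreal Ct * A"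
    by (rule tail_bound[OF d_pos, where 'a='a]) (erule that, blast)
  define v where "v = unit_ball_vol (real ?n)"
  have v: "v > 0" unfolding v_def by (rule unit_ball_vol_DIM_pos)
  \<comment> \<open>One constant per piece: Chebyshev in L2 at height lam / 3 for the good part (9 =
    3^2), the volume of balls of radius 2 n s around the bad cubes, and the kernel tail at height
    lam / 3 (6 = 3 * 2, as a bad function has at most twice the mass of \<open>f\<close> on its
    cube).\<close>
  define c1 where "c1 = 9 * C2 * 2 ^ ?n"
  define c2 where "c2 = v * (2 * real ?n) ^ ?n"
  define c3 where "c3 = 6 * Ck * Ct"
  have cpos: "c1 > 0" "c2 > 0" "c3 > 0" using C2_pos v Ck_pos Ct(1) by (auto simp: c1_def c2_def c3_def)
  have main: "emeasure lebesgue {x. lam < norm (T f x)} \<le> ennreal ((c1 + c2 + c3) / lam) * (\<integral>\<^sup>+x. ennreal (norm (f x)) \<partial>lebesgue)"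
    if f: "L2 f" and bd: "bounded {x. f x \<noteq> 0}" and lam: "lam > 0" for f lam
  proof (cases "(\<integral>\<^sup>+x. ennreal (norm (f x)) \<partial>lebesgue) = \<infinity>")
    case True
    then show ?thesis using lam cpos by (simp add: ennreal_mult_top)
  next
    case False
    note fm [measurable] = L2_measurable[OF f]
    define G where "G = (\<integral>\<^sup>+x. ennreal (norm (f x)) \<partial>lebesgue)"
    obtain G' where G': "G = ennreal G'" "G' \<ge> 0" using False by (cases G) (auto simp: G_def)
    obtain R where R: "R > 0" "\<And>x. f x \<noteq> 0 \<Longrightarrow> norm x \<le> R"
      using bd unfolding bounded_pos by auto
    \<comment> \<open>Large enough for the cube to contain the support and, because s \<ge> 1 gives
      s \<le> s^n, for the average of |f| over it to be at most \<open>lam\<close>.\<close>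
    define s where "s = 2 * R + 1 + G' / lam"
    have s: "s \<ge> 1" "s \<ge> G' / lam" "s > 2 * R" using R(1) divide_nonneg_pos[OF G'(2) lam] unfolding s_def by linarith+
    define q where "q = ((- (s / 2)) *\<^sub>R (One::'a), s)"
    have q: "snd q > 0" using s by (simp add: q_def)
    have fq: "f x = 0" if "x \<notin> hcube q" for x
    proof (rule ccontr)
      assume "f x \<noteq> 0"
      then have "norm x \<le> R" using R by blast
      then have "\<bar>x \<bullet> i\<bar> \<le> R" if "i \<in> Basis" for i using Basis_le_norm[OF that, of x] by linarith
      then have "x \<in> hcube q" using s unfolding hcube_def q_def by (force simp: abs_le_iff)
      then show False using that by simp
    qed
    have sn: "G' \<le> lam * s ^ ?n"
    proof -
      have "G' \<le> lam * s" using s(2) lam by (simp add: field_simps)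
      also have "\<dots> \<le> lam * s ^ ?n" using power_increasing[of 1 ?n s] s lam by (intro mult_left_mono) auto
      finally show ?thesis .
    qed
    have le: "(\<integral>\<^sup>+x\<in>hcube q. ennreal (norm (f x)) \<partial>lebesgue) \<le> ennreal lam * emeasure lebesgue (hcube q)"
    proof -
      have "(\<integral>\<^sup>+x\<in>hcube q. ennreal (norm (f x)) \<partial>lebesgue) \<le> G"
        unfolding G_def by (intro nn_integral_mono) (auto split: split_indicator)
      also have "\<dots> \<le> ennreal (lam * s ^ ?n)" using sn G' by (simp add: ennreal_leI)
      also have "\<dots> = ennreal lam * emeasure lebesgue (hcube q)" using lam s q by (simp add: emeasure_hcube ennreal_mult q_def)
      finally show ?thesis .
    qed
    obtain P where P: "countable P" "disjoint_family_on hcube P" "\<And>r. r \<in> P \<Longrightarrow> snd r > 0 \<and> hcube r \<subseteq> hcube q"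
      "\<And>r. r \<in> P \<Longrightarrow> ennreal lam * emeasure lebesgue (hcube r) \<le> (\<integral>\<^sup>+x\<in>hcube r. ennreal (norm (f x)) \<partial>lebesgue)"
      "\<And>r. r \<in> P \<Longrightarrow> (\<integral>\<^sup>+x\<in>hcube r. ennreal (norm (f x)) \<partial>lebesgue) \<le> ennreal (2 ^ ?n * lam) * emeasure lebesgue (hcube r)"
      "AE x in lebesgue. x \<in> hcube q \<longrightarrow> x \<notin> (\<Union>r\<in>P. hcube r) \<longrightarrow> ennreal (norm (f x)) \<le> ennreal lam"
      by (rule stopping_cubes[OF q _ lam le]) auto
    let ?U = "\<Union>r\<in>P. hcube r"
    have Um [measurable]: "(\<Union>r\<in>P'. hcube r) \<in> sets lebesgue" if "P' \<subseteq> P" for P'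
      using countable_subset[OF that P(1)] by (intro sets.countable_UN') auto
    have Um0 [measurable]: "?U \<in> sets lebesgue" by (rule Um[OF order_refl])
    have eps: "emeasure lebesgue {x. lam < norm (T f x)} \<le> ennreal ((c1 + c2 + c3) / lam) * G + ennreal e" if e: "e > 0" for e
    proof -
      \<comment> \<open>The L2 mass allowed on the discarded cubes: Chebyshev at height lam / 3
        turns it into exactly \<open>e\<close>.\<close>
      define e1 where "e1 = e * lam\<^sup>2 / (9 * C2)"
      have e1: "e1 > 0" using e lam C2_pos by (simp add: e1_def)
      obtain F where F: "finite F" "F \<subseteq> P" "(\<integral>\<^sup>+x\<in>(\<Union>r\<in>P-F. hcube r). ennreal ((norm (f x))\<^sup>2) \<partial>lebesgue) \<le> ennreal e1"
        using f by (elim finite_subfamily_remainder[OF P(1,2) _ _ e1, rotated 2]) (auto simp: L2_iff)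
      have dF: "disjoint_family_on hcube F" using P(2) F(2) by (rule disjoint_family_on_mono[rotated])
      have FP: "snd r > 0" "hcube r \<subseteq> hcube q" if "r \<in> F" for r using P(3) F(2) that by blast+
      have GF: "(\<Sum>r\<in>F. \<integral>\<^sup>+x\<in>hcube r. ennreal (norm (f x)) \<partial>lebesgue) + (\<integral>\<^sup>+x\<in>hcube q - ?U. ennreal (norm (f x)) \<partial>lebesgue) \<le> G"
      proof -
        have "(\<Sum>r\<in>F. \<integral>\<^sup>+x\<in>hcube r. ennreal (norm (f x)) \<partial>lebesgue) + (\<integral>\<^sup>+x\<in>hcube q - ?U. ennreal (norm (f x)) \<partial>lebesgue)
          = (\<integral>\<^sup>+x. (\<Sum>r\<in>F. ennreal (norm (f x)) * indicator (hcube r) x) + ennreal (norm (f x)) * indicator (hcube q - ?U) x \<partial>lebesgue)"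
          by (subst nn_integral_add) (auto simp: nn_integral_sum intro!: borel_measurable_indicator sets.Diff Um)
        also have "\<dots> \<le> G"
          unfolding G_def
        proof (rule nn_integral_mono)
          fix x
          have "(\<Sum>r\<in>F. ennreal (norm (f x)) * indicator (hcube r) x) = ennreal (norm (f x)) * indicator (\<Union>r\<in>F. hcube r) x"
            using F(1) dF by (simp add: indicator_UN_disjoint sum_distrib_left)
          then show "(\<Sum>r\<in>F. ennreal (norm (f x)) * indicator (hcube r) x) + ennreal (norm (f x)) * indicator (hcube q - ?U) x \<le> ennreal (norm (f x))"
            using F(2) by (auto split: split_indicator)
        qed
        finally show ?thesis .
      qed
      then have GF1: "(\<Sum>r\<in>F. \<integral>\<^sup>+x\<in>hcube r. ennreal (norm (f x)) \<partial>lebesgue) \<le> G"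
        by (rule order_trans[rotated]) simp
      have fi: "integrable lebesgue f" using False by (simp add: integrable_iff_bounded top.not_eq_extremum)
      have fir: "integrable lebesgue (\<lambda>y. indicator (hcube r) y * f y)" for r
        by (rule Bochner_Integration.integrable_bound[OF fi]) (auto simp: norm_mult split: split_indicator)
      define a where "a r = (\<integral>y. indicator (hcube r) y * f y \<partial>lebesgue) / complex_of_real (snd r ^ ?n)" for r :: "'a \<times> real"
      have ar: "ennreal (norm (a r)) * emeasure lebesgue (hcube r) \<le> (\<integral>\<^sup>+x\<in>hcube r. ennreal (norm (f x)) \<partial>lebesgue)" if "r \<in> F" for r
      proof -
        have "norm (a r) * snd r ^ ?n = norm (\<integral>y. indicator (hcube r) y * f y \<partial>lebesgue)"
          using FP[OF that] by (simp add: a_def norm_divide norm_power)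
        then have "ennreal (norm (a r)) * emeasure lebesgue (hcube r) = ennreal (norm (\<integral>y. indicator (hcube r) y * f y \<partial>lebesgue))"
          using FP[OF that] by (simp add: emeasure_hcube ennreal_mult[symmetric])
        also have "\<dots> \<le> (\<integral>\<^sup>+y. ennreal (norm (indicator (hcube r) y * f y)) \<partial>lebesgue)"
          by (rule integral_norm_bound_ennreal[OF fir])
        also have "\<dots> = (\<integral>\<^sup>+x\<in>hcube r. ennreal (norm (f x)) \<partial>lebesgue)"
          by (intro nn_integral_cong) (auto split: split_indicator)
        finally show ?thesis .
      qed
      have ar2: "norm (a r) \<le> 2 ^ ?n * lam" if r: "r \<in> F" for r
      proof -
        have "ennreal (norm (a r)) * emeasure lebesgue (hcube r) \<le> ennreal (2 ^ ?n * lam) * emeasure lebesgue (hcube r)"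
          using ar[OF r] P(5)[of r] r F(2) by (auto intro: order_trans)
        then have "norm (a r) * snd r ^ ?n \<le> 2 ^ ?n * lam * snd r ^ ?n"
          using FP[OF r] lam by (simp add: emeasure_hcube ennreal_mult[symmetric])
        then show ?thesis using FP[OF r] by simp
      qed
      \<comment> \<open>Cubes outside \<open>F\<close> are neither averaged nor corrected: on them
        \<open>f\<close> itself goes into \<open>rm\<close>. Only \<open>F\<close> enters the sums,
        so finite additivity of \<open>T\<close> suffices.\<close>
      define good where "good x = indicator (hcube q - ?U) x * f x + (\<Sum>r\<in>F. indicator (hcube r) x * a r)" for x
      define bad where "bad r x = indicator (hcube r) x * f x + indicator (hcube r) x * (- a r)" for r x
      define rm where "rm x = indicator (\<Union>r\<in>P-F. hcube r) x * f x" for x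
      have f_eq: "f = (\<lambda>x. (good x + (\<Sum>r\<in>F. bad r x)) + rm x)"
      proof
        fix x
        have "(\<Sum>r\<in>F. indicator (hcube r) x * f x) = indicator (\<Union>r\<in>F. hcube r) x * f x"
          using F(1) dF by (simp add: indicator_UN_disjoint sum_distrib_right)
        then have "(good x + (\<Sum>r\<in>F. bad r x)) + rm x = (indicator (hcube q - ?U) x + indicator (\<Union>r\<in>F. hcube r) x + indicator (\<Union>r\<in>P-F. hcube r) x) * f x"
          by (simp add: good_def bad_def rm_def sum.distrib sum_negf sum_subtractf algebra_simps)
        also have "\<dots> = indicator (hcube q) x * f x"
        proof -
          have "(\<Union>r\<in>F. hcube r) \<inter> (\<Union>r\<in>P-F. hcube r) = {}"
          proof -
            have "hcube r \<inter> hcube t = {}" if "r \<in> F" "t \<in> P - F" for r t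
              using disjoint_family_onD[OF P(2), of r t] F(2) that by blast
            then show ?thesis by blast
          qed
          moreover have "?U = (\<Union>r\<in>F. hcube r) \<union> (\<Union>r\<in>P-F. hcube r)" using F(2) by blast
          moreover have "?U \<subseteq> hcube q" using P(3) by blast
          ultimately show ?thesis unfolding indicator_def by auto
        qed
        also have "\<dots> = f x" using fq[of x] by (cases "x \<in> hcube q") auto
        finally show "f x = (good x + (\<Sum>r\<in>F. bad r x)) + rm x" by simp
      qed
      have L2c: "L2 (\<lambda>x. indicator (hcube r) x * z)" if "r \<in> F" for r z
      proof (rule L2_bounded_finite[of "hcube r" _ "norm z"])
        show "emeasure lebesgue (hcube r) < \<infinity>" using FP[OF that] by (simp add: emeasure_hcube)
      qed (auto simp: norm_mult split: split_indicator)
      have L2good: "L2 good"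
        unfolding good_def using F(1) by (intro L2_add L2_indicator L2_sum f sets.Diff Um L2c) auto
      have L2bad: "L2 (bad r)" if "r \<in> F" for r
        unfolding bad_def using that by (intro L2_add L2_indicator f L2c) auto
      have L2rm: "L2 rm" unfolding rm_def by (intro L2_indicator f Um) auto
      have Tf: "AE x in lebesgue. T f x = T good x + (\<Sum>r\<in>F. T (bad r) x) + T rm x"
      proof -
        have L2b: "L2 (\<lambda>x. \<Sum>r\<in>F. bad r x)" using F(1) L2bad by (intro L2_sum)
        have "AE x in lebesgue. T (\<lambda>x. (good x + (\<Sum>r\<in>F. bad r x)) + rm x) x = T (\<lambda>x. good x + (\<Sum>r\<in>F. bad r x)) x + T rm x"
          by (intro T_add L2_add L2good L2b L2rm)
        moreover have "AE x in lebesgue. T (\<lambda>x. good x + (\<Sum>r\<in>F. bad r x)) x = T good x + T (\<lambda>x. \<Sum>r\<in>F. bad r x) x"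
          by (intro T_add L2good L2b)
        moreover have "AE x in lebesgue. T (\<lambda>x. \<Sum>r\<in>F. bad r x) x = (\<Sum>r\<in>F. T (bad r) x)"
          using F(1) L2bad by (intro T_sum)
        ultimately show ?thesis unfolding f_eq[symmetric] by eventually_elim simp
      qed
      let ?l = "\<lambda>r. 2 * real ?n * snd r"
      define N where "N = (\<Union>r\<in>F. ball (fst r) (?l r))"
      have Nm [measurable]: "N \<in> sets lebesgue" unfolding N_def using F(1) by (intro sets.finite_UN) auto
      have [measurable]: "- N \<in> sets lebesgue" using Nm by (simp add: Compl_in_sets_lebesgue)
      note [measurable] = L2_measurable[OF T_L2[OF L2good]] L2_measurable[OF T_L2[OF L2rm]]
      have Tbm: "T (bad r) \<in> borel_measurable lebesgue" if "r \<in> F" for r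
        using L2_measurable[OF T_L2[OF L2bad[OF that]]] .
      define S where "S x = norm (\<Sum>r\<in>F. T (bad r) x)" for x
      have Sm [measurable]: "S \<in> borel_measurable lebesgue"
      proof -
        have "(\<lambda>x. \<Sum>r\<in>F. T (bad r) x) \<in> borel_measurable lebesgue"
          by (rule borel_measurable_sum) (rule Tbm)
        then show ?thesis unfolding S_def by measurable
      qed
      let ?E1 = "{x. lam / 3 < norm (T good x)}" and ?E3 = "{x \<in> - N. lam / 3 < S x}" and ?E4 = "{x. lam / 3 < norm (T rm x)}"
      have E1m: "?E1 \<in> sets lebesgue" "?E4 \<in> sets lebesgue" by (intro sets_Collect_gt_lebesgue; measurable)+
      have E3m: "?E3 \<in> sets lebesgue"
      proof -
        have "(- N) \<inter> {x. lam / 3 < S x} \<in> sets lebesgue"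
          using Nm by (intro sets.Int sets_Collect_gt_lebesgue Sm) (auto simp: Compl_in_sets_lebesgue)
        moreover have "(- N) \<inter> {x. lam / 3 < S x} = ?E3" by auto
        ultimately show ?thesis by (simp only:)
      qed
      have "emeasure lebesgue {x. lam < norm (T f x)} \<le> emeasure lebesgue (?E1 \<union> N \<union> ?E3 \<union> ?E4)"
      proof (rule emeasure_mono_AE)
        show "AE x in lebesgue. x \<in> {x. lam < norm (T f x)} \<longrightarrow> x \<in> ?E1 \<union> N \<union> ?E3 \<union> ?E4"
          using Tf
        proof eventually_elim
          case (elim x)
          have "norm (T f x) \<le> norm (T good x) + S x + norm (T rm x)"
            unfolding elim S_def by (meson norm_triangle_le norm_triangle_ineq add_mono order_refl order_trans)
          then show ?case by auto
        qed
        show "?E1 \<union> N \<union> ?E3 \<union> ?E4 \<in> sets lebesgue" using E1m E3m Nm by auto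
      qed
      also have "\<dots> \<le> emeasure lebesgue ?E1 + emeasure lebesgue N + emeasure lebesgue ?E3 + emeasure lebesgue ?E4"
        using E1m E3m Nm by (intro order_trans[OF emeasure_subadditive] add_mono order_refl) auto
      also have "emeasure lebesgue ?E1 \<le> ennreal (c1 / lam) * G"
      proof -
        \<comment> \<open>A real majorant of |good|, almost everywhere at most 2^n lam and with
          integral at most that of |f|; the square is estimated by one factor of each kind.\<close>
        define u where "u x = indicator (hcube q - ?U) x * norm (f x) + (\<Sum>r\<in>F. indicator (hcube r) x * norm (a r))" for x
        have u0: "u x \<ge> 0" for x unfolding u_def by (intro add_nonneg_nonneg sum_nonneg mult_nonneg_nonneg) (auto simp: indicator_def)
        have gu: "norm (good x) \<le> u x" for x
          unfolding good_def u_def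
          by (intro norm_triangle_le add_mono order_trans[OF norm_sum] sum_mono) (auto simp: norm_mult split: split_indicator)
        have u2: "AE x in lebesgue. u x \<le> 2 ^ ?n * lam"
          using P(6)
        proof eventually_elim
          case (elim x)
          have "(\<Sum>r\<in>F. indicator (hcube r) x * norm (a r)) \<le> (\<Sum>r\<in>F. indicator (hcube r) x * (2 ^ ?n * lam))"
            by (intro sum_mono mult_left_mono ar2) auto
          also have "\<dots> = indicator (\<Union>r\<in>F. hcube r) x * (2 ^ ?n * lam)"
            using F(1) dF by (simp add: indicator_UN_disjoint sum_distrib_right)
          finally have 1: "(\<Sum>r\<in>F. indicator (hcube r) x * norm (a r)) \<le> indicator (\<Union>r\<in>F. hcube r) x * (2 ^ ?n * lam)" .
          have "lam \<le> 2 ^ ?n * lam" using lam by simp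
          then have 2: "indicator (hcube q - ?U) x * norm (f x) \<le> indicator (hcube q - ?U) x * (2 ^ ?n * lam)"
          proof (cases "x \<in> hcube q - ?U")
            case True
            then have "norm (f x) \<le> lam" using elim lam by simp
            then show ?thesis using True \<open>lam \<le> 2 ^ ?n * lam\<close> by (simp del: mult_le_cancel_right2)
          qed simp
          have 3: "indicator (hcube q - ?U) x + indicator (\<Union>r\<in>F. hcube r) x \<le> (1::real)"
            using F(2) by (auto split: split_indicator)
          have "u x \<le> (indicator (hcube q - ?U) x + indicator (\<Union>r\<in>F. hcube r) x) * (2 ^ ?n * lam)"
            using 1 2 unfolding u_def by (simp only: distrib_right)
          also have "\<dots> \<le> 1 * (2 ^ ?n * lam)" using 3 lam by (intro mult_right_mono) auto
          finally show ?case by simp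
        qed
        have "(\<integral>\<^sup>+x. ennreal ((norm (good x))\<^sup>2) \<partial>lebesgue) \<le> (\<integral>\<^sup>+x. ennreal (2 ^ ?n * lam) * ennreal (u x) \<partial>lebesgue)"
        proof (rule nn_integral_mono_AE, use u2 in eventually_elim)
          case (elim x)
          have "(norm (good x))\<^sup>2 \<le> u x * u x" unfolding power2_eq_square using gu[of x] u0[of x] by (intro mult_mono) auto
          also have "\<dots> \<le> (2 ^ ?n * lam) * u x" using elim u0[of x] by (intro mult_right_mono)
          finally have "ennreal ((norm (good x))\<^sup>2) \<le> ennreal ((2 ^ ?n * lam) * u x)" by (rule ennreal_leI)
          then show ?case using lam u0[of x] by (simp add: ennreal_mult)
        qed
        also have "\<dots> = ennreal (2 ^ ?n * lam) * (\<integral>\<^sup>+x. ennreal (u x) \<partial>lebesgue)"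
          unfolding u_def by (rule nn_integral_cmult) measurable
        also have "(\<integral>\<^sup>+x. ennreal (u x) \<partial>lebesgue) = (\<integral>\<^sup>+x. (\<Sum>r\<in>F. ennreal (norm (a r)) * indicator (hcube r) x) + ennreal (norm (f x)) * indicator (hcube q - ?U) x \<partial>lebesgue)"
        proof (rule nn_integral_cong)
          fix x
          have "ennreal (u x) = ennreal (indicator (hcube q - ?U) x * norm (f x)) + (\<Sum>r\<in>F. ennreal (indicator (hcube r) x * norm (a r)))"
            unfolding u_def by (subst ennreal_plus) (auto intro!: sum_nonneg simp: sum_ennreal)
          also have "\<dots> = (\<Sum>r\<in>F. ennreal (norm (a r)) * indicator (hcube r) x) + ennreal (norm (f x)) * indicator (hcube q - ?U) x"
            by (subst add.commute) (intro arg_cong2[where f="(+)"] sum.cong, auto split: split_indicator)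
          finally show "ennreal (u x) = (\<Sum>r\<in>F. ennreal (norm (a r)) * indicator (hcube r) x) + ennreal (norm (f x)) * indicator (hcube q - ?U) x" .
        qed
        also have "\<dots> = (\<Sum>r\<in>F. ennreal (norm (a r)) * emeasure lebesgue (hcube r)) + (\<integral>\<^sup>+x\<in>hcube q - ?U. ennreal (norm (f x)) \<partial>lebesgue)"
          by (subst nn_integral_add) (auto simp: nn_integral_sum nn_integral_cmult_indicator intro!: borel_measurable_indicator sets.Diff Um)
        also have "\<dots> \<le> G" using GF by (rule order_trans[rotated]) (intro add_mono sum_mono ar order_refl)
        finally have "(\<integral>\<^sup>+x. ennreal ((norm (good x))\<^sup>2) \<partial>lebesgue) \<le> ennreal (2 ^ ?n * lam) * G"
          by (simp add: mult_left_mono)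
        then have "ennreal (C2 / (lam / 3)\<^sup>2) * (\<integral>\<^sup>+x. ennreal ((norm (good x))\<^sup>2) \<partial>lebesgue) \<le> ennreal (C2 / (lam / 3)\<^sup>2) * (ennreal (2 ^ ?n * lam) * G)"
          by (intro mult_left_mono) auto
        also have "\<dots> = ennreal (C2 / (lam / 3)\<^sup>2 * (2 ^ ?n * lam)) * G"
          using C2_pos lam by (simp only: mult.assoc[symmetric]) (subst ennreal_mult[symmetric], auto simp: mult.assoc)
        also have "C2 / (lam / 3)\<^sup>2 * (2 ^ ?n * lam) = c1 / lam" using lam by (simp add: c1_def field_simps power2_eq_square)
        finally show ?thesis using T_strong_weak[OF L2good, of "lam / 3"] lam by (auto intro: order_trans)
      qed
      also have "emeasure lebesgue N \<le> ennreal (c2 / lam) * G"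
      proof -
        have "emeasure lebesgue N \<le> (\<Sum>r\<in>F. emeasure lebesgue (ball (fst r) (?l r)))"
          unfolding N_def using F(1) by (intro emeasure_subadditive_finite) auto
        also have "\<dots> \<le> (\<Sum>r\<in>F. ennreal (c2 / lam) * (\<integral>\<^sup>+x\<in>hcube r. ennreal (norm (f x)) \<partial>lebesgue))"
        proof (rule sum_mono)
          fix r assume r: "r \<in> F"
          have "emeasure lebesgue (ball (fst r) (?l r)) = ennreal (c2 / lam) * (ennreal lam * emeasure lebesgue (hcube r))"
            using FP[OF r] cpos lam by (simp add: emeasure_lebesgue_ball emeasure_hcube v_def[symmetric] ennreal_mult[symmetric] c2_def power_mult_distrib mult.assoc)
          also have "\<dots> \<le> ennreal (c2 / lam) * (\<integral>\<^sup>+x\<in>hcube r. ennreal (norm (f x)) \<partial>lebesgue)"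
            using P(4)[of r] r F(2) by (intro mult_left_mono) auto
          finally show "emeasure lebesgue (ball (fst r) (?l r)) \<le> ennreal (c2 / lam) * (\<integral>\<^sup>+x\<in>hcube r. ennreal (norm (f x)) \<partial>lebesgue)" .
        qed
        also have "\<dots> \<le> ennreal (c2 / lam) * G"
          unfolding sum_distrib_left[symmetric] using GF1 by (intro mult_left_mono) auto
        finally show ?thesis .
      qed
      also have "emeasure lebesgue ?E3 \<le> ennreal (c3 / lam) * G"
      proof -
        \<comment> \<open>Off \<open>N\<close> a point is at distance at least 2 n s from the corner
          of the cube, so the cancellation estimate applies, and the tail integrates to a
          constant.\<close>
        have one: "(\<integral>\<^sup>+x\<in>- N. ennreal (norm (T (bad r) x)) \<partial>lebesgue) \<le> ennreal (2 * Ck * Ct) * (\<integral>\<^sup>+x\<in>hcube r. ennreal (norm (f x)) \<partial>lebesgue)"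
          if r: "r \<in> F" for r
        proof -
          have rs: "snd r > 0" using FP[OF r] by simp
          have ib: "integrable lebesgue (\<lambda>y. indicator (hcube r) y * (- a r))"
            using rs by (intro integrable_indicator_mult) (auto simp: emeasure_hcube)
          have bi: "integrable lebesgue (bad r)"
            unfolding bad_def using fir ib by (rule Bochner_Integration.integrable_add)
          have "(\<integral>y. bad r y \<partial>lebesgue) = (\<integral>y. indicator (hcube r) y * f y \<partial>lebesgue) + (\<integral>y. indicator (hcube r) y * (- a r) \<partial>lebesgue)"
            unfolding bad_def using fir ib by (rule Bochner_Integration.integral_add)
          also have "(\<integral>y. indicator (hcube r) y * (- a r) \<partial>lebesgue) = complex_of_real (measure lebesgue (hcube r)) * (- a r)"
            using rs by (intro integral_indicator_mult) (auto simp: emeasure_hcube)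
          also have "measure lebesgue (hcube r) = snd r ^ ?n" using rs by (simp add: measure_def emeasure_hcube)
          finally have b0: "(\<integral>y. bad r y \<partial>lebesgue) = 0" using rs by (simp add: a_def)
          have bs: "bad r y = 0" if "y \<notin> ccube r" for y
            using that box_hcube_cbox(2)[of r] by (auto simp: bad_def split: split_indicator)
          define B where "B = (\<integral>y. norm (bad r y) \<partial>lebesgue)"
          have B: "ennreal B \<le> 2 * (\<integral>\<^sup>+x\<in>hcube r. ennreal (norm (f x)) \<partial>lebesgue)"
          proof -
            have "ennreal B = (\<integral>\<^sup>+y. ennreal (norm (bad r y)) \<partial>lebesgue)"
              unfolding B_def using bi by (intro nn_integral_eq_integral[symmetric]) auto
            also have "\<dots> \<le> (\<integral>\<^sup>+y. ennreal (norm (f y)) * indicator (hcube r) y + ennreal (norm (a r)) * indicator (hcube r) y \<partial>lebesgue)"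
            proof (rule nn_integral_mono)
              fix y
              have "norm (bad r y) \<le> norm (f y) + norm (a r)" if "y \<in> hcube r"
                using that norm_triangle_ineq4[of "f y" "a r"] by (simp add: bad_def)
              moreover have "bad r y = 0" if "y \<notin> hcube r" using that by (simp add: bad_def)
              ultimately show "ennreal (norm (bad r y)) \<le> ennreal (norm (f y)) * indicator (hcube r) y + ennreal (norm (a r)) * indicator (hcube r) y"
                by (cases "y \<in> hcube r") (auto simp: ennreal_plus[symmetric] simp del: ennreal_plus intro!: ennreal_leI)
            qed
            also have "\<dots> = (\<integral>\<^sup>+x\<in>hcube r. ennreal (norm (f x)) \<partial>lebesgue) + ennreal (norm (a r)) * emeasure lebesgue (hcube r)"
              by (subst nn_integral_add) (auto simp: nn_integral_cmult_indicator)
            also have "\<dots> \<le> (\<integral>\<^sup>+x\<in>hcube r. ennreal (norm (f x)) \<partial>lebesgue) + (\<integral>\<^sup>+x\<in>hcube r. ennreal (norm (f x)) \<partial>lebesgue)"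
              using ar[OF r] by (intro add_left_mono)
            finally show ?thesis by (simp add: mult_2)
          qed
          have lpos: "?l r > 0" using rs by simp
          have "(\<lambda>x. ennreal (?l r powr d / dist (fst r) x powr (real ?n + d)) * 1 * indicator {x. ?l r \<le> dist (fst r) x} x) \<in> borel_measurable lborel"
            by measurable
          then have km: "(\<lambda>x. ennreal (?l r powr d / dist (fst r) x powr (real ?n + d)) * 1 * indicator {x. ?l r \<le> dist (fst r) x} x) \<in> borel_measurable lebesgue"
            by (rule measurable_completion)
          have "AE x in lebesgue. x \<notin> ccube r \<longrightarrow> T (bad r) x = (\<integral>y. K x y * bad r y \<partial>lebesgue)"
            by (rule T_ker[OF L2bad[OF r]]) (auto simp: bs)
          then have "(\<integral>\<^sup>+x\<in>- N. ennreal (norm (T (bad r) x)) \<partial>lebesgue) \<le>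
            (\<integral>\<^sup>+x. ennreal (Ck * B) * (ennreal (?l r powr d / dist (fst r) x powr (real ?n + d)) * 1 * indicator {x. ?l r \<le> dist (fst r) x} x) \<partial>lebesgue)"
          proof (intro nn_integral_mono_AE, eventually_elim)
            case (elim x)
            show ?case
            proof (cases "x \<in> - N")
              case True
              then have dx: "?l r \<le> dist (fst r) x" using r by (auto simp: N_def not_less)
              have "x \<notin> ccube r"
              proof
                assume "x \<in> ccube r"
                moreover have "fst r \<in> ccube r" using rs by (simp add: mem_box inner_add_left)
                ultimately have "dist (fst r) x \<le> real ?n * snd r" by (intro dist_le_hcube)
                moreover have "0 < real ?n * snd r" using rs by simp
                ultimately show False using dx by linarith
              qed
              then have "norm (T (bad r) x) \<le> Ck * ?l r powr d / dist (fst r) x powr (real ?n + d) * B"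
                using elim kernel_mean_zero[OF rs bi b0 bs dx] by (simp add: B_def)
              also have "\<dots> = (Ck * B) * (?l r powr d / dist (fst r) x powr (real ?n + d))" by simp
              finally have "ennreal (norm (T (bad r) x)) \<le> ennreal ((Ck * B) * (?l r powr d / dist (fst r) x powr (real ?n + d)))"
                by (rule ennreal_leI)
              also have "\<dots> = ennreal (Ck * B) * ennreal (?l r powr d / dist (fst r) x powr (real ?n + d))"
                using Ck_pos by (intro ennreal_mult) (auto simp: B_def)
              finally show ?thesis using True dx by simp
            qed simp
          qed
          also have "\<dots> = ennreal (Ck * B) * (\<integral>\<^sup>+x\<in>{x. ?l r \<le> dist (fst r) x}. ennreal (?l r powr d / dist (fst r) x powr (real ?n + d)) * 1 \<partial>lebesgue)"
            by (rule nn_integral_cmult[OF km])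
          \<comment> \<open>The tail bound with g = 1, whose averages over balls are 1.\<close>
          also have "\<dots> \<le> ennreal (Ck * B) * (ennreal Ct * 1)"
            by (intro mult_left_mono Ct(2)[OF lpos]) auto
          also have "\<dots> = ennreal (Ck * Ct) * ennreal B"
            using Ck_pos Ct(1) by (simp add: ennreal_mult'[symmetric] ennreal_mult''[symmetric] mult_ac B_def)
          also have "\<dots> \<le> ennreal (Ck * Ct) * (2 * (\<integral>\<^sup>+x\<in>hcube r. ennreal (norm (f x)) \<partial>lebesgue))"
            using B by (intro mult_left_mono) auto
          also have "\<dots> = ennreal (2 * Ck * Ct) * (\<integral>\<^sup>+x\<in>hcube r. ennreal (norm (f x)) \<partial>lebesgue)"
          proof -
            have "ennreal (2 * Ck * Ct) = ennreal (Ck * Ct) * 2" using Ck_pos Ct(1) by (simp add: ennreal_mult' mult_ac)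
            then show ?thesis by (simp add: mult.assoc)
          qed
          finally show ?thesis .
        qed
        have "emeasure lebesgue ?E3 \<le> ennreal (1 / (lam / 3)) * (\<integral>\<^sup>+x\<in>- N. ennreal (S x) \<partial>lebesgue)"
          using lam Nm by (intro emeasure_gt_le) (auto simp: Compl_in_sets_lebesgue)
        also have "(\<integral>\<^sup>+x\<in>- N. ennreal (S x) \<partial>lebesgue) \<le> (\<integral>\<^sup>+x. (\<Sum>r\<in>F. ennreal (norm (T (bad r) x)) * indicator (- N) x) \<partial>lebesgue)"
        proof (rule nn_integral_mono)
          fix x
          have "ennreal (S x) \<le> ennreal (\<Sum>r\<in>F. norm (T (bad r) x))"
            unfolding S_def by (intro ennreal_leI norm_sum)
          also have "\<dots> = (\<Sum>r\<in>F. ennreal (norm (T (bad r) x)))" by (simp add: sum_ennreal)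
          finally show "ennreal (S x) * indicator (- N) x \<le> (\<Sum>r\<in>F. ennreal (norm (T (bad r) x)) * indicator (- N) x)"
            by (simp add: sum_distrib_right[symmetric] mult_right_mono)
        qed
        also have "\<dots> = (\<Sum>r\<in>F. \<integral>\<^sup>+x\<in>- N. ennreal (norm (T (bad r) x)) \<partial>lebesgue)"
        proof (rule nn_integral_sum)
          fix r assume "r \<in> F"
          note [measurable] = Tbm[OF this]
          have "indicator (- N) \<in> borel_measurable lebesgue"
            using Nm by (intro borel_measurable_indicator) (simp add: Compl_in_sets_lebesgue)
          then show "(\<lambda>x. ennreal (norm (T (bad r) x)) * indicator (- N) x) \<in> borel_measurable lebesgue" by measurable
        qed
        also have "\<dots> \<le> (\<Sum>r\<in>F. ennreal (2 * Ck * Ct) * (\<integral>\<^sup>+x\<in>hcube r. ennreal (norm (f x)) \<partial>lebesgue))"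
          by (intro sum_mono one)
        also have "\<dots> \<le> ennreal (2 * Ck * Ct) * G"
          unfolding sum_distrib_left[symmetric] using GF1 by (intro mult_left_mono) auto
        finally have "emeasure lebesgue ?E3 \<le> ennreal (1 / (lam / 3)) * (ennreal (2 * Ck * Ct) * G)"
          by (simp add: mult_left_mono)
        also have "\<dots> = ennreal (c3 / lam) * G"
          using lam Ck_pos Ct(1) by (simp add: mult.assoc[symmetric] ennreal_mult[symmetric] c3_def)
        finally show ?thesis .
      qed
      also have "emeasure lebesgue ?E4 \<le> ennreal e"
      proof -
        have "(\<integral>\<^sup>+x. ennreal ((norm (rm x))\<^sup>2) \<partial>lebesgue) = (\<integral>\<^sup>+x\<in>(\<Union>r\<in>P-F. hcube r). ennreal ((norm (f x))\<^sup>2) \<partial>lebesgue)"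
          by (intro nn_integral_cong) (auto simp: rm_def norm_mult split: split_indicator)
        then have "emeasure lebesgue ?E4 \<le> ennreal (C2 / (lam / 3)\<^sup>2) * ennreal e1"
          using T_strong_weak[OF L2rm, of "lam / 3"] lam F(3) by (auto elim!: order_trans intro!: mult_left_mono)
        also have "\<dots> = ennreal e" using C2_pos lam e1 by (simp add: ennreal_mult[symmetric] e1_def field_simps power2_eq_square)
        finally show ?thesis .
      qed
      finally have "emeasure lebesgue {x. lam < norm (T f x)} \<le> ennreal (c1 / lam) * G + ennreal (c2 / lam) * G + ennreal (c3 / lam) * G + ennreal e"
        by (simp add: add_mono)
      also have "ennreal (c1 / lam) * G + ennreal (c2 / lam) * G + ennreal (c3 / lam) * G = ennreal ((c1 + c2 + c3) / lam) * G"
        using cpos lam by (simp add: add_divide_distrib distrib_right)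
      finally show ?thesis .
    qed
    show ?thesis unfolding G_def[symmetric] by (rule ennreal_le_epsilon) (rule eps)
  qed
  show ?thesis by (rule that[of "c1 + c2 + c3"], use cpos in simp, rule main)
qed

end

section \<open>Iterated commutators\<close>

text \<open>The class on which iterated commutators make sense when \<open>T\<close> is controlled
  on L2 only: it is closed under multiplication by \<open>b\<close>, so every function met in the
  recursion is an admissible argument of \<open>T\<close>.\<close>

definition moments :: "('a::euclidean_space \<Rightarrow> real) \<Rightarrow> ('a \<Rightarrow> complex) \<Rightarrow> bool" where
  "moments b f \<longleftrightarrow> (\<forall>k. L2 (\<lambda>y. of_real (b y) ^ k * f y))"

lemma moments_L2: "moments b f \<Longrightarrow> L2 (\<lambda>y. of_real (b y) ^ k * f y)"
  by (simp add: moments_def)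

lemma moments_L2_0: "moments b f \<Longrightarrow> L2 f"
  using moments_L2[of b f 0] by simp

lemma moments_mult: assumes "moments b f" shows "moments b (\<lambda>y. of_real (b y) * f y)"
  unfolding moments_def
proof
  fix k
  have "(\<lambda>y. of_real (b y) ^ k * (of_real (b y) * f y)) = (\<lambda>y. of_real (b y) ^ Suc k * f y)"
    by (auto simp: algebra_simps)
  then show "L2 (\<lambda>y. of_real (b y) ^ k * (of_real (b y) * f y))"
    using moments_L2[OF assms, of "Suc k"] by (simp only:)
qed

lemma moments_lin: assumes "moments b f" "moments b g" shows "moments b (\<lambda>y. c * f y + g y)"
  unfolding moments_def
proof
  fix k
  have "(\<lambda>y. of_real (b y) ^ k * (c * f y + g y)) = (\<lambda>y. c * (of_real (b y) ^ k * f y) + of_real (b y) ^ k * g y)"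
    by (auto simp: algebra_simps)
  then show "L2 (\<lambda>y. of_real (b y) ^ k * (c * f y + g y))"
    using assms[THEN moments_L2, of k] by (simp only:) (intro L2_add L2_cmult)
qed

text \<open>Induction on the power with the function generalised: one factor b - c at a time is
  moved into the function, so no binomial expansion occurs.\<close>

lemma moments_shift: assumes "moments b f" shows "moments (\<lambda>y. b y - c) f"
proof -
  have "moments b g \<Longrightarrow> L2 (\<lambda>y. of_real (b y - c) ^ k * g y)" for k g
  proof (induction k arbitrary: g)
    case 0
    then show ?case using moments_L2_0 by simp
  next
    case (Suc k)
    have "moments b (\<lambda>y. - of_real c * g y + of_real (b y) * g y)"
      by (intro moments_lin moments_mult Suc.prems)
    from Suc.IH[OF this] have "L2 (\<lambda>y. of_real (b y - c) ^ k * (- of_real c * g y + of_real (b y) * g y))" .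
    moreover have "(\<lambda>y. of_real (b y - c) ^ k * (- of_real c * g y + of_real (b y) * g y)) = (\<lambda>y. of_real (b y - c) ^ Suc k * g y)"
      by (auto simp: algebra_simps)
    ultimately show ?case by (simp only:)
  qed
  then show ?thesis using assms by (simp add: moments_def)
qed

lemma moments_indicator:
  assumes "moments b f" "S \<in> sets lebesgue" shows "moments b (\<lambda>y. indicator S y * f y)"
  unfolding moments_def
proof
  fix k
  have "(\<lambda>y. of_real (b y) ^ k * (indicator S y * f y)) = (\<lambda>y. indicator S y * (of_real (b y) ^ k * f y))"
    by (auto simp: algebra_simps)
  then show "L2 (\<lambda>y. of_real (b y) ^ k * (indicator S y * f y))"
    using L2_indicator[OF moments_L2[OF assms(1), of k] assms(2)] by (simp only:)
qed

text \<open>Any power of |b| is below a multiple of exp(c |b| / 2), whose square is integrable over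
  a cube by John-Nirenberg. In this way bounded functions with bounded support become arguments of
  the commutator.\<close>

lemma moments_bmo1:
  fixes b :: "'a::euclidean_space \<Rightarrow> real"
  assumes b: "bmo1 b" and f: "f \<in> borel_measurable lebesgue" "\<And>x. norm (f x) \<le> B"
    and R: "cube R" "\<And>x. x \<notin> R \<Longrightarrow> f x = 0"
  shows "moments b f"
  unfolding moments_def
proof
  fix k
  note [measurable] = bmo1_measurable[OF b] f(1)
  note m = cube_measure[OF R(1)]
  note [measurable] = m(4)
  define c :: real where "c = ln (3/2) / 2 ^ (DIM('a) + 1)"
  have c: "c > 0" by (simp add: c_def)
  \<comment> \<open>Half of the John-Nirenberg exponent, because the function gets squared.\<close>
  obtain K where K: "K > 0" "\<And>y. y \<ge> 0 \<Longrightarrow> y ^ k \<le> K * exp (c / 2 * y)"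
    using power_le_exp_mult[of "c / 2" k] c by auto
  define D where "D = (K * B)\<^sup>2 * exp (c * \<bar>avg b R\<bar>)"
  have "(norm (of_real (b x) ^ k * f x))\<^sup>2 \<le> D * exp (c * \<bar>b x - avg b R\<bar>)" for x
  proof -
    have "norm (of_real (b x) ^ k * f x) \<le> \<bar>b x\<bar> ^ k * B"
      using f(2)[of x] by (simp add: norm_mult norm_power mult_left_mono)
    also have "\<dots> \<le> (K * exp (c / 2 * \<bar>b x\<bar>)) * B"
      using K(2)[of "\<bar>b x\<bar>"] order_trans[OF norm_ge_zero f(2)[of x]] by (intro mult_right_mono) auto
    finally have "(norm (of_real (b x) ^ k * f x))\<^sup>2 \<le> ((K * exp (c / 2 * \<bar>b x\<bar>)) * B)\<^sup>2"
      by (intro power_mono) auto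
    also have "\<dots> = (K * B)\<^sup>2 * exp (c * \<bar>b x\<bar>)"
      by (simp add: power_mult_distrib exp_double[symmetric])
    also have "\<dots> \<le> (K * B)\<^sup>2 * exp (c * \<bar>avg b R\<bar> + c * \<bar>b x - avg b R\<bar>)"
    proof -
      have "c * \<bar>b x\<bar> \<le> c * (\<bar>avg b R\<bar> + \<bar>b x - avg b R\<bar>)" using c by (intro mult_left_mono) auto
      then show ?thesis by (intro mult_left_mono) (auto simp: distrib_left)
    qed
    finally show ?thesis by (simp add: D_def exp_add mult.assoc)
  qed
  then have "(\<integral>\<^sup>+x. ennreal ((norm (of_real (b x) ^ k * f x))\<^sup>2) \<partial>lebesgue) \<le>
     (\<integral>\<^sup>+x. ennreal D * (ennreal (exp (c * \<bar>b x - avg b R\<bar>)) * indicator R x) \<partial>lebesgue)"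
    using R(2) by (intro nn_integral_mono) (auto simp: ennreal_mult[symmetric] D_def intro!: ennreal_leI split: split_indicator)
  also have "\<dots> = ennreal D * (\<integral>\<^sup>+x\<in>R. ennreal (exp (c * \<bar>b x - avg b R\<bar>)) \<partial>lebesgue)"
    by (intro nn_integral_cmult) measurable
  also have "\<dots> \<le> ennreal D * (7 * emeasure lebesgue R)"
    unfolding c_def by (intro mult_left_mono John_Nirenberg[OF b R(1)]) simp
  also have "\<dots> < \<infinity>" using m(3) by (auto simp: ennreal_mult_less_top)
  finally show "L2 (\<lambda>y. of_real (b y) ^ k * f y)" by (simp add: L2_iff)
qed

context CZ begin

lemma iter_lin:
  assumes "moments b f" "moments b g"
  shows "AE x in lebesgue. iter_comm T b m (\<lambda>y. c * f y + g y) x = c * iter_comm T b m f x + iter_comm T b m g x"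
  using assms
proof (induction m arbitrary: f g)
  case 0
  then show ?case using T_lin[OF 0[THEN moments_L2_0]] by simp
next
  case (Suc m)
  have "AE x in lebesgue. iter_comm T b m (\<lambda>y. c * (of_real (b y) * f y) + of_real (b y) * g y) x =
     c * iter_comm T b m (\<lambda>y. of_real (b y) * f y) x + iter_comm T b m (\<lambda>y. of_real (b y) * g y) x"
    using Suc.prems by (intro Suc.IH moments_mult)
  moreover have "(\<lambda>y. c * (of_real (b y) * f y) + of_real (b y) * g y) = (\<lambda>y. of_real (b y) * (c * f y + g y))"
    by (auto simp: algebra_simps)
  ultimately have "AE x in lebesgue. iter_comm T b m (\<lambda>y. of_real (b y) * (c * f y + g y)) x =
     c * iter_comm T b m (\<lambda>y. of_real (b y) * f y) x + iter_comm T b m (\<lambda>y. of_real (b y) * g y) x"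
    by (simp only:)
  moreover note Suc.IH[OF Suc.prems]
  ultimately show ?case by eventually_elim (simp add: algebra_simps)
qed

lemma iter_add:
  assumes "moments b f" "moments b g"
  shows "AE x in lebesgue. iter_comm T b m (\<lambda>y. f y + g y) x = iter_comm T b m f x + iter_comm T b m g x"
  using iter_lin[OF assms, of m 1] by simp

text \<open>A constant commutes with \<open>T\<close>, so subtracting it from the symbol changes
  nothing. On each cube \<open>b\<close> may thus be centred at its own average.\<close>

lemma iter_shift:
  assumes "moments b f"
  shows "AE x in lebesgue. iter_comm T (\<lambda>x. b x - c) m f x = iter_comm T b m f x"
  using assms
proof (induction m arbitrary: f)
  case 0
  then show ?case by simp
next
  case (Suc m)
  let ?g = "\<lambda>y. - of_real c * f y + of_real (b y) * f y"
  have g: "moments b ?g" using Suc.prems by (intro moments_lin moments_mult)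
  have eq: "(\<lambda>y. of_real (b y - c) * f y) = ?g" by (auto simp: algebra_simps)
  have "AE x in lebesgue. iter_comm T b m ?g x = - of_real c * iter_comm T b m f x + iter_comm T b m (\<lambda>y. of_real (b y) * f y) x"
    by (intro iter_lin Suc.prems moments_mult)
  moreover note Suc.IH[OF Suc.prems] Suc.IH[OF g]
  ultimately show ?case
    unfolding iter_comm.simps eq by eventually_elim (simp add: algebra_simps)
qed

text \<open>Degree \<open>m\<close> in the symbol and degree 1 in the function; the source of the
  factor ||b||^m in the final estimate.\<close>

lemma iter_scale:
  assumes "moments b f"
  shows "AE x in lebesgue. iter_comm T (\<lambda>x. s * b x) m (\<lambda>y. u * f y) x = of_real s ^ m * u * iter_comm T b m f x"
  using assms
proof (induction m arbitrary: f u)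
  case 0
  then show ?case using T_cmult[OF moments_L2_0[OF 0]] by simp
next
  case (Suc m)
  have eq: "(\<lambda>y. of_real (s * b y) * (u * f y)) = (\<lambda>y. (of_real s * u) * (of_real (b y) * f y))" by (auto simp: algebra_simps)
  note Suc.IH[OF Suc.prems, of u] Suc.IH[OF moments_mult[OF Suc.prems], of "of_real s * u"]
  then show ?case
    unfolding iter_comm.simps eq by eventually_elim (simp add: algebra_simps)
qed

end

text \<open>The recursion for the iterated commutator bounds it without expanding into binomial coefficients.\<close>
lemma iter_comm_bound:
  assumes "\<And>h. h \<le> m \<Longrightarrow> \<bar>b x\<bar> ^ (m - h) * norm (T (\<lambda>y. of_real (b y) ^ h * f y) x) \<le> W"
  shows "norm (iter_comm T b m f x) \<le> 2 ^ m * W"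
proof -
  have "i + k + j = m \<Longrightarrow> \<bar>b x\<bar> ^ i * norm (iter_comm T b k (\<lambda>y. of_real (b y) ^ j * f y) x) \<le> 2 ^ k * W" for i k j
  proof (induction k arbitrary: i j)
    case 0
    then have "i = m - j" "j \<le> m" by auto
    then show ?case using assms[of j] by simp
  next
    case (Suc k)
    have eq: "(\<lambda>y. of_real (b y) * (of_real (b y) ^ j * f y)) = (\<lambda>y. of_real (b y) ^ Suc j * f y)" by (auto simp: algebra_simps)
    have "norm (iter_comm T b (Suc k) (\<lambda>y. of_real (b y) ^ j * f y) x) \<le>
      \<bar>b x\<bar> * norm (iter_comm T b k (\<lambda>y. of_real (b y) ^ j * f y) x) + norm (iter_comm T b k (\<lambda>y. of_real (b y) ^ Suc j * f y) x)"
      unfolding iter_comm.simps eq by (rule order_trans[OF norm_triangle_ineq4]) (simp add: norm_mult)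
    then have "\<bar>b x\<bar> ^ i * norm (iter_comm T b (Suc k) (\<lambda>y. of_real (b y) ^ j * f y) x) \<le> \<bar>b x\<bar> ^ i *
      (\<bar>b x\<bar> * norm (iter_comm T b k (\<lambda>y. of_real (b y) ^ j * f y) x) + norm (iter_comm T b k (\<lambda>y. of_real (b y) ^ Suc j * f y) x))"
      by (intro mult_left_mono) auto
    also have "\<dots> = \<bar>b x\<bar> ^ Suc i * norm (iter_comm T b k (\<lambda>y. of_real (b y) ^ j * f y) x) + \<bar>b x\<bar> ^ i * norm (iter_comm T b k (\<lambda>y. of_real (b y) ^ Suc j * f y) x)"
      by (simp add: algebra_simps)
    also have "\<dots> \<le> 2 ^ k * W + 2 ^ k * W"
      using Suc.prems by (intro add_mono Suc.IH) auto
    finally show ?case by (simp del: iter_comm.simps add: algebra_simps)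
  qed
  from this[of 0 m 0] show ?thesis by simp
qed

section \<open>One step of the sparse domination\<close>

text \<open>The concentric cube with margin 2 n s on every side, twice the diameter bound n s. Hence
  kernel regularity applies to any two points of the cube and any point outside its dilate.\<close>

definition dilate :: "'a::euclidean_space \<times> real \<Rightarrow> 'a \<times> real" where
  "dilate q = (fst q - (2 * real DIM('a) * snd q) *\<^sub>R One, (4 * real DIM('a) + 1) * snd q)"

abbreviation dcube :: "'a::euclidean_space \<times> real \<Rightarrow> 'a set" where
  "dcube q \<equiv> ccube (dilate q)"

lemma snd_dilate: "snd q > 0 \<Longrightarrow> snd (dilate q) > 0"
  by (auto simp: dilate_def intro!: mult_pos_pos add_nonneg_pos)

lemma mem_dcube: "y \<in> dcube q \<longleftrightarrow> (\<forall>i\<in>Basis. fst q \<bullet> i - 2 * real DIM('a) * snd q \<le> y \<bullet> i \<and>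
     y \<bullet> i \<le> fst q \<bullet> i + (2 * real DIM('a) + 1) * snd q)" for y :: "'a::euclidean_space"
  by (auto simp: dilate_def mem_box inner_add_left inner_diff_left algebra_simps)

lemma mem_ccube: "y \<in> ccube q \<longleftrightarrow> (\<forall>i\<in>Basis. fst q \<bullet> i \<le> y \<bullet> i \<and> y \<bullet> i \<le> fst q \<bullet> i + snd q)"
  by (auto simp: mem_box inner_add_left)

lemma ccube_subset_dcube: "snd q > 0 \<Longrightarrow> ccube q \<subseteq> dcube q"
proof
  fix x assume q: "snd q > 0" and x: "x \<in> ccube q"
  have 0: "0 \<le> real DIM('a) * snd q" using q by simp
  show "x \<in> dcube q"
    unfolding mem_dcube
  proof
    fix i :: 'a assume "i \<in> Basis"
    then have "fst q \<bullet> i \<le> x \<bullet> i" "x \<bullet> i \<le> fst q \<bullet> i + snd q" using x[unfolded mem_ccube] by auto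
    then show "fst q \<bullet> i - 2 * real DIM('a) * snd q \<le> x \<bullet> i \<and> x \<bullet> i \<le> fst q \<bullet> i + (2 * real DIM('a) + 1) * snd q"
      using 0 by (simp only: distrib_right mult.assoc) linarith
  qed
qed

lemma hcube_subset_dcube: "snd q > 0 \<Longrightarrow> hcube q \<subseteq> dcube q"
  using ccube_subset_dcube box_hcube_cbox(2) by blast

lemma dcube_mono:
  assumes "snd r > 0" "hcube r \<subseteq> hcube (q::'a::euclidean_space \<times> real)"
  shows "dcube r \<subseteq> dcube q"
proof -
  have "box (fst r) (fst r + snd r *\<^sub>R One) \<subseteq> ccube q"
    using assms(2) box_hcube_cbox(1)[of r] box_hcube_cbox(2)[of q] by blast
  moreover have "\<forall>i\<in>Basis. fst r \<bullet> i < (fst r + snd r *\<^sub>R One) \<bullet> i" using assms(1) by (simp add: inner_add_left)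
  ultimately have *: "\<forall>i\<in>Basis. fst q \<bullet> i \<le> fst r \<bullet> i \<and> (fst r + snd r *\<^sub>R One) \<bullet> i \<le> (fst q + snd q *\<^sub>R One) \<bullet> i"
    unfolding subset_box by blast
  have le: "fst q \<bullet> i \<le> fst r \<bullet> i \<and> fst r \<bullet> i + snd r \<le> fst q \<bullet> i + snd q" if "i \<in> Basis" for i
    using *[rule_format, OF that] that by (simp add: inner_add_left)
  obtain j :: 'a where j: "j \<in> Basis" using nonempty_Basis by blast
  have s: "snd r \<le> snd q" using le[OF j] by linarith
  then have s2: "real DIM('a) * snd r \<le> real DIM('a) * snd q" by (intro mult_left_mono) auto
  show ?thesis
  proof
    fix y assume y: "y \<in> dcube r"
    show "y \<in> dcube q"
      unfolding mem_dcube
    proof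
      fix i :: 'a assume i: "i \<in> Basis"
      show "fst q \<bullet> i - 2 * real DIM('a) * snd q \<le> y \<bullet> i \<and> y \<bullet> i \<le> fst q \<bullet> i + (2 * real DIM('a) + 1) * snd q"
        using y[unfolded mem_dcube, rule_format, OF i] le[OF i] s s2 by (simp only: distrib_right mult.assoc) linarith
    qed
  qed
qed

lemma dist_ge_dcube:
  fixes x :: "'a::euclidean_space"
  assumes "x \<in> ccube q" "y \<notin> dcube q" shows "dist x y \<ge> 2 * real DIM('a) * snd q"
proof -
  obtain i where i: "i \<in> Basis" "\<not> (fst q \<bullet> i - 2 * real DIM('a) * snd q \<le> y \<bullet> i \<and> y \<bullet> i \<le> fst q \<bullet> i + (2 * real DIM('a) + 1) * snd q)"
    using assms(2) unfolding mem_dcube by blast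
  have "fst q \<bullet> i \<le> x \<bullet> i \<and> x \<bullet> i \<le> fst q \<bullet> i + snd q" using assms(1) i(1) unfolding mem_ccube by blast
  then have "2 * real DIM('a) * snd q \<le> \<bar>(x - y) \<bullet> i\<bar>" using i(2) by (simp only: inner_diff_left distrib_right mult.assoc) linarith
  also have "\<dots> \<le> dist x y" using Basis_le_norm[OF i(1), of "x - y"] by (simp add: dist_norm)
  finally show ?thesis .
qed

text \<open>The dilate has side (4 n + 1) s; the larger factor 4 n + 2 gives the strict inequality
  that an open ball requires.\<close>

lemma dcube_subset_ball:
  fixes x :: "'a::euclidean_space"
  assumes "snd q > 0" "x \<in> ccube q"
  shows "dcube q \<subseteq> ball x (real DIM('a) * (4 * real DIM('a) + 2) * snd q)"
proof
  fix y assume y: "y \<in> dcube q"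
  have x: "x \<in> dcube q" using assms ccube_subset_dcube by blast
  have "dist x y \<le> real DIM('a) * snd (dilate q)" using x y by (rule dist_le_hcube)
  also have "\<dots> = real DIM('a) * (4 * real DIM('a) + 1) * snd q" by (simp add: dilate_def mult.assoc)
  also have "\<dots> < real DIM('a) * (4 * real DIM('a) + 2) * snd q"
    using assms(1) by (intro mult_strict_right_mono mult_strict_left_mono) auto
  finally show "y \<in> ball x (real DIM('a) * (4 * real DIM('a) + 2) * snd q)" by simp
qed

lemma emeasure_dcube: "snd q > 0 \<Longrightarrow> emeasure lebesgue (dcube q) = ennreal ((4 * real DIM('a) + 1) ^ DIM('a)) * emeasure lebesgue (hcube (q::'a::euclidean_space \<times> real))"
  by (subst emeasure_cube) (auto simp: dilate_def emeasure_hcube power_mult_distrib ennreal_mult)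

lemma measure_dcube: "snd q > 0 \<Longrightarrow> measure lebesgue (dcube q) = ((4 * real DIM('a) + 1) * snd q) ^ DIM('a)" for q :: "'a::euclidean_space \<times> real"
  by (subst measure_cube) (auto simp: dilate_def)

section \<open>Averages and exceptional sets\<close>

definition mean :: "('a::euclidean_space \<Rightarrow> complex) \<Rightarrow> 'a set \<Rightarrow> real" where
  "mean g R = enn2real (\<integral>\<^sup>+x\<in>R. ennreal (norm (g x)) \<partial>lebesgue) / measure lebesgue R"

lemma mean_nonneg: "0 \<le> mean g R"
  by (simp add: mean_def)

lemma L2_set_integral_finite:
  assumes "L2 g" "R \<in> sets lebesgue" "emeasure lebesgue R < \<infinity>"
  shows "(\<integral>\<^sup>+x\<in>R. ennreal (norm (g x)) \<partial>lebesgue) < \<infinity>"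
proof -
  note [measurable] = L2_measurable[OF assms(1)] assms(2)
  have "z \<le> 1 + z\<^sup>2" for z :: real
  proof -
    have "2 * z \<le> 1 + z\<^sup>2" "0 \<le> z\<^sup>2" using sum_squares_bound[of 1 z] by auto
    then show ?thesis by linarith
  qed
  then have "(\<integral>\<^sup>+x\<in>R. ennreal (norm (g x)) \<partial>lebesgue) \<le> (\<integral>\<^sup>+x. indicator R x + ennreal ((norm (g x))\<^sup>2) \<partial>lebesgue)"
    using ennreal_leI[of "norm (g x)" "1 + (norm (g x))\<^sup>2" for x]
    by (intro nn_integral_mono) (auto split: split_indicator)
  also have "\<dots> = emeasure lebesgue R + (\<integral>\<^sup>+x. ennreal ((norm (g x))\<^sup>2) \<partial>lebesgue)"
    by (subst nn_integral_add) auto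
  also have "\<dots> < \<infinity>" using assms by (auto simp: L2_iff)
  finally show ?thesis .
qed

text \<open>An L2 function has finite integral over a cube, so the default value of
  \<open>enn2real\<close> inside \<open>mean\<close> is never met.\<close>

lemma mean_eq:
  assumes "L2 g" "cube R"
  shows "(\<integral>\<^sup>+x\<in>R. ennreal (norm (g x)) \<partial>lebesgue) = ennreal (mean g R) * emeasure lebesgue R"
proof -
  note m = cube_measure[OF assms(2)]
  have f: "(\<integral>\<^sup>+x\<in>R. ennreal (norm (g x)) \<partial>lebesgue) < \<infinity>"
    using L2_set_integral_finite[OF assms(1) m(4,3)] .
  have "ennreal (mean g R) * emeasure lebesgue R = ennreal (mean g R * measure lebesgue R)"
    using m mean_nonneg[of g R] by (simp add: ennreal_mult del: measure_completion)
  also have "mean g R * measure lebesgue R = enn2real (\<integral>\<^sup>+x\<in>R. ennreal (norm (g x)) \<partial>lebesgue)"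
    using m(1) by (simp add: mean_def del: measure_completion)
  finally show ?thesis using f by simp
qed

context CZ begin

text \<open>The weak type bounds for \<open>T\<close> and for the maximal function are applied at
  height A times the mean. The total mass of \<open>g\<close> is the mean times |R|, so the measure
  lost is of order |Q| / A.\<close>

lemma exceptional_set:
  obtains C where "C > 0" "\<And>A g q. A > 0 \<Longrightarrow> snd q > 0 \<Longrightarrow> L2 g \<Longrightarrow> (\<And>x. x \<notin> dcube q \<Longrightarrow> g x = 0) \<Longrightarrow>
    \<exists>N\<in>sets lebesgue. emeasure lebesgue N \<le> ennreal (C / A) * emeasure lebesgue (hcube q) \<and>
      (\<forall>x. x \<notin> N \<longrightarrow> norm (T g x) \<le> A * mean g (dcube q) \<and>
         (\<forall>r>0. (\<integral>\<^sup>+y\<in>ball x r. ennreal (norm (g y)) \<partial>lebesgue) \<le> ennreal (A * mean g (dcube q)) * emeasure lebesgue (ball x r)))"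
proof -
  obtain C where C: "C > 0" "\<And>f lam. L2 f \<Longrightarrow> bounded {x. f x \<noteq> 0} \<Longrightarrow> lam > 0 \<Longrightarrow>
    emeasure lebesgue {x. lam < norm (T f x)} \<le> ennreal (C / lam) * (\<integral>\<^sup>+x. ennreal (norm (f x)) \<partial>lebesgue)"
    by (rule weak_type_1_1) blast
  define a where "a = (4 * real DIM('a) + 1) ^ DIM('a)"
  have a: "a > 0" by (auto simp: a_def intro!: zero_less_power add_nonneg_pos)
  define C' where "C' = (C + 5 ^ DIM('a)) * a"
  have "\<exists>N\<in>sets lebesgue. emeasure lebesgue N \<le> ennreal (C' / A) * emeasure lebesgue (hcube q) \<and>
      (\<forall>x. x \<notin> N \<longrightarrow> norm (T g x) \<le> A * mean g (dcube q) \<and>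
         (\<forall>r>0. (\<integral>\<^sup>+y\<in>ball x r. ennreal (norm (g y)) \<partial>lebesgue) \<le> ennreal (A * mean g (dcube q)) * emeasure lebesgue (ball x r)))"
    if A: "A > 0" and q: "snd q > 0" and g: "L2 g" and supp: "\<And>x. x \<notin> dcube q \<Longrightarrow> g x = 0" for A g q
  proof -
    note gm [measurable] = L2_measurable[OF g]
    have cub: "cube (dcube q)" using q by (intro cube_ccube snd_dilate)
    note m = cube_measure[OF cub]
    define G where "G = (\<integral>\<^sup>+x. ennreal (norm (g x)) \<partial>lebesgue)"
    have "G = (\<integral>\<^sup>+x\<in>dcube q. ennreal (norm (g x)) \<partial>lebesgue)"
      unfolding G_def using supp by (intro nn_integral_cong) (auto split: split_indicator)
    then have G: "G = ennreal (mean g (dcube q)) * emeasure lebesgue (dcube q)"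
      using mean_eq[OF g cub] by simp
    have bd: "bounded {x. g x \<noteq> 0}"
      using supp compact_imp_bounded[OF m(5)] by (metis (mono_tags, lifting) bounded_subset mem_Collect_eq subsetI)
    show ?thesis
    \<comment> \<open>Weak type bounds need a positive height. For mean zero, \<open>g\<close>
      vanishes almost everywhere, and the set where \<open>T g\<close> is non-zero is null and
      serves as \<open>N\<close>.\<close>
    proof (cases "mean g (dcube q) = 0")
      case True
      then have "G = 0" using G by simp
      then have "AE x in lebesgue. ennreal (norm (g x)) = 0"
        unfolding G_def by (subst (asm) nn_integral_0_iff_AE) auto
      then have g0: "AE x in lebesgue. g x = 0" by eventually_elim simp
      define N where "N = {x. 0 < norm (T g x)}"
      have N: "N \<in> sets lebesgue"
        unfolding N_def using L2_measurable[OF T_L2[OF g]] by (intro sets_Collect_gt_lebesgue) measurable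
      have "AE x in lebesgue. x \<notin> N" using T_zero[OF gm g0] unfolding N_def by eventually_elim simp
      then have "emeasure lebesgue N = 0" using AE_iff_null_sets[OF N] by auto
      moreover have "(\<integral>\<^sup>+y\<in>ball x r. ennreal (norm (g y)) \<partial>lebesgue) = 0" for x r
      proof -
        have "(\<integral>\<^sup>+y\<in>ball x r. ennreal (norm (g y)) \<partial>lebesgue) = (\<integral>\<^sup>+(y::'a). 0 \<partial>lebesgue)"
          by (rule nn_integral_cong_AE) (use g0 in auto)
        then show ?thesis by simp
      qed
      ultimately show ?thesis using N True by (intro bexI[of _ N]) (auto simp: N_def)
    next
      case False
      then have M: "mean g (dcube q) > 0" using mean_nonneg[of g "dcube q"] by linarith
      define lam where "lam = A * mean g (dcube q)"
      have lam: "lam > 0" using M A by (simp add: lam_def)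
      have G2: "ennreal (c / lam) * G = ennreal (c * a / A) * emeasure lebesgue (hcube q)" if "c > 0" for c
      proof -
        have "ennreal (c / lam) * G = ennreal (c / lam) * (ennreal (mean g (dcube q)) * (ennreal a * emeasure lebesgue (hcube q)))"
          using G emeasure_dcube[OF q] by (simp add: a_def)
        also have "\<dots> = ennreal (c / lam * mean g (dcube q) * a) * emeasure lebesgue (hcube q)"
          using that lam M a by (simp add: ennreal_mult[symmetric] mult.assoc[symmetric])
        also have "c / lam * mean g (dcube q) * a = c * a / A" using M A by (simp add: lam_def)
        finally show ?thesis .
      qed
      define N1 where "N1 = {x. lam < norm (T g x)}"
      have N1: "N1 \<in> sets lebesgue"
        unfolding N1_def using L2_measurable[OF T_L2[OF g]] by (intro sets_Collect_gt_lebesgue) measurable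
      have e1: "emeasure lebesgue N1 \<le> ennreal (C * a / A) * emeasure lebesgue (hcube q)"
        using C(2)[OF g bd lam] G2[OF C(1)] by (simp add: N1_def G_def)
      obtain N2 where N2: "N2 \<in> sets lebesgue"
        "\<And>x r. r > 0 \<Longrightarrow> ennreal lam * emeasure lebesgue (ball x r) < (\<integral>\<^sup>+y\<in>ball x r. ennreal (norm (g y)) \<partial>lebesgue) \<Longrightarrow> x \<in> N2"
        "emeasure lebesgue N2 \<le> ennreal (5 ^ DIM('a) / lam) * (\<integral>\<^sup>+x. ennreal (norm (g x)) \<partial>lebesgue)"
        by (rule maximal_weak_type[of "\<lambda>x. ennreal (norm (g x))" lam]) (use lam in auto)
      have e2: "emeasure lebesgue N2 \<le> ennreal (5 ^ DIM('a) * a / A) * emeasure lebesgue (hcube q)"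
        using N2(3) G2[of "5 ^ DIM('a)"] by (simp add: G_def)
      have "emeasure lebesgue (N1 \<union> N2) \<le> ennreal (C * a / A) * emeasure lebesgue (hcube q) + ennreal (5 ^ DIM('a) * a / A) * emeasure lebesgue (hcube q)"
        using e1 e2 N1 N2(1) by (intro order_trans[OF emeasure_subadditive] add_mono)
      also have "\<dots> = ennreal (C' / A) * emeasure lebesgue (hcube q)"
        using C(1) a A by (simp add: C'_def distrib_right add_divide_distrib ennreal_plus)
      finally have "emeasure lebesgue (N1 \<union> N2) \<le> ennreal (C' / A) * emeasure lebesgue (hcube q)" .
      then show ?thesis using N1 N2(1,2)
        by (intro bexI[of _ "N1 \<union> N2"]) (auto simp: N1_def lam_def[symmetric] not_less[symmetric])
    qed
  qed
  note main = this
  show ?thesis by (rule that[of C'], use C(1) a in \<open>simp add: C'_def add_pos_pos\<close>, rule main)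
qed

text \<open>Regularity in the second variable gives continuity off the diagonal, from which
  measurability of \<open>K x\<close> is derived; the definition of a standard kernel does not
  contain it.\<close>

lemma kernel_continuous: "continuous_on (- {x}) (K x)"
proof (rule continuous_at_imp_continuous_on, rule ballI)
  fix y assume "y \<in> - {x}"
  then have D: "dist y x > 0" by auto
  define C where "C = Ck / dist y x powr (real DIM('a) + d)"
  have b: "norm (K x y' - K x y) \<le> C * dist y y' powr d" if "dist y y' < dist y x / 2" for y'
    using K_reg2[of y x y'] D that by (auto simp: C_def norm_minus_commute)
  have "((\<lambda>y'. K x y' - K x y) \<longlongrightarrow> 0) (at y)"
  proof (rule Lim_null_comparison)
    show "\<forall>\<^sub>F y' in at y. norm (K x y' - K x y) \<le> C * dist y y' powr d"
      unfolding eventually_at using b D by (intro exI[of _ "dist y x / 2"]) (auto simp: dist_commute)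
    have "((\<lambda>y'. dist y y') \<longlongrightarrow> dist y y) (at y)" by (intro tendsto_intros)
    then have "((\<lambda>y'. dist y y' powr d) \<longlongrightarrow> 0) (at y)"
      using d_pos by (intro tendsto_zero_powrI[where b=d]) (auto intro: tendsto_intros)
    then show "((\<lambda>y'. C * dist y y' powr d) \<longlongrightarrow> 0) (at y)" by (rule tendsto_mult_right_zero)
  qed
  then show "isCont (K x) y" unfolding isCont_def by (simp add: LIM_zero_iff)
qed

text \<open>At distance at least \<open>e\<close> from \<open>x\<close> the size condition bounds
  the kernel, so integrability is inherited from \<open>g\<close>. The value on the diagonal is
  masked by an indicator to obtain measurability.\<close>

lemma kernel_integrable:
  assumes g: "integrable lebesgue g" and e: "e > 0" and far: "\<And>y. g y \<noteq> 0 \<Longrightarrow> e \<le> dist x y"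
  shows "integrable lebesgue (\<lambda>y. K x y * g y)"
proof (rule Bochner_Integration.integrable_bound)
  show "integrable lebesgue (\<lambda>y. (Ck / e ^ DIM('a)) *\<^sub>R g y)" using g by simp
  have "(\<lambda>y. indicator (- {x}) y *\<^sub>R K x y) \<in> borel_measurable borel"
    by (intro borel_measurable_continuous_on_indicator kernel_continuous) auto
  then have "(\<lambda>y. indicator (- {x}) y *\<^sub>R K x y) \<in> borel_measurable lborel" by simp
  then have "(\<lambda>y. indicator (- {x}) y *\<^sub>R K x y) \<in> borel_measurable lebesgue" by (rule measurable_completion)
  then have "(\<lambda>y. (indicator (- {x}) y *\<^sub>R K x y) * g y) \<in> borel_measurable lebesgue"
    using g by (intro borel_measurable_times) auto
  moreover have "(indicator (- {x}) y *\<^sub>R K x y) * g y = K x y * g y" for y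
    using far[of x] e by (auto split: split_indicator)
  ultimately show "(\<lambda>y. K x y * g y) \<in> borel_measurable lebesgue" by simp
  show "AE y in lebesgue. norm (K x y * g y) \<le> norm ((Ck / e ^ DIM('a)) *\<^sub>R g y)"
  proof (rule AE_I2)
    fix y
    show "norm (K x y * g y) \<le> norm ((Ck / e ^ DIM('a)) *\<^sub>R g y)"
    proof (cases "g y = 0")
      case False
      then have r: "e \<le> dist x y" by (rule far)
      then have "x \<noteq> y" using e by auto
      then have "norm (K x y) \<le> Ck / dist x y ^ DIM('a)" by (rule K_size)
      also have "\<dots> \<le> Ck / e ^ DIM('a)" using r e Ck_pos by (intro divide_left_mono power_mono mult_pos_pos zero_less_power) auto
      finally show ?thesis using Ck_pos e by (simp add: norm_mult mult_right_mono del: times_divide_eq_left)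
    qed simp
  qed
qed

end

text \<open>The closed cube lies in the open interior of its dilate. Removing that interior from a
  larger cube leaves a compact set that misses the small cube, as the kernel representation
  demands.\<close>

lemma ccube_subset_box_dcube: "snd q > 0 \<Longrightarrow> ccube q \<subseteq> box (fst (dilate q)) (fst (dilate q) + snd (dilate q) *\<^sub>R One)" for q :: "'a::euclidean_space \<times> real"
proof
  fix x assume q: "snd q > 0" and x: "x \<in> ccube q"
  have 0: "0 < real DIM('a) * snd q" using q by simp
  have "fst (dilate q) \<bullet> i < x \<bullet> i \<and> x \<bullet> i < fst (dilate q) \<bullet> i + snd (dilate q)" if i: "i \<in> Basis" for i
  proof -
    have "fst q \<bullet> i \<le> x \<bullet> i" "x \<bullet> i \<le> fst q \<bullet> i + snd q" using x i unfolding mem_ccube by auto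
    moreover have "fst (dilate q) \<bullet> i = fst q \<bullet> i - 2 * (real DIM('a) * snd q)"
      "fst (dilate q) \<bullet> i + snd (dilate q) = fst q \<bullet> i + snd q + 2 * (real DIM('a) * snd q)"
      using i by (simp_all add: dilate_def inner_diff_left algebra_simps)
    ultimately show ?thesis using 0 by linarith
  qed
  then show "x \<in> box (fst (dilate q)) (fst (dilate q) + snd (dilate q) *\<^sub>R One)" by (auto simp: mem_box inner_add_left)
qed

context CZ begin

text \<open>The value at \<open>x\<close> is compared with the value at one good point of the same cube, so no maximal
  truncated operator is needed.\<close>
lemma far_part_bound:
  obtains C where "C > 0" "\<And>A g q r E. A \<ge> 0 \<Longrightarrow> snd q > 0 \<Longrightarrow> L2 g \<Longrightarrow> (\<And>x. x \<notin> dcube q \<Longrightarrow> g x = 0) \<Longrightarrow>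
    snd r > 0 \<Longrightarrow> hcube r \<subseteq> hcube q \<Longrightarrow> E \<in> sets lebesgue \<Longrightarrow> 2 * emeasure lebesgue (E \<inter> hcube r) \<le> emeasure lebesgue (hcube r) \<Longrightarrow>
    (\<And>x. x \<notin> E \<Longrightarrow> x \<in> hcube r \<Longrightarrow> norm (T g x) \<le> A) \<Longrightarrow>
    (\<And>x t. x \<notin> E \<Longrightarrow> x \<in> hcube r \<Longrightarrow> t > 0 \<Longrightarrow> (\<integral>\<^sup>+y\<in>ball x t. ennreal (norm (g y)) \<partial>lebesgue) \<le> ennreal A * emeasure lebesgue (ball x t)) \<Longrightarrow>
    (AE x in lebesgue. x \<in> hcube r \<longrightarrow> norm (T (\<lambda>y. indicator (- dcube r) y * g y) x) \<le> C * A)"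
proof -
  let ?n = "real DIM('a)"
  obtain C0 where C0: "C0 > 0" "\<And>A g q. A > 0 \<Longrightarrow> snd q > 0 \<Longrightarrow> L2 g \<Longrightarrow> (\<And>x. x \<notin> dcube q \<Longrightarrow> g x = 0) \<Longrightarrow>
    \<exists>N\<in>sets lebesgue. emeasure lebesgue N \<le> ennreal (C0 / A) * emeasure lebesgue (hcube q) \<and>
      (\<forall>x. x \<notin> N \<longrightarrow> norm (T g x) \<le> A * mean g (dcube q) \<and>
         (\<forall>r>0. (\<integral>\<^sup>+y\<in>ball x r. ennreal (norm (g y)) \<partial>lebesgue) \<le> ennreal (A * mean g (dcube q)) * emeasure lebesgue (ball x r)))"
    by (rule exceptional_set) blast
  obtain Ct where Ct: "Ct > 0" "\<And>(x::'a) l g A. l > 0 \<Longrightarrow> g \<in> borel_measurable lebesgue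
    \<Longrightarrow> (\<And>r. r > 0 \<Longrightarrow> (\<integral>\<^sup>+y\<in>ball x r. g y \<partial>lebesgue) \<le> A * emeasure lebesgue (ball x r))
    \<Longrightarrow> (\<integral>\<^sup>+y\<in>{y. l \<le> dist x y}. ennreal (l powr d / dist x y powr (?n + d)) * g y \<partial>lebesgue) \<le> ennreal Ct * A"
    by (rule tail_bound[OF d_pos, where 'a='a]) (erule that, blast)
  define v where "v = unit_ball_vol ?n"
  have v: "v > 0" unfolding v_def by (rule unit_ball_vol_DIM_pos)
  \<comment> \<open>The volume of a ball of radius n (4 n + 2) s over the volume of the dilate,
    whose side is (4 n + 1) s.\<close>
  define k where "k = v * (?n * (4 * ?n + 2)) ^ DIM('a) / (4 * ?n + 1) ^ DIM('a)"
  have n4: "4 * ?n + 1 > 0" by (simp add: add_nonneg_pos)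
  have k0: "k > 0" using v n4 by (simp add: k_def add_nonneg_pos)
  \<comment> \<open>Three contributions: \<open>T g\<close> at the good point, \<open>T\<close> of
    the local part there, and the kernel oscillation on the way from that point to
    \<open>x\<close>.\<close>
  define C where "C = 1 + 4 * C0 * k + Ck * Ct"
  have main: "AE x in lebesgue. x \<in> hcube r \<longrightarrow> norm (T (\<lambda>y. indicator (- dcube r) y * g y) x) \<le> C * A"
    if A: "A \<ge> 0" and q: "snd q > 0" and g: "L2 g" and supp: "\<And>x. x \<notin> dcube q \<Longrightarrow> g x = 0"
      and r: "snd r > 0" "hcube r \<subseteq> hcube q" and E: "E \<in> sets lebesgue" "2 * emeasure lebesgue (E \<inter> hcube r) \<le> emeasure lebesgue (hcube r)"
      and good: "\<And>x. x \<notin> E \<Longrightarrow> x \<in> hcube r \<Longrightarrow> norm (T g x) \<le> A"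
      and balls: "\<And>x t. x \<notin> E \<Longrightarrow> x \<in> hcube r \<Longrightarrow> t > 0 \<Longrightarrow> (\<integral>\<^sup>+y\<in>ball x t. ennreal (norm (g y)) \<partial>lebesgue) \<le> ennreal A * emeasure lebesgue (ball x t)"
    for A g q r E
  proof -
    note gm [measurable] = L2_measurable[OF g]
    have cub: "cube (dcube q)" "cube (dcube r)" using q r by (auto intro!: cube_ccube snd_dilate)
    define g1 where "g1 = (\<lambda>y. indicator (dcube r) y * g y)"
    define g2 where "g2 = (\<lambda>y. indicator (- dcube r) y * g y)"
    have L1: "L2 g1" unfolding g1_def by (intro L2_indicator g) simp
    have L2: "L2 g2" unfolding g2_def by (intro L2_indicator g) (simp add: Compl_in_sets_lebesgue)
    have g12: "g = (\<lambda>y. g1 y + g2 y)" unfolding g1_def g2_def by (auto split: split_indicator)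
    have Tadd: "AE x in lebesgue. T g x = T g1 x + T g2 x"
      using T_add[OF L1 L2] unfolding g12[symmetric] .
    \<comment> \<open>A compact set that contains the support of the far part and misses the small
      cube; subtracting the closed dilate would not leave a closed set.\<close>
    define S where "S = dcube q - box (fst (dilate r)) (fst (dilate r) + snd (dilate r) *\<^sub>R One)"
    have S: "compact S" unfolding S_def by (intro compact_diff compact_cbox open_box)
    have S0: "g2 y = 0" if "y \<notin> S" for y
      using that supp[of y] box_subset_cbox[of "fst (dilate r)" "fst (dilate r) + snd (dilate r) *\<^sub>R One"]
      by (auto simp: S_def g2_def split: split_indicator)
    have Tk: "AE x in lebesgue. x \<notin> S \<longrightarrow> T g2 x = (\<integral>y. K x y * g2 y \<partial>lebesgue)"
      by (rule T_ker[OF L2 S S0])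
    have xS: "x \<notin> S" "x \<in> ccube r" if "x \<in> hcube r" for x
      using that box_hcube_cbox(2)[of r] ccube_subset_box_dcube[OF r(1)] by (auto simp: S_def)
    \<comment> \<open>The height 4 C0 leaves at most a quarter of the cube exceptional for the local
      part.\<close>
    obtain N where N: "N \<in> sets lebesgue" "emeasure lebesgue N \<le> ennreal (C0 / (4 * C0)) * emeasure lebesgue (hcube r)"
      "\<And>x. x \<notin> N \<Longrightarrow> norm (T g1 x) \<le> 4 * C0 * mean g1 (dcube r)"
      using C0(2)[of "4 * C0" r g1] C0(1) r(1) L1 by (auto simp: g1_def)
    define nice where "nice x \<longleftrightarrow> T g x = T g1 x + T g2 x \<and> (x \<notin> S \<longrightarrow> T g2 x = (\<integral>y. K x y * g2 y \<partial>lebesgue))" for x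
    have nice: "AE x in lebesgue. nice x" using Tadd Tk unfolding nice_def by eventually_elim blast
    \<comment> \<open>\<open>E\<close> takes at most half of the cube and \<open>N\<close> at most a
      quarter, and the identities for \<open>T\<close> fail only on a null set, so a point with all
      the properties remains.\<close>
    obtain x' where x': "x' \<in> hcube r" "x' \<notin> E" "x' \<notin> N" "nice x'"
    proof (rule ccontr)
      assume "\<not> thesis"
      then have *: "\<And>x. x \<in> hcube r \<Longrightarrow> nice x \<Longrightarrow> x \<in> E \<or> x \<in> N" using that by blast
      have EN: "E \<inter> hcube r \<union> N \<in> sets lebesgue" using E N by auto
      have "emeasure lebesgue (hcube r) \<le> emeasure lebesgue (E \<inter> hcube r \<union> N)"
        by (rule emeasure_mono_AE[OF _ EN]) (use nice * in \<open>auto elim!: eventually_mono\<close>)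
      also have "\<dots> \<le> emeasure lebesgue (E \<inter> hcube r) + emeasure lebesgue N"
        using E N by (intro emeasure_subadditive) auto
      also have "\<dots> \<le> emeasure lebesgue (E \<inter> hcube r) + ennreal (1/4) * emeasure lebesgue (hcube r)"
        using N(2) C0(1) by (intro add_left_mono) simp
      finally have "2 * emeasure lebesgue (hcube r) \<le> 2 * (emeasure lebesgue (E \<inter> hcube r) + ennreal (1/4) * emeasure lebesgue (hcube r))"
        by (intro mult_left_mono) auto
      also have "\<dots> = 2 * emeasure lebesgue (E \<inter> hcube r) + ennreal (1/2) * emeasure lebesgue (hcube r)"
      proof -
        have "2 * ennreal (1/4) = ennreal (1/2)" by (simp add: ennreal_mult''[symmetric] ennreal_numeral[symmetric] del: ennreal_numeral)
        then show ?thesis by (simp add: distrib_left mult.assoc[symmetric])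
      qed
      also have "\<dots> \<le> emeasure lebesgue (hcube r) + ennreal (1/2) * emeasure lebesgue (hcube r)"
        using E(2) by (intro add_right_mono)
      finally have "2 * ennreal (snd r ^ DIM('a)) \<le> ennreal (snd r ^ DIM('a)) + ennreal (1/2) * ennreal (snd r ^ DIM('a))"
        using r(1) by (simp add: emeasure_hcube del: ennreal_half)
      moreover have "2 * ennreal (snd r ^ DIM('a)) = ennreal (2 * snd r ^ DIM('a))" by (simp add: ennreal_mult')
      moreover have "ennreal (snd r ^ DIM('a)) + ennreal (1/2) * ennreal (snd r ^ DIM('a)) = ennreal (snd r ^ DIM('a) + 1/2 * snd r ^ DIM('a))"
        using r(1) by (subst ennreal_plus) (auto simp: ennreal_mult'[symmetric] simp del: ennreal_half)
      ultimately have "ennreal (2 * snd r ^ DIM('a)) \<le> ennreal (snd r ^ DIM('a) + 1/2 * snd r ^ DIM('a))" by (simp only:)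
      then have "2 * snd r ^ DIM('a) \<le> snd r ^ DIM('a) + 1/2 * snd r ^ DIM('a)"
        using r(1) by (subst (asm) ennreal_le_iff) auto
      then show False using zero_less_power[OF r(1), of "DIM('a)"] by linarith
    qed
    have x'cc: "x' \<in> ccube r" "x' \<notin> S" using xS x'(1) by auto
    \<comment> \<open>A ball around \<open>x'\<close> of comparable size contains the dilate, so the
      maximal bound at \<open>x'\<close> controls the mean of the local part.\<close>
    have mean1: "mean g1 (dcube r) \<le> A * k"
    proof -
      let ?t = "?n * (4 * ?n + 2) * snd r"
      have t: "?t > 0" using r(1) by (simp add: add_nonneg_pos)
      have "ennreal (mean g1 (dcube r)) * emeasure lebesgue (dcube r) = (\<integral>\<^sup>+x\<in>dcube r. ennreal (norm (g1 x)) \<partial>lebesgue)"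
        using mean_eq[OF L1 cub(2)] by simp
      also have "\<dots> \<le> (\<integral>\<^sup>+y\<in>ball x' ?t. ennreal (norm (g y)) \<partial>lebesgue)"
        using dcube_subset_ball[OF r(1) x'cc(1)] by (intro nn_integral_mono) (auto simp: g1_def split: split_indicator)
      also have "\<dots> \<le> ennreal A * emeasure lebesgue (ball x' ?t)" using x' t by (intro balls)
      finally have "ennreal (mean g1 (dcube r) * ((4 * ?n + 1) * snd r) ^ DIM('a)) \<le> ennreal (A * (v * ?t ^ DIM('a)))"
        using r(1) t A v n4 cube_measure(2)[OF cub(2)] measure_dcube[OF r(1)]
        by (simp add: emeasure_lebesgue_ball v_def[symmetric] ennreal_mult mean_nonneg del: measure_completion)
      then have "mean g1 (dcube r) * ((4 * ?n + 1) * snd r) ^ DIM('a) \<le> A * (v * ?t ^ DIM('a))"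
        using A v t by (subst (asm) ennreal_le_iff) auto
      then have "mean g1 (dcube r) * (4 * ?n + 1) ^ DIM('a) * snd r ^ DIM('a) \<le> A * (v * (?n * (4 * ?n + 2)) ^ DIM('a)) * snd r ^ DIM('a)"
        by (simp only: power_mult_distrib mult.assoc)
      then have "mean g1 (dcube r) * (4 * ?n + 1) ^ DIM('a) \<le> A * (v * (?n * (4 * ?n + 2)) ^ DIM('a))"
        using zero_less_power[OF r(1), of "DIM('a)"] by (simp only: mult_le_cancel_right_pos)
      then show ?thesis using n4 by (simp add: k_def pos_le_divide_eq)
    qed
    have Tx': "norm (T g2 x') \<le> A + 4 * C0 * (A * k)"
    proof -
      have "T g2 x' = T g x' - T g1 x'" using x'(4) by (simp add: nice_def)
      then have "norm (T g2 x') \<le> norm (T g x') + norm (T g1 x')" by (simp add: norm_triangle_ineq4)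
      also have "\<dots> \<le> A + 4 * C0 * mean g1 (dcube r)" using good[of x'] N(3)[of x'] x' by (intro add_mono) auto
      also have "\<dots> \<le> A + 4 * C0 * (A * k)" using mean1 C0(1) by (intro add_left_mono mult_left_mono) auto
      finally show ?thesis .
    qed
    have fin: "(\<integral>\<^sup>+x. ennreal (norm (g2 x)) \<partial>lebesgue) < \<infinity>"
    proof -
      have "(\<integral>\<^sup>+x. ennreal (norm (g2 x)) \<partial>lebesgue) \<le> (\<integral>\<^sup>+x\<in>dcube q. ennreal (norm (g x)) \<partial>lebesgue)"
        using supp by (intro nn_integral_mono) (auto simp: g2_def split: split_indicator)
      also have "\<dots> < \<infinity>" using cube_measure[OF cub(1)] by (intro L2_set_integral_finite g)
      finally show ?thesis .
    qed
    have g2i: "integrable lebesgue g2" using fin L2_measurable[OF L2] by (simp add: integrable_iff_bounded)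
    let ?l = "2 * ?n * snd r"
    have l: "?l > 0" using r(1) by simp
    have far: "?l \<le> dist x y" if "x \<in> ccube r" "g2 y \<noteq> 0" for x y
      using that dist_ge_dcube[of x r y] by (auto simp: g2_def split: split_indicator_asm)
    \<comment> \<open>Regularity in the first variable between \<open>x'\<close> and
      \<open>x\<close>, whose distance is at most half the distance from \<open>x'\<close> to the
      support of the far part. The tail is centred at \<open>x'\<close>, the point where the maximal
      function is under control.\<close>
    have diff: "norm ((\<integral>y. K x y * g2 y \<partial>lebesgue) - (\<integral>y. K x' y * g2 y \<partial>lebesgue)) \<le> Ck * Ct * A" if x: "x \<in> ccube r" for x
    proof -
      have i1: "integrable lebesgue (\<lambda>y. K x y * g2 y)" by (rule kernel_integrable[OF g2i l far[OF x]])
      have i2: "integrable lebesgue (\<lambda>y. K x' y * g2 y)" by (rule kernel_integrable[OF g2i l far[OF x'cc(1)]])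
      have i3: "integrable lebesgue (\<lambda>y. K x y * g2 y - K x' y * g2 y)" using i1 i2 by (rule Bochner_Integration.integrable_diff)
      have "(\<integral>y. K x y * g2 y \<partial>lebesgue) - (\<integral>y. K x' y * g2 y \<partial>lebesgue) = (\<integral>y. K x y * g2 y - K x' y * g2 y \<partial>lebesgue)"
        using i1 i2 by (rule Bochner_Integration.integral_diff[symmetric])
      then have "ennreal (norm ((\<integral>y. K x y * g2 y \<partial>lebesgue) - (\<integral>y. K x' y * g2 y \<partial>lebesgue))) \<le> (\<integral>\<^sup>+y. ennreal (norm (K x y * g2 y - K x' y * g2 y)) \<partial>lebesgue)"
        using integral_norm_bound_ennreal[OF i3] by simp
      also have "\<dots> \<le> (\<integral>\<^sup>+y. ennreal Ck * (ennreal (?l powr d / dist x' y powr (?n + d)) * ennreal (norm (g y)) * indicator {y. ?l \<le> dist x' y} y) \<partial>lebesgue)"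
      proof (rule nn_integral_mono)
        fix y
        show "ennreal (norm (K x y * g2 y - K x' y * g2 y)) \<le> ennreal Ck * (ennreal (?l powr d / dist x' y powr (?n + d)) * ennreal (norm (g y)) * indicator {y. ?l \<le> dist x' y} y)"
        proof (cases "g2 y = 0")
          case False
          have dy: "?l \<le> dist x' y" using far[OF x'cc(1) False] .
          have dx: "dist x' x \<le> ?n * snd r" using x'cc(1) x by (rule dist_le_hcube)
          have "?n * snd r > 0" using r(1) by simp
          then have dx2: "dist x' x \<le> ?l" "2 * dist x' x \<le> dist x' y" using dx dy by linarith+
          have "x' \<noteq> y" using dy l by auto
          then have "norm (K x' y - K x y) \<le> Ck * dist x' x powr d / dist x' y powr (?n + d)"
            using dx2(2) by (intro K_reg1)
          also have "\<dots> \<le> Ck * ?l powr d / dist x' y powr (?n + d)"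
            using dx2(1) Ck_pos d_pos by (intro divide_right_mono mult_left_mono powr_mono2) auto
          finally have "norm (K x' y - K x y) * norm (g2 y) \<le> (Ck * ?l powr d / dist x' y powr (?n + d)) * norm (g2 y)"
            by (intro mult_right_mono) auto
          moreover have "norm (K x y * g2 y - K x' y * g2 y) = norm (K x' y - K x y) * norm (g2 y)"
            by (simp only: norm_mult left_diff_distrib[symmetric] norm_minus_commute[of "K x y"])
          moreover have "norm (g2 y) \<le> norm (g y)" by (auto simp: g2_def split: split_indicator)
          moreover have "0 \<le> Ck * ?l powr d / dist x' y powr (?n + d)" using Ck_pos by simp
          ultimately have "norm (K x y * g2 y - K x' y * g2 y) \<le> (Ck * ?l powr d / dist x' y powr (?n + d)) * norm (g y)"
            by (metis mult_left_mono order_trans)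
          also have "\<dots> = Ck * ((?l powr d / dist x' y powr (?n + d)) * norm (g y))" by simp
          finally have "ennreal (norm (K x y * g2 y - K x' y * g2 y)) \<le> ennreal (Ck * ((?l powr d / dist x' y powr (?n + d)) * norm (g y)))"
            by (rule ennreal_leI)
          also have "\<dots> = ennreal Ck * (ennreal (?l powr d / dist x' y powr (?n + d)) * ennreal (norm (g y)))"
            using Ck_pos by (simp add: ennreal_mult[symmetric] del: times_divide_eq_left times_divide_eq_right)
          finally show ?thesis using dy by simp
        qed simp
      qed
      also have "\<dots> = ennreal Ck * (\<integral>\<^sup>+y\<in>{y. ?l \<le> dist x' y}. ennreal (?l powr d / dist x' y powr (?n + d)) * ennreal (norm (g y)) \<partial>lebesgue)"
      proof (rule nn_integral_cmult)
        have "(\<lambda>y. ennreal (?l powr d / dist x' y powr (?n + d)) * indicator {y. ?l \<le> dist x' y} y) \<in> borel_measurable lborel"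
          by measurable
        then have "(\<lambda>y. ennreal (?l powr d / dist x' y powr (?n + d)) * indicator {y. ?l \<le> dist x' y} y) \<in> borel_measurable lebesgue"
          by (rule measurable_completion)
        then have "(\<lambda>y. (ennreal (?l powr d / dist x' y powr (?n + d)) * indicator {y. ?l \<le> dist x' y} y) * ennreal (norm (g y))) \<in> borel_measurable lebesgue"
          by measurable
        then show "(\<lambda>y. ennreal (?l powr d / dist x' y powr (?n + d)) * ennreal (norm (g y)) * indicator {y. ?l \<le> dist x' y} y) \<in> borel_measurable lebesgue"
          by (simp add: mult_ac)
      qed
      also have "\<dots> \<le> ennreal Ck * (ennreal Ct * ennreal A)"
        using x' l by (intro mult_left_mono Ct(2) balls) auto
      also have "\<dots> = ennreal (Ck * Ct * A)"
        using Ck_pos Ct(1) A by (simp add: ennreal_mult mult.assoc)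
      finally show ?thesis using Ck_pos Ct(1) A by (subst (asm) ennreal_le_iff) auto
    qed
    show ?thesis
      using nice
    proof eventually_elim
      case (elim x)
      show ?case
      proof
        assume x: "x \<in> hcube r"
        have "T g2 x = ((\<integral>y. K x y * g2 y \<partial>lebesgue) - (\<integral>y. K x' y * g2 y \<partial>lebesgue)) + T g2 x'"
          using elim x'(4) x'cc xS[OF x] by (simp add: nice_def)
        then have "norm (T g2 x) \<le> norm ((\<integral>y. K x y * g2 y \<partial>lebesgue) - (\<integral>y. K x' y * g2 y \<partial>lebesgue)) + norm (T g2 x')"
          by (metis norm_triangle_ineq)
        also have "\<dots> \<le> Ck * Ct * A + (A + 4 * C0 * (A * k))" using diff[OF xS(2)[OF x]] Tx' by (intro add_mono)
        also have "\<dots> = C * A" by (simp add: C_def algebra_simps)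
        finally show "norm (T (\<lambda>y. indicator (- dcube r) y * g y) x) \<le> C * A" by (simp add: g2_def)
      qed
    qed
  qed
  have "C > 0" unfolding C_def using C0(1) k0 Ck_pos Ct(1) by (intro add_pos_pos mult_pos_pos) auto
  show ?thesis by (rule that[OF \<open>C > 0\<close>], rule main)
qed

text \<open>Stopping on the density of the joint exceptional set of all m + 1 functions. A child
  meets that set in at most half of its measure, as the comparison with a good point requires, and
  the children together fill at most half of \<open>q\<close>.\<close>

lemma local_family:
  fixes m :: nat
  obtains C where "C > 0" "\<And>q g. snd q > 0 \<Longrightarrow> (\<forall>h\<le>m. L2 (g h)) \<Longrightarrow> (\<forall>h\<le>m. \<forall>x. x \<notin> dcube q \<longrightarrow> g h x = 0) \<Longrightarrow>
    \<exists>P. countable P \<and> disjoint_family_on hcube P \<and> (\<forall>r\<in>P. snd r > 0 \<and> hcube r \<subseteq> hcube q) \<and>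
      2 * emeasure lebesgue (\<Union>r\<in>P. hcube r) \<le> emeasure lebesgue (hcube q) \<and>
      (AE x in lebesgue. x \<in> hcube q \<longrightarrow> x \<notin> (\<Union>r\<in>P. hcube r) \<longrightarrow> (\<forall>h\<le>m. norm (T (g h) x) \<le> C * mean (g h) (dcube q))) \<and>
      (\<forall>r\<in>P. \<forall>h\<le>m. AE x in lebesgue. x \<in> hcube r \<longrightarrow> norm (T (\<lambda>y. indicator (- dcube r) y * g h y) x) \<le> C * mean (g h) (dcube q))"
proof -
  obtain C0 where C0: "C0 > 0" "\<And>A g q. A > 0 \<Longrightarrow> snd q > 0 \<Longrightarrow> L2 g \<Longrightarrow> (\<And>x. x \<notin> dcube q \<Longrightarrow> g x = 0) \<Longrightarrow>
    \<exists>N\<in>sets lebesgue. emeasure lebesgue N \<le> ennreal (C0 / A) * emeasure lebesgue (hcube q) \<and>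
      (\<forall>x. x \<notin> N \<longrightarrow> norm (T g x) \<le> A * mean g (dcube q) \<and>
         (\<forall>r>0. (\<integral>\<^sup>+y\<in>ball x r. ennreal (norm (g y)) \<partial>lebesgue) \<le> ennreal (A * mean g (dcube q)) * emeasure lebesgue (ball x r)))"
    by (rule exceptional_set) blast
  obtain C1 where C1: "C1 > 0" "\<And>A g q r E. A \<ge> 0 \<Longrightarrow> snd q > 0 \<Longrightarrow> L2 g \<Longrightarrow> (\<And>x. x \<notin> dcube q \<Longrightarrow> g x = 0) \<Longrightarrow>
    snd r > 0 \<Longrightarrow> hcube r \<subseteq> hcube q \<Longrightarrow> E \<in> sets lebesgue \<Longrightarrow> 2 * emeasure lebesgue (E \<inter> hcube r) \<le> emeasure lebesgue (hcube r) \<Longrightarrow>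
    (\<And>x. x \<notin> E \<Longrightarrow> x \<in> hcube r \<Longrightarrow> norm (T g x) \<le> A) \<Longrightarrow>
    (\<And>x t. x \<notin> E \<Longrightarrow> x \<in> hcube r \<Longrightarrow> t > 0 \<Longrightarrow> (\<integral>\<^sup>+y\<in>ball x t. ennreal (norm (g y)) \<partial>lebesgue) \<le> ennreal A * emeasure lebesgue (ball x t)) \<Longrightarrow>
    (AE x in lebesgue. x \<in> hcube r \<longrightarrow> norm (T (\<lambda>y. indicator (- dcube r) y * g y) x) \<le> C1 * A)"
    by (rule far_part_bound) blast
  \<comment> \<open>The union of the m + 1 exceptional sets then has measure at most 2^(-n-2) |Q|,
    half of the stopping density 2^(-n-1).\<close>
  define A where "A = C0 * (real m + 1) * 2 ^ (DIM('a) + 2)"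
  have A: "A > 0" using C0(1) by (simp add: A_def)
  define C where "C = A + C1 * A"
  have main: "\<exists>P. countable P \<and> disjoint_family_on hcube P \<and> (\<forall>r\<in>P. snd r > 0 \<and> hcube r \<subseteq> hcube q) \<and>
      2 * emeasure lebesgue (\<Union>r\<in>P. hcube r) \<le> emeasure lebesgue (hcube q) \<and>
      (AE x in lebesgue. x \<in> hcube q \<longrightarrow> x \<notin> (\<Union>r\<in>P. hcube r) \<longrightarrow> (\<forall>h\<le>m. norm (T (g h) x) \<le> C * mean (g h) (dcube q))) \<and>
      (\<forall>r\<in>P. \<forall>h\<le>m. AE x in lebesgue. x \<in> hcube r \<longrightarrow> norm (T (\<lambda>y. indicator (- dcube r) y * g h y) x) \<le> C * mean (g h) (dcube q))"
    if q: "snd q > 0" and g': "\<forall>h\<le>m. L2 (g h)" and supp': "\<forall>h\<le>m. \<forall>x. x \<notin> dcube q \<longrightarrow> g h x = 0" for q g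
  proof -
    note g = g'[rule_format] and supp = supp'[rule_format]
    have "\<forall>h. \<exists>N. h \<le> m \<longrightarrow> N\<in>sets lebesgue \<and> emeasure lebesgue N \<le> ennreal (C0 / A) * emeasure lebesgue (hcube q) \<and>
      (\<forall>x. x \<notin> N \<longrightarrow> norm (T (g h) x) \<le> A * mean (g h) (dcube q) \<and>
         (\<forall>r>0. (\<integral>\<^sup>+y\<in>ball x r. ennreal (norm (g h y)) \<partial>lebesgue) \<le> ennreal (A * mean (g h) (dcube q)) * emeasure lebesgue (ball x r)))"
      using C0(2)[OF A q g supp] by blast
    from choice[OF this] obtain N where N': "\<forall>h. h \<le> m \<longrightarrow> N h\<in>sets lebesgue \<and> emeasure lebesgue (N h) \<le> ennreal (C0 / A) * emeasure lebesgue (hcube q) \<and>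
      (\<forall>x. x \<notin> N h \<longrightarrow> norm (T (g h) x) \<le> A * mean (g h) (dcube q) \<and>
         (\<forall>r>0. (\<integral>\<^sup>+y\<in>ball x r. ennreal (norm (g h y)) \<partial>lebesgue) \<le> ennreal (A * mean (g h) (dcube q)) * emeasure lebesgue (ball x r)))"
      by (elim exE)
    have N: "\<And>h. h \<le> m \<Longrightarrow> N h \<in> sets lebesgue"
      "\<And>h. h \<le> m \<Longrightarrow> emeasure lebesgue (N h) \<le> ennreal (C0 / A) * emeasure lebesgue (hcube q)"
      "\<And>h x. h \<le> m \<Longrightarrow> x \<notin> N h \<Longrightarrow> norm (T (g h) x) \<le> A * mean (g h) (dcube q)"
      "\<And>h x r. h \<le> m \<Longrightarrow> x \<notin> N h \<Longrightarrow> r > 0 \<Longrightarrow> (\<integral>\<^sup>+y\<in>ball x r. ennreal (norm (g h y)) \<partial>lebesgue) \<le> ennreal (A * mean (g h) (dcube q)) * emeasure lebesgue (ball x r)"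
      using N' by blast+
    define E where "E = (\<Union>h\<le>m. N h)"
    have E: "E \<in> sets lebesgue" unfolding E_def using N(1) by (intro sets.finite_UN) auto
    have Emeas: "emeasure lebesgue E \<le> ennreal (1 / 2 ^ (DIM('a) + 2)) * emeasure lebesgue (hcube q)"
    proof -
      have "emeasure lebesgue E \<le> (\<Sum>h\<le>m. emeasure lebesgue (N h))"
        unfolding E_def using N(1) by (intro emeasure_subadditive_finite) auto
      also have "\<dots> \<le> (\<Sum>h\<le>m. ennreal (C0 / A) * emeasure lebesgue (hcube q))" using N(2) by (intro sum_mono) auto
      also have "\<dots> = ennreal ((real m + 1) * (C0 / A)) * emeasure lebesgue (hcube q)"
      proof -
        have "ennreal ((real m + 1) * (C0 / A)) = of_nat (Suc m) * ennreal (C0 / A)"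
          using C0(1) A by (subst ennreal_mult) (auto simp: ennreal_of_nat_eq_real_of_nat add.commute)
        then show ?thesis by (simp add: mult.assoc del: of_nat_Suc)
      qed
      also have "(real m + 1) * (C0 / A) = 1 / 2 ^ (DIM('a) + 2)"
      proof -
        have "real m + 1 > 0" by simp
        then show ?thesis using C0(1) by (simp add: A_def)
      qed
      finally show ?thesis .
    qed
    \<comment> \<open>After the loss of 2^n at the parent, the density of \<open>E\<close> in a
      child is still at most 1/2.\<close>
    define lam :: real where "lam = 1 / 2 ^ (DIM('a) + 1)"
    have lam: "lam > 0" by (simp add: lam_def)
    have EI: "(\<integral>\<^sup>+x\<in>S. indicator E x \<partial>lebesgue) = emeasure lebesgue (E \<inter> S)" if "S \<in> sets lebesgue" for S
      using emeasure_Int_eq_nn_integral[OF E that] by simp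
    have Eq: "(\<integral>\<^sup>+x\<in>hcube q. indicator E x \<partial>lebesgue) \<le> ennreal (lam / 2) * emeasure lebesgue (hcube q)"
    proof -
      have "emeasure lebesgue (E \<inter> hcube q) \<le> emeasure lebesgue E" using E by (intro emeasure_mono) auto
      also note Emeas
      finally show ?thesis by (simp add: EI lam_def)
    qed
    also have "\<dots> \<le> ennreal lam * emeasure lebesgue (hcube q)"
      using lam by (intro mult_right_mono ennreal_leI) auto
    finally have le: "(\<integral>\<^sup>+x\<in>hcube q. indicator E x \<partial>lebesgue) \<le> ennreal lam * emeasure lebesgue (hcube q)" .
    obtain P where P: "countable P" "disjoint_family_on hcube P" "\<And>r. r \<in> P \<Longrightarrow> snd r > 0 \<and> hcube r \<subseteq> hcube q"
      "\<And>r. r \<in> P \<Longrightarrow> (\<integral>\<^sup>+x\<in>hcube r. indicator E x \<partial>lebesgue) \<le> ennreal (2 ^ DIM('a) * lam) * emeasure lebesgue (hcube r)"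
      "AE x in lebesgue. x \<in> hcube q \<longrightarrow> x \<notin> (\<Union>r\<in>P. hcube r) \<longrightarrow> (indicator E x::ennreal) \<le> ennreal lam"
      "ennreal lam * emeasure lebesgue (\<Union>r\<in>P. hcube r) \<le> (\<integral>\<^sup>+x\<in>hcube q. indicator E x \<partial>lebesgue)"
      by (rule stopping_cubes[OF q _ lam le]) (use E in auto)
    have half: "2 * emeasure lebesgue (\<Union>r\<in>P. hcube r) \<le> emeasure lebesgue (hcube q)"
    proof -
      have "ennreal lam * emeasure lebesgue (\<Union>r\<in>P. hcube r) \<le> ennreal (lam / 2) * emeasure lebesgue (hcube q)"
        using P(6) Eq by (rule order_trans)
      then have "ennreal (2 / lam) * (ennreal lam * emeasure lebesgue (\<Union>r\<in>P. hcube r)) \<le> ennreal (2 / lam) * (ennreal (lam / 2) * emeasure lebesgue (hcube q))"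
        by (intro mult_left_mono) auto
      moreover have "ennreal (2 / lam) * ennreal lam = 2" "ennreal (2 / lam) * ennreal (lam / 2) = 1"
        using lam by (simp_all add: ennreal_mult[symmetric])
      ultimately show ?thesis by (simp add: mult.assoc[symmetric])
    qed
    have M0: "0 \<le> mean (g h) (dcube q)" for h by (rule mean_nonneg)
    have ae1: "AE x in lebesgue. x \<in> hcube q \<longrightarrow> x \<notin> (\<Union>r\<in>P. hcube r) \<longrightarrow> (\<forall>h\<le>m. norm (T (g h) x) \<le> C * mean (g h) (dcube q))"
      using P(5)
    proof eventually_elim
      case (elim x)
      show ?case
      proof (intro impI allI)
        fix h assume x: "x \<in> hcube q" "x \<notin> (\<Union>r\<in>P. hcube r)" and h: "h \<le> m"
        \<comment> \<open>An indicator bounded by \<open>lam\<close> < 1 must vanish, so points off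
          the children avoid \<open>E\<close>.\<close>
        have "(1::real) < 2 ^ (DIM('a) + 1)" by (rule one_less_power) auto
        then have "lam < 1" by (simp add: lam_def)
        then have "ennreal lam < 1" using ennreal_lessI[of 1 lam] by simp
        then have "x \<notin> E" using elim x by (auto dest: leD)
        then have "norm (T (g h) x) \<le> A * mean (g h) (dcube q)" using h N(3) by (auto simp: E_def)
        also have "\<dots> \<le> C * mean (g h) (dcube q)" using M0[of h] C1(1) A by (intro mult_right_mono) (auto simp: C_def)
        finally show "norm (T (g h) x) \<le> C * mean (g h) (dcube q)" .
      qed
    qed
    have ae2: "AE x in lebesgue. x \<in> hcube r \<longrightarrow> norm (T (\<lambda>y. indicator (- dcube r) y * g h y) x) \<le> C * mean (g h) (dcube q)"
      if r: "r \<in> P" and h: "h \<le> m" for r h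
    proof -
      have "2 * emeasure lebesgue (E \<inter> hcube r) \<le> 2 * (ennreal (2 ^ DIM('a) * lam) * emeasure lebesgue (hcube r))"
        using P(4)[OF r] by (intro mult_left_mono) (auto simp: EI)
      also have "ennreal (2 ^ DIM('a) * lam) = ennreal (1/2)" by (simp add: lam_def)
      also have "2 * (ennreal (1/2) * emeasure lebesgue (hcube r)) = emeasure lebesgue (hcube r)"
      proof -
        have "2 * ennreal (1/2) = 1" by (simp add: ennreal_mult''[symmetric] ennreal_numeral[symmetric] del: ennreal_numeral ennreal_half)
        then show ?thesis by (simp add: mult.assoc[symmetric] del: ennreal_half)
      qed
      finally have e: "2 * emeasure lebesgue (E \<inter> hcube r) \<le> emeasure lebesgue (hcube r)" .
      have "AE x in lebesgue. x \<in> hcube r \<longrightarrow> norm (T (\<lambda>y. indicator (- dcube r) y * g h y) x) \<le> C1 * (A * mean (g h) (dcube q))"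
      proof (rule C1(2)[where q=q and E=E])
        show "0 \<le> A * mean (g h) (dcube q)" using A M0 by simp
        show "norm (T (g h) x) \<le> A * mean (g h) (dcube q)" if "x \<notin> E" for x
          using that h by (intro N(3)) (auto simp: E_def)
        show "(\<integral>\<^sup>+y\<in>ball x t. ennreal (norm (g h y)) \<partial>lebesgue) \<le> ennreal (A * mean (g h) (dcube q)) * emeasure lebesgue (ball x t)"
          if "x \<notin> E" "t > 0" for x t
          using that h by (intro N(4)) (auto simp: E_def)
      qed (use P(3)[OF r] q g[OF h] supp[OF h] E e in auto)
      moreover have "C1 * (A * mean (g h) (dcube q)) \<le> C * mean (g h) (dcube q)"
        using M0[of h] A C1(1) by (simp add: C_def distrib_right mult.assoc)
      ultimately show ?thesis by (auto elim!: eventually_mono)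
    qed
    show ?thesis using P(1,2,3) half ae1 ae2 by (intro exI[of _ P] conjI) blast+
  qed
  have "C > 0" using A C1(1) by (simp add: C_def add_pos_pos)
  show ?thesis by (rule that[OF \<open>C > 0\<close>], rule main)
qed

end

section \<open>From the operator to its iterated commutator\<close>

definition cutoff :: "'a::euclidean_space \<times> real \<Rightarrow> ('a \<Rightarrow> complex) \<Rightarrow> 'a \<Rightarrow> complex" where
  "cutoff q f = (\<lambda>y. indicator (dcube q) y * f y)"

definition osc_pow :: "('a::euclidean_space \<Rightarrow> real) \<Rightarrow> ('a \<Rightarrow> complex) \<Rightarrow> nat \<Rightarrow> 'a \<times> real \<Rightarrow> 'a \<Rightarrow> complex" where
  "osc_pow b f h q y = of_real (b y - avg b (dcube q)) ^ h * f y"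

text \<open>The summand of the sparse bound. Of the products of |b - b_R|^(m-h) with the mean of |b
  - b_R|^h |f|, only the extreme orders h = 0 and h = m are kept.\<close>

definition Bterm :: "('a::euclidean_space \<Rightarrow> real) \<Rightarrow> ('a \<Rightarrow> complex) \<Rightarrow> nat \<Rightarrow> 'a \<times> real \<Rightarrow> 'a \<Rightarrow> real" where
  "Bterm b f m q x = mean f (dcube q) * \<bar>b x - avg b (dcube q)\<bar> ^ m + mean (osc_pow b f m q) (dcube q)"

lemma mean_cutoff: "mean (\<lambda>y. u y * cutoff q f y) (dcube q) = mean (\<lambda>y. u y * f y) (dcube q)"
proof -
  have "(\<integral>\<^sup>+x\<in>dcube q. ennreal (norm (u x * cutoff q f x)) \<partial>lebesgue) = (\<integral>\<^sup>+x\<in>dcube q. ennreal (norm (u x * f x)) \<partial>lebesgue)"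
    by (rule nn_integral_cong) (auto simp: cutoff_def split: split_indicator)
  then show ?thesis by (simp add: mean_def)
qed

text \<open>The larger of the two bases takes over the whole power.\<close>

lemma interpolate_powers:
  fixes a y :: real assumes "a \<ge> 0" "y \<ge> 0" "h \<le> m" shows "a ^ (m - h) * y ^ h \<le> a ^ m + y ^ m"
proof (cases "y \<le> a")
  case True
  have "a ^ (m - h) * y ^ h \<le> a ^ (m - h) * a ^ h" using True assms by (intro mult_left_mono power_mono) auto
  also have "\<dots> = a ^ m" using assms(3) by (simp add: power_add[symmetric])
  finally show ?thesis using assms by (simp add: add_increasing2)
next
  case False
  have "a ^ (m - h) * y ^ h \<le> y ^ (m - h) * y ^ h" using False assms by (intro mult_right_mono power_mono) auto
  also have "\<dots> = y ^ m" using assms(3) by (simp add: power_add[symmetric])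
  finally show ?thesis using assms by (simp add: add_increasing)
qed

text \<open>Used with a = |b(x) - b_R| to absorb the intermediate orders into the two extreme
  ones.\<close>

lemma mean_osc_pow_le:
  assumes mom: "moments b f" and q: "snd q > 0" and a: "a \<ge> 0" and h: "h \<le> m"
  shows "a ^ (m - h) * mean (osc_pow b f h q) (dcube q) \<le> mean f (dcube q) * a ^ m + mean (osc_pow b f m q) (dcube q)"
proof -
  let ?R = "dcube q"
  have cub: "cube ?R" using q by (intro cube_ccube snd_dilate)
  note m = cube_measure[OF cub]
  have L: "L2 (osc_pow b f k q)" for k
    unfolding osc_pow_def by (intro moments_L2 moments_shift mom)
  have Lf: "L2 f" using mom moments_L2_0 by blast
  note [measurable] = L2_measurable[OF L] L2_measurable[OF Lf]
  have "ennreal (a ^ (m - h)) * (ennreal (mean (osc_pow b f h q) ?R) * emeasure lebesgue ?R)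
     = (\<integral>\<^sup>+x. ennreal (a ^ (m - h)) * (ennreal (norm (osc_pow b f h q x)) * indicator ?R x) \<partial>lebesgue)"
    unfolding mean_eq[OF L cub, symmetric] by (rule nn_integral_cmult[symmetric]) measurable
  also have "\<dots> \<le> (\<integral>\<^sup>+x. ennreal (a ^ m) * (ennreal (norm (f x)) * indicator ?R x) + ennreal (norm (osc_pow b f m q x)) * indicator ?R x \<partial>lebesgue)"
  proof (rule nn_integral_mono)
    fix x
    have "a ^ (m - h) * norm (osc_pow b f h q x) = (a ^ (m - h) * \<bar>b x - avg b ?R\<bar> ^ h) * norm (f x)"
      by (simp add: osc_pow_def norm_mult norm_power mult.assoc del: of_real_diff)
    also have "\<dots> \<le> (a ^ m + \<bar>b x - avg b ?R\<bar> ^ m) * norm (f x)"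
      using a h by (intro mult_right_mono interpolate_powers) auto
    also have "\<dots> = a ^ m * norm (f x) + norm (osc_pow b f m q x)"
      by (simp add: osc_pow_def norm_mult norm_power distrib_right del: of_real_diff)
    finally have "ennreal (a ^ (m - h) * norm (osc_pow b f h q x)) \<le> ennreal (a ^ m * norm (f x) + norm (osc_pow b f m q x))"
      by (rule ennreal_leI)
    then have "ennreal (a ^ (m - h)) * ennreal (norm (osc_pow b f h q x)) \<le> ennreal (a ^ m) * ennreal (norm (f x)) + ennreal (norm (osc_pow b f m q x))"
      using a by (simp add: ennreal_mult)
    then show "ennreal (a ^ (m - h)) * (ennreal (norm (osc_pow b f h q x)) * indicator ?R x) \<le> ennreal (a ^ m) * (ennreal (norm (f x)) * indicator ?R x) + ennreal (norm (osc_pow b f m q x)) * indicator ?R x"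
      by (auto split: split_indicator)
  qed
  also have "\<dots> = ennreal (a ^ m) * (ennreal (mean f ?R) * emeasure lebesgue ?R) + ennreal (mean (osc_pow b f m q) ?R) * emeasure lebesgue ?R"
    unfolding mean_eq[OF L cub, symmetric] mean_eq[OF Lf cub, symmetric]
    by (subst nn_integral_add) (auto simp: nn_integral_cmult)
  finally have "ennreal (a ^ (m - h) * mean (osc_pow b f h q) ?R * measure lebesgue ?R) \<le> ennreal ((mean f ?R * a ^ m + mean (osc_pow b f m q) ?R) * measure lebesgue ?R)"
    using a m(2) mean_nonneg[of f ?R] mean_nonneg[of "osc_pow b f m q" ?R] mean_nonneg[of "osc_pow b f h q" ?R]
    by (simp add: ennreal_mult distrib_left distrib_right mult_ac del: measure_completion)
  then have "a ^ (m - h) * mean (osc_pow b f h q) ?R * measure lebesgue ?R \<le> (mean f ?R * a ^ m + mean (osc_pow b f m q) ?R) * measure lebesgue ?R"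
    using a m(1) mean_nonneg[of f ?R] mean_nonneg[of "osc_pow b f m q" ?R] by (subst (asm) ennreal_le_iff) (auto simp del: measure_completion)
  then show ?thesis using m(1) by (simp only: mult_le_cancel_right_pos)
qed

context CZ begin

text \<open>The local step runs simultaneously on (b - b_R)^h f for all h \<le> m, after shifting
  the symbol by b_R. Since the dilate of a child lies in the dilate of its parent, consecutive
  cut-offs differ exactly by the part of \<open>f\<close> far from the child.\<close>

lemma commutator_step:
  obtains C where "C > 0" "\<And>b f q. moments b f \<Longrightarrow> snd q > 0 \<Longrightarrow>
    \<exists>P. countable P \<and> disjoint_family_on hcube P \<and> (\<forall>r\<in>P. snd r > 0 \<and> hcube r \<subseteq> hcube q) \<and>
      2 * emeasure lebesgue (\<Union>r\<in>P. hcube r) \<le> emeasure lebesgue (hcube q) \<and>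
      (AE x in lebesgue. x \<in> hcube q \<longrightarrow> x \<notin> (\<Union>r\<in>P. hcube r) \<longrightarrow> norm (iter_comm T b m (cutoff q f) x) \<le> C * Bterm b f m q x) \<and>
      (\<forall>r\<in>P. AE x in lebesgue. x \<in> hcube r \<longrightarrow>
         norm (iter_comm T b m (cutoff q f) x - iter_comm T b m (cutoff r f) x) \<le> C * Bterm b f m q x)"
proof -
  obtain C where C: "C > 0" "\<And>q g. snd q > 0 \<Longrightarrow> (\<forall>h\<le>m. L2 (g h)) \<Longrightarrow> (\<forall>h\<le>m. \<forall>x. x \<notin> dcube q \<longrightarrow> g h x = 0) \<Longrightarrow>
    \<exists>P. countable P \<and> disjoint_family_on hcube P \<and> (\<forall>r\<in>P. snd r > 0 \<and> hcube r \<subseteq> hcube q) \<and>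
      2 * emeasure lebesgue (\<Union>r\<in>P. hcube r) \<le> emeasure lebesgue (hcube q) \<and>
      (AE x in lebesgue. x \<in> hcube q \<longrightarrow> x \<notin> (\<Union>r\<in>P. hcube r) \<longrightarrow> (\<forall>h\<le>m. norm (T (g h) x) \<le> C * mean (g h) (dcube q))) \<and>
      (\<forall>r\<in>P. \<forall>h\<le>m. AE x in lebesgue. x \<in> hcube r \<longrightarrow> norm (T (\<lambda>y. indicator (- dcube r) y * g h y) x) \<le> C * mean (g h) (dcube q))"
    by (rule local_family[of m]) blast
  have main: "\<exists>P. countable P \<and> disjoint_family_on hcube P \<and> (\<forall>r\<in>P. snd r > 0 \<and> hcube r \<subseteq> hcube q) \<and>
      2 * emeasure lebesgue (\<Union>r\<in>P. hcube r) \<le> emeasure lebesgue (hcube q) \<and>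
      (AE x in lebesgue. x \<in> hcube q \<longrightarrow> x \<notin> (\<Union>r\<in>P. hcube r) \<longrightarrow> norm (iter_comm T b m (cutoff q f) x) \<le> (2 ^ m * C) * Bterm b f m q x) \<and>
      (\<forall>r\<in>P. AE x in lebesgue. x \<in> hcube r \<longrightarrow>
         norm (iter_comm T b m (cutoff q f) x - iter_comm T b m (cutoff r f) x) \<le> (2 ^ m * C) * Bterm b f m q x)"
    if mom: "moments b f" and q: "snd q > 0" for b f q
  proof -
    let ?c = "avg b (dcube q)" and ?F = "cutoff q f"
    define g where "g h = (\<lambda>y. of_real (b y - ?c) ^ h * ?F y)" for h
    have momF: "moments b ?F" unfolding cutoff_def by (intro moments_indicator mom) simp
    have gL: "\<forall>h\<le>m. L2 (g h)" unfolding g_def by (intro allI impI moments_L2 moments_shift momF)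
    have g0: "\<forall>h\<le>m. \<forall>x. x \<notin> dcube q \<longrightarrow> g h x = 0" by (simp add: g_def cutoff_def)
    have gm: "mean (g h) (dcube q) = mean (osc_pow b f h q) (dcube q)" for h
      unfolding g_def osc_pow_def by (rule mean_cutoff)
    have W: "\<bar>b x - ?c\<bar> ^ (m - h) * z \<le> C * Bterm b f m q x" if "h \<le> m" "z \<le> C * mean (g h) (dcube q)" for h x z
    proof -
      have "\<bar>b x - ?c\<bar> ^ (m - h) * z \<le> \<bar>b x - ?c\<bar> ^ (m - h) * (C * mean (g h) (dcube q))"
        using that(2) by (intro mult_left_mono) auto
      also have "\<dots> = C * (\<bar>b x - ?c\<bar> ^ (m - h) * mean (osc_pow b f h q) (dcube q))" by (simp add: gm)
      also have "\<dots> \<le> C * (mean f (dcube q) * \<bar>b x - ?c\<bar> ^ m + mean (osc_pow b f m q) (dcube q))"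
        using C(1) that(1) mom q by (intro mult_left_mono mean_osc_pow_le) auto
      finally show ?thesis by (simp add: Bterm_def)
    qed
    obtain P where P: "countable P" "disjoint_family_on hcube P" "\<forall>r\<in>P. snd r > 0 \<and> hcube r \<subseteq> hcube q"
      "2 * emeasure lebesgue (\<Union>r\<in>P. hcube r) \<le> emeasure lebesgue (hcube q)"
      "AE x in lebesgue. x \<in> hcube q \<longrightarrow> x \<notin> (\<Union>r\<in>P. hcube r) \<longrightarrow> (\<forall>h\<le>m. norm (T (g h) x) \<le> C * mean (g h) (dcube q))"
      "\<forall>r\<in>P. \<forall>h\<le>m. AE x in lebesgue. x \<in> hcube r \<longrightarrow> norm (T (\<lambda>y. indicator (- dcube r) y * g h y) x) \<le> C * mean (g h) (dcube q)"
      using C(2)[OF q gL g0] by (elim exE conjE) (rule that)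
    have ae1: "AE x in lebesgue. x \<in> hcube q \<longrightarrow> x \<notin> (\<Union>r\<in>P. hcube r) \<longrightarrow> norm (iter_comm T b m ?F x) \<le> (2 ^ m * C) * Bterm b f m q x"
      using P(5) iter_shift[OF momF, of ?c m]
    proof eventually_elim
      case (elim x)
      show ?case
      proof (intro impI)
        assume x: "x \<in> hcube q" "x \<notin> (\<Union>r\<in>P. hcube r)"
        have "norm (iter_comm T (\<lambda>x. b x - ?c) m ?F x) \<le> 2 ^ m * (C * Bterm b f m q x)"
        proof (rule iter_comm_bound)
          fix h assume h: "h \<le> m"
          show "\<bar>b x - ?c\<bar> ^ (m - h) * norm (T (\<lambda>y. of_real (b y - ?c) ^ h * ?F y) x) \<le> C * Bterm b f m q x"
            using W[OF h] elim(1) x h unfolding g_def by blast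
        qed
        then show "norm (iter_comm T b m ?F x) \<le> (2 ^ m * C) * Bterm b f m q x" using elim(2) by (simp add: mult.assoc)
      qed
    qed
    have ae2: "AE x in lebesgue. x \<in> hcube r \<longrightarrow>
         norm (iter_comm T b m ?F x - iter_comm T b m (cutoff r f) x) \<le> (2 ^ m * C) * Bterm b f m q x" if r: "r \<in> P" for r
    proof -
      define G where "G = (\<lambda>y. indicator (- dcube r) y * ?F y)"
      have momG: "moments b G" unfolding G_def by (intro moments_indicator momF) (simp add: Compl_in_sets_lebesgue)
      have momr: "moments b (cutoff r f)" unfolding cutoff_def by (intro moments_indicator mom) simp
      have "dcube r \<subseteq> dcube q" using P(3) r by (intro dcube_mono) auto
      then have "?F y = cutoff r f y + G y" for y unfolding G_def cutoff_def by (auto split: split_indicator)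
      then have eq: "?F = (\<lambda>y. cutoff r f y + G y)" by (rule ext)
      have "AE x in lebesgue. iter_comm T b m ?F x = iter_comm T b m (cutoff r f) x + iter_comm T b m G x"
        using iter_add[OF momr momG, of m] unfolding eq[symmetric] .
      moreover have "AE x in lebesgue. \<forall>h\<in>{..m}. x \<in> hcube r \<longrightarrow> norm (T (\<lambda>y. indicator (- dcube r) y * g h y) x) \<le> C * mean (g h) (dcube q)"
        using P(6) r by (intro AE_finite_allI) auto
      moreover note iter_shift[OF momG, of ?c m]
      ultimately show ?thesis
      proof eventually_elim
        case (elim x)
        show ?case
        proof
          assume x: "x \<in> hcube r"
          have "norm (iter_comm T (\<lambda>x. b x - ?c) m G x) \<le> 2 ^ m * (C * Bterm b f m q x)"
          proof (rule iter_comm_bound)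
            fix h assume h: "h \<le> m"
            have e: "(\<lambda>y. of_real (b y - ?c) ^ h * G y) = (\<lambda>y. indicator (- dcube r) y * g h y)"
              unfolding G_def g_def by (auto split: split_indicator)
            show "\<bar>b x - ?c\<bar> ^ (m - h) * norm (T (\<lambda>y. of_real (b y - ?c) ^ h * G y) x) \<le> C * Bterm b f m q x"
              unfolding e using W[OF h] elim(2) x h by auto
          qed
          then show "norm (iter_comm T b m ?F x - iter_comm T b m (cutoff r f) x) \<le> (2 ^ m * C) * Bterm b f m q x"
            using elim(1,3) by (simp add: mult.assoc)
        qed
      qed
    qed
    show ?thesis using P(1-4) ae1 ae2 by (intro exI[of _ P] conjI ballI) auto
  qed
  have "2 ^ m * C > 0" using C(1) by simp
  show ?thesis by (rule that[OF \<open>2 ^ m * C > 0\<close>], rule main)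
qed

end

section \<open>Sparse families\<close>

definition gen_union :: "(nat \<Rightarrow> ('a::euclidean_space \<times> real) set) \<Rightarrow> nat \<Rightarrow> 'a set" where
  "gen_union G j = (\<Union>q\<in>G j. hcube q)"

text \<open>Sparseness organised by generations: at least half of each cube is free of the next one.
  Cubes are indexed by pairs in \<open>Sigma UNIV G\<close>, so that the generation stays at hand
  for counting overlaps.\<close>

definition sparse_gens :: "(nat \<Rightarrow> ('a::euclidean_space \<times> real) set) \<Rightarrow> bool" where
  "sparse_gens G \<longleftrightarrow> (\<forall>j. countable (G j) \<and> disjoint_family_on hcube (G j) \<and> (\<forall>q\<in>G j. snd q > 0) \<and>
     (\<forall>r\<in>G (Suc j). \<exists>q\<in>G j. hcube r \<subseteq> hcube q) \<and>
     (\<forall>q\<in>G j. 2 * emeasure lebesgue (hcube q \<inter> gen_union G (Suc j)) \<le> emeasure lebesgue (hcube q)))"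

lemma sparse_gensD:
  assumes "sparse_gens G"
  shows "countable (G j)" "disjoint_family_on hcube (G j)" "q \<in> G j \<Longrightarrow> snd q > 0"
    "r \<in> G (Suc j) \<Longrightarrow> \<exists>q\<in>G j. hcube r \<subseteq> hcube q"
    "q \<in> G j \<Longrightarrow> 2 * emeasure lebesgue (hcube q \<inter> gen_union G (Suc j)) \<le> emeasure lebesgue (hcube q)"
  using assms unfolding sparse_gens_def by auto

lemma gen_union_sets [measurable]: assumes "sparse_gens G" shows "gen_union G j \<in> sets lebesgue"
  unfolding gen_union_def using sparse_gensD(1)[OF assms] by (intro sets.countable_UN') auto

lemma sparse_unique:
  assumes "sparse_gens G" "q \<in> G j" "r \<in> G j" "x \<in> hcube q" "x \<in> hcube r" shows "q = r"
  using disjoint_family_onD[OF sparse_gensD(2)[OF assms(1)] assms(2,3)] assms(4,5) by blast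

lemma gen_union_decreasing:
  assumes "sparse_gens G" "i \<le> j" shows "gen_union G j \<subseteq> gen_union G i"
  using assms(2)
proof (induction j rule: dec_induct)
  case (step k)
  have "gen_union G (Suc k) \<subseteq> gen_union G k"
    using sparse_gensD(4)[OF assms(1)] unfolding gen_union_def by blast
  then show ?case using step by blast
qed simp

lemma sparse_ancestor:
  assumes "sparse_gens G" "r \<in> G (j + u)" shows "\<exists>q\<in>G j. hcube r \<subseteq> hcube q"
  using assms(2)
proof (induction u arbitrary: r)
  case (Suc u)
  then obtain q where "q \<in> G (j + u)" "hcube r \<subseteq> hcube q" using sparse_gensD(4)[OF assms(1), of r "j + u"] by auto
  then show ?case using Suc.IH by blast
qed auto

text \<open>Iterated halving: cut \<open>q\<close> into its descendants in generation j + u and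
  apply the sparseness condition to each of them.\<close>

lemma sparse_decay:
  fixes G :: "nat \<Rightarrow> ('a::euclidean_space \<times> real) set"
  assumes G: "sparse_gens G" and q: "q \<in> G j"
  shows "emeasure lebesgue (hcube q \<inter> gen_union G (j + u)) \<le> ennreal ((1/2) ^ u) * emeasure lebesgue (hcube q)"
proof (induction u)
  case 0
  then show ?case by (simp add: emeasure_mono)
next
  case (Suc u)
  define A where "A = {r \<in> G (j + u). hcube r \<subseteq> hcube q}"
  have cA: "countable A" "disjoint_family_on hcube A"
    using sparse_gensD(1,2)[OF G, of "j + u"] unfolding A_def disjoint_family_on_def by auto
  have UA: "(\<Union>r\<in>A. hcube r) = hcube q \<inter> gen_union G (j + u)"
  proof (intro set_eqI iffI)
    fix x assume x: "x \<in> hcube q \<inter> gen_union G (j + u)"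
    then obtain r where r: "r \<in> G (j + u)" "x \<in> hcube r" by (auto simp: gen_union_def)
    obtain q' where "q' \<in> G j" "hcube r \<subseteq> hcube q'" using sparse_ancestor[OF G r(1)] by blast
    then have "q' = q" using sparse_unique[OF G _ q] x r by blast
    then show "x \<in> (\<Union>r\<in>A. hcube r)" using r \<open>hcube r \<subseteq> hcube q'\<close> unfolding A_def by blast
  qed (auto simp: A_def gen_union_def)
  have "hcube q \<inter> gen_union G (j + Suc u) \<subseteq> (\<Union>r\<in>A. hcube r \<inter> gen_union G (Suc (j + u)))"
    using gen_union_decreasing[OF G, of "j + u" "Suc (j + u)"] UA by auto
  then have "emeasure lebesgue (hcube q \<inter> gen_union G (j + Suc u)) \<le> emeasure lebesgue (\<Union>r\<in>A. hcube r \<inter> gen_union G (Suc (j + u)))"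
    using cA(1) gen_union_sets[OF G] by (intro emeasure_mono sets.countable_UN') auto
  also have "\<dots> \<le> (\<integral>\<^sup>+r. emeasure lebesgue (hcube r \<inter> gen_union G (Suc (j + u))) \<partial>count_space A)"
    using cA(1) gen_union_sets[OF G] by (intro emeasure_UN_le_count_space) auto
  also have "\<dots> \<le> (\<integral>\<^sup>+r. (\<integral>\<^sup>+x\<in>hcube r. ennreal (1/2) \<partial>lebesgue) \<partial>count_space A)"
  proof (rule nn_integral_mono)
    fix r assume "r \<in> space (count_space A)"
    then have r: "r \<in> G (j + u)" by (simp add: A_def)
    have "ennreal (1/2) * (2 * emeasure lebesgue (hcube r \<inter> gen_union G (Suc (j + u)))) \<le> ennreal (1/2) * emeasure lebesgue (hcube r)"
      by (intro mult_left_mono sparse_gensD(5)[OF G r]) simp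
    moreover have "ennreal (1/2) * 2 = 1" by (simp add: ennreal_mult'[symmetric] ennreal_numeral[symmetric] del: ennreal_numeral ennreal_half)
    ultimately show "emeasure lebesgue (hcube r \<inter> gen_union G (Suc (j + u))) \<le> (\<integral>\<^sup>+x\<in>hcube r. ennreal (1/2) \<partial>lebesgue)"
      by (simp add: mult.assoc[symmetric] nn_integral_cmult_indicator del: ennreal_half)
  qed
  also have "\<dots> = (\<integral>\<^sup>+x\<in>(\<Union>r\<in>A. hcube r). ennreal (1/2) \<partial>lebesgue)"
    using cA by (intro nn_integral_disjoint_hcube[symmetric]) auto
  also have "\<dots> = ennreal (1/2) * emeasure lebesgue (hcube q \<inter> gen_union G (j + u))"
    unfolding UA using gen_union_sets[OF G] by (intro nn_integral_cmult_indicator) auto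
  also have "\<dots> \<le> ennreal (1/2) * (ennreal ((1/2) ^ u) * emeasure lebesgue (hcube q))"
    using Suc.IH by (intro mult_left_mono) auto
  also have "\<dots> = ennreal ((1/2) ^ Suc u) * emeasure lebesgue (hcube q)"
    by (simp add: mult.assoc[symmetric] ennreal_mult'[symmetric] del: ennreal_half)
  finally show ?case .
qed

text \<open>Removing the next generation from each cube leaves pairwise disjoint sets that keep half
  of the measure. They are formed from the full family, so the same constant serves every subfamily
  \<open>A\<close>.\<close>

lemma sparse_packing:
  assumes G: "sparse_gens G" and A: "A \<subseteq> Sigma UNIV G"
  shows "(\<integral>\<^sup>+p. emeasure lebesgue (hcube (snd p)) \<partial>count_space A) \<le> 2 * emeasure lebesgue (\<Union>p\<in>A. hcube (snd p))"
proof -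
  have cS: "countable (Sigma UNIV G)" using sparse_gensD(1)[OF G] by (intro countable_SIGMA) auto
  have cA: "countable A" using A cS by (rule countable_subset)
  define E where "E p = hcube (snd p) - gen_union G (Suc (fst p))" for p
  have Em: "E p \<in> sets lebesgue" for p unfolding E_def using gen_union_sets[OF G] by auto
  have AG: "snd p \<in> G (fst p)" if "p \<in> A" for p using A that by auto
  have dj: "disjoint_family_on E A"
    unfolding disjoint_family_on_def
  proof (intro ballI impI, rule ccontr)
    fix p p' assume p: "p \<in> A" "p' \<in> A" "p \<noteq> p'" "E p \<inter> E p' \<noteq> {}"
    then obtain x where x: "x \<in> E p" "x \<in> E p'" by blast
    have *: False if "fst r < fst r'" "r \<in> A" "r' \<in> A" "x \<in> E r" "x \<in> E r'" for r r'
    proof -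
      have "x \<in> gen_union G (fst r')" using that(5) AG[OF that(3)] unfolding E_def gen_union_def by blast
      then have "x \<in> gen_union G (Suc (fst r))" using gen_union_decreasing[OF G, of "Suc (fst r)" "fst r'"] that(1) by auto
      then show False using that(4) by (simp add: E_def)
    qed
    then have "fst p = fst p'" using p x by (metis linorder_neqE_nat)
    moreover have "snd p = snd p'" using sparse_unique[OF G AG[OF p(1)], of "snd p'" x] AG[OF p(2)] x calculation by (auto simp: E_def)
    ultimately show False using p(3) by (simp add: prod_eq_iff)
  qed
  have half: "emeasure lebesgue (hcube (snd p)) \<le> 2 * emeasure lebesgue (E p)" if "p \<in> A" for p
  proof -
    let ?q = "snd p" and ?V = "gen_union G (Suc (fst p))"
    have s: "snd ?q > 0" using sparse_gensD(3)[OF G AG[OF that]] .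
    have fin: "emeasure lebesgue (hcube ?q) < \<infinity>" using s by (simp add: emeasure_hcube)
    have "hcube ?q = (hcube ?q \<inter> ?V) \<union> E p" by (auto simp: E_def)
    then have "emeasure lebesgue (hcube ?q) \<le> emeasure lebesgue (hcube ?q \<inter> ?V) + emeasure lebesgue (E p)"
      using emeasure_subadditive[of "hcube ?q \<inter> ?V" lebesgue "E p"] Em gen_union_sets[OF G] by auto
    then have "2 * emeasure lebesgue (hcube ?q) \<le> 2 * (emeasure lebesgue (hcube ?q \<inter> ?V) + emeasure lebesgue (E p))"
      by (intro mult_left_mono) auto
    also have "\<dots> = 2 * emeasure lebesgue (hcube ?q \<inter> ?V) + 2 * emeasure lebesgue (E p)" by (rule distrib_left)
    also have "\<dots> \<le> emeasure lebesgue (hcube ?q) + 2 * emeasure lebesgue (E p)"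
      by (intro add_right_mono sparse_gensD(5)[OF G AG[OF that]])
    finally have "emeasure lebesgue (hcube ?q) + emeasure lebesgue (hcube ?q) \<le> emeasure lebesgue (hcube ?q) + 2 * emeasure lebesgue (E p)"
      by (simp add: mult_2)
    then show ?thesis by (rule ennreal_add_cancel_le[OF fin])
  qed
  have "(\<integral>\<^sup>+p. emeasure lebesgue (hcube (snd p)) \<partial>count_space A) \<le> (\<integral>\<^sup>+p. 2 * (\<integral>\<^sup>+x\<in>E p. 1 \<partial>lebesgue) \<partial>count_space A)"
    by (rule nn_integral_mono) (use half Em in auto)
  also have "\<dots> = 2 * (\<integral>\<^sup>+p. (\<integral>\<^sup>+x\<in>E p. 1 \<partial>lebesgue) \<partial>count_space A)" by (rule nn_integral_cmult) simp
  also have "(\<integral>\<^sup>+p. (\<integral>\<^sup>+x\<in>E p. 1 \<partial>lebesgue) \<partial>count_space A) = (\<integral>\<^sup>+x\<in>(\<Union>p\<in>A. E p). 1 \<partial>lebesgue)"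
    using cA dj Em by (intro nn_integral_disjoint_UN[symmetric]) auto
  also have "\<dots> = emeasure lebesgue (\<Union>p\<in>A. E p)"
  proof -
    have "(\<Union>p\<in>A. E p) \<in> sets lebesgue" using cA Em by (intro sets.countable_UN') auto
    then show ?thesis by simp
  qed
  also have "\<dots> \<le> emeasure lebesgue (\<Union>p\<in>A. hcube (snd p))"
    using cA by (intro emeasure_mono sets.countable_UN') (auto simp: E_def)
  finally show ?thesis by (simp add: mult_left_mono)
qed

lemma sum_le_nn_integral_count_space:
  assumes "finite A" "A \<subseteq> S"
  shows "(\<Sum>p\<in>A. f p) \<le> (\<integral>\<^sup>+p. f p \<partial>count_space S)"
proof -
  have "(\<Sum>p\<in>A. f p) = (\<integral>\<^sup>+p. f p \<partial>count_space A)" using assms by (simp add: nn_integral_count_space_finite)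
  also have "\<dots> = (\<integral>\<^sup>+p. f p * indicator A p \<partial>count_space UNIV)" by (rule nn_integral_count_space_indicator) simp
  also have "\<dots> \<le> (\<integral>\<^sup>+p. f p * indicator S p \<partial>count_space UNIV)"
    using assms by (intro nn_integral_mono) (auto split: split_indicator)
  also have "\<dots> = (\<integral>\<^sup>+p. f p \<partial>count_space S)" by (rule nn_integral_count_space_indicator[symmetric]) simp
  finally show ?thesis .
qed

lemma Bterm_nonneg: "0 \<le> Bterm b f m q x"
  by (simp add: Bterm_def mean_nonneg)

context CZ begin

text \<open>Iterate the commutator step from \<open>q0\<close>. Almost every point leaves the
  generations after finitely many steps; differences of cut-offs telescope along its chain of
  ancestors down to the last cube, where the commutator itself is bounded.\<close>

lemma sparse_domination:
  fixes m :: nat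
  obtains C where "C > 0" "\<And>b f q0. moments b f \<Longrightarrow> snd q0 > 0 \<Longrightarrow> (\<And>x. x \<notin> dcube q0 \<Longrightarrow> f x = 0) \<Longrightarrow>
    \<exists>G. sparse_gens G \<and> (AE x in lebesgue. x \<in> hcube q0 \<longrightarrow>
       ennreal (norm (iter_comm T b m f x)) \<le>
         ennreal C * (\<integral>\<^sup>+p. ennreal (Bterm b f m (snd p) x) * indicator (hcube (snd p)) x \<partial>count_space (Sigma UNIV G)))"
proof -
  obtain C where C: "C > 0" "\<And>b f q. moments b f \<Longrightarrow> snd q > 0 \<Longrightarrow>
    \<exists>P. countable P \<and> disjoint_family_on hcube P \<and> (\<forall>r\<in>P. snd r > 0 \<and> hcube r \<subseteq> hcube q) \<and>
      2 * emeasure lebesgue (\<Union>r\<in>P. hcube r) \<le> emeasure lebesgue (hcube q) \<and>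
      (AE x in lebesgue. x \<in> hcube q \<longrightarrow> x \<notin> (\<Union>r\<in>P. hcube r) \<longrightarrow> norm (iter_comm T b m (cutoff q f) x) \<le> C * Bterm b f m q x) \<and>
      (\<forall>r\<in>P. AE x in lebesgue. x \<in> hcube r \<longrightarrow>
         norm (iter_comm T b m (cutoff q f) x - iter_comm T b m (cutoff r f) x) \<le> C * Bterm b f m q x)"
    by (rule commutator_step[of m]) blast
  have main: "\<exists>G. sparse_gens G \<and> (AE x in lebesgue. x \<in> hcube q0 \<longrightarrow>
       ennreal (norm (iter_comm T b m f x)) \<le>
         ennreal C * (\<integral>\<^sup>+p. ennreal (Bterm b f m (snd p) x) * indicator (hcube (snd p)) x \<partial>count_space (Sigma UNIV G)))"
    if mom: "moments b f" and q0: "snd q0 > 0" and supp: "\<And>x. x \<notin> dcube q0 \<Longrightarrow> f x = 0" for b f q0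
  proof -
    define it where "it q = iter_comm T b m (cutoff q f)" for q
    define stp where "stp q P \<longleftrightarrow> countable P \<and> disjoint_family_on hcube P \<and> (\<forall>r\<in>P. snd r > 0 \<and> hcube r \<subseteq> hcube q) \<and>
      2 * emeasure lebesgue (\<Union>r\<in>P. hcube r) \<le> emeasure lebesgue (hcube q) \<and>
      (AE x in lebesgue. x \<in> hcube q \<longrightarrow> x \<notin> (\<Union>r\<in>P. hcube r) \<longrightarrow> norm (it q x) \<le> C * Bterm b f m q x) \<and>
      (\<forall>r\<in>P. AE x in lebesgue. x \<in> hcube r \<longrightarrow> norm (it q x - it r x) \<le> C * Bterm b f m q x)" for q P
    have "\<forall>q. \<exists>P. snd q > 0 \<longrightarrow> stp q P" using C(2)[OF mom] unfolding stp_def it_def by blast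
    from choice[OF this] obtain ch where ch: "\<And>q. snd q > 0 \<Longrightarrow> stp q (ch q)" by blast
    \<comment> \<open>A choice of children for every cube turns the one-step statement into a
      recursion on generations.\<close>
    define G where "G = rec_nat {q0} (\<lambda>j A. \<Union>q\<in>A. ch q)"
    have G0: "G 0 = {q0}" and GS: "G (Suc j) = (\<Union>q\<in>G j. ch q)" for j by (auto simp: G_def)
    have chpos: "snd r > 0" if "snd q > 0" "r \<in> ch q" for q r
      using ch[OF that(1)] that(2) unfolding stp_def by blast
    have Gpos: "\<forall>q\<in>G j. snd q > 0" for j
    proof (induction j)
      case (Suc j)
      then show ?case unfolding GS using chpos by blast
    qed (simp add: G0 q0)
    have st: "stp q (ch q)" if "q \<in> G j" for q j using Gpos that ch by blast
    have chsub: "hcube r \<subseteq> hcube q" if "q \<in> G j" "r \<in> ch q" for q r j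
      using st[OF that(1)] that(2) unfolding stp_def by blast
    have Gc: "countable (G j)" for j
    proof (induction j)
      case (Suc j)
      have "countable (ch q)" if "q \<in> G j" for q using st[OF that] unfolding stp_def by blast
      then show ?case unfolding GS using Suc by blast
    qed (simp add: G0)
    have Gd: "disjoint_family_on hcube (G j)" for j
    proof (induction j)
      case 0
      then show ?case by (simp add: G0 disjoint_family_on_def)
    next
      case (Suc j)
      show ?case
        unfolding disjoint_family_on_def
      proof (intro ballI impI)
        fix r r' assume r: "r \<in> G (Suc j)" "r' \<in> G (Suc j)" "r \<noteq> r'"
        then obtain q q' where q: "q \<in> G j" "q' \<in> G j" "r \<in> ch q" "r' \<in> ch q'" by (auto simp: GS)
        show "hcube r \<inter> hcube r' = {}"
        proof (cases "q = q'")
          case True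
          then show ?thesis using st[OF q(1)] q r(3) by (auto simp: stp_def disjoint_family_on_def)
        next
          case False
          then have "hcube q \<inter> hcube q' = {}" using Suc.IH q by (auto simp: disjoint_family_on_def)
          moreover have "hcube r \<subseteq> hcube q" "hcube r' \<subseteq> hcube q'" using chsub q by blast+
          ultimately show ?thesis by blast
        qed
      qed
    qed
    have inter: "hcube q \<inter> gen_union G (Suc j) = (\<Union>r\<in>ch q. hcube r)" if q: "q \<in> G j" for q j
    proof (intro set_eqI iffI)
      fix x assume x: "x \<in> hcube q \<inter> gen_union G (Suc j)"
      then obtain q' r where q': "q' \<in> G j" "r \<in> ch q'" "x \<in> hcube r" by (auto simp: gen_union_def GS)
      then have "x \<in> hcube q'" using chsub by blast
      then have "q' = q" using Gd[of j] q q' x by (auto simp: disjoint_family_on_def)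
      then show "x \<in> (\<Union>r\<in>ch q. hcube r)" using q' by blast
    next
      fix x assume "x \<in> (\<Union>r\<in>ch q. hcube r)"
      then show "x \<in> hcube q \<inter> gen_union G (Suc j)" using chsub[OF q] q unfolding gen_union_def GS by blast
    qed
    have SG: "sparse_gens G"
      unfolding sparse_gens_def
    proof (intro allI conjI ballI)
      fix j
      show "countable (G j)" "disjoint_family_on hcube (G j)" by (rule Gc Gd)+
      show "0 < snd q" if "q \<in> G j" for q using Gpos that by blast
      show "\<exists>q\<in>G j. hcube r \<subseteq> hcube q" if "r \<in> G (Suc j)" for r
        using that chsub unfolding GS by blast
      show "2 * emeasure lebesgue (hcube q \<inter> gen_union G (Suc j)) \<le> emeasure lebesgue (hcube q)" if "q \<in> G j" for q
        using st[OF that] inter[OF that] by (simp add: stp_def)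
    qed
    \<comment> \<open>The points lying in all generations form a null set, by the decay 2^(-u)
      inside \<open>q0\<close>.\<close>
    have fin: "AE x in lebesgue. \<not> (\<forall>j. x \<in> gen_union G j)"
    proof -
      define Z where "Z = (\<Inter>j. gen_union G j)"
      have Z: "Z \<in> sets lebesgue" unfolding Z_def using gen_union_sets[OF SG] by (intro sets.countable_INT) auto
      have Zs: "Z \<subseteq> hcube q0" 
      proof -
        have "gen_union G 0 = hcube q0" by (simp add: gen_union_def G0)
        then show ?thesis unfolding Z_def by blast
      qed
      have le: "emeasure lebesgue Z \<le> ennreal ((1/2) ^ u * snd q0 ^ DIM('a))" for u
      proof -
        have "emeasure lebesgue Z \<le> emeasure lebesgue (hcube q0 \<inter> gen_union G (0 + u))"
          using Zs gen_union_sets[OF SG] by (intro emeasure_mono) (auto simp: Z_def)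
        also have "\<dots> \<le> ennreal ((1/2) ^ u) * emeasure lebesgue (hcube q0)"
          by (rule sparse_decay[OF SG]) (simp add: G0)
        finally show ?thesis using q0 by (simp add: emeasure_hcube ennreal_mult)
      qed
      have "(\<lambda>u. (1/2) ^ u * snd q0 ^ DIM('a)) \<longlonglongrightarrow> 0"
        by (intro tendsto_mult_left_zero LIMSEQ_realpow_zero) auto
      then have "(\<lambda>u. ennreal ((1/2) ^ u * snd q0 ^ DIM('a))) \<longlonglongrightarrow> ennreal 0" by (rule tendsto_ennrealI)
      then have "emeasure lebesgue Z \<le> ennreal 0" using le by (intro LIMSEQ_le_const) auto
      then have "Z \<in> null_sets lebesgue" using Z by (simp add: null_sets_def)
      then have "AE x in lebesgue. x \<notin> Z" by (rule AE_not_in)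
      then show ?thesis by eventually_elim (auto simp: Z_def)
    qed
    have cS: "countable (Sigma UNIV G)" using Gc by (intro countable_SIGMA) auto
    have ae1: "AE x in lebesgue. \<forall>p\<in>Sigma UNIV G. x \<in> hcube (snd p) \<longrightarrow> x \<notin> (\<Union>r\<in>ch (snd p). hcube r) \<longrightarrow> norm (it (snd p) x) \<le> C * Bterm b f m (snd p) x"
      by (rule AE_ball_countable'[OF _ cS]) (use st in \<open>auto simp: stp_def\<close>)
    have ae2: "AE x in lebesgue. \<forall>p\<in>Sigma UNIV G. \<forall>r\<in>ch (snd p). x \<in> hcube r \<longrightarrow> norm (it (snd p) x - it r x) \<le> C * Bterm b f m (snd p) x"
      by (intro AE_ball_countable'[OF _ cS] AE_ball_countable') (use st in \<open>auto simp: stp_def\<close>)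
    have "AE x in lebesgue. x \<in> hcube q0 \<longrightarrow> ennreal (norm (it q0 x)) \<le>
         ennreal C * (\<integral>\<^sup>+p. ennreal (Bterm b f m (snd p) x) * indicator (hcube (snd p)) x \<partial>count_space (Sigma UNIV G))"
      using fin ae1 ae2
    proof eventually_elim
      case (elim x)
      show ?case
      proof
        assume x0: "x \<in> hcube q0"
        define J where "J = (LEAST j. x \<notin> gen_union G j)"
        have J1: "x \<notin> gen_union G J" 
        proof -
          have "\<exists>j. x \<notin> gen_union G j" using elim(1) by simp
          then show ?thesis unfolding J_def by (rule LeastI_ex)
        qed
        have J2: "x \<in> gen_union G j" if "j < J" for j using not_less_Least[of j "\<lambda>j. x \<notin> gen_union G j"] that by (auto simp: J_def)
        have J0: "J > 0" using J1 x0 by (cases J) (auto simp: gen_union_def G0)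
        define qa where "qa j = (SOME q. q \<in> G j \<and> x \<in> hcube q)" for j
        have qa: "qa j \<in> G j" "x \<in> hcube (qa j)" if "j < J" for j
        proof -
          have "\<exists>q. q \<in> G j \<and> x \<in> hcube q" using J2[OF that] by (auto simp: gen_union_def)
          then have "qa j \<in> G j \<and> x \<in> hcube (qa j)" unfolding qa_def by (rule someI_ex)
          then show "qa j \<in> G j" "x \<in> hcube (qa j)" by auto
        qed
        \<comment> \<open>Backward induction from the last generation J - 1 that contains
          \<open>x\<close>, where the bound off the children applies; each step back adds one
          comparison of cut-offs.\<close>
        have chain: "k < J \<Longrightarrow> norm (it (qa (J - Suc k)) x) \<le> C * (\<Sum>i\<in>{J - Suc k..<J}. Bterm b f m (qa i) x)" for k
        proof (induction k)
          case 0
          have j: "J - Suc 0 < J" using J0 by simp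
          have "{J - Suc 0..<J} = {J - Suc 0}" using J0 by auto
          moreover have "x \<notin> (\<Union>r\<in>ch (qa (J - Suc 0)). hcube r)"
            using inter[OF qa(1)[OF j]] J1 J0 by auto
          ultimately show ?case using elim(2)[rule_format, of "(J - Suc 0, qa (J - Suc 0))"] qa[OF j] by auto
        next
          case (Suc k)
          define j where "j = J - Suc (Suc k)"
          have j: "j < J" "J - Suc k = Suc j" "Suc j < J" using Suc.prems by (auto simp: j_def)
          have "x \<in> (\<Union>r\<in>ch (qa j). hcube r)" using inter[OF qa(1)[OF j(1)]] qa(2)[OF j(1)] J2[OF j(3)] by blast
          then obtain r where r: "r \<in> ch (qa j)" "x \<in> hcube r" by blast
          then have "r \<in> G (Suc j)" using qa(1)[OF j(1)] by (auto simp: GS)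
          then have "r = qa (Suc j)" using sparse_unique[OF SG _ qa(1)[OF j(3)]] r(2) qa(2)[OF j(3)] by blast
          then have "norm (it (qa j) x - it (qa (Suc j)) x) \<le> C * Bterm b f m (qa j) x"
            using elim(3)[rule_format, of "(j, qa j)" r] r qa[OF j(1)] by auto
          moreover have "norm (it (qa (Suc j)) x) \<le> C * (\<Sum>i\<in>{Suc j..<J}. Bterm b f m (qa i) x)"
            using Suc.IH Suc.prems j(2) by simp
          moreover have "norm (it (qa j) x) \<le> norm (it (qa j) x - it (qa (Suc j)) x) + norm (it (qa (Suc j)) x)"
            by (metis diff_add_cancel norm_triangle_ineq)
          moreover have "(\<Sum>i\<in>{j..<J}. Bterm b f m (qa i) x) = Bterm b f m (qa j) x + (\<Sum>i\<in>{Suc j..<J}. Bterm b f m (qa i) x)"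
            using j by (simp add: sum.atLeast_Suc_lessThan)
          ultimately show ?case by (simp add: j_def[symmetric] distrib_left)
        qed
        have "qa 0 = q0" using qa(1)[OF J0] by (simp add: G0)
        then have "norm (it q0 x) \<le> C * (\<Sum>i<J. Bterm b f m (qa i) x)"
          using chain[of "J - 1"] J0 by (simp add: atLeast0LessThan)
        then have "ennreal (norm (it q0 x)) \<le> ennreal (C * (\<Sum>i<J. Bterm b f m (qa i) x))" by (rule ennreal_leI)
        also have "\<dots> = ennreal C * (\<Sum>i<J. ennreal (Bterm b f m (qa i) x))"
          using C(1) by (simp add: ennreal_mult' sum_ennreal Bterm_nonneg)
        also have "(\<Sum>i<J. ennreal (Bterm b f m (qa i) x)) = (\<Sum>p\<in>(\<lambda>i. (i, qa i)) ` {..<J}. ennreal (Bterm b f m (snd p) x) * indicator (hcube (snd p)) x)"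
          using qa by (subst sum.reindex) (auto simp: inj_on_def)
        also have "\<dots> \<le> (\<integral>\<^sup>+p. ennreal (Bterm b f m (snd p) x) * indicator (hcube (snd p)) x \<partial>count_space (Sigma UNIV G))"
          using qa by (intro sum_le_nn_integral_count_space) auto
        finally show "ennreal (norm (it q0 x)) \<le> ennreal C * (\<integral>\<^sup>+p. ennreal (Bterm b f m (snd p) x) * indicator (hcube (snd p)) x \<partial>count_space (Sigma UNIV G))"
          by (simp add: mult_left_mono)
      qed
    qed
    moreover have "cutoff q0 f = f" using supp by (auto simp: cutoff_def fun_eq_iff split: split_indicator)
    ultimately show ?thesis using SG unfolding it_def by auto
  qed
  show ?thesis by (rule that[OF C(1)], rule main)
qed

end

section \<open>Sums over sparse families\<close>

text \<open>Required for exchanging integrals in the layer cake argument; the exhausting sets come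
  from the Borel measure.\<close>

lemma sigma_finite_lebesgue: "sigma_finite_measure (lebesgue :: 'a::euclidean_space measure)"
proof
  obtain A :: "'a set set" where A: "countable A" "A \<subseteq> sets lborel" "\<Union>A = space lborel" "\<forall>a\<in>A. emeasure lborel a \<noteq> \<infinity>"
    using lborel.sigma_finite_countable by blast
  then have "A \<subseteq> sets lebesgue" "\<forall>a\<in>A. emeasure lebesgue a \<noteq> \<infinity>"
    by (auto simp: emeasure_completion sets_completionI_sets)
  then show "\<exists>A. countable A \<and> A \<subseteq> sets lebesgue \<and> \<Union>A = space (lebesgue :: 'a measure) \<and> (\<forall>a\<in>A. emeasure lebesgue a \<noteq> \<infinity>)"
    using A by (intro exI[of _ A]) auto
qed

text \<open>Infinite \<open>a\<close> is included, because \<open>Mterm\<close> can be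
  infinite.\<close>

lemma layer_cake_ennreal: "emeasure lborel {s::real. 0 \<le> s \<and> ennreal s < a} = a"
proof (cases a)
  case (real c)
  then have "{s. 0 \<le> s \<and> ennreal s < a} = {0..<c}" by (auto simp: ennreal_less_iff)
  then show ?thesis using real by simp
next
  case top
  then have eq: "{s. 0 \<le> s \<and> ennreal s < a} = {0..}" by auto
  show ?thesis
  proof (rule ccontr)
    assume "emeasure lborel {s. 0 \<le> s \<and> ennreal s < a} \<noteq> a"
    then have "emeasure lborel {0::real..} \<noteq> \<infinity>" unfolding eq using top by simp
    then obtain c where c: "emeasure lborel {0::real..} = ennreal c" "c \<ge> 0"
      by (cases "emeasure lborel {0::real..}") auto
    have "ennreal (c + 1) = emeasure lborel {0..c + 1}" using c by simp
    also have "\<dots> \<le> emeasure lborel {0::real..}" by (intro emeasure_mono) auto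
    finally show False using c by (simp del: ennreal_plus)
  qed
qed

text \<open>Packing reduces the sum to the measure of the union. Dilates of disjoint cubes overlap,
  so integrals over them cannot be added directly; Vitali, applied to balls containing the dilates,
  extracts a disjoint subfamily for which they can. In \<open>C\<close>, 2 is the packing constant
  and 5 the Vitali enlargement.\<close>

lemma sparse_level:
  fixes G :: "nat \<Rightarrow> ('a::euclidean_space \<times> real) set"
  assumes G: "sparse_gens G" and A: "A \<subseteq> Sigma UNIV G" and lam: "lam > 0" and g [measurable]: "g \<in> borel_measurable lebesgue"
    and le: "\<And>p. p \<in> A \<Longrightarrow> ennreal lam * emeasure lebesgue (dcube (snd p)) \<le> (\<integral>\<^sup>+x\<in>dcube (snd p). g x \<partial>lebesgue)"
    and C: "C = 2 * unit_ball_vol (real DIM('a)) * (5 * (real DIM('a) * (4 * real DIM('a) + 2))) ^ DIM('a)"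
  shows "ennreal lam * (\<integral>\<^sup>+p. emeasure lebesgue (hcube (snd p)) \<partial>count_space A) \<le> ennreal C * (\<integral>\<^sup>+x\<in>(\<Union>p\<in>A. dcube (snd p)). g x \<partial>lebesgue)"
proof (cases "(\<integral>\<^sup>+x\<in>(\<Union>p\<in>A. dcube (snd p)). g x \<partial>lebesgue) = \<infinity>")
  case True
  have "C > 0" using unit_ball_vol_DIM_pos[where 'a='a] unfolding C by (intro mult_pos_pos zero_less_power) auto
  then show ?thesis using True by (simp add: ennreal_mult_top)
next
  case False
  let ?n = "real DIM('a)" and ?I = "\<integral>\<^sup>+x\<in>(\<Union>p\<in>A. dcube (snd p)). g x \<partial>lebesgue"
  define v where "v = unit_ball_vol ?n"
  have v: "v > 0" unfolding v_def by (rule unit_ball_vol_DIM_pos)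
  obtain I where I: "?I = ennreal I" "I \<ge> 0" using False by (cases ?I) auto
  have cA: "countable A" using A sparse_gensD(1)[OF G] by (meson countable_SIGMA countableI_type countable_subset)
  have pos: "snd (snd p) > 0" if "p \<in> A" for p using A that sparse_gensD(3)[OF G] by auto
  let ?r = "\<lambda>p. ?n * (4 * ?n + 2) * snd (snd p)"
  have n4: "0 < ?n * (4 * ?n + 2)" by (simp add: add_nonneg_pos)
  have cub: "cube (dcube (snd p))" if "p \<in> A" for p using pos[OF that] by (intro cube_ccube snd_dilate)
  have sub: "dcube (snd p) \<subseteq> ball (fst (snd p)) (?r p)" if "p \<in> A" for p
    using pos[OF that] by (intro dcube_subset_ball) (auto simp: mem_ccube)
  \<comment> \<open>Vitali needs bounded radii, which follow from finiteness of the integral on the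
    right.\<close>
  have B: "0 < ?r p \<and> ?r p \<le> ?n * (4 * ?n + 2) * max 1 (I / lam)" if p: "p \<in> A" for p
  proof -
    let ?s = "snd (snd p)"
    have s: "?s > 0" by (rule pos[OF p])
    have "ennreal (lam * ?s ^ DIM('a)) = ennreal lam * emeasure lebesgue (hcube (snd p))"
      using s lam by (simp add: emeasure_hcube ennreal_mult)
    also have "\<dots> \<le> ennreal lam * emeasure lebesgue (dcube (snd p))"
      using hcube_subset_dcube[OF s] by (intro mult_left_mono emeasure_mono) auto
    also have "\<dots> \<le> (\<integral>\<^sup>+x\<in>dcube (snd p). g x \<partial>lebesgue)" by (rule le[OF p])
    also have "\<dots> \<le> ?I" using p by (intro nn_integral_mono) (auto split: split_indicator)
    finally have "lam * ?s ^ DIM('a) \<le> I" using I by simp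
    then have "?s ^ DIM('a) \<le> I / lam" using lam by (simp add: field_simps)
    moreover have "?s \<le> ?s ^ DIM('a)" if "?s \<ge> 1" using power_increasing[of 1 "DIM('a)" ?s] that by simp
    ultimately have "?s \<le> max 1 (I / lam)" by linarith
    then have "?r p \<le> ?n * (4 * ?n + 2) * max 1 (I / lam)" using n4 by (intro mult_left_mono) auto
    moreover have "0 < ?r p" using n4 s by (intro mult_pos_pos) auto
    ultimately show ?thesis by blast
  qed
  obtain D where D: "countable D" "D \<subseteq> A" "pairwise (\<lambda>i j. disjnt (ball (fst (snd i)) (?r i)) (ball (fst (snd j)) (?r j))) D"
    "(\<Union>p\<in>A. ball (fst (snd p)) (?r p)) \<subseteq> (\<Union>p\<in>D. ball (fst (snd p)) (5 * ?r p))"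
    by (rule Vitali_covering_lemma_balls[OF subset_refl B])
  have dj: "disjoint_family_on (\<lambda>p. dcube (snd p)) D"
    unfolding disjoint_family_on_def
  proof (intro ballI impI)
    fix i j assume ij: "i \<in> D" "j \<in> D" "i \<noteq> j"
    then have "disjnt (ball (fst (snd i)) (?r i)) (ball (fst (snd j)) (?r j))" using D(3) by (auto simp: pairwise_def)
    then show "dcube (snd i) \<inter> dcube (snd j) = {}" using sub[of i] sub[of j] ij D(2) unfolding disjnt_def by blast
  qed
  have "(\<Union>p\<in>A. hcube (snd p)) \<subseteq> (\<Union>p\<in>D. ball (fst (snd p)) (5 * ?r p))"
    using D(4) sub hcube_subset_dcube[OF pos] by blast
  then have "emeasure lebesgue (\<Union>p\<in>A. hcube (snd p)) \<le> emeasure lebesgue (\<Union>p\<in>D. ball (fst (snd p)) (5 * ?r p))"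
    using D(1) by (intro emeasure_mono sets.countable_UN') auto
  also have "\<dots> \<le> (\<integral>\<^sup>+p. emeasure lebesgue (ball (fst (snd p)) (5 * ?r p)) \<partial>count_space D)"
    using D(1) by (intro emeasure_UN_le_count_space) auto
  finally have 1: "emeasure lebesgue (\<Union>p\<in>A. hcube (snd p)) \<le> (\<integral>\<^sup>+p. emeasure lebesgue (ball (fst (snd p)) (5 * ?r p)) \<partial>count_space D)" .
  have "ennreal lam * (\<integral>\<^sup>+p. emeasure lebesgue (hcube (snd p)) \<partial>count_space A) \<le> ennreal lam * (2 * (\<integral>\<^sup>+p. emeasure lebesgue (ball (fst (snd p)) (5 * ?r p)) \<partial>count_space D))"
    using order_trans[OF sparse_packing[OF G A] mult_left_mono[OF 1, of 2]] by (intro mult_left_mono) auto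
  also have "\<dots> = (\<integral>\<^sup>+p. ennreal lam * (2 * emeasure lebesgue (ball (fst (snd p)) (5 * ?r p))) \<partial>count_space D)"
    by (simp add: nn_integral_cmult)
  also have "\<dots> \<le> (\<integral>\<^sup>+p. ennreal C * (\<integral>\<^sup>+x\<in>dcube (snd p). g x \<partial>lebesgue) \<partial>count_space D)"
  proof (rule nn_integral_mono)
    fix p assume "p \<in> space (count_space D)"
    then have p: "p \<in> A" using D(2) by auto
    let ?s = "snd (snd p)"
    have s: "?s > 0" by (rule pos[OF p])
    have "2 * emeasure lebesgue (ball (fst (snd p)) (5 * ?r p)) = ennreal (2 * (v * (5 * ?r p) ^ DIM('a)))"
      using B[OF p] v by (simp add: emeasure_lebesgue_ball v_def[symmetric] ennreal_mult')
    also have "2 * (v * (5 * ?r p) ^ DIM('a)) = C * ?s ^ DIM('a)"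
      by (simp add: C v_def power_mult_distrib)
    also have "ennreal (C * ?s ^ DIM('a)) = ennreal C * emeasure lebesgue (hcube (snd p))"
      using s v by (simp add: emeasure_hcube C v_def[symmetric] ennreal_mult)
    also have "\<dots> \<le> ennreal C * emeasure lebesgue (dcube (snd p))"
      using hcube_subset_dcube[OF s] by (intro mult_left_mono emeasure_mono) auto
    finally have "ennreal lam * (2 * emeasure lebesgue (ball (fst (snd p)) (5 * ?r p))) \<le> ennreal lam * (ennreal C * emeasure lebesgue (dcube (snd p)))"
      by (intro mult_left_mono) auto
    also have "\<dots> = ennreal C * (ennreal lam * emeasure lebesgue (dcube (snd p)))" by (simp only: mult_ac)
    also have "\<dots> \<le> ennreal C * (\<integral>\<^sup>+x\<in>dcube (snd p). g x \<partial>lebesgue)" by (intro mult_left_mono le[OF p]) auto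
    finally show "ennreal lam * (2 * emeasure lebesgue (ball (fst (snd p)) (5 * ?r p))) \<le> ennreal C * (\<integral>\<^sup>+x\<in>dcube (snd p). g x \<partial>lebesgue)" .
  qed
  also have "\<dots> = ennreal C * (\<integral>\<^sup>+p. (\<integral>\<^sup>+x\<in>dcube (snd p). g x \<partial>lebesgue) \<partial>count_space D)"
    by (rule nn_integral_cmult) simp
  also have "(\<integral>\<^sup>+p. (\<integral>\<^sup>+x\<in>dcube (snd p). g x \<partial>lebesgue) \<partial>count_space D) = (\<integral>\<^sup>+x\<in>(\<Union>p\<in>D. dcube (snd p)). g x \<partial>lebesgue)"
    using D(1) dj by (intro nn_integral_disjoint_UN[symmetric]) auto
  also have "\<dots> \<le> ?I" using D(2) by (intro nn_integral_mono) (auto split: split_indicator)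
  finally show ?thesis by (simp add: mult_left_mono)
qed

text \<open>Layer cake in the values of \<open>a\<close>, with the packing bound applied to each superlevel family.\<close>
lemma sparse_sum_le:
  fixes G :: "nat \<Rightarrow> ('a::euclidean_space \<times> real) set" and a :: "nat \<times> 'a \<times> real \<Rightarrow> ennreal"
  assumes G: "sparse_gens G" and A: "A \<subseteq> Sigma UNIV G" and lam: "lam > 0" and g [measurable]: "g \<in> borel_measurable lebesgue"
    and le: "\<And>p. p \<in> A \<Longrightarrow> ennreal lam * emeasure lebesgue (dcube (snd p)) \<le> (\<integral>\<^sup>+x\<in>dcube (snd p). g x \<partial>lebesgue)"
    and aM: "\<And>p x. p \<in> A \<Longrightarrow> x \<in> dcube (snd p) \<Longrightarrow> a p \<le> M x"
    and C: "C = 2 * unit_ball_vol (real DIM('a)) * (5 * (real DIM('a) * (4 * real DIM('a) + 2))) ^ DIM('a)"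
  shows "(\<integral>\<^sup>+p. ennreal lam * emeasure lebesgue (hcube (snd p)) * a p \<partial>count_space A) \<le> ennreal C * (\<integral>\<^sup>+x. g x * M x \<partial>lebesgue)"
proof -
  have cA: "countable A" using A sparse_gensD(1)[OF G] by (meson countable_SIGMA countableI_type countable_subset)
  \<comment> \<open>The interval [0, a p), whose length is the summand \<open>a p\<close>; at height
    s the cubes with s in \<open>L p\<close> form the superlevel family.\<close>
  define L where "L p = {s::real. 0 \<le> s \<and> ennreal s < a p}" for p
  have Lm [measurable]: "L p \<in> sets lborel" for p
  proof -
    have "{s \<in> space lborel. 0 \<le> s \<and> ennreal s < a p} \<in> sets (lborel :: real measure)" by measurable
    then show ?thesis by (simp add: L_def)
  qed
  define W where "W s = (\<Union>p\<in>{p\<in>A. s \<in> L p}. dcube (snd p))" for s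
  have "(\<integral>\<^sup>+p. ennreal lam * emeasure lebesgue (hcube (snd p)) * a p \<partial>count_space A)
     = (\<integral>\<^sup>+p. (\<integral>\<^sup>+s. ennreal lam * emeasure lebesgue (hcube (snd p)) * indicator (L p) s \<partial>lborel) \<partial>count_space A)"
    using layer_cake_ennreal[of "a p" for p] by (intro nn_integral_cong) (simp only: nn_integral_cmult_indicator[OF Lm], simp add: L_def)
  also have "\<dots> = (\<integral>\<^sup>+s. (\<integral>\<^sup>+p. ennreal lam * emeasure lebesgue (hcube (snd p)) * indicator (L p) s \<partial>count_space A) \<partial>lborel)"
    using cA by (intro nn_integral_count_space_nn_integral[symmetric]) measurable
  also have "\<dots> \<le> (\<integral>\<^sup>+s. ennreal C * (\<integral>\<^sup>+x. g x * indicator (W s) x \<partial>lebesgue) \<partial>lborel)"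
  proof (rule nn_integral_mono)
    fix s :: real
    let ?A = "{p\<in>A. s \<in> L p}"
    have "(\<integral>\<^sup>+p. ennreal lam * emeasure lebesgue (hcube (snd p)) * indicator (L p) s \<partial>count_space A)
       = (\<integral>\<^sup>+p. ennreal lam * emeasure lebesgue (hcube (snd p)) \<partial>count_space ?A)"
      by (subst (1 2) nn_integral_count_space_indicator) (auto intro!: nn_integral_cong split: split_indicator)
    also have "\<dots> = ennreal lam * (\<integral>\<^sup>+p. emeasure lebesgue (hcube (snd p)) \<partial>count_space ?A)"
      by (rule nn_integral_cmult) simp
    also have "\<dots> \<le> ennreal C * (\<integral>\<^sup>+x\<in>(\<Union>p\<in>?A. dcube (snd p)). g x \<partial>lebesgue)"
      using A le by (intro sparse_level[OF G _ lam g _ C]) auto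
    finally show "(\<integral>\<^sup>+p. ennreal lam * emeasure lebesgue (hcube (snd p)) * indicator (L p) s \<partial>count_space A)
      \<le> ennreal C * (\<integral>\<^sup>+x. g x * indicator (W s) x \<partial>lebesgue)" by (simp add: W_def)
  qed
  also have "\<dots> = ennreal C * (\<integral>\<^sup>+x. (\<integral>\<^sup>+s. g x * indicator (W s) x \<partial>lborel) \<partial>lebesgue)"
  proof -
    interpret L: sigma_finite_measure "lebesgue :: 'a measure" by (rule sigma_finite_lebesgue)
    interpret P: pair_sigma_finite "lborel :: real measure" "lebesgue :: 'a measure" ..
    \<comment> \<open>The pairs (s, x) with x in \<open>W s\<close> form a countable union of
      measurable rectangles, which gives the joint measurability for Fubini.\<close>
    have set: "(\<Union>p\<in>A. L p \<times> dcube (snd p)) \<in> sets (lborel \<Otimes>\<^sub>M lebesgue)"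
      using cA Lm by (intro sets.countable_UN') auto
    have meas: "case_prod (\<lambda>s x. g x * indicator (W s) x) \<in> borel_measurable (lborel \<Otimes>\<^sub>M lebesgue)"
    proof -
      have "(\<lambda>z. g (snd z) * indicator (\<Union>p\<in>A. L p \<times> dcube (snd p)) z) \<in> borel_measurable ((lborel :: real measure) \<Otimes>\<^sub>M lebesgue)"
        using set by (intro borel_measurable_times_ennreal borel_measurable_indicator measurable_compose[OF measurable_snd g]) auto
      moreover have "g (snd z) * indicator (\<Union>p\<in>A. L p \<times> dcube (snd p)) z = case_prod (\<lambda>s x. g x * indicator (W s) x) z" for z
        by (cases z) (auto simp: W_def split: split_indicator)
      ultimately show ?thesis by (simp only:)
    qed
    have "(\<integral>\<^sup>+s. ennreal C * (\<integral>\<^sup>+x. g x * indicator (W s) x \<partial>lebesgue) \<partial>lborel) = ennreal C * (\<integral>\<^sup>+s. (\<integral>\<^sup>+x. g x * indicator (W s) x \<partial>lebesgue) \<partial>lborel)"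
      by (rule nn_integral_cmult) (rule L.borel_measurable_nn_integral[OF meas])
    then show ?thesis using P.Fubini'[OF meas] by simp
  qed
  also have "\<dots> \<le> ennreal C * (\<integral>\<^sup>+x. g x * M x \<partial>lebesgue)"
  proof (intro mult_left_mono nn_integral_mono)
    fix x
    have "(\<integral>\<^sup>+s. g x * indicator (W s) x \<partial>lborel) \<le> (\<integral>\<^sup>+s. g x * indicator {s. 0 \<le> s \<and> ennreal s < M x} s \<partial>lborel)"
    proof (intro nn_integral_mono mult_left_mono)
      fix s :: real
      show "indicator (W s) x \<le> (indicator {s. 0 \<le> s \<and> ennreal s < M x} s :: ennreal)"
      proof (cases "x \<in> W s")
        case True
        then obtain p where "p \<in> A" "s \<in> L p" "x \<in> dcube (snd p)" unfolding W_def by blast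
        then have "0 \<le> s \<and> ennreal s < M x" using aM[of p x] unfolding L_def by (auto intro: less_le_trans)
        then show ?thesis by (simp add: indicator_def)
      qed simp
    qed simp
    also have "\<dots> = g x * M x"
    proof -
      have "{s \<in> space lborel. 0 \<le> s \<and> ennreal s < M x} \<in> sets (lborel :: real measure)" by measurable
      then have "{s. 0 \<le> s \<and> ennreal s < M x} \<in> sets (lborel :: real measure)" by simp
      then show ?thesis using layer_cake_ennreal[of "M x"] by (simp add: nn_integral_cmult_indicator)
    qed
    finally show "(\<integral>\<^sup>+s. g x * indicator (W s) x \<partial>lborel) \<le> g x * M x" .
  qed simp
  finally show ?thesis .
qed

section \<open>Weights on small sets\<close>

text \<open>The generations of the cubes counted lie in a window of length \<open>u\<close> ending
  at the first generation that misses \<open>x\<close>, and each generation has at most one cube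
  through \<open>x\<close>.\<close>

lemma sparse_overlap:
  assumes G: "sparse_gens G" and A: "A \<subseteq> Sigma UNIV G"
  shows "(\<integral>\<^sup>+p. indicator (hcube (snd p) - gen_union G (fst p + u)) x \<partial>count_space A) \<le> of_nat u"
proof -
  define B where "B = {p \<in> A. x \<in> hcube (snd p) - gen_union G (fst p + u)}"
  have AG: "snd p \<in> G (fst p)" if "p \<in> A" for p using A that by auto
  have inj: "inj_on fst B"
  proof (rule inj_onI)
    fix p p' assume p: "p \<in> B" "p' \<in> B" "fst p = fst p'"
    then have "snd p = snd p'" using sparse_unique[OF G, of "snd p" "fst p" "snd p'" x] AG[of p] AG[of p'] by (auto simp: B_def)
    then show "p = p'" using p(3) by (simp add: prod_eq_iff)
  qed
  have sub: "\<exists>J. fst ` B \<subseteq> {J - u..<J}"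
  proof (cases "B = {}")
    case False
    then obtain p0 where "p0 \<in> B" by blast
    then have ex: "\<exists>j. x \<notin> gen_union G j" by (auto simp: B_def)
    define J where "J = (LEAST j. x \<notin> gen_union G j)"
    have J1: "x \<notin> gen_union G J" unfolding J_def using ex by (rule LeastI_ex)
    \<comment> \<open>Truncated subtraction is harmless here: it can only shorten the
      window.\<close>
    have "fst p \<in> {J - u..<J}" if p: "p \<in> B" for p
    proof -
      have "x \<in> hcube (snd p)" "x \<notin> gen_union G (fst p + u)" "snd p \<in> G (fst p)" using p AG[of p] by (auto simp: B_def)
      then have 1: "x \<in> gen_union G (fst p)" unfolding gen_union_def by blast
      have "fst p < J"
      proof (rule ccontr)
        assume "\<not> fst p < J"
        then show False using 1 J1 gen_union_decreasing[OF G, of J "fst p"] by auto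
      qed
      moreover have "J \<le> fst p + u" unfolding J_def by (rule Least_le) fact
      ultimately show ?thesis by auto
    qed
    then show ?thesis by blast
  qed auto
  then obtain J where J: "fst ` B \<subseteq> {J - u..<J}" by blast
  have finB: "finite B" using finite_imageD[OF finite_subset[OF J] inj] by simp
  have "card B = card (fst ` B)" using inj by (simp add: card_image)
  also have "\<dots> \<le> card {J - u..<J}" using J by (intro card_mono) auto
  finally have card: "card B \<le> u" by simp
  have "(\<integral>\<^sup>+p. indicator (hcube (snd p) - gen_union G (fst p + u)) x \<partial>count_space A) = (\<integral>\<^sup>+p. indicator B p \<partial>count_space A)"
    by (intro nn_integral_cong) (auto simp: B_def split: split_indicator)
  also have "\<dots> = emeasure (count_space A) B" by (rule nn_integral_indicator) (auto simp: B_def)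
  also have "\<dots> = of_nat (card B)" using finB by (subst emeasure_count_space_finite) (auto simp: B_def)
  also have "\<dots> \<le> of_nat u" using card by simp
  finally show ?thesis .
qed

text \<open>The decay of layer \<open>k\<close>. The first summand serves cubes with entropy ratio
  at least 2^(k div 2), through log_2(2 + r) eps(r); the second serves the others, where 2^(-k)
  times the ratio is still geometrically small. The maximum with 1 covers k div 2 = 0.\<close>

definition eta :: "(real \<Rightarrow> real) \<Rightarrow> nat \<Rightarrow> real" where
  "eta eps k = 1 / (max 1 (real (k div 2)) * eps (2 ^ (k div 2))) + (1/2) ^ (k - k div 2)"

text \<open>Cauchy condensation: the block 2^n \<le> h < 2^(n+1) has 2^n terms, each at most 2^(-n)
  / eps(2^(2^n)) by monotonicity. The leading 1 bounds the term h = 0.\<close>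

lemma condensation_partial_sum:
  fixes eps :: "real \<Rightarrow> real"
  assumes e1: "\<forall>s\<ge>1. eps s \<ge> 1" and mono: "mono_on {1..} eps"
  shows "(\<Sum>h<2 ^ n. 1 / (max 1 (real h) * eps (2 ^ h))) \<le> 1 + (\<Sum>r<n. 1 / eps (2 ^ (2 ^ r)))"
proof (induction n)
  case 0
  then show ?case using e1[rule_format, of 1] by simp
next
  case (Suc n)
  have "(\<Sum>h\<in>{2 ^ n..<2 ^ Suc n}. 1 / (max 1 (real h) * eps (2 ^ h))) \<le> (\<Sum>h\<in>{(2::nat) ^ n..<2 ^ Suc n}. 1 / (2 ^ n * eps (2 ^ (2 ^ n))))"
  proof (rule sum_mono)
    fix h :: nat assume "h \<in> {2 ^ n..<2 ^ Suc n}"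
    then have h: "2 ^ n \<le> h" by simp
    then have "real (2 ^ n) \<le> real h" by (simp only: of_nat_le_iff)
    then have hr: "(2::real) ^ n \<le> max 1 (real h)" by (simp only: of_nat_power of_nat_numeral le_max_iff_disj) simp
    have "(2::real) ^ (2 ^ n) \<le> 2 ^ h" using h by (intro power_increasing) auto
    then have "eps (2 ^ (2 ^ n)) \<le> eps (2 ^ h)" using mono by (intro mono_onD[OF mono]) (auto intro: one_le_power)
    moreover have "1 \<le> eps (2 ^ (2 ^ n))" by (rule e1[rule_format]) (simp add: one_le_power)
    ultimately show "1 / (max 1 (real h) * eps (2 ^ h)) \<le> 1 / (2 ^ n * eps (2 ^ (2 ^ n)))"
      using hr by (intro divide_left_mono mult_mono mult_pos_pos) (auto intro: less_le_trans[of 0 1])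
  qed
  also have "\<dots> = 1 / eps (2 ^ (2 ^ n))" by simp
  finally have "(\<Sum>h\<in>{2 ^ n..<2 ^ Suc n}. 1 / (max 1 (real h) * eps (2 ^ h))) \<le> 1 / eps (2 ^ (2 ^ n))" .
  moreover have "(\<Sum>h<2 ^ Suc n. 1 / (max 1 (real h) * eps (2 ^ h))) = (\<Sum>h<2 ^ n. 1 / (max 1 (real h) * eps (2 ^ h))) + (\<Sum>h\<in>{2 ^ n..<2 ^ Suc n}. 1 / (max 1 (real h) * eps (2 ^ h)))"
  proof -
    show ?thesis
      using sum.atLeastLessThan_concat[of 0 "2 ^ n" "2 ^ Suc n" "\<lambda>h. 1 / (max 1 (real h) * eps (2 ^ h))"]
      by (simp add: lessThan_atLeast0)
  qed
  ultimately show ?case using Suc.IH by simp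
qed

lemma sum_double_index: "(\<Sum>k<2 * (n::nat). (g k :: real)) = (\<Sum>i<n. g (2 * i) + g (2 * i + 1))"
  by (induction n) (auto simp: algebra_simps)

lemma eta_nonneg: assumes "\<forall>s\<ge>1. eps s \<ge> (1::real)" shows "0 < eta eps k"
proof -
  have "1 \<le> eps (2 ^ (k div 2))" by (rule assms[rule_format]) (simp add: one_le_power)
  then show ?thesis unfolding eta_def by (intro add_nonneg_pos divide_nonneg_nonneg mult_nonneg_nonneg) auto
qed

text \<open>The indices 2 i and 2 i + 1 have the same half, so the condensed sum is counted twice.
  With S the series, the total is at most 2 (1 + S) + 3, hence the 7.\<close>

lemma suminf_eta_le:
  fixes eps :: "real \<Rightarrow> real"
  assumes e1: "\<forall>s\<ge>1. eps s \<ge> 1" and mono: "mono_on {1..} eps"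
    and sm: "summable (\<lambda>r::nat. 1 / eps (2 ^ (2 ^ r)))"
  shows "(\<Sum>k. ennreal (eta eps k)) \<le> ennreal (7 * max (\<Sum>r. 1 / eps (2 ^ (2 ^ r))) 1)"
proof (rule suminf_le_const[OF summableI])
  fix n
  define S where "S = (\<Sum>r. 1 / eps (2 ^ (2 ^ r)))"
  define a where "a h = 1 / (max 1 (real h) * eps (2 ^ h))" for h
  have ee: "1 \<le> eps (2 ^ h)" for h :: nat by (rule e1[rule_format]) (simp add: one_le_power)
  have a0: "0 \<le> a h" for h unfolding a_def using ee[of h] by (intro divide_nonneg_nonneg mult_nonneg_nonneg) auto
  have e0: "0 \<le> eta eps k" for k using eta_nonneg[OF e1, of k] by simp
  have aS: "(\<Sum>h<N. a h) \<le> 1 + S" for N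
  proof -
    have "N \<le> 2 ^ N" by (simp add: less_imp_le)
    then have "(\<Sum>h<N. a h) \<le> (\<Sum>h<2 ^ N. a h)" using a0 by (intro sum_mono2) auto
    also have "\<dots> \<le> 1 + (\<Sum>r<N. 1 / eps (2 ^ (2 ^ r)))" unfolding a_def by (rule condensation_partial_sum[OF e1 mono])
    also have "(\<Sum>r<N. 1 / eps (2 ^ (2 ^ r))) \<le> S" unfolding S_def
      using sm ee by (intro sum_le_suminf) (auto intro!: divide_nonneg_nonneg intro: order_trans[OF zero_le_one])
    finally show ?thesis by simp
  qed
  have geo: "(\<Sum>i<N. (1/2::real) ^ i) \<le> 2" for N
  proof -
    have "(\<Sum>i<N. (1/2::real) ^ i) \<le> (\<Sum>i. (1/2) ^ i)" by (intro sum_le_suminf summable_geometric) auto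
    also have "\<dots> = 2" by (subst suminf_geometric) auto
    finally show ?thesis .
  qed
  have "(\<Sum>k<n. eta eps k) \<le> (\<Sum>k<2 * n. eta eps k)" using e0 by (intro sum_mono2) auto
  also have "\<dots> = (\<Sum>i<n. eta eps (2 * i) + eta eps (2 * i + 1))" by (rule sum_double_index)
  also have "\<dots> = (\<Sum>i<n. 2 * a i + 3/2 * (1/2) ^ i)"
  proof (rule sum.cong[OF refl])
    fix i
    have "(2 * i) div 2 = i" "(2 * i + 1) div 2 = i" "2 * i - i = i" "2 * i + 1 - i = Suc i" by auto
    then show "eta eps (2 * i) + eta eps (2 * i + 1) = 2 * a i + 3/2 * (1/2) ^ i"
      unfolding eta_def a_def by simp
  qed
  also have "\<dots> = 2 * (\<Sum>i<n. a i) + 3/2 * (\<Sum>i<n. (1/2) ^ i)" by (simp add: sum.distrib sum_distrib_left)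
  also have "\<dots> \<le> 2 * (1 + S) + 3/2 * 2" by (intro add_mono mult_left_mono aS geo) auto
  also have "\<dots> \<le> 7 * max S 1" by simp
  finally have "(\<Sum>k<n. eta eps k) \<le> 7 * max S 1" .
  then have "ennreal (\<Sum>k<n. eta eps k) \<le> ennreal (7 * max S 1)" by (rule ennreal_leI)
  then show "(\<Sum>k<n. ennreal (eta eps k)) \<le> ennreal (7 * max (\<Sum>r. 1 / eps (2 ^ (2 ^ r))) 1)"
    using e0 by (simp add: sum_ennreal S_def)
qed

section \<open>Averages, Orlicz norms and entropy terms of a weight\<close>

lemma weightD: assumes "weight w" shows "0 \<le> w x" "w \<in> borel_measurable lebesgue" "locally_integrable w"
  using assms by (auto simp: weight_def locally_integrable_def)

lemma nn_integral_weight: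
  assumes "weight w" "cube R"
  shows "(\<integral>\<^sup>+x\<in>R. ennreal (w x) \<partial>lebesgue) = ennreal (avg w R) * emeasure lebesgue R" "0 \<le> avg w R"
proof -
  note m = cube_measure[OF assms(2)]
  have i: "set_integrable lebesgue R w" using locally_integrable_cube[OF weightD(3)[OF assms(1)] assms(2)] .
  have "(\<integral>\<^sup>+x\<in>R. ennreal (w x) \<partial>lebesgue) = (\<integral>\<^sup>+x. ennreal (indicator R x *\<^sub>R w x) \<partial>lebesgue)"
    by (rule nn_integral_cong) (auto split: split_indicator)
  also have "\<dots> = ennreal (LINT x:R|lebesgue. w x)"
    using i weightD(1)[OF assms(1)] unfolding set_lebesgue_integral_def set_integrable_def by (intro nn_integral_eq_integral) auto
  also have "(LINT x:R|lebesgue. w x) = avg w R * measure lebesgue R" using m(1) by (simp add: avg_def)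
  finally have e: "(\<integral>\<^sup>+x\<in>R. ennreal (w x) \<partial>lebesgue) = ennreal (avg w R * measure lebesgue R)" .
  have "0 \<le> (LINT x:R|lebesgue. w x)" unfolding set_lebesgue_integral_def
    using weightD(1)[OF assms(1)] by (intro integral_nonneg_AE) auto
  then show a: "0 \<le> avg w R" by (simp add: avg_def)
  then show "(\<integral>\<^sup>+x\<in>R. ennreal (w x) \<partial>lebesgue) = ennreal (avg w R) * emeasure lebesgue R"
    using e m by (simp add: ennreal_mult del: measure_completion)
qed

text \<open>From t \<le> Phi_k(t). As a consequence the entropy ratio is at least 1 and lies in the
  domain of \<open>eps\<close>.\<close>

lemma avg_le_lux_norm:
  assumes "weight w" "cube R"
  shows "ennreal (avg w R) \<le> lux_norm (Phi k) w R"
proof -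
  note m = cube_measure[OF assms(2)]
  note w = weightD[OF assms(1)]
  note [measurable] = w(2) m(4)
  have "(\<integral>\<^sup>+x\<in>R. ennreal (w x) \<partial>lebesgue) \<le> emeasure lebesgue R * lux_norm (Phi k) w R"
  proof (rule lux_norm_bound[OF assms(2)])
    show "0 < emeasure lebesgue R" "emeasure lebesgue R < \<infinity>" using m by (auto simp del: measure_completion)
    fix lam :: real assume lam: "lam > 0"
      and le: "(\<integral>\<^sup>+ x \<in> R. ennreal (Phi k (\<bar>w x\<bar> / lam)) \<partial>lebesgue) \<le> emeasure lebesgue R"
    have "(\<integral>\<^sup>+x\<in>R. ennreal (w x) \<partial>lebesgue) \<le> (\<integral>\<^sup>+x. ennreal lam * (ennreal (Phi k (\<bar>w x\<bar> / lam)) * indicator R x) \<partial>lebesgue)"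
    proof (rule nn_integral_mono)
      fix x
      have "w x / lam \<le> Phi k (w x / lam)" using w(1)[of x] lam by (intro Phi_ge) auto
      then have "w x \<le> lam * Phi k (\<bar>w x\<bar> / lam)" using lam w(1)[of x] by (simp add: field_simps)
      then have "ennreal (w x) \<le> ennreal lam * ennreal (Phi k (\<bar>w x\<bar> / lam))"
        using lam by (simp add: ennreal_mult'[symmetric] ennreal_leI)
      then show "ennreal (w x) * indicator R x \<le> ennreal lam * (ennreal (Phi k (\<bar>w x\<bar> / lam)) * indicator R x)"
        by (auto split: split_indicator)
    qed
    also have "\<dots> = ennreal lam * (\<integral>\<^sup>+ x \<in> R. ennreal (Phi k (\<bar>w x\<bar> / lam)) \<partial>lebesgue)"
      by (rule nn_integral_cmult) measurable
    also have "\<dots> \<le> ennreal lam * emeasure lebesgue R" using le by (intro mult_left_mono) auto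
    finally show "(\<integral>\<^sup>+x\<in>R. ennreal (w x) \<partial>lebesgue) \<le> emeasure lebesgue R * ennreal lam" by (simp add: mult.commute)
  qed
  then have "emeasure lebesgue R * ennreal (avg w R) \<le> emeasure lebesgue R * lux_norm (Phi k) w R"
    using nn_integral_weight[OF assms] by (simp add: mult.commute)
  then show ?thesis using m by (subst (asm) ennreal_mult_le_mult_iff) (auto simp del: measure_completion)
qed

text \<open>Separates the conventional values of \<open>Mterm\<close> from the regular case, in
  which the norm of order \<open>k\<close> is the entropy ratio times the average.\<close>

lemma Mterm_cases:
  assumes w: "weight w" and R: "cube R" and e1: "\<forall>s\<ge>1. eps s \<ge> (1::real)"
  obtains "avg w R = 0" | "avg w R > 0" "Mterm eps (Phi m) k w R = \<infinity>"
  | r where "avg w R > 0" "r \<ge> 1" "lux_norm (Phi k) w R = ennreal (r * avg w R)"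
      "Mterm eps (Phi m) k w R = lux_norm (Phi m) w R * ennreal (log 2 (2 + r) * eps r)"
proof (cases "avg w R = 0")
  case False
  then have a: "avg w R > 0" using nn_integral_weight(2)[OF w R] by simp
  show ?thesis
  proof (cases "lux_norm (Phi k) w R = \<infinity>")
    case True
    then show ?thesis using that(2) a by (simp add: Mterm_def)
  next
    case False
    define r where "r = rho k w R"
    have l: "lux_norm (Phi k) w R = ennreal (r * avg w R)"
      using False a by (simp add: r_def rho_def less_top)
    then have "ennreal (avg w R) \<le> ennreal (r * avg w R)" using avg_le_lux_norm[OF w R, of k] by simp
    then have "1 * avg w R \<le> r * avg w R" using a by (subst (asm) ennreal_le_iff2) auto
    then have "r \<ge> 1" using a by (simp only: mult_le_cancel_right_pos)
    then show ?thesis using that(3)[of r] a l False by (simp add: Mterm_def r_def)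
  qed
qed (rule that(1))

text \<open>Both extra factors in the regular case are at least 1, since log_2(2 + r) \<ge> log_2 2
  and eps \<ge> 1.\<close>

lemma lux_norm_le_Mterm:
  assumes w: "weight w" and R: "cube R" and e1: "\<forall>s\<ge>1. eps s \<ge> (1::real)" and a: "avg w R \<noteq> 0"
  shows "lux_norm (Phi m) w R \<le> Mterm eps (Phi m) k w R"
proof (rule Mterm_cases[OF w R e1, where m=m and k=k])
  fix r assume r: "avg w R > 0" "r \<ge> 1" "Mterm eps (Phi m) k w R = lux_norm (Phi m) w R * ennreal (log 2 (2 + r) * eps r)"
  have "log 2 2 \<le> log 2 (2 + r)" using r(2) by (subst log_le_cancel_iff) auto
  then have "1 * 1 \<le> log 2 (2 + r) * eps r" using e1[rule_format, OF r(2)] by (intro mult_mono) auto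
  then have "1 \<le> ennreal (log 2 (2 + r) * eps r)" using ennreal_leI[of 1 "log 2 (2 + r) * eps r"] by simp
  then show ?thesis unfolding r(3) using mult_left_mono[of 1 "ennreal (log 2 (2 + r) * eps r)" "lux_norm (Phi m) w R"] by simp
qed (use a in auto)

lemma weight_le_Mterm:
  assumes w: "weight w" and R: "cube R" and e1: "\<forall>s\<ge>1. eps s \<ge> (1::real)"
  shows "(\<integral>\<^sup>+x\<in>R. ennreal (w x) \<partial>lebesgue) \<le> emeasure lebesgue R * Mterm eps (Phi m) k w R"
proof (cases "avg w R = 0")
  case False
  have "ennreal (avg w R) \<le> Mterm eps (Phi m) k w R"
    using order_trans[OF avg_le_lux_norm[OF w R, of m] lux_norm_le_Mterm[OF w R e1 False, where m=m and k=k]] by simp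
  then show ?thesis unfolding nn_integral_weight(1)[OF w R] mult.commute[of "ennreal (avg w R)"] by (rule mult_left_mono) simp
qed (use nn_integral_weight(1)[OF w R] in simp)

text \<open>The set \<open>F\<close> is so small that v = kap 2^k on \<open>F\<close> is as
  exponentially integrable as X = |b - b_R|, and so is Y = max(X, v) on \<open>F\<close>. This
  permits a trade: X^m \<le> Y^(m+1) / v costs one more logarithm on \<open>w\<close> and gains
  2^(-k), while 1 \<le> Y^m / v^m controls the weight of \<open>F\<close>. The entropy ratio decides
  whether the first trade is made.\<close>

lemma small_set_bounds:
  fixes m :: nat and tau c :: real
  assumes m: "m \<ge> 1" and tau: "tau > 0" "tau \<le> c" and c: "c = ln (3/2) / 2 ^ (DIM('a) + 1)"
  obtains Cw where "Cw > 0" "\<And>(b::'a::euclidean_space \<Rightarrow> real) w R F k eps. bmo1 b \<Longrightarrow> weight w \<Longrightarrow> cube R \<Longrightarrow> F \<in> sets lebesgue \<Longrightarrow> F \<subseteq> R \<Longrightarrow>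
     emeasure lebesgue F \<le> ennreal (9 * exp (- tau * 2 ^ k)) * emeasure lebesgue R \<Longrightarrow> \<forall>s\<ge>1. eps s \<ge> 1 \<Longrightarrow> mono_on {1..} eps \<Longrightarrow>
     (\<integral>\<^sup>+x\<in>F. ennreal (w x * \<bar>b x - avg b R\<bar> ^ m) \<partial>lebesgue) \<le> ennreal (Cw * eta eps k) * emeasure lebesgue R * Mterm eps (Phi m) (m + 1) w R \<and>
     (\<integral>\<^sup>+x\<in>F. ennreal (w x) \<partial>lebesgue) \<le> ennreal (Cw * (1/2) ^ k) * emeasure lebesgue R * Mterm eps (Phi m) (m + 1) w R"
proof -
  have c0: "c > 0" using tau by linarith
  obtain C1 where C1: "C1 > 0" "\<And>(w::'a \<Rightarrow> real) Y R. cube R \<Longrightarrow> (\<And>x. 0 \<le> w x) \<Longrightarrow> w \<in> borel_measurable lebesgue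
    \<Longrightarrow> (\<And>x. 0 \<le> Y x) \<Longrightarrow> Y \<in> borel_measurable lebesgue
    \<Longrightarrow> (\<integral>\<^sup>+x\<in>R. ennreal (exp (c * Y x)) \<partial>lebesgue) \<le> ennreal 17 * emeasure lebesgue R
    \<Longrightarrow> (\<integral>\<^sup>+x\<in>R. ennreal (w x * Y x ^ m) \<partial>lebesgue) \<le> ennreal C1 * emeasure lebesgue R * lux_norm (Phi m) w R"
    by (rule weighted_power_bound[OF c0, of 17 m, where 'a='a]) (simp, erule that, blast)
  obtain C2 where C2: "C2 > 0" "\<And>(w::'a \<Rightarrow> real) Y R. cube R \<Longrightarrow> (\<And>x. 0 \<le> w x) \<Longrightarrow> w \<in> borel_measurable lebesgue
    \<Longrightarrow> (\<And>x. 0 \<le> Y x) \<Longrightarrow> Y \<in> borel_measurable lebesgue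
    \<Longrightarrow> (\<integral>\<^sup>+x\<in>R. ennreal (exp (c * Y x)) \<partial>lebesgue) \<le> ennreal 17 * emeasure lebesgue R
    \<Longrightarrow> (\<integral>\<^sup>+x\<in>R. ennreal (w x * Y x ^ (m + 1)) \<partial>lebesgue) \<le> ennreal C2 * emeasure lebesgue R * lux_norm (Phi (m + 1)) w R"
    by (rule weighted_power_bound[OF c0, of 17 "m + 1", where 'a='a]) (simp, erule that, blast)
  \<comment> \<open>Gives c v = tau 2^k for v = kap 2^k, which matches the exponential smallness of
    \<open>F\<close>.\<close>
  define kap where "kap = tau / c"
  have kap: "kap > 0" using tau c0 by (simp add: kap_def)
  define Cw where "Cw = C1 + C2 / kap + C1 / kap ^ m"
  have parts: "C1 \<le> Cw" "C2 / kap \<le> Cw" "C1 / kap ^ m \<le> Cw" "Cw > 0"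
    using C1(1) C2(1) kap by (auto simp: Cw_def add_pos_pos)
  have main: "(\<integral>\<^sup>+x\<in>F. ennreal (w x * \<bar>b x - avg b R\<bar> ^ m) \<partial>lebesgue) \<le> ennreal (Cw * eta eps k) * emeasure lebesgue R * Mterm eps (Phi m) (m + 1) w R \<and>
     (\<integral>\<^sup>+x\<in>F. ennreal (w x) \<partial>lebesgue) \<le> ennreal (Cw * (1/2) ^ k) * emeasure lebesgue R * Mterm eps (Phi m) (m + 1) w R"
    if b: "bmo1 b" and w: "weight w" and R: "cube R" and F: "F \<in> sets lebesgue" "F \<subseteq> R"
      "emeasure lebesgue F \<le> ennreal (9 * exp (- tau * 2 ^ k)) * emeasure lebesgue R"
      and e1: "\<forall>s\<ge>1. eps s \<ge> 1" and mono: "mono_on {1..} eps"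
    for b w :: "'a \<Rightarrow> real" and R F k eps
  proof -
    note wD = weightD[OF w] and mR = cube_measure[OF R]
    note [measurable] = bmo1_measurable[OF b] wD(2) F(1) mR(4)
    define X where "X x = \<bar>b x - avg b R\<bar>" for x
    have X0: "X x \<ge> 0" for x by (simp add: X_def)
    have Xm [measurable]: "X \<in> borel_measurable lebesgue" unfolding X_def by measurable
    define v where "v = kap * 2 ^ k"
    have v: "v > 0" using kap by (simp add: v_def)
    have cv: "c * v = tau * 2 ^ k" using c0 by (simp add: v_def kap_def)
    define Y where "Y x = max (X x) v * indicator F x" for x
    have Y0: "Y x \<ge> 0" for x using X0[of x] by (simp add: Y_def max_def split: split_indicator)
    have Ym [measurable]: "Y \<in> borel_measurable lebesgue" unfolding Y_def by measurable
    let ?E = "emeasure lebesgue R" and ?Nm = "lux_norm (Phi m) w R" and ?N1 = "lux_norm (Phi (m + 1)) w R" and ?M = "Mterm eps (Phi m) (m + 1) w R"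
    have JN: "(\<integral>\<^sup>+x\<in>R. ennreal (exp (c * X x)) \<partial>lebesgue) \<le> 7 * ?E"
      using John_Nirenberg[OF b R] by (simp add: X_def c)
    then have JN17: "(\<integral>\<^sup>+x\<in>R. ennreal (exp (c * X x)) \<partial>lebesgue) \<le> ennreal 17 * ?E"
      by (rule order_trans) (simp add: mult_right_mono)
    \<comment> \<open>17 = 1 + 7 + 9: the part off \<open>F\<close>, John-Nirenberg for
      \<open>X\<close>, and the constant \<open>v\<close> on \<open>F\<close>.\<close>
    have YE: "(\<integral>\<^sup>+x\<in>R. ennreal (exp (c * Y x)) \<partial>lebesgue) \<le> ennreal 17 * ?E"
    proof -
      have "(\<integral>\<^sup>+x\<in>R. ennreal (exp (c * Y x)) \<partial>lebesgue) \<le>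
        (\<integral>\<^sup>+x. indicator R x + (ennreal (exp (c * X x)) * indicator R x + ennreal (exp (tau * 2 ^ k)) * indicator F x) \<partial>lebesgue)"
      proof (rule nn_integral_mono)
        fix x
        show "ennreal (exp (c * Y x)) * indicator R x \<le> indicator R x + (ennreal (exp (c * X x)) * indicator R x + ennreal (exp (tau * 2 ^ k)) * indicator F x)"
        proof (cases "x \<in> F")
          case True
          have "exp (c * Y x) \<le> exp (c * X x) + exp (tau * 2 ^ k)"
            unfolding cv[symmetric] using True by (cases "X x \<le> v") (auto simp: Y_def max_def)
          then have "ennreal (exp (c * Y x)) \<le> ennreal (exp (c * X x)) + ennreal (exp (tau * 2 ^ k))"
            by (simp add: ennreal_plus[symmetric] ennreal_leI del: ennreal_plus)
          then show ?thesis using True F(2) by (auto intro: order_trans split: split_indicator simp: add_increasing)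
        next
          case False
          then show ?thesis by (auto simp: Y_def split: split_indicator)
        qed
      qed
      also have "\<dots> = ?E + ((\<integral>\<^sup>+x\<in>R. ennreal (exp (c * X x)) \<partial>lebesgue) + ennreal (exp (tau * 2 ^ k)) * emeasure lebesgue F)"
        using F(1) mR(4) by (simp add: nn_integral_add nn_integral_cmult_indicator)
      also have "\<dots> \<le> ?E + (7 * ?E + ennreal (exp (tau * 2 ^ k)) * (ennreal (9 * exp (- tau * 2 ^ k)) * ?E))"
        by (intro add_left_mono add_mono JN mult_left_mono F(3)) simp
      also have "ennreal (exp (tau * 2 ^ k)) * (ennreal (9 * exp (- tau * 2 ^ k)) * ?E) = 9 * ?E"
      proof -
        have "ennreal (exp (tau * 2 ^ k)) * ennreal (9 * exp (- tau * 2 ^ k)) = ennreal (exp (tau * 2 ^ k) * (9 * exp (- tau * 2 ^ k)))"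
          by (rule ennreal_mult'[symmetric]) simp
        also have "exp (tau * 2 ^ k) * (9 * exp (- tau * 2 ^ k)) = 9" by (simp add: exp_minus)
        finally show ?thesis by (simp only: mult.assoc[symmetric] ennreal_numeral)
      qed
      also have "?E + (7 * ?E + 9 * ?E) = 17 * ?E"
        using distrib_right[of 7 9 ?E] distrib_right[of 1 16 ?E] by simp
      finally show ?thesis by simp
    qed
    have a: "(\<integral>\<^sup>+x\<in>F. ennreal (w x * X x ^ m) \<partial>lebesgue) \<le> ennreal C1 * ?E * ?Nm"
    proof -
      have "(\<integral>\<^sup>+x\<in>F. ennreal (w x * X x ^ m) \<partial>lebesgue) \<le> (\<integral>\<^sup>+x\<in>R. ennreal (w x * X x ^ m) \<partial>lebesgue)"
        using F(2) by (intro nn_integral_mono) (auto split: split_indicator)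
      also have "\<dots> \<le> ennreal C1 * ?E * ?Nm" by (intro C1(2) R wD(1,2) X0 Xm JN17)
      finally show ?thesis .
    qed
    have b1: "(\<integral>\<^sup>+x\<in>F. ennreal (w x * X x ^ m) \<partial>lebesgue) \<le> ennreal (1 / v) * (ennreal C2 * ?E * ?N1)"
    proof -
      have "(\<integral>\<^sup>+x\<in>F. ennreal (w x * X x ^ m) \<partial>lebesgue) \<le> (\<integral>\<^sup>+x. ennreal (1 / v) * (ennreal (w x * Y x ^ (m + 1)) * indicator R x) \<partial>lebesgue)"
      proof (rule nn_integral_mono)
        fix x
        show "ennreal (w x * X x ^ m) * indicator F x \<le> ennreal (1 / v) * (ennreal (w x * Y x ^ (m + 1)) * indicator R x)"
        proof (cases "x \<in> F")
          case True
          have "v * X x ^ m \<le> Y x * Y x ^ m" using True v X0[of x] by (intro mult_mono power_mono) (auto simp: Y_def)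
          then have "w x * (v * X x ^ m) \<le> w x * Y x ^ (m + 1)" using wD(1)[of x] by (intro mult_left_mono) auto
          then have "w x * X x ^ m \<le> 1 / v * (w x * Y x ^ (m + 1))" using v by (simp add: field_simps)
          then have "ennreal (w x * X x ^ m) \<le> ennreal (1 / v) * ennreal (w x * Y x ^ (m + 1))"
            using v by (subst ennreal_mult'[symmetric]) (auto intro: ennreal_leI)
          then show ?thesis using True F(2) by auto
        qed simp
      qed
      also have "\<dots> = ennreal (1 / v) * (\<integral>\<^sup>+x\<in>R. ennreal (w x * Y x ^ (m + 1)) \<partial>lebesgue)"
        by (rule nn_integral_cmult) measurable
      also have "\<dots> \<le> ennreal (1 / v) * (ennreal C2 * ?E * ?N1)"
        by (intro mult_left_mono C2(2) R wD(1,2) Y0 Ym YE) simp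
      finally show ?thesis .
    qed
    have c1: "(\<integral>\<^sup>+x\<in>F. ennreal (w x) \<partial>lebesgue) \<le> ennreal (1 / v ^ m) * (ennreal C1 * ?E * ?Nm)"
    proof -
      have "(\<integral>\<^sup>+x\<in>F. ennreal (w x) \<partial>lebesgue) \<le> (\<integral>\<^sup>+x. ennreal (1 / v ^ m) * (ennreal (w x * Y x ^ m) * indicator R x) \<partial>lebesgue)"
      proof (rule nn_integral_mono)
        fix x
        show "ennreal (w x) * indicator F x \<le> ennreal (1 / v ^ m) * (ennreal (w x * Y x ^ m) * indicator R x)"
        proof (cases "x \<in> F")
          case True
          have "v ^ m \<le> Y x ^ m" using True v by (intro power_mono) (auto simp: Y_def)
          then have "w x * v ^ m \<le> w x * Y x ^ m" using wD(1)[of x] by (intro mult_left_mono) auto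
          then have "w x \<le> 1 / v ^ m * (w x * Y x ^ m)" using v by (simp add: field_simps)
          then have "ennreal (w x) \<le> ennreal (1 / v ^ m) * ennreal (w x * Y x ^ m)"
            using v by (subst ennreal_mult'[symmetric]) (auto intro: ennreal_leI)
          then show ?thesis using True F(2) by auto
        qed simp
      qed
      also have "\<dots> = ennreal (1 / v ^ m) * (\<integral>\<^sup>+x\<in>R. ennreal (w x * Y x ^ m) \<partial>lebesgue)"
        by (rule nn_integral_cmult) measurable
      also have "\<dots> \<le> ennreal (1 / v ^ m) * (ennreal C1 * ?E * ?Nm)"
        by (intro mult_left_mono C1(2) R wD(1,2) Y0 Ym YE) simp
      finally show ?thesis .
    qed
    have E0: "?E > 0" using mR by (simp del: measure_completion)
    have et: "eta eps k > 0" by (rule eta_nonneg[OF e1])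
    show ?thesis
    proof (rule Mterm_cases[OF w R e1, where m=m and k="m + 1"])
      \<comment> \<open>\<open>Mterm\<close> is 0 by convention; the left sides vanish too, because
        \<open>w\<close> = 0 almost everywhere on \<open>R\<close>.\<close>
      assume "avg w R = 0"
      then have "(\<integral>\<^sup>+x\<in>R. ennreal (w x) \<partial>lebesgue) = 0" using nn_integral_weight(1)[OF w R] by simp
      then have "AE x in lebesgue. ennreal (w x) * indicator R x = 0" by (subst (asm) nn_integral_0_iff_AE) auto
      then have w0: "AE x in lebesgue. x \<in> F \<longrightarrow> w x = 0"
        by eventually_elim (use F(2) wD(1) in \<open>auto simp: ennreal_eq_0_iff antisym split: split_indicator_asm\<close>)
      have "(\<integral>\<^sup>+x\<in>F. ennreal (w x * u x) \<partial>lebesgue) = (\<integral>\<^sup>+(x::'a). 0 \<partial>lebesgue)" for u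
        by (rule nn_integral_cong_AE) (use w0 in \<open>auto split: split_indicator\<close>)
      from this[of "\<lambda>x. \<bar>b x - avg b R\<bar> ^ m"] this[of "\<lambda>x. 1"] show ?thesis by simp
    next
      assume "?M = \<infinity>"
      then show ?thesis using E0 et parts(4) by (simp add: ennreal_mult_top ennreal_mult_eq_top_iff)
    next
      fix r assume r: "avg w R > 0" "r \<ge> 1" "?N1 = ennreal (r * avg w R)" "?M = ?Nm * ennreal (log 2 (2 + r) * eps r)"
      have NM: "?Nm \<le> ?M" by (rule lux_norm_le_Mterm[OF w R e1]) (use r in simp)
      let ?h = "k div 2"
      have "(\<integral>\<^sup>+x\<in>F. ennreal (w x * X x ^ m) \<partial>lebesgue) \<le> ennreal (Cw * eta eps k) * ?E * ?M"
      \<comment> \<open>Large ratio: no trade, since \<open>eta\<close> times log_2(2 + r) eps(r) is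
        at least 1. Small ratio: the trade leaves a multiple of r / 2^k \<le> 2^(h-k) times the
        average of \<open>w\<close>.\<close>
      proof (cases "2 ^ ?h \<le> r")
        case True
        have "real ?h = log 2 (2 ^ ?h)" by simp
        also have "\<dots> \<le> log 2 (2 + r)" using True r(2) by (subst log_le_cancel_iff) auto
        finally have "real ?h \<le> log 2 (2 + r)" .
        moreover have "log 2 2 \<le> log 2 (2 + r)" using r(2) by (subst log_le_cancel_iff) auto
        ultimately have lg: "max 1 (real ?h) \<le> log 2 (2 + r)" by simp
        have ep: "eps (2 ^ ?h) \<le> eps r" using True r(2) by (intro mono_onD[OF mono]) (auto intro: one_le_power)
        have ep1: "1 \<le> eps (2 ^ ?h)" by (rule e1[rule_format]) (simp add: one_le_power)
        let ?z = "max 1 (real ?h) * eps (2 ^ ?h)"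
        have z: "?z > 0" using ep1 by (intro mult_pos_pos) auto
        have "1 = 1 / y * y" if "y > 0" for y :: real using that by simp
        from this[OF z] have "1 = 1 / ?z * ?z" .
        also have "\<dots> \<le> eta eps k * (log 2 (2 + r) * eps r)"
          using lg ep ep1 z by (intro mult_mono) (auto simp: eta_def)
        finally have "1 \<le> ennreal (eta eps k * (log 2 (2 + r) * eps r))"
          using ennreal_leI[of 1 "eta eps k * (log 2 (2 + r) * eps r)"] by simp
        then have "?Nm * 1 \<le> ?Nm * ennreal (eta eps k * (log 2 (2 + r) * eps r))" by (intro mult_left_mono) auto
        also have "\<dots> = ennreal (eta eps k) * ?M" 
        proof -
          have "ennreal (eta eps k * (log 2 (2 + r) * eps r)) = ennreal (eta eps k) * ennreal (log 2 (2 + r) * eps r)"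
            using et by (intro ennreal_mult') simp
          then show ?thesis unfolding r(4) by (simp only: mult_ac)
        qed
        finally have "?Nm \<le> ennreal (eta eps k) * ?M" by simp
        then have "ennreal C1 * ?E * ?Nm \<le> ennreal Cw * ?E * (ennreal (eta eps k) * ?M)"
          using parts(1) by (intro mult_mono ennreal_leI) auto
        also have "\<dots> = ennreal (Cw * eta eps k) * ?E * ?M" using et parts(4) by (simp add: ennreal_mult mult_ac)
        finally show ?thesis using a by (rule order_trans[rotated])
      next
        case False
        have "ennreal (1 / v) * (ennreal C2 * ?E * ?N1) = ennreal (C2 / v * r) * ?E * ennreal (avg w R)"
          unfolding r(3) using v C2(1) r(1,2) by (simp add: ennreal_mult divide_inverse mult_ac)
        also have "\<dots> \<le> ennreal (Cw * eta eps k) * ?E * ?M"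
        proof (rule mult_mono[OF mult_mono[OF ennreal_leI order_refl]])
          have "C2 / v * r \<le> C2 / v * 2 ^ ?h" using False C2(1) v by (intro mult_left_mono) auto
          also have "\<dots> = C2 / kap * (2 ^ ?h / 2 ^ k)" by (simp add: v_def)
          also have "(2::real) ^ ?h / 2 ^ k = (1/2) ^ (k - ?h)" by (simp add: power_diff power_one_over field_simps)
          also have "C2 / kap * (1/2) ^ (k - ?h) \<le> Cw * eta eps k"
          proof (intro mult_mono parts)
            have "1 \<le> eps (2 ^ ?h)" by (rule e1[rule_format]) (simp add: one_le_power)
            then show "(1/2) ^ (k - ?h) \<le> eta eps k" unfolding eta_def by (intro add_increasing divide_nonneg_nonneg mult_nonneg_nonneg) auto
          qed (use parts in auto)
          finally show "C2 / v * r \<le> Cw * eta eps k" .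
          show "ennreal (avg w R) \<le> ?M" using avg_le_lux_norm[OF w R, of m] NM by (rule order_trans)
        qed auto
        finally show ?thesis using b1 by (rule order_trans[rotated])
      qed
      moreover have "(\<integral>\<^sup>+x\<in>F. ennreal (w x) \<partial>lebesgue) \<le> ennreal (Cw * (1/2) ^ k) * ?E * ?M"
      proof -
        have "ennreal (1 / v ^ m) * (ennreal C1 * ?E * ?Nm) = ennreal (C1 / v ^ m) * ?E * ?Nm"
          using v C1(1) by (simp add: ennreal_mult divide_inverse mult_ac)
        also have "\<dots> \<le> ennreal (Cw * (1/2) ^ k) * ?E * ?M"
        proof (intro mult_mono ennreal_leI order_refl NM)
          \<comment> \<open>Here m \<ge> 1 enters: v^(-m) decays at least like 2^(-k).\<close>
          have "(2::real) ^ k \<le> (2 ^ k) ^ m" using power_increasing[of 1 m "(2::real) ^ k"] m by (simp add: one_le_power)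
          then have "C1 / v ^ m \<le> C1 / (kap ^ m * 2 ^ k)"
            unfolding v_def power_mult_distrib using C1(1) kap by (intro divide_left_mono mult_left_mono mult_pos_pos) auto
          also have "\<dots> = C1 / kap ^ m * (1/2) ^ k" by (simp add: power_one_over field_simps)
          also have "\<dots> \<le> Cw * (1/2) ^ k" using parts by (intro mult_right_mono) auto
          finally show "C1 / v ^ m \<le> Cw * (1/2) ^ k" .
        qed auto
        finally show ?thesis using c1 by (rule order_trans[rotated])
      qed
      ultimately show ?thesis by (simp add: X_def)
    qed
  qed
  show ?thesis by (rule that[OF parts(4)], rule main)
qed

section \<open>Sorting a sparse sum by the size of its averages\<close>

lemma nn_integral_count_space_subset:
  assumes "A \<subseteq> S"
  shows "(\<integral>\<^sup>+p. h p * indicator A p \<partial>count_space S) = (\<integral>\<^sup>+p. h p \<partial>count_space A)"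
  using assms by (subst (1 2) nn_integral_count_space_indicator) (auto intro!: nn_integral_cong split: split_indicator)

lemma exists_level:
  fixes i t :: real assumes "0 < i" "i < 1" "0 < t" "t \<le> 1"
  obtains k where "i ^ Suc k < t" "t \<le> i ^ k"
proof -
  obtain n where "i ^ n < t" using real_arch_pow_inv[OF assms(3,2)] by blast
  then have ex: "\<exists>n. i ^ Suc n < t"
    using assms by (intro exI[of _ n]) (auto intro: le_less_trans[OF mult_left_le_one_le])
  define k where "k = (LEAST n. i ^ Suc n < t)"
  have k1: "i ^ Suc k < t" unfolding k_def using ex by (rule LeastI_ex)
  have k2: "t \<le> i ^ k"
  proof (cases k)
    case 0
    then show ?thesis using assms by simp
  next
    case (Suc j)
    then have "\<not> i ^ Suc j < t" using not_less_Least[of j "\<lambda>n. i ^ Suc n < t"] by (simp add: k_def)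
    then show ?thesis using Suc by simp
  qed
  show ?thesis by (rule that[OF k1 k2])
qed

text \<open>At points off the exceptional sets, at most \<open>u k\<close> cubes of level
  \<open>k\<close> meet at \<open>x\<close> and each contributes at most i^k z_k, so these terms add
  up to at most 2 th. \<open>gam\<close> and \<open>Z\<close> stay abstract because both halves of
  \<open>Bterm\<close> are split in this way, with Z = |b - b_R|^m and Z = 1.\<close>

lemma level_split:
  fixes G :: "nat \<Rightarrow> ('a::euclidean_space \<times> real) set" and gam Z :: "nat \<times> 'a \<times> real \<Rightarrow> real"
  assumes G: "sparse_gens G" and i: "0 < i" "i < 1" and th: "th \<ge> 0"
    and gam: "\<And>p. 0 \<le> gam p" "\<And>p. p \<in> Sigma UNIV G \<Longrightarrow> x \<in> hcube (snd p) \<Longrightarrow> gam p \<le> 1" and Z: "\<And>p. 0 \<le> Z p"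
    and F: "\<And>k p. p \<in> Sigma UNIV G \<Longrightarrow> x \<in> hcube (snd p) \<Longrightarrow> x \<notin> F k p \<Longrightarrow> Z p \<le> z k \<and> x \<notin> gen_union G (fst p + u k)"
    and z: "\<And>k. 0 \<le> z k" "\<And>k. i ^ k * z k * real (u k) \<le> th * (1/2) ^ k"
  shows "(\<integral>\<^sup>+p. ennreal (gam p * Z p) * indicator (hcube (snd p)) x \<partial>count_space (Sigma UNIV G))
    \<le> ennreal (2 * th) + (\<Sum>k. \<integral>\<^sup>+p. ennreal (i ^ k * Z p) * indicator (F k p) x \<partial>count_space {p \<in> Sigma UNIV G. i ^ Suc k < gam p \<and> gam p \<le> i ^ k})"
proof -
  let ?S = "Sigma UNIV G"
  define A where "A k = {p \<in> ?S. i ^ Suc k < gam p \<and> gam p \<le> i ^ k}" for k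
  have AS: "A k \<subseteq> ?S" for k by (auto simp: A_def)
  define t1 where "t1 k p = ennreal (i ^ k * z k) * indicator (hcube (snd p) - gen_union G (fst p + u k)) x" for k p
  define t2 where "t2 k p = ennreal (i ^ k * Z p) * indicator (F k p) x" for k p
  have "(\<integral>\<^sup>+p. ennreal (gam p * Z p) * indicator (hcube (snd p)) x \<partial>count_space ?S)
     \<le> (\<integral>\<^sup>+p. (\<Sum>k. (t1 k p + t2 k p) * indicator (A k) p) \<partial>count_space ?S)"
  proof (rule nn_integral_mono)
    fix p assume "p \<in> space (count_space ?S)"
    then have p: "p \<in> ?S" by simp
    show "ennreal (gam p * Z p) * indicator (hcube (snd p)) x \<le> (\<Sum>k. (t1 k p + t2 k p) * indicator (A k) p)"
    proof (cases "x \<in> hcube (snd p) \<and> gam p > 0")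
      case True
      then obtain k where k: "i ^ Suc k < gam p" "gam p \<le> i ^ k"
        using exists_level[OF i, of "gam p"] gam(2)[OF p] by blast
      have "p \<in> A k" using p k by (simp add: A_def)
      have "ennreal (gam p * Z p) \<le> ennreal (i ^ k * Z p)"
        using k Z[of p] by (intro ennreal_leI mult_right_mono)
      also have "\<dots> \<le> t1 k p + t2 k p"
      proof (cases "x \<in> F k p")
        case True
        then show ?thesis by (simp add: t2_def)
      next
        case False
        then have f: "Z p \<le> z k" "x \<notin> gen_union G (fst p + u k)" using F[OF p] True by auto
        then have "ennreal (i ^ k * Z p) \<le> ennreal (i ^ k * z k)" using i by (intro ennreal_leI mult_left_mono) auto
        then show ?thesis using True f by (simp add: t1_def add_increasing2)
      qed
      finally have "ennreal (gam p * Z p) * indicator (hcube (snd p)) x \<le> (t1 k p + t2 k p) * indicator (A k) p"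
        using \<open>p \<in> A k\<close> True by simp
      also have "\<dots> \<le> (\<Sum>k. (t1 k p + t2 k p) * indicator (A k) p)" by (rule le_suminf_ennreal)
      finally show ?thesis .
    next
      case False
      then have "gam p = 0 \<or> x \<notin> hcube (snd p)" using gam(1)[of p] by auto
      then show ?thesis by auto
    qed
  qed
  also have "\<dots> = (\<Sum>k. \<integral>\<^sup>+p. (t1 k p + t2 k p) * indicator (A k) p \<partial>count_space ?S)"
    by (rule nn_integral_suminf) simp
  also have "\<dots> = (\<Sum>k. \<integral>\<^sup>+p. t1 k p + t2 k p \<partial>count_space (A k))"
    using AS by (simp add: nn_integral_count_space_subset)
  also have "\<dots> \<le> (\<Sum>k. ennreal (th * (1/2) ^ k) + (\<integral>\<^sup>+p. t2 k p \<partial>count_space (A k)))"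
  proof (intro suminf_le summableI)
    fix k
    have "(\<integral>\<^sup>+p. t1 k p + t2 k p \<partial>count_space (A k)) = (\<integral>\<^sup>+p. t1 k p \<partial>count_space (A k)) + (\<integral>\<^sup>+p. t2 k p \<partial>count_space (A k))"
      by (rule nn_integral_add) auto
    also have "(\<integral>\<^sup>+p. t1 k p \<partial>count_space (A k)) = ennreal (i ^ k * z k) * (\<integral>\<^sup>+p. indicator (hcube (snd p) - gen_union G (fst p + u k)) x \<partial>count_space (A k))"
      unfolding t1_def by (rule nn_integral_cmult) simp
    also have "\<dots> \<le> ennreal (i ^ k * z k) * of_nat (u k)"
      by (intro mult_left_mono sparse_overlap[OF G AS]) simp
    also have "\<dots> = ennreal (i ^ k * z k * real (u k))"
      using i z(1)[of k] by (simp add: ennreal_mult ennreal_of_nat_eq_real_of_nat)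
    also have "\<dots> \<le> ennreal (th * (1/2) ^ k)" by (intro ennreal_leI z(2))
    finally show "(\<integral>\<^sup>+p. t1 k p + t2 k p \<partial>count_space (A k)) \<le> ennreal (th * (1/2) ^ k) + (\<integral>\<^sup>+p. t2 k p \<partial>count_space (A k))"
      by (simp add: add_right_mono)
  qed
  also have "\<dots> = (\<Sum>k. ennreal (th * (1/2) ^ k)) + (\<Sum>k. \<integral>\<^sup>+p. t2 k p \<partial>count_space (A k))"
    by (intro suminf_add[symmetric] summableI)
  also have "(\<Sum>k. ennreal (th * (1/2) ^ k)) = ennreal (2 * th)"
  proof (rule suminf_ennreal_eq)
    show "(\<lambda>k. th * (1/2) ^ k) sums (2 * th)"
      using sums_mult[OF geometric_sums[of "1/2::real"], of th] by (simp add: mult.commute)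
  qed (use th in simp)
  finally show ?thesis by (simp add: t2_def A_def)
qed

text \<open>\<open>K\<close> is the cost of a cube and \<open>lam\<close> the lower bound for the
  averages of \<open>g\<close>; their ratio is all that a level retains. The power of 4 n + 1
  converts dilates back into the cubes for which packing holds.\<close>

lemma sparse_weighted_sum:
  fixes G :: "nat \<Rightarrow> ('a::euclidean_space \<times> real) set" and zz :: "nat \<times> 'a \<times> real \<Rightarrow> ennreal"
  assumes G: "sparse_gens G" and A: "A \<subseteq> Sigma UNIV G" and lam: "lam > 0" and g: "g \<in> borel_measurable lebesgue"
    and le: "\<And>p. p \<in> A \<Longrightarrow> ennreal lam * emeasure lebesgue (dcube (snd p)) \<le> (\<integral>\<^sup>+x\<in>dcube (snd p). g x \<partial>lebesgue)"
    and K: "K \<ge> 0" and zz: "\<And>p. p \<in> A \<Longrightarrow> zz p \<le> ennreal K * emeasure lebesgue (dcube (snd p)) * Mterm eps (Phi m) k w (dcube (snd p))"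
    and C: "C = 2 * unit_ball_vol (real DIM('a)) * (5 * (real DIM('a) * (4 * real DIM('a) + 2))) ^ DIM('a)"
  shows "(\<integral>\<^sup>+p. zz p \<partial>count_space A) \<le> ennreal (K / lam * ((4 * real DIM('a) + 1) ^ DIM('a) * C)) * (\<integral>\<^sup>+x. g x * M_eps eps (Phi m) k w x \<partial>lebesgue)"
proof -
  let ?a = "(4 * real DIM('a) + 1) ^ DIM('a)"
  have a: "?a \<ge> 0" by simp
  have C0: "C \<ge> 0" using unit_ball_vol_DIM_pos[where 'a='a] unfolding C by (intro mult_nonneg_nonneg) auto
  have pos: "snd (snd p) > 0" if "p \<in> A" for p using A that sparse_gensD(3)[OF G] by auto
  have "(\<integral>\<^sup>+p. zz p \<partial>count_space A) \<le> (\<integral>\<^sup>+p. ennreal (K / lam * ?a) * (ennreal lam * emeasure lebesgue (hcube (snd p)) * Mterm eps (Phi m) k w (dcube (snd p))) \<partial>count_space A)"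
  proof (rule nn_integral_mono)
    fix p assume "p \<in> space (count_space A)"
    then have p: "p \<in> A" by simp
    have "ennreal K * ennreal ?a = ennreal (K / lam * ?a) * ennreal lam"
      using K lam a by (simp add: ennreal_mult'[symmetric] ennreal_mult''[symmetric])
    then have "ennreal K * (ennreal ?a * emeasure lebesgue (hcube (snd p))) * Mterm eps (Phi m) k w (dcube (snd p)) =
       ennreal (K / lam * ?a) * (ennreal lam * emeasure lebesgue (hcube (snd p)) * Mterm eps (Phi m) k w (dcube (snd p)))"
      by (simp only: mult.assoc[symmetric])
    then show "zz p \<le> ennreal (K / lam * ?a) * (ennreal lam * emeasure lebesgue (hcube (snd p)) * Mterm eps (Phi m) k w (dcube (snd p)))"
      using zz[OF p] by (simp only: emeasure_dcube[OF pos[OF p]])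
  qed
  also have "\<dots> = ennreal (K / lam * ?a) * (\<integral>\<^sup>+p. ennreal lam * emeasure lebesgue (hcube (snd p)) * Mterm eps (Phi m) k w (dcube (snd p)) \<partial>count_space A)"
    by (rule nn_integral_cmult) simp
  also have "\<dots> \<le> ennreal (K / lam * ?a) * (ennreal C * (\<integral>\<^sup>+x. g x * M_eps eps (Phi m) k w x \<partial>lebesgue))"
  proof (intro mult_left_mono sparse_sum_le[OF G A lam g le _ C])
    fix p x assume p: "p \<in> A" and x: "x \<in> dcube (snd p)"
    have "cube (dcube (snd p))" using pos[OF p] by (intro cube_ccube snd_dilate)
    then show "Mterm eps (Phi m) k w (dcube (snd p)) \<le> M_eps eps (Phi m) k w x"
      unfolding M_eps_def using x by (intro SUP_upper) auto
  qed auto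
  also have "\<dots> = ennreal (K / lam * (?a * C)) * (\<integral>\<^sup>+x. g x * M_eps eps (Phi m) k w x \<partial>lebesgue)"
    using K lam a C0 by (simp add: mult.assoc[symmetric] ennreal_mult[symmetric])
  finally show ?thesis .
qed

text \<open>The factor 2 compensates for rounding down the exponent.\<close>

lemma half_power_floor_le: "(1/2::real) ^ nat \<lfloor>y\<rfloor> \<le> 2 * exp (- (y * ln 2))" if "y \<ge> 0"
proof -
  have "y - 1 \<le> real (nat \<lfloor>y\<rfloor>)" using that by linarith
  then have "(y - 1) * ln 2 \<le> real (nat \<lfloor>y\<rfloor>) * ln 2" by (intro mult_right_mono) auto
  then have "exp (- (real (nat \<lfloor>y\<rfloor>) * ln 2)) \<le> exp (- ((y - 1) * ln 2))" by simp
  moreover have "exp (- (real (nat \<lfloor>y\<rfloor>) * ln 2)) = (1/2) ^ nat \<lfloor>y\<rfloor>"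
    by (simp add: exp_minus exp_of_nat_mult power_one_over inverse_eq_divide)
  moreover have "exp (- ((y - 1) * ln 2)) = 2 * exp (- (y * ln 2))"
  proof -
    have "- ((y - 1) * ln 2) = ln 2 + (- (y * ln 2))" by (simp add: algebra_simps)
    then show ?thesis by (simp only: exp_add) simp
  qed
  ultimately show ?thesis by simp
qed

text \<open>A point is exceptional for two reasons: it survives th 2^k further generations (rounded
  down), which sparse decay makes exponentially rare, or the oscillation exceeds 2^k, which
  Chebyshev and John-Nirenberg make exponentially rare. The 9 is 2 from rounding plus 7 from
  John-Nirenberg.\<close>

lemma exceptional_part_small:
  fixes G :: "nat \<Rightarrow> ('a::euclidean_space \<times> real) set" and b :: "'a \<Rightarrow> real"
  assumes G: "sparse_gens G" and p: "p \<in> Sigma UNIV G" and b: "bmo1 b" and th: "th > 0"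
    and c: "c = ln (3/2) / 2 ^ (DIM('a) + 1)" and tau: "tau \<le> c" "tau \<le> th * ln 2"
    and F: "F = (hcube (snd p) \<inter> gen_union G (fst p + nat \<lfloor>th * 2 ^ k\<rfloor>)) \<union> {x \<in> hcube (snd p). 2 ^ k < \<bar>b x - avg b (dcube (snd p))\<bar>}"
  shows "F \<in> sets lebesgue" "F \<subseteq> dcube (snd p)"
    "emeasure lebesgue F \<le> ennreal (9 * exp (- tau * 2 ^ k)) * emeasure lebesgue (dcube (snd p))"
proof -
  let ?q = "snd p" and ?R = "dcube (snd p)"
  let ?V = "gen_union G (fst p + nat \<lfloor>th * 2 ^ k\<rfloor>)" and ?X = "\<lambda>x. \<bar>b x - avg b ?R\<bar>"
  have q: "snd ?q > 0" "?q \<in> G (fst p)" using p sparse_gensD(3)[OF G] by auto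
  have R: "cube ?R" using q(1) by (intro cube_ccube snd_dilate)
  note mR = cube_measure[OF R]
  note [measurable] = bmo1_measurable[OF b] mR(4)
  have c0: "c > 0" by (simp add: c)
  have "{x. 2 ^ k < ?X x} \<in> sets lebesgue" by (rule sets_Collect_gt_lebesgue) measurable
  then have "hcube ?q \<inter> {x. 2 ^ k < ?X x} \<in> sets lebesgue" by auto
  moreover have "hcube ?q \<inter> {x. 2 ^ k < ?X x} = {x \<in> hcube ?q. 2 ^ k < ?X x}" by auto
  ultimately have m2: "{x \<in> hcube ?q. 2 ^ k < ?X x} \<in> sets lebesgue" by (simp only:)
  have m1: "hcube ?q \<inter> ?V \<in> sets lebesgue" using gen_union_sets[OF G] by auto
  show "F \<in> sets lebesgue" unfolding F using m1 m2 by auto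
  show "F \<subseteq> ?R" unfolding F using hcube_subset_dcube[OF q(1)] by auto
  have hR: "emeasure lebesgue (hcube ?q) \<le> emeasure lebesgue ?R"
    using hcube_subset_dcube[OF q(1)] by (intro emeasure_mono) auto
  have e1: "emeasure lebesgue (hcube ?q \<inter> ?V) \<le> ennreal (2 * exp (- tau * 2 ^ k)) * emeasure lebesgue ?R"
  proof -
    have "tau * 2 ^ k \<le> th * ln 2 * 2 ^ k" using tau(2) by (intro mult_right_mono) auto
    then have "exp (- (th * 2 ^ k * ln 2)) \<le> exp (- tau * 2 ^ k)" by (simp add: mult_ac)
    moreover have "(1/2) ^ nat \<lfloor>th * 2 ^ k\<rfloor> \<le> 2 * exp (- (th * 2 ^ k * ln 2))" using th by (intro half_power_floor_le) simp
    ultimately have h: "(1/2) ^ nat \<lfloor>th * 2 ^ k\<rfloor> \<le> 2 * exp (- tau * 2 ^ k)" by linarith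
    have "emeasure lebesgue (hcube ?q \<inter> ?V) \<le> ennreal ((1/2) ^ nat \<lfloor>th * 2 ^ k\<rfloor>) * emeasure lebesgue (hcube ?q)"
      by (rule sparse_decay[OF G q(2)])
    also have "\<dots> \<le> ennreal (2 * exp (- tau * 2 ^ k)) * emeasure lebesgue ?R"
      by (intro mult_mono ennreal_leI h hR) auto
    finally show ?thesis .
  qed
  have e2: "emeasure lebesgue {x \<in> hcube ?q. 2 ^ k < ?X x} \<le> ennreal (7 * exp (- tau * 2 ^ k)) * emeasure lebesgue ?R"
  proof -
    have "{x \<in> hcube ?q. 2 ^ k < ?X x} \<subseteq> {x \<in> ?R. exp (c * 2 ^ k) < exp (c * ?X x)}"
      using hcube_subset_dcube[OF q(1)] c0 by auto
    moreover have "{x \<in> ?R. exp (c * 2 ^ k) < exp (c * ?X x)} \<in> sets lebesgue"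
    proof -
      have "?R \<inter> {x. exp (c * 2 ^ k) < exp (c * ?X x)} \<in> sets lebesgue"
        using mR(4) by (intro sets.Int sets_Collect_gt_lebesgue) measurable
      moreover have "?R \<inter> {x. exp (c * 2 ^ k) < exp (c * ?X x)} = {x \<in> ?R. exp (c * 2 ^ k) < exp (c * ?X x)}" by auto
      ultimately show ?thesis by (simp only:)
    qed
    ultimately have "emeasure lebesgue {x \<in> hcube ?q. 2 ^ k < ?X x} \<le> emeasure lebesgue {x \<in> ?R. exp (c * 2 ^ k) < exp (c * ?X x)}"
      by (intro emeasure_mono)
    also have "\<dots> \<le> ennreal (1 / exp (c * 2 ^ k)) * (\<integral>\<^sup>+x\<in>?R. ennreal (exp (c * ?X x)) \<partial>lebesgue)"
      using mR(4) by (intro emeasure_gt_le) measurable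
    also have "\<dots> \<le> ennreal (1 / exp (c * 2 ^ k)) * (7 * emeasure lebesgue ?R)"
      unfolding c by (intro mult_left_mono John_Nirenberg[OF b R]) simp
    also have "\<dots> = ennreal (7 * exp (- c * 2 ^ k)) * emeasure lebesgue ?R"
    proof -
      have "7 * exp (- c * 2 ^ k) = 1 / exp (c * 2 ^ k) * 7" by (simp add: exp_minus inverse_eq_divide)
      then have "ennreal (7 * exp (- c * 2 ^ k)) = ennreal (1 / exp (c * 2 ^ k)) * 7"
        by (simp only:) (subst ennreal_mult, auto)
      then show ?thesis by (simp add: mult.assoc)
    qed
    also have "\<dots> \<le> ennreal (7 * exp (- tau * 2 ^ k)) * emeasure lebesgue ?R"
      using tau(1) by (intro mult_right_mono ennreal_leI) auto
    finally show ?thesis .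
  qed
  have "emeasure lebesgue F \<le> ennreal (2 * exp (- tau * 2 ^ k)) * emeasure lebesgue ?R + ennreal (7 * exp (- tau * 2 ^ k)) * emeasure lebesgue ?R"
    unfolding F using m1 m2 e1 e2 by (intro order_trans[OF emeasure_subadditive] add_mono)
  also have "\<dots> = ennreal (9 * exp (- tau * 2 ^ k)) * emeasure lebesgue ?R"
  proof -
    have "9 * exp (- tau * 2 ^ k) = 2 * exp (- tau * 2 ^ k) + 7 * exp (- tau * 2 ^ k)" by simp
    then have "ennreal (9 * exp (- tau * 2 ^ k)) = ennreal (2 * exp (- tau * 2 ^ k)) + ennreal (7 * exp (- tau * 2 ^ k))"
      by (simp only:) (subst ennreal_plus, auto)
    then show ?thesis by (simp only: distrib_right)
  qed
  finally show "emeasure lebesgue F \<le> ennreal (9 * exp (- tau * 2 ^ k)) * emeasure lebesgue ?R" .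
qed

text \<open>The polynomial is absorbed by a multiple of (4/3)^k, which leaves the ratio 4/3 * 1/2 =
  2/3.\<close>

lemma summable_poly_geometric: "summable (\<lambda>k. (real k + 1) ^ m * (1/2) ^ k)"
proof -
  obtain K :: real where K: "K > 0" "\<And>y. y \<ge> 0 \<Longrightarrow> y ^ m \<le> K * exp (ln (4/3) * y)"
    using power_le_exp_mult[of "ln (4/3)" m] by auto
  have "norm ((real k + 1) ^ m * (1/2) ^ k) \<le> (K * (4/3)) * (2/3) ^ k" for k
  proof -
    have "exp (ln (4/3) * (real k + 1)) = exp (real (Suc k) * ln (4/3))" by (simp add: algebra_simps)
    also have "\<dots> = exp (ln (4/3)) ^ Suc k" by (rule exp_of_nat_mult)
    also have "exp (ln (4/3)) = (4/3::real)" by simp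
    finally have eq: "exp (ln (4/3) * (real k + 1)) = (4/3) ^ Suc k" .
    have "(real k + 1) ^ m \<le> K * exp (ln (4/3) * (real k + 1))" by (rule K(2)) simp
    then have "(real k + 1) ^ m \<le> K * (4/3) ^ Suc k" unfolding eq .
    then have "(real k + 1) ^ m * (1/2) ^ k \<le> (K * (4/3) ^ Suc k) * (1/2) ^ k" by (intro mult_right_mono) auto
    also have "\<dots> = (K * (4/3)) * ((4/3) ^ k * (1/2) ^ k)" by simp
    also have "(4/3) ^ k * (1/2) ^ k = (2/3::real) ^ k" by (simp add: power_mult_distrib[symmetric])
    finally show ?thesis by simp
  qed
  then have 1: "\<forall>\<^sub>F k in sequentially. norm ((real k + 1) ^ m * (1/2) ^ k) \<le> (K * (4/3)) * (2/3) ^ k" by simp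
  have "summable (\<lambda>k. (K * (4/3)) * (2/3::real) ^ k)" by (intro summable_mult summable_geometric) auto
  then show ?thesis by (rule summable_comparison_test_ev[OF 1])
qed

section \<open>The weighted weak-type estimate\<close>

lemma nn_integral_weighted_count_space:
  fixes W :: "'a \<Rightarrow> ennreal" and h :: "'i \<Rightarrow> 'a \<Rightarrow> ennreal"
  assumes "countable A" "W \<in> borel_measurable M" "\<And>p. p \<in> A \<Longrightarrow> h p \<in> borel_measurable M"
  shows "(\<integral>\<^sup>+x. W x * (\<integral>\<^sup>+p. h p x \<partial>count_space A) \<partial>M) = (\<integral>\<^sup>+p. (\<integral>\<^sup>+x. W x * h p x \<partial>M) \<partial>count_space A)"
proof -
  have "(\<integral>\<^sup>+x. W x * (\<integral>\<^sup>+p. h p x \<partial>count_space A) \<partial>M) = (\<integral>\<^sup>+x. (\<integral>\<^sup>+p. W x * h p x \<partial>count_space A) \<partial>M)"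
    by (intro nn_integral_cong nn_integral_cmult[symmetric]) simp
  also have "\<dots> = (\<integral>\<^sup>+p. (\<integral>\<^sup>+x. W x * h p x \<partial>M) \<partial>count_space A)"
    using assms by (intro nn_integral_count_space_nn_integral) auto
  finally show ?thesis .
qed

lemma borel_measurable_count_space_integral:
  fixes h :: "'i \<Rightarrow> 'a \<Rightarrow> ennreal"
  assumes "countable A" "\<And>p. p \<in> A \<Longrightarrow> h p \<in> borel_measurable M"
  shows "(\<lambda>x. \<integral>\<^sup>+p. h p x \<partial>count_space A) \<in> borel_measurable M"
proof (cases "A = {}")
  case False
  interpret sigma_finite_measure "count_space A" using assms(1) by (rule sigma_finite_measure_count_space_countable)
  have "(\<lambda>(p, x). h p x) \<in> borel_measurable (count_space A \<Otimes>\<^sub>M M)"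
    using assms by (intro measurable_pair_measure_countable1) auto
  from measurable_pair_swap[OF this] have "(\<lambda>(x, p). h p x) \<in> borel_measurable (M \<Otimes>\<^sub>M count_space A)" by simp
  then show ?thesis by (rule borel_measurable_nn_integral)
qed (simp add: nn_integral_count_space_finite)

context CZ begin

text \<open>The constant is chosen before \<open>q0\<close> and the bound \<open>B\<close> of
  \<open>f\<close>, as exhausting space by cubes requires. Cubes with an average above 1 belong to
  no level and are paid for with their whole weight. The others are layered, and their ordinary
  parts use up only half of the height.\<close>

lemma normalized_estimate:
  fixes m :: nat
  assumes m: "m \<ge> 1"
  obtains C where "C > 0" "\<And>b w eps f B q0. bmo1 b \<Longrightarrow> weight w \<Longrightarrow> \<forall>s\<ge>1. eps s \<ge> 1 \<Longrightarrow> mono_on {1..} eps \<Longrightarrow>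
    summable (\<lambda>r::nat. 1 / eps (2 ^ (2 ^ r))) \<Longrightarrow> f \<in> borel_measurable lebesgue \<Longrightarrow> \<forall>x. norm (f x) \<le> B \<Longrightarrow>
    snd q0 > 0 \<Longrightarrow> \<forall>x. x \<notin> dcube q0 \<longrightarrow> f x = 0 \<Longrightarrow>
    (\<integral>\<^sup>+x\<in>{x \<in> hcube q0. 1 < norm (iter_comm T b m f x)}. ennreal (w x) \<partial>lebesgue) \<le>
      ennreal (C * max (\<Sum>r. 1 / eps (2 ^ (2 ^ r))) 1) * (\<integral>\<^sup>+x. ennreal (Phi m (norm (f x))) * M_eps eps (Phi m) (m + 1) w x \<partial>lebesgue)"
proof -
  obtain C1 where C1: "C1 > 0" "\<And>b f q0. moments b f \<Longrightarrow> snd q0 > 0 \<Longrightarrow> (\<And>x. x \<notin> dcube q0 \<Longrightarrow> f x = 0) \<Longrightarrow>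
    \<exists>G. sparse_gens G \<and> (AE x in lebesgue. x \<in> hcube q0 \<longrightarrow>
       ennreal (norm (iter_comm T b m f x)) \<le>
         ennreal C1 * (\<integral>\<^sup>+p. ennreal (Bterm b f m (snd p) x) * indicator (hcube (snd p)) x \<partial>count_space (Sigma UNIV G)))"
    by (rule sparse_domination[of m]) blast
  \<comment> \<open>Off the exceptional sets the two halves of \<open>Bterm\<close> contribute 2 th
    each, and C1 * 4 th = 1/2.\<close>
  define th where "th = 1 / (8 * C1)"
  have th: "th > 0" using C1(1) by (simp add: th_def)
  define c :: real where "c = ln (3/2) / 2 ^ (DIM('a) + 1)"
  have c: "c > 0" by (simp add: c_def)
  define tau where "tau = min c (th * ln 2)"
  have tau: "tau > 0" "tau \<le> c" "tau \<le> th * ln 2" using c th by (auto simp: tau_def)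
  obtain Cw where Cw: "Cw > 0" "\<And>(b::'a \<Rightarrow> real) w R F k eps. bmo1 b \<Longrightarrow> weight w \<Longrightarrow> cube R \<Longrightarrow> F \<in> sets lebesgue \<Longrightarrow> F \<subseteq> R \<Longrightarrow>
     emeasure lebesgue F \<le> ennreal (9 * exp (- tau * 2 ^ k)) * emeasure lebesgue R \<Longrightarrow> \<forall>s\<ge>1. eps s \<ge> 1 \<Longrightarrow> mono_on {1..} eps \<Longrightarrow>
     (\<integral>\<^sup>+x\<in>F. ennreal (w x * \<bar>b x - avg b R\<bar> ^ m) \<partial>lebesgue) \<le> ennreal (Cw * eta eps k) * emeasure lebesgue R * Mterm eps (Phi m) (m + 1) w R \<and>
     (\<integral>\<^sup>+x\<in>F. ennreal (w x) \<partial>lebesgue) \<le> ennreal (Cw * (1/2) ^ k) * emeasure lebesgue R * Mterm eps (Phi m) (m + 1) w R"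
    by (rule small_set_bounds[OF m tau(1,2) c_def]) blast
  \<comment> \<open>With i = 1 / La, the product i^k (2^k)^m 2^k of average, oscillation power and
    overlap equals 2^(-(m+1)k), which is at most 2^(-k).\<close>
  define La :: real where "La = 4 ^ (m + 1)"
  have La: "La > 1" unfolding La_def by (rule one_less_power) auto
  define i where "i = 1 / La"
  have i: "0 < i" "i < 1" using La by (auto simp: i_def)
  obtain Cl where Cl: "Cl > 0" "\<And>(f::'a \<Rightarrow> real) Y R q. cube R \<Longrightarrow> (\<And>x. 0 \<le> f x) \<Longrightarrow> f \<in> borel_measurable lebesgue
    \<Longrightarrow> (\<And>x. 0 \<le> Y x) \<Longrightarrow> Y \<in> borel_measurable lebesgue
    \<Longrightarrow> (\<integral>\<^sup>+x\<in>R. ennreal (exp (c * Y x)) \<partial>lebesgue) \<le> 7 * emeasure lebesgue R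
    \<Longrightarrow> ennreal ((1/La) ^ Suc q) * emeasure lebesgue R \<le> (\<integral>\<^sup>+x\<in>R. ennreal (f x * Y x ^ m) \<partial>lebesgue)
    \<Longrightarrow> ennreal ((1/La) ^ q) * emeasure lebesgue R \<le> ennreal (Cl * (real q + 1) ^ m) * (\<integral>\<^sup>+x\<in>R. ennreal (Phi m (f x)) \<partial>lebesgue)"
    by (rule level_bound[OF c La, of m, where 'a='a]) (erule that, blast)
  define Cs where "Cs = 2 * unit_ball_vol (real DIM('a)) * (5 * (real DIM('a) * (4 * real DIM('a) + 2))) ^ DIM('a)"
  define D where "D = (4 * real DIM('a) + 1) ^ DIM('a) * Cs"
  have D: "D \<ge> 0" using unit_ball_vol_DIM_pos[where 'a='a] unfolding D_def Cs_def by (intro mult_nonneg_nonneg) auto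
  define Sg where "Sg = (\<Sum>k. (real k + 1) ^ m * (1/2) ^ k)"
  have Sg0: "Sg \<ge> 0" unfolding Sg_def by (intro suminf_nonneg summable_poly_geometric) auto
  define C where "C = D + Cl * D + 2 * C1 * (7 * (Cw * La * D) + Cw * Cl * D * Sg) + 1"
  have main: "(\<integral>\<^sup>+x\<in>{x \<in> hcube q0. 1 < norm (iter_comm T b m f x)}. ennreal (w x) \<partial>lebesgue) \<le>
      ennreal (C * max (\<Sum>r. 1 / eps (2 ^ (2 ^ r))) 1) * (\<integral>\<^sup>+x. ennreal (Phi m (norm (f x))) * M_eps eps (Phi m) (m + 1) w x \<partial>lebesgue)"
    if b: "bmo1 b" and w: "weight w" and e1: "\<forall>s\<ge>1. eps s \<ge> 1" and mono: "mono_on {1..} eps"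
      and sm: "summable (\<lambda>r::nat. 1 / eps (2 ^ (2 ^ r)))" and f: "f \<in> borel_measurable lebesgue" "\<forall>x. norm (f x) \<le> B"
      and q0: "snd q0 > 0" and supp: "\<forall>x. x \<notin> dcube q0 \<longrightarrow> f x = 0"
    for b w eps f B q0
  proof -
    note wD = weightD[OF w]
    note [measurable] = bmo1_measurable[OF b] wD(2) f(1)
    have mom: "moments b f"
      by (rule moments_bmo1[OF b f(1) f(2)[rule_format], of "dcube q0"]) (use q0 supp in \<open>auto intro!: cube_ccube snd_dilate\<close>)
    have fL2: "L2 f" using mom by (rule moments_L2_0)
    obtain G where G: "sparse_gens G" and dom: "AE x in lebesgue. x \<in> hcube q0 \<longrightarrow>
       ennreal (norm (iter_comm T b m f x)) \<le>
         ennreal C1 * (\<integral>\<^sup>+p. ennreal (Bterm b f m (snd p) x) * indicator (hcube (snd p)) x \<partial>count_space (Sigma UNIV G))"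
      using C1(2)[OF mom q0] supp by blast
    let ?S = "Sigma UNIV G"
    have cS: "countable ?S" using sparse_gensD(1)[OF G] by (intro countable_SIGMA) auto
    define gam0 where "gam0 p = mean f (dcube (snd p))" for p :: "nat \<times> 'a \<times> real"
    define gamm where "gamm p = mean (osc_pow b f m (snd p)) (dcube (snd p))" for p :: "nat \<times> 'a \<times> real"
    define X where "X p x = \<bar>b x - avg b (dcube (snd p))\<bar>" for p :: "nat \<times> 'a \<times> real" and x
    have X0: "0 \<le> X p x" for p x by (simp add: X_def)
    have Xm [measurable]: "X p \<in> borel_measurable lebesgue" for p unfolding X_def by measurable
    \<comment> \<open>The overlap tolerated at level \<open>k\<close>. It is proportional to the
      threshold 2^k for the oscillation, so both kinds of exceptional points have relative measure
      of order exp(-tau 2^k).\<close>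
    define u where "u k = nat \<lfloor>th * 2 ^ k\<rfloor>" for k :: nat
    define F where "F k p = (hcube (snd p) \<inter> gen_union G (fst p + u k)) \<union> {x \<in> hcube (snd p). 2 ^ k < X p x}" for k p
    define A0 where "A0 k = {p \<in> ?S. i ^ Suc k < gam0 p \<and> gam0 p \<le> i ^ k}" for k
    define Am where "Am k = {p \<in> ?S. i ^ Suc k < gamm p \<and> gamm p \<le> i ^ k}" for k
    have sub: "A0 k \<subseteq> ?S" "Am k \<subseteq> ?S" "{p \<in> ?S. 1 < gam0 p} \<subseteq> ?S" "{p \<in> ?S. 1 < gamm p} \<subseteq> ?S" for k
      by (auto simp: A0_def Am_def)
    have cA: "countable (A0 k)" "countable (Am k)" "countable {p \<in> ?S. 1 < gam0 p}" "countable {p \<in> ?S. 1 < gamm p}" for k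
      using countable_subset[OF _ cS] sub by blast+
    have pos: "snd (snd p) > 0" if "p \<in> ?S" for p using that sparse_gensD(3)[OF G] by auto
    have cub: "cube (dcube (snd p))" if "p \<in> ?S" for p using pos[OF that] by (intro cube_ccube snd_dilate)
    let ?R = "\<lambda>p. dcube (snd (p :: nat \<times> 'a \<times> real))"
    let ?Mt = "\<lambda>p. Mterm eps (Phi m) (m + 1) w (dcube (snd (p :: nat \<times> 'a \<times> real)))"
    define IM where "IM = (\<integral>\<^sup>+x. ennreal (Phi m (norm (f x))) * M_eps eps (Phi m) (m + 1) w x \<partial>lebesgue)"
    have Fp: "F k p \<in> sets lebesgue" "F k p \<subseteq> ?R p" "emeasure lebesgue (F k p) \<le> ennreal (9 * exp (- tau * 2 ^ k)) * emeasure lebesgue (?R p)"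
      if "p \<in> ?S" for k p
      using exceptional_part_small[OF G that b th c_def tau(2,3), of "F k p" k] by (auto simp: F_def u_def X_def)
    have sm0: "(\<integral>\<^sup>+x\<in>F k p. ennreal (w x * X p x ^ m) \<partial>lebesgue) \<le> ennreal (Cw * eta eps k) * emeasure lebesgue (?R p) * ?Mt p"
      and smm: "(\<integral>\<^sup>+x\<in>F k p. ennreal (w x) \<partial>lebesgue) \<le> ennreal (Cw * (1/2) ^ k) * emeasure lebesgue (?R p) * ?Mt p"
      if "p \<in> ?S" for k p
      using Cw(2)[OF b w cub[OF that] Fp[OF that] e1 mono] by (auto simp: X_def)
    have et: "eta eps k > 0" for k by (rule eta_nonneg[OF e1])
    have fM: "(\<integral>\<^sup>+x. ennreal (norm (f x)) * M_eps eps (Phi m) (m + 1) w x \<partial>lebesgue) \<le> IM"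
      unfolding IM_def by (intro nn_integral_mono mult_right_mono ennreal_leI Phi_ge) auto
    have le0: "ennreal t * emeasure lebesgue (?R p) \<le> (\<integral>\<^sup>+x\<in>?R p. ennreal (norm (f x)) \<partial>lebesgue)" if "p \<in> ?S" "t \<le> gam0 p" for p t
      unfolding mean_eq[OF fL2 cub[OF that(1)]] using that(2) by (intro mult_right_mono ennreal_leI) (auto simp: gam0_def)
    \<comment> \<open>The mean of |b - b_R|^m |f| is not an average of \<open>f\<close> alone.
      \<open>level_bound\<close> replaces it by the modular Phi_m(|f|), with a loss (k + 1)^m that
      ends up in the convergent series \<open>Sg\<close>.\<close>
    have lem: "ennreal (i ^ k / (Cl * (real k + 1) ^ m)) * emeasure lebesgue (?R p) \<le> (\<integral>\<^sup>+x\<in>?R p. ennreal (Phi m (norm (f x))) \<partial>lebesgue)"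
      if p: "p \<in> ?S" and k: "i ^ Suc k \<le> gamm p" for p k
    proof -
      have oL2: "L2 (osc_pow b f m (snd p))" unfolding osc_pow_def by (intro moments_L2 moments_shift mom)
      have "ennreal (i ^ Suc k) * emeasure lebesgue (?R p) \<le> ennreal (gamm p) * emeasure lebesgue (?R p)"
        using k by (intro mult_right_mono ennreal_leI) auto
      also have "\<dots> = (\<integral>\<^sup>+x\<in>?R p. ennreal (norm (osc_pow b f m (snd p) x)) \<partial>lebesgue)"
        unfolding mean_eq[OF oL2 cub[OF p]] by (simp add: gamm_def)
      also have "\<dots> = (\<integral>\<^sup>+x\<in>?R p. ennreal (norm (f x) * X p x ^ m) \<partial>lebesgue)"
        by (intro nn_integral_cong) (simp add: osc_pow_def X_def norm_mult norm_power mult.commute del: of_real_diff)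
      finally have ge: "ennreal ((1/La) ^ Suc k) * emeasure lebesgue (?R p) \<le> (\<integral>\<^sup>+x\<in>?R p. ennreal (norm (f x) * X p x ^ m) \<partial>lebesgue)"
        by (simp add: i_def)
      have JN: "(\<integral>\<^sup>+x\<in>?R p. ennreal (exp (c * X p x)) \<partial>lebesgue) \<le> 7 * emeasure lebesgue (?R p)"
        unfolding X_def c_def by (rule John_Nirenberg[OF b cub[OF p]])
      have *: "ennreal (i ^ k) * emeasure lebesgue (?R p) \<le> ennreal (Cl * (real k + 1) ^ m) * (\<integral>\<^sup>+x\<in>?R p. ennreal (Phi m (norm (f x))) \<partial>lebesgue)"
        using Cl(2)[OF cub[OF p] _ _ X0 Xm JN ge] by (simp add: i_def)
      let ?q = "Cl * (real k + 1) ^ m"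
      have q: "?q > 0" using Cl(1) by (intro mult_pos_pos zero_less_power) auto
      have "ennreal (1 / ?q) * (ennreal (i ^ k) * emeasure lebesgue (?R p)) \<le> ennreal (1 / ?q) * (ennreal ?q * (\<integral>\<^sup>+x\<in>?R p. ennreal (Phi m (norm (f x))) \<partial>lebesgue))"
        by (intro mult_left_mono *) simp
      moreover have "ennreal (1 / ?q) * ennreal ?q = 1" using q by (subst ennreal_mult[symmetric]) auto
      moreover have "ennreal (1 / ?q) * ennreal (i ^ k) = ennreal (i ^ k / ?q)" using q i by (subst ennreal_mult[symmetric]) auto
      ultimately show ?thesis by (simp only: mult.assoc[symmetric] mult_1)
    qed
    \<comment> \<open>\<open>H0\<close> and \<open>Hm\<close> collect the exceptional contributions
      of level \<open>k\<close> to the two halves of \<open>Bterm\<close>, each average being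
      replaced by its upper bound i^k. \<open>O0\<close> and \<open>O1\<close> count the cubes with
      an average above 1.\<close>
    define H0 where "H0 k x = (\<integral>\<^sup>+p. ennreal (i ^ k * X p x ^ m) * indicator (F k p) x \<partial>count_space (A0 k))" for k x
    define Hm where "Hm k x = (\<integral>\<^sup>+p. ennreal (i ^ k * 1) * indicator (F k p) x \<partial>count_space (Am k))" for k x
    define O0 where "O0 x = (\<integral>\<^sup>+p. indicator (hcube (snd p)) x \<partial>count_space {p \<in> ?S. 1 < gam0 p})" for x :: 'a
    define O1 where "O1 x = (\<integral>\<^sup>+p. indicator (hcube (snd p)) x \<partial>count_space {p \<in> ?S. 1 < gamm p})" for x :: 'a
    \<comment> \<open>The upper bound i^k of the averages is set against their lower bound i^(k+1):
      the level cancels up to La and only \<open>eta\<close> remains.\<close>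
    have I0: "(\<integral>\<^sup>+x. ennreal (w x) * H0 k x \<partial>lebesgue) \<le> ennreal (Cw * La * D * eta eps k) * IM" for k
    proof -
      have hm: "(\<lambda>x. ennreal (i ^ k * X p x ^ m) * indicator (F k p) x) \<in> borel_measurable lebesgue" if "p \<in> A0 k" for p
      proof -
        have [measurable]: "F k p \<in> sets lebesgue" using Fp(1) sub(1) that by blast
        show ?thesis by measurable
      qed
      have "(\<integral>\<^sup>+x. ennreal (w x) * H0 k x \<partial>lebesgue) = (\<integral>\<^sup>+p. (\<integral>\<^sup>+x. ennreal (w x) * (ennreal (i ^ k * X p x ^ m) * indicator (F k p) x) \<partial>lebesgue) \<partial>count_space (A0 k))"
        unfolding H0_def using cA(1) hm by (intro nn_integral_weighted_count_space) auto
      also have "\<dots> \<le> ennreal (i ^ k * (Cw * eta eps k) / i ^ Suc k * ((4 * real DIM('a) + 1) ^ DIM('a) * Cs)) * (\<integral>\<^sup>+x. ennreal (norm (f x)) * M_eps eps (Phi m) (m + 1) w x \<partial>lebesgue)"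
      proof (rule sparse_weighted_sum[OF G sub(1) _ _ _ _ _ Cs_def])
        show "0 < i ^ Suc k" using i by simp
        show "(\<lambda>x. ennreal (norm (f x))) \<in> borel_measurable lebesgue" by measurable
        show "ennreal (i ^ Suc k) * emeasure lebesgue (?R p) \<le> (\<integral>\<^sup>+x\<in>?R p. ennreal (norm (f x)) \<partial>lebesgue)" if "p \<in> A0 k" for p
          using that by (intro le0) (auto simp: A0_def)
        show "0 \<le> i ^ k * (Cw * eta eps k)" using i Cw(1) et[of k] by simp
        fix p assume "p \<in> A0 k"
        then have p: "p \<in> ?S" using sub(1) by blast
        note [measurable] = Fp(1)[OF p]
        have "(\<integral>\<^sup>+x. ennreal (w x) * (ennreal (i ^ k * X p x ^ m) * indicator (F k p) x) \<partial>lebesgue) = (\<integral>\<^sup>+x. ennreal (i ^ k) * (ennreal (w x * X p x ^ m) * indicator (F k p) x) \<partial>lebesgue)"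
          using i wD(1) X0 by (intro nn_integral_cong) (simp add: ennreal_mult mult_ac)
        also have "\<dots> = ennreal (i ^ k) * (\<integral>\<^sup>+x\<in>F k p. ennreal (w x * X p x ^ m) \<partial>lebesgue)"
          by (rule nn_integral_cmult) measurable
        also have "\<dots> \<le> ennreal (i ^ k) * (ennreal (Cw * eta eps k) * emeasure lebesgue (?R p) * ?Mt p)"
          by (intro mult_left_mono sm0[OF p]) simp
        also have "\<dots> = ennreal (i ^ k * (Cw * eta eps k)) * emeasure lebesgue (?R p) * ?Mt p"
          using i Cw(1) et[of k] by (simp add: ennreal_mult mult.assoc)
        finally show "(\<integral>\<^sup>+x. ennreal (w x) * (ennreal (i ^ k * X p x ^ m) * indicator (F k p) x) \<partial>lebesgue) \<le> ennreal (i ^ k * (Cw * eta eps k)) * emeasure lebesgue (?R p) * ?Mt p" .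
      qed
      also have "i ^ k * (Cw * eta eps k) / i ^ Suc k * ((4 * real DIM('a) + 1) ^ DIM('a) * Cs) = Cw * La * D * eta eps k"
        using i La by (simp add: i_def D_def field_simps)
      also have "ennreal (Cw * La * D * eta eps k) * (\<integral>\<^sup>+x. ennreal (norm (f x)) * M_eps eps (Phi m) (m + 1) w x \<partial>lebesgue) \<le> ennreal (Cw * La * D * eta eps k) * IM"
        by (intro mult_left_mono fM) simp
      finally show ?thesis .
    qed
    \<comment> \<open>The level cancels against the lower bound i^k / (Cl (k + 1)^m) on the modular;
      the decay 2^(-k) comes from the weight of the exceptional set.\<close>
    have Im: "(\<integral>\<^sup>+x. ennreal (w x) * Hm k x \<partial>lebesgue) \<le> ennreal (Cw * Cl * D * ((real k + 1) ^ m * (1/2) ^ k)) * IM" for k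
    proof -
      have hm: "(\<lambda>x. ennreal (i ^ k * 1) * indicator (F k p) x) \<in> borel_measurable lebesgue" if "p \<in> Am k" for p
      proof -
        have [measurable]: "F k p \<in> sets lebesgue" using Fp(1) sub(2) that by blast
        show ?thesis by measurable
      qed
      have "(\<integral>\<^sup>+x. ennreal (w x) * Hm k x \<partial>lebesgue) = (\<integral>\<^sup>+p. (\<integral>\<^sup>+x. ennreal (w x) * (ennreal (i ^ k * 1) * indicator (F k p) x) \<partial>lebesgue) \<partial>count_space (Am k))"
        unfolding Hm_def using cA(2) hm by (intro nn_integral_weighted_count_space) auto
      also have "\<dots> \<le> ennreal (i ^ k * (Cw * (1/2) ^ k) / (i ^ k / (Cl * (real k + 1) ^ m)) * ((4 * real DIM('a) + 1) ^ DIM('a) * Cs)) * (\<integral>\<^sup>+x. ennreal (Phi m (norm (f x))) * M_eps eps (Phi m) (m + 1) w x \<partial>lebesgue)"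
      proof (rule sparse_weighted_sum[OF G sub(2) _ _ _ _ _ Cs_def])
        show "0 < i ^ k / (Cl * (real k + 1) ^ m)" using i Cl(1) by (intro divide_pos_pos mult_pos_pos zero_less_power) auto
        show "(\<lambda>x. ennreal (Phi m (norm (f x)))) \<in> borel_measurable lebesgue" by measurable
        show "ennreal (i ^ k / (Cl * (real k + 1) ^ m)) * emeasure lebesgue (?R p) \<le> (\<integral>\<^sup>+x\<in>?R p. ennreal (Phi m (norm (f x))) \<partial>lebesgue)" if "p \<in> Am k" for p
          using that by (intro lem) (auto simp: Am_def)
        show "0 \<le> i ^ k * (Cw * (1/2) ^ k)" using i Cw(1) by simp
        fix p assume "p \<in> Am k"
        then have p: "p \<in> ?S" using sub(2) by blast
        note [measurable] = Fp(1)[OF p]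
        have "(\<integral>\<^sup>+x. ennreal (w x) * (ennreal (i ^ k * 1) * indicator (F k p) x) \<partial>lebesgue) = (\<integral>\<^sup>+x. ennreal (i ^ k) * (ennreal (w x) * indicator (F k p) x) \<partial>lebesgue)"
          by (intro nn_integral_cong) (simp add: mult_ac)
        also have "\<dots> = ennreal (i ^ k) * (\<integral>\<^sup>+x\<in>F k p. ennreal (w x) \<partial>lebesgue)"
          by (rule nn_integral_cmult) measurable
        also have "\<dots> \<le> ennreal (i ^ k) * (ennreal (Cw * (1/2) ^ k) * emeasure lebesgue (?R p) * ?Mt p)"
          by (intro mult_left_mono smm[OF p]) simp
        also have "\<dots> = ennreal (i ^ k * (Cw * (1/2) ^ k)) * emeasure lebesgue (?R p) * ?Mt p"
          using i Cw(1) by (simp add: ennreal_mult mult.assoc)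
        finally show "(\<integral>\<^sup>+x. ennreal (w x) * (ennreal (i ^ k * 1) * indicator (F k p) x) \<partial>lebesgue) \<le> ennreal (i ^ k * (Cw * (1/2) ^ k)) * emeasure lebesgue (?R p) * ?Mt p" .
      qed
      also have "i ^ k * (Cw * (1/2) ^ k) / (i ^ k / (Cl * (real k + 1) ^ m)) * ((4 * real DIM('a) + 1) ^ DIM('a) * Cs) = Cw * Cl * D * ((real k + 1) ^ m * (1/2) ^ k)"
        using i by (simp add: D_def)
      finally show ?thesis by (simp add: IM_def)
    qed
    have hcw: "(\<integral>\<^sup>+x. ennreal (w x) * indicator (hcube (snd p)) x \<partial>lebesgue) \<le> ennreal 1 * emeasure lebesgue (?R p) * ?Mt p" if p: "p \<in> ?S" for p
    proof -
      have "(\<integral>\<^sup>+x. ennreal (w x) * indicator (hcube (snd p)) x \<partial>lebesgue) \<le> (\<integral>\<^sup>+x\<in>?R p. ennreal (w x) \<partial>lebesgue)"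
        using hcube_subset_dcube[OF pos[OF p]] by (intro nn_integral_mono) (auto split: split_indicator)
      also have "\<dots> \<le> emeasure lebesgue (?R p) * ?Mt p" by (rule weight_le_Mterm[OF w cub[OF p] e1])
      finally show ?thesis by simp
    qed
    have IO0: "(\<integral>\<^sup>+x. ennreal (w x) * O0 x \<partial>lebesgue) \<le> ennreal D * IM"
    proof -
      have "(\<integral>\<^sup>+x. ennreal (w x) * O0 x \<partial>lebesgue) = (\<integral>\<^sup>+p. (\<integral>\<^sup>+x. ennreal (w x) * indicator (hcube (snd p)) x \<partial>lebesgue) \<partial>count_space {p \<in> ?S. 1 < gam0 p})"
        unfolding O0_def using cA(3) by (intro nn_integral_weighted_count_space) auto
      also have "\<dots> \<le> ennreal (1 / 1 * ((4 * real DIM('a) + 1) ^ DIM('a) * Cs)) * (\<integral>\<^sup>+x. ennreal (norm (f x)) * M_eps eps (Phi m) (m + 1) w x \<partial>lebesgue)"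
      proof (rule sparse_weighted_sum[OF G sub(3) _ _ _ _ _ Cs_def])
        show "ennreal 1 * emeasure lebesgue (?R p) \<le> (\<integral>\<^sup>+x\<in>?R p. ennreal (norm (f x)) \<partial>lebesgue)" if "p \<in> {p \<in> ?S. 1 < gam0 p}" for p
          using that by (intro le0) auto
        show "(\<integral>\<^sup>+x. ennreal (w x) * indicator (hcube (snd p)) x \<partial>lebesgue) \<le> ennreal 1 * emeasure lebesgue (?R p) * ?Mt p" if "p \<in> {p \<in> ?S. 1 < gam0 p}" for p
          using that by (intro hcw) blast
      qed auto
      also have "\<dots> \<le> ennreal D * IM" using fM by (simp add: D_def mult_left_mono)
      finally show ?thesis .
    qed
    have IO1: "(\<integral>\<^sup>+x. ennreal (w x) * O1 x \<partial>lebesgue) \<le> ennreal (Cl * D) * IM"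
    proof -
      have "(\<integral>\<^sup>+x. ennreal (w x) * O1 x \<partial>lebesgue) = (\<integral>\<^sup>+p. (\<integral>\<^sup>+x. ennreal (w x) * indicator (hcube (snd p)) x \<partial>lebesgue) \<partial>count_space {p \<in> ?S. 1 < gamm p})"
        unfolding O1_def using cA(4) by (intro nn_integral_weighted_count_space) auto
      also have "\<dots> \<le> ennreal (1 / (1 / Cl) * ((4 * real DIM('a) + 1) ^ DIM('a) * Cs)) * (\<integral>\<^sup>+x. ennreal (Phi m (norm (f x))) * M_eps eps (Phi m) (m + 1) w x \<partial>lebesgue)"
      proof (rule sparse_weighted_sum[OF G sub(4) _ _ _ _ _ Cs_def])
        show "(\<lambda>x. ennreal (Phi m (norm (f x)))) \<in> borel_measurable lebesgue" by measurable
        show "ennreal (1 / Cl) * emeasure lebesgue (?R p) \<le> (\<integral>\<^sup>+x\<in>?R p. ennreal (Phi m (norm (f x))) \<partial>lebesgue)" if "p \<in> {p \<in> ?S. 1 < gamm p}" for p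
          using lem[of p 0] that i by auto
        show "(\<integral>\<^sup>+x. ennreal (w x) * indicator (hcube (snd p)) x \<partial>lebesgue) \<le> ennreal 1 * emeasure lebesgue (?R p) * ?Mt p" if "p \<in> {p \<in> ?S. 1 < gamm p}" for p
          using that by (intro hcw) blast
      qed (use Cl(1) in auto)
      also have "1 / (1 / Cl) * ((4 * real DIM('a) + 1) ^ DIM('a) * Cs) = Cl * D" by (simp add: D_def)
      finally show ?thesis by (simp add: IM_def)
    qed
    define H where "H x = (\<Sum>k. H0 k x) + (\<Sum>k. Hm k x)" for x
    \<comment> \<open>Where the commutator exceeds 1, either a cube with an average above 1 passes
      through \<open>x\<close>, or the ordinary parts supply at most 1/2 and the exceptional parts
      must supply the rest.\<close>
    have point: "AE x in lebesgue. ennreal (w x) * indicator {x \<in> hcube q0. 1 < norm (iter_comm T b m f x)} x \<le>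
       ennreal (w x) * O0 x + ennreal (w x) * O1 x + ennreal (2 * C1) * (ennreal (w x) * H x)"
      using dom
    proof eventually_elim
      case (elim x)
      show ?case
      proof (cases "x \<in> hcube q0 \<and> 1 < norm (iter_comm T b m f x)")
        case False
        then show ?thesis by auto
      next
        case True
        have "1 \<le> O0 x + O1 x + ennreal (2 * C1) * H x"
        proof (cases "\<exists>p\<in>?S. x \<in> hcube (snd p) \<and> (1 < gam0 p \<or> 1 < gamm p)")
          case ex: True
          then obtain p where p: "p \<in> ?S" "x \<in> hcube (snd p)" "1 < gam0 p \<or> 1 < gamm p" by blast
          have "1 \<le> O0 x + O1 x"
          proof (cases "1 < gam0 p")
            case True
            then have "indicator (hcube (snd p)) x \<le> O0 x" unfolding O0_def using p by (intro nn_integral_ge_point) auto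
            then show ?thesis using p(2) by (simp add: add_increasing2)
          next
            case False
            then have "indicator (hcube (snd p)) x \<le> O1 x" unfolding O1_def using p by (intro nn_integral_ge_point) auto
            then show ?thesis using p(2) by (simp add: add_increasing)
          qed
          then show ?thesis by (rule order_trans) simp
        next
          case no: False
          have lev: "i ^ k * z * real (u k) \<le> th * (1/2) ^ k" if "0 \<le> z" "z \<le> (2 ^ k) ^ m" for k z
          proof -
            have uk: "real (u k) \<le> th * 2 ^ k" using th by (simp add: u_def)
            have "i ^ k * z * real (u k) \<le> i ^ k * (2 ^ k) ^ m * (th * 2 ^ k)"
              using that i uk th by (intro mult_mono) auto
            also have "\<dots> = th * (i * 2 ^ m * 2) ^ k"
              by (simp add: power_mult_distrib power_mult[symmetric] mult.commute)
            also have "i * 2 ^ m * 2 = (1/2) ^ (m + 1)"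
              by (simp add: i_def La_def power_one_over field_simps power_mult_distrib[symmetric])
            also have "th * ((1/2) ^ (m + 1)) ^ k \<le> th * (1/2) ^ k"
              using th by (intro mult_left_mono power_mono) (auto simp: power_le_one)
            finally show ?thesis .
          qed
          have l0: "(\<integral>\<^sup>+p. ennreal (gam0 p * X p x ^ m) * indicator (hcube (snd p)) x \<partial>count_space ?S) \<le> ennreal (2 * th) + (\<Sum>k. H0 k x)"
            unfolding H0_def A0_def
          proof (rule level_split[OF G i less_imp_le[OF th], where u=u and z="\<lambda>k. (2 ^ k) ^ m"])
            show "X p x ^ m \<le> (2 ^ k) ^ m \<and> x \<notin> gen_union G (fst p + u k)" if "p \<in> ?S" "x \<in> hcube (snd p)" "x \<notin> F k p" for k p
              using that X0[of p x] by (auto simp: F_def not_less intro!: power_mono)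
            show "i ^ k * (2 ^ k) ^ m * real (u k) \<le> th * (1/2) ^ k" for k by (rule lev) auto
          qed (use no X0 in \<open>auto simp: gam0_def mean_nonneg not_less\<close>)
          have lm: "(\<integral>\<^sup>+p. ennreal (gamm p * 1) * indicator (hcube (snd p)) x \<partial>count_space ?S) \<le> ennreal (2 * th) + (\<Sum>k. Hm k x)"
            unfolding Hm_def Am_def
          proof (rule level_split[OF G i less_imp_le[OF th], where u=u and z="\<lambda>k. 1"])
            show "1 \<le> (1::real) \<and> x \<notin> gen_union G (fst p + u k)" if "p \<in> ?S" "x \<in> hcube (snd p)" "x \<notin> F k p" for k p
              using that by (auto simp: F_def)
            show "i ^ k * 1 * real (u k) \<le> th * (1/2) ^ k" for k by (rule lev) (auto simp: one_le_power)
          qed (use no in \<open>auto simp: gamm_def mean_nonneg not_less\<close>)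
          have "1 \<le> ennreal (norm (iter_comm T b m f x))" using True ennreal_leI[of 1 "norm (iter_comm T b m f x)"] by simp
          also have "\<dots> \<le> ennreal C1 * (\<integral>\<^sup>+p. ennreal (Bterm b f m (snd p) x) * indicator (hcube (snd p)) x \<partial>count_space ?S)"
            using elim True by blast
          also have "(\<integral>\<^sup>+p. ennreal (Bterm b f m (snd p) x) * indicator (hcube (snd p)) x \<partial>count_space ?S) =
            (\<integral>\<^sup>+p. ennreal (gam0 p * X p x ^ m) * indicator (hcube (snd p)) x + ennreal (gamm p * 1) * indicator (hcube (snd p)) x \<partial>count_space ?S)"
            by (intro nn_integral_cong) (auto simp: Bterm_def gam0_def gamm_def X_def ennreal_plus mean_nonneg split: split_indicator)
          also have "\<dots> = (\<integral>\<^sup>+p. ennreal (gam0 p * X p x ^ m) * indicator (hcube (snd p)) x \<partial>count_space ?S) + (\<integral>\<^sup>+p. ennreal (gamm p * 1) * indicator (hcube (snd p)) x \<partial>count_space ?S)"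
            by (rule nn_integral_add) auto
          also have "\<dots> \<le> (ennreal (2 * th) + (\<Sum>k. H0 k x)) + (ennreal (2 * th) + (\<Sum>k. Hm k x))"
            by (rule add_mono[OF l0 lm])
          also have "\<dots> = ennreal (4 * th) + H x"
          proof -
            have "ennreal (2 * th) + ennreal (2 * th) = ennreal (4 * th)" using th by (subst ennreal_plus[symmetric]) auto
            then show ?thesis unfolding H_def by (metis add.assoc add.commute)
          qed
          finally have "1 \<le> ennreal C1 * (ennreal (4 * th) + H x)" by (simp add: mult_left_mono)
          also have "\<dots> = ennreal (1/2) + ennreal C1 * H x"
          proof -
            have "ennreal C1 * ennreal (4 * th) = ennreal (1/2)" using C1(1) th by (subst ennreal_mult[symmetric]) (auto simp: th_def)
            then show ?thesis by (simp only: distrib_left)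
          qed
          \<comment> \<open>Writing 1 as 1/2 + 1/2 allows a finite summand to be cancelled in the
            extended reals.\<close>
          finally have "ennreal (1/2) + ennreal (1/2) \<le> ennreal (1/2) + ennreal C1 * H x"
            by (subst ennreal_plus[symmetric]) auto
          then have "ennreal (1/2) \<le> ennreal C1 * H x" by (rule ennreal_add_cancel_le[rotated]) (simp del: ennreal_half)
          then have "ennreal 2 * ennreal (1/2) \<le> ennreal 2 * (ennreal C1 * H x)" by (intro mult_left_mono) auto
          moreover have "ennreal 2 * ennreal (1/2) = 1" by (subst ennreal_mult[symmetric]) auto
          moreover have "ennreal 2 * (ennreal C1 * H x) = ennreal (2 * C1) * H x" using C1(1) by (simp only: mult.assoc[symmetric]) (subst ennreal_mult[symmetric], auto)
          ultimately have "1 \<le> ennreal (2 * C1) * H x" by (simp only:)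
          then show ?thesis by (simp add: add_increasing)
        qed
        then have "ennreal (w x) * 1 \<le> ennreal (w x) * (O0 x + O1 x + ennreal (2 * C1) * H x)" by (intro mult_left_mono) auto
        also have "\<dots> = ennreal (w x) * O0 x + ennreal (w x) * O1 x + ennreal (2 * C1) * (ennreal (w x) * H x)"
          by (simp only: distrib_left mult_ac)
        finally show ?thesis using True by simp
      qed
    qed
    have mH0: "H0 k \<in> borel_measurable lebesgue" for k
      unfolding H0_def
    proof (rule borel_measurable_count_space_integral[OF cA(1)])
      fix p assume "p \<in> A0 k"
      then have [measurable]: "F k p \<in> sets lebesgue" using Fp(1) sub(1) by blast
      show "(\<lambda>x. ennreal (i ^ k * X p x ^ m) * indicator (F k p) x) \<in> borel_measurable lebesgue" by measurable
    qed
    have mHm: "Hm k \<in> borel_measurable lebesgue" for k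
      unfolding Hm_def
    proof (rule borel_measurable_count_space_integral[OF cA(2)])
      fix p assume "p \<in> Am k"
      then have [measurable]: "F k p \<in> sets lebesgue" using Fp(1) sub(2) by blast
      show "(\<lambda>x. ennreal (i ^ k * 1) * indicator (F k p) x) \<in> borel_measurable lebesgue" by measurable
    qed
    have mO: "O0 \<in> borel_measurable lebesgue" "O1 \<in> borel_measurable lebesgue"
      unfolding O0_def O1_def by (intro borel_measurable_count_space_integral[OF cA(3)] borel_measurable_count_space_integral[OF cA(4)] borel_measurable_indicator hcube_lebesgue)+
    have mH: "H \<in> borel_measurable lebesgue" unfolding H_def using mH0 mHm by measurable
    define SE where "SE = max (\<Sum>r. 1 / eps (2 ^ (2 ^ r))) 1"
    have SE: "SE \<ge> 1" by (simp add: SE_def)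
    have IH: "(\<integral>\<^sup>+x. ennreal (w x) * H x \<partial>lebesgue) \<le> ennreal ((7 * (Cw * La * D) + Cw * Cl * D * Sg) * SE) * IM"
    proof -
      note [measurable] = mH0 mHm
      have "(\<integral>\<^sup>+x. ennreal (w x) * H x \<partial>lebesgue) = (\<integral>\<^sup>+x. (\<Sum>k. ennreal (w x) * H0 k x) + (\<Sum>k. ennreal (w x) * Hm k x) \<partial>lebesgue)"
        unfolding H_def by (simp add: distrib_left ennreal_suminf_cmult)
      also have "\<dots> = (\<integral>\<^sup>+x. (\<Sum>k. ennreal (w x) * H0 k x) \<partial>lebesgue) + (\<integral>\<^sup>+x. (\<Sum>k. ennreal (w x) * Hm k x) \<partial>lebesgue)"
        by (rule nn_integral_add) measurable
      also have "(\<integral>\<^sup>+x. (\<Sum>k. ennreal (w x) * H0 k x) \<partial>lebesgue) = (\<Sum>k. \<integral>\<^sup>+x. ennreal (w x) * H0 k x \<partial>lebesgue)"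
        by (rule nn_integral_suminf) measurable
      also have "(\<integral>\<^sup>+x. (\<Sum>k. ennreal (w x) * Hm k x) \<partial>lebesgue) = (\<Sum>k. \<integral>\<^sup>+x. ennreal (w x) * Hm k x \<partial>lebesgue)"
        by (rule nn_integral_suminf) measurable
      also have "(\<Sum>k. \<integral>\<^sup>+x. ennreal (w x) * H0 k x \<partial>lebesgue) \<le> ennreal (Cw * La * D * (7 * SE)) * IM"
      proof -
        have "(\<Sum>k. \<integral>\<^sup>+x. ennreal (w x) * H0 k x \<partial>lebesgue) \<le> (\<Sum>k. ennreal (Cw * La * D * eta eps k) * IM)"
          by (intro suminf_le summableI I0)
        also have "\<dots> = (\<Sum>k. ennreal (Cw * La * D) * ennreal (eta eps k)) * IM"
          using Cw(1) La D et by (simp add: ennreal_suminf_multc ennreal_mult less_imp_le)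
        also have "(\<Sum>k. ennreal (Cw * La * D) * ennreal (eta eps k)) = ennreal (Cw * La * D) * (\<Sum>k. ennreal (eta eps k))"
          by (rule ennreal_suminf_cmult)
        also have "\<dots> \<le> ennreal (Cw * La * D) * ennreal (7 * SE)"
          unfolding SE_def by (intro mult_left_mono suminf_eta_le[OF e1 mono sm]) simp
        also have "\<dots> = ennreal (Cw * La * D * (7 * SE))" using Cw(1) La D SE by (intro ennreal_mult[symmetric]) auto
        finally show ?thesis by (simp add: mult_right_mono)
      qed
      also have "(\<Sum>k. \<integral>\<^sup>+x. ennreal (w x) * Hm k x \<partial>lebesgue) \<le> ennreal (Cw * Cl * D * Sg * SE) * IM"
      proof -
        have "(\<Sum>k. \<integral>\<^sup>+x. ennreal (w x) * Hm k x \<partial>lebesgue) \<le> (\<Sum>k. ennreal (Cw * Cl * D * ((real k + 1) ^ m * (1/2) ^ k)) * IM)"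
          by (intro suminf_le summableI Im)
        also have "\<dots> = (\<Sum>k. ennreal (Cw * Cl * D * ((real k + 1) ^ m * (1/2) ^ k))) * IM" by (rule ennreal_suminf_multc)
        also have "(\<Sum>k. ennreal (Cw * Cl * D * ((real k + 1) ^ m * (1/2) ^ k))) = ennreal (Cw * Cl * D * Sg)"
        proof (rule suminf_ennreal_eq)
          show "(\<lambda>k. Cw * Cl * D * ((real k + 1) ^ m * (1/2) ^ k)) sums (Cw * Cl * D * Sg)"
            unfolding Sg_def by (intro sums_mult summable_sums summable_poly_geometric)
          show "0 \<le> Cw * Cl * D * ((real k + 1) ^ m * (1/2) ^ k)" for k using Cw(1) Cl(1) D by simp
        qed
        also have "ennreal (Cw * Cl * D * Sg) \<le> ennreal (Cw * Cl * D * Sg * SE)"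
          using mult_left_mono[OF SE, of "Cw * Cl * D * Sg"] Cw(1) Cl(1) D Sg0 by (intro ennreal_leI) simp
        finally show ?thesis by (simp add: mult_right_mono)
      qed
      also have "ennreal (Cw * La * D * (7 * SE)) * IM + ennreal (Cw * Cl * D * Sg * SE) * IM = ennreal ((7 * (Cw * La * D) + Cw * Cl * D * Sg) * SE) * IM"
      proof -
        have "(7 * (Cw * La * D) + Cw * Cl * D * Sg) * SE = Cw * La * D * (7 * SE) + Cw * Cl * D * Sg * SE" by (simp add: algebra_simps)
        moreover have "0 \<le> Cw * La * D * (7 * SE)" "0 \<le> Cw * Cl * D * Sg * SE" using Cw(1) Cl(1) La D Sg0 SE by auto
        ultimately have "ennreal ((7 * (Cw * La * D) + Cw * Cl * D * Sg) * SE) = ennreal (Cw * La * D * (7 * SE)) + ennreal (Cw * Cl * D * Sg * SE)"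
          by (simp only: ennreal_plus)
        then show ?thesis by (simp only: distrib_right)
      qed
      finally show ?thesis by (simp add: add_mono)
    qed
    have "(\<integral>\<^sup>+x\<in>{x \<in> hcube q0. 1 < norm (iter_comm T b m f x)}. ennreal (w x) \<partial>lebesgue) \<le>
      (\<integral>\<^sup>+x. ennreal (w x) * O0 x + ennreal (w x) * O1 x + ennreal (2 * C1) * (ennreal (w x) * H x) \<partial>lebesgue)"
      by (rule nn_integral_mono_AE[OF point])
    also have "\<dots> = (\<integral>\<^sup>+x. ennreal (w x) * O0 x \<partial>lebesgue) + (\<integral>\<^sup>+x. ennreal (w x) * O1 x \<partial>lebesgue) + ennreal (2 * C1) * (\<integral>\<^sup>+x. ennreal (w x) * H x \<partial>lebesgue)"
      using mO mH by (simp add: nn_integral_add nn_integral_cmult)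
    also have "\<dots> \<le> ennreal D * IM + ennreal (Cl * D) * IM + ennreal (2 * C1) * (ennreal ((7 * (Cw * La * D) + Cw * Cl * D * Sg) * SE) * IM)"
      by (intro add_mono mult_left_mono IO0 IO1 IH) simp
    also have "\<dots> = ennreal (D + Cl * D + 2 * C1 * ((7 * (Cw * La * D) + Cw * Cl * D * Sg) * SE)) * IM"
    proof -
      let ?z = "(7 * (Cw * La * D) + Cw * Cl * D * Sg) * SE"
      have nn: "0 \<le> Cl * D" "0 \<le> ?z" "0 \<le> 2 * C1 * ?z" using Cl(1) Cw(1) La D Sg0 SE C1(1) by auto
      have "ennreal (D + Cl * D + 2 * C1 * ?z) = ennreal (D + Cl * D) + ennreal (2 * C1 * ?z)" using D nn by (intro ennreal_plus) auto
      also have "\<dots> = ennreal D + ennreal (Cl * D) + ennreal (2 * C1) * ennreal ?z"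
        using D nn C1(1) by (simp only: ennreal_plus) (subst ennreal_mult, auto)
      finally show ?thesis by (simp only: distrib_right mult.assoc)
    qed
    \<comment> \<open>The terms that do not contain the series are enlarged by the factor
      \<open>SE\<close>, which is at least 1.\<close>
    also have "\<dots> \<le> ennreal (C * SE) * IM"
    proof (intro mult_right_mono ennreal_leI)
      let ?y = "2 * C1 * (7 * (Cw * La * D) + Cw * Cl * D * Sg)"
      have "D * 1 \<le> D * SE" "(Cl * D) * 1 \<le> (Cl * D) * SE" using D Cl(1) SE by (intro mult_left_mono; simp)+
      then show "D + Cl * D + 2 * C1 * ((7 * (Cw * La * D) + Cw * Cl * D * Sg) * SE) \<le> C * SE"
        unfolding C_def using SE by (simp only: distrib_right mult_1 mult.assoc)
    qed simp
    finally show ?thesis by (simp add: IM_def SE_def)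
  qed
  have "C > 0" unfolding C_def using D Cl(1) C1(1) Cw(1) La Sg0 by (intro add_nonneg_pos add_nonneg_nonneg mult_nonneg_nonneg) auto
  show ?thesis by (rule that[OF \<open>C > 0\<close>], rule main)
qed

end

section \<open>Reduction to the unit ball of BMO, height one and a single cube\<close>

lemma locally_integrable_scale:
  assumes "locally_integrable b" shows "locally_integrable (\<lambda>x. c * b x)"
  using assms unfolding locally_integrable_def by (auto intro: set_integrable_mult_right)

lemma avg_scale: "avg (\<lambda>x. c * b x) Q = c * avg b Q"
  by (simp add: avg_def)

lemma BMO_avg_le:
  assumes "b \<in> BMO" "cube Q"
  shows "avg (\<lambda>x. \<bar>b x - avg b Q\<bar>) Q \<le> enn2real (bmo_norm b)"
proof -
  have "ennreal (avg (\<lambda>x. \<bar>b x - avg b Q\<bar>) Q) \<le> bmo_norm b"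
    unfolding bmo_norm_def using assms(2) by (intro SUP_upper) auto
  moreover have "bmo_norm b = ennreal (enn2real (bmo_norm b))" using assms(1) by (simp add: BMO_def)
  ultimately have "ennreal (avg (\<lambda>x. \<bar>b x - avg b Q\<bar>) Q) \<le> ennreal (enn2real (bmo_norm b))" by simp
  then show ?thesis by (subst (asm) ennreal_le_iff) auto
qed

text \<open>Any s above the norm is allowed, so that norm zero is covered with s = 1, where dividing
  by the norm is impossible.\<close>

lemma bmo1_normalize:
  assumes "b \<in> BMO" and s: "s > 0" "enn2real (bmo_norm b) \<le> s"
  shows "bmo1 (\<lambda>x. 1 / s * b x)"
  unfolding bmo1_def
proof (intro conjI allI impI)
  show "locally_integrable (\<lambda>x. 1 / s * b x)" using assms(1) by (intro locally_integrable_scale) (simp add: BMO_def)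
  fix Q :: "'a set" assume Q: "cube Q"
  have "(\<lambda>x. \<bar>1 / s * b x - avg (\<lambda>x. 1 / s * b x) Q\<bar>) = (\<lambda>x. 1 / s * \<bar>b x - avg b Q\<bar>)"
  proof
    fix x
    have "1 / s * b x - avg (\<lambda>x. 1 / s * b x) Q = 1 / s * (b x - avg b Q)" unfolding avg_scale by (simp add: right_diff_distrib)
    then show "\<bar>1 / s * b x - avg (\<lambda>x. 1 / s * b x) Q\<bar> = 1 / s * \<bar>b x - avg b Q\<bar>" using s by (simp add: abs_mult)
  qed
  then have "avg (\<lambda>x. \<bar>1 / s * b x - avg (\<lambda>x. 1 / s * b x) Q\<bar>) Q = 1 / s * avg (\<lambda>x. \<bar>b x - avg b Q\<bar>) Q"
    by (simp only: avg_scale)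
  also have "\<dots> \<le> 1 / s * s" using BMO_avg_le[OF assms(1) Q] s by (intro mult_left_mono) auto
  finally show "avg (\<lambda>x. \<bar>1 / s * b x - avg (\<lambda>x. 1 / s * b x) Q\<bar>) Q \<le> 1" using s by simp
qed

text \<open>Cubes exhausting space; the successor keeps the side positive at N = 0.\<close>

definition centred :: "nat \<Rightarrow> 'a::euclidean_space \<times> real" where
  "centred N = ((- real (Suc N)) *\<^sub>R One, 2 * real (Suc N))"

lemma snd_centred: "snd (centred N) > 0" by (simp add: centred_def)

lemma mem_centred: "x \<in> hcube (centred N) \<longleftrightarrow> (\<forall>i\<in>Basis. - real (Suc N) \<le> x \<bullet> i \<and> x \<bullet> i < real (Suc N))"
  by (auto simp: hcube_def centred_def)

lemma norm_less_centred: assumes "norm x < real (Suc N)" shows "x \<in> hcube (centred N)"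
  unfolding mem_centred
proof
  fix i :: 'a assume "i \<in> Basis"
  then show "- real (Suc N) \<le> x \<bullet> i \<and> x \<bullet> i < real (Suc N)" using Basis_le_norm[of i x] assms by linarith
qed

lemma centred_mono: "N \<le> M \<Longrightarrow> hcube (centred N) \<subseteq> hcube (centred M)"
  unfolding subset_iff mem_centred by force

context CZ begin

lemma iter_comm_measurable:
  assumes "b \<in> borel_measurable lebesgue" "moments b f"
  shows "iter_comm T b m f \<in> borel_measurable lebesgue"
  using assms(2)
proof (induction m arbitrary: f)
  case 0
  then show ?case using L2_measurable[OF T_L2[OF moments_L2_0]] by simp
next
  case (Suc m)
  note [measurable] = assms(1) Suc.IH[OF Suc.prems] Suc.IH[OF moments_mult[OF Suc.prems]]
  show ?case by simp
qed

text \<open>A symbol of norm zero is almost everywhere equal to a constant on each large cube. After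
  subtracting it, every order h < m carries a factor vanishing at \<open>x\<close>, and for h = m
  the argument of \<open>T\<close> is zero almost everywhere because m \<ge> 1.\<close>

lemma iter_comm_zero_norm:
  assumes b: "b \<in> BMO" "enn2real (bmo_norm b) = 0" and m: "m \<ge> 1"
    and f: "f \<in> borel_measurable lebesgue" "\<And>x. norm (f x) \<le> B" "\<And>x. f x \<noteq> 0 \<Longrightarrow> norm x < real (Suc N0)"
  shows "AE x in lebesgue. iter_comm T b m f x = 0"
proof -
  have b1: "bmo1 b" using bmo1_normalize[OF b(1), of 1] b(2) by simp
  note [measurable] = bmo1_measurable[OF b1] f(1)
  have one: "AE x in lebesgue. x \<in> hcube (centred N) \<longrightarrow> iter_comm T b m f x = 0" if N: "N \<ge> N0" for N
  proof -
    let ?R = "ccube (centred N :: 'a \<times> real)"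
    have R: "cube ?R" using cube_ccube[OF snd_centred] .
    have f0: "f x = 0" if "x \<notin> ?R" for x
    proof (rule ccontr)
      assume "f x \<noteq> 0"
      then have "x \<in> hcube (centred N)" using f(3)[of x] N by (intro norm_less_centred) auto
      then show False using that box_hcube_cbox(2) by blast
    qed
    have mom: "moments b f" by (rule moments_bmo1[OF b1 f(1,2) R f0])
    define c where "c = avg b ?R"
    have "avg (\<lambda>x. \<bar>b x - c\<bar>) ?R \<le> 0" using BMO_avg_le[OF b(1) R] b(2) by (simp add: c_def)
    have i: "set_integrable lebesgue ?R (\<lambda>x. \<bar>b x - c\<bar>)"
      using locally_integrable_cube[OF _ R, of b] b1 set_integrable_const_cube[OF R]
      by (intro set_integrable_abs set_integral_diff) (auto simp: bmo1_def)
    have "(\<integral>\<^sup>+x\<in>?R. ennreal \<bar>b x - c\<bar> \<partial>lebesgue) = (\<integral>\<^sup>+x. ennreal (indicator ?R x *\<^sub>R \<bar>b x - c\<bar>) \<partial>lebesgue)"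
      by (rule nn_integral_cong) (auto split: split_indicator)
    also have "\<dots> = ennreal (LINT x:?R|lebesgue. \<bar>b x - c\<bar>)"
      using i unfolding set_lebesgue_integral_def set_integrable_def by (intro nn_integral_eq_integral) auto
    also have "\<dots> = 0"
      using \<open>avg (\<lambda>x. \<bar>b x - c\<bar>) ?R \<le> 0\<close> cube_measure(1)[OF R]
      by (intro ennreal_neg) (simp add: avg_def divide_le_0_iff del: measure_completion)
    finally have "(\<integral>\<^sup>+x\<in>?R. ennreal \<bar>b x - c\<bar> \<partial>lebesgue) = 0" .
    then have "AE x in lebesgue. ennreal \<bar>b x - c\<bar> * indicator ?R x = 0"
      by (subst (asm) nn_integral_0_iff_AE) auto
    then have bc: "AE x in lebesgue. x \<in> ?R \<longrightarrow> b x = c" by eventually_elim (auto split: split_indicator_asm)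
    define g where "g = (\<lambda>y. of_real (b y - c) ^ m * f y)"
    have gm: "g \<in> borel_measurable lebesgue" unfolding g_def by measurable
    have "AE y in lebesgue. g y = 0" using bc by eventually_elim (use f0 m in \<open>auto simp: g_def\<close>)
    then have Tg: "AE x in lebesgue. T g x = 0" by (rule T_zero[OF gm])
    show ?thesis using iter_shift[OF mom, of c m] Tg bc
    proof eventually_elim
      case (elim x)
      show ?case
      proof
        assume "x \<in> hcube (centred N)"
        then have bx: "b x = c" using elim(3) box_hcube_cbox(2) by blast
        have "norm (iter_comm T (\<lambda>x. b x - c) m f x) \<le> 2 ^ m * 0"
        proof (rule iter_comm_bound)
          fix h assume h: "h \<le> m"
          show "\<bar>b x - c\<bar> ^ (m - h) * norm (T (\<lambda>y. of_real (b y - c) ^ h * f y) x) \<le> 0"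
          proof (cases "h = m")
            case True
            then show ?thesis using elim(2) by (simp add: g_def)
          next
            case False
            then show ?thesis using bx h by (simp add: power_0_left)
          qed
        qed
        then show "iter_comm T b m f x = 0" using elim(1) by simp
      qed
    qed
  qed
  have "AE x in lebesgue. \<forall>N\<in>{N0..}. x \<in> hcube (centred N) \<longrightarrow> iter_comm T b m f x = 0"
    by (rule AE_ball_countable') (use one in auto)
  then show ?thesis
  proof eventually_elim
    case (elim x)
    obtain N where "norm x < real N" using reals_Archimedean2 by blast
    then have "norm x < real (Suc (max N N0))" by linarith
    then show ?case using elim norm_less_centred[of x "max N N0"] by auto
  qed
qed

end

text \<open>With b' = b / ||b|| and f' = ||b||^m f / t the height becomes 1 and |f'| is exactly the
  argument of Phi_m on the right. The estimate on one cube is uniform in the cube, so monotone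
  convergence extends it to all of space. Norm zero admits no such scaling, but then the commutator
  vanishes almost everywhere.\<close>

theorem theorem1p1:
  fixes T :: "('a::euclidean_space \<Rightarrow> complex) \<Rightarrow> ('a \<Rightarrow> complex)" and m :: nat
  assumes "m \<ge> 1" and "CZO T"
  shows "\<exists>c>0. \<forall>(b :: 'a \<Rightarrow> real) (w :: 'a \<Rightarrow> real) (eps :: real \<Rightarrow> real) (t :: real) (f :: 'a \<Rightarrow> complex).
     b \<in> BMO \<longrightarrow> weight w \<longrightarrow>
     (\<forall>s\<ge>1. eps s \<ge> 1) \<longrightarrow> mono_on {1..} eps \<longrightarrow>
     summable (\<lambda>r::nat. 1 / eps (2 ^ (2 ^ r))) \<longrightarrow>
     t > 0 \<longrightarrow>
     f \<in> borel_measurable lebesgue \<longrightarrow> (\<exists>B. \<forall>x. norm (f x) \<le> B) \<longrightarrow>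
     (\<exists>S. compact S \<and> (\<forall>x. x \<notin> S \<longrightarrow> f x = 0)) \<longrightarrow>
     (\<integral>\<^sup>+ x \<in> {x. norm (iter_comm T b m f x) > t}. ennreal (w x) \<partial>lebesgue)
       \<le> ennreal (c * max (\<Sum>r. 1 / eps (2 ^ (2 ^ r))) 1) *
          (\<integral>\<^sup>+ x. ennreal (Phi m (enn2real (bmo_norm b) ^ m * norm (f x) / t))
                  * M_eps eps (Phi m) (m + 1) w x \<partial>lebesgue)"
proof -
  obtain K Ck d C2 where "CZ T K Ck d C2" using CZO_imp_CZ[OF assms(2)] by blast
  then interpret CZ T K Ck d C2 .
  obtain C where C: "C > 0" "\<And>b w eps f B q0. bmo1 b \<Longrightarrow> weight w \<Longrightarrow> \<forall>s\<ge>1. eps s \<ge> 1 \<Longrightarrow> mono_on {1..} eps \<Longrightarrow>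
    summable (\<lambda>r::nat. 1 / eps (2 ^ (2 ^ r))) \<Longrightarrow> f \<in> borel_measurable lebesgue \<Longrightarrow> \<forall>x. norm (f x) \<le> B \<Longrightarrow>
    snd q0 > 0 \<Longrightarrow> \<forall>x. x \<notin> dcube q0 \<longrightarrow> f x = 0 \<Longrightarrow>
    (\<integral>\<^sup>+x\<in>{x \<in> hcube q0. 1 < norm (iter_comm T b m f x)}. ennreal (w x) \<partial>lebesgue) \<le>
      ennreal (C * max (\<Sum>r. 1 / eps (2 ^ (2 ^ r))) 1) * (\<integral>\<^sup>+x. ennreal (Phi m (norm (f x))) * M_eps eps (Phi m) (m + 1) w x \<partial>lebesgue)"
    by (rule normalized_estimate[OF assms(1)]) blast
  show ?thesis
  proof (rule exI[of _ C], rule conjI[OF C(1)], intro allI impI)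
    fix b w :: "'a \<Rightarrow> real" and eps :: "real \<Rightarrow> real" and t :: real and f :: "'a \<Rightarrow> complex"
    assume b: "b \<in> BMO" and w: "weight w" and e1: "\<forall>s\<ge>1. eps s \<ge> 1" and mono: "mono_on {1..} eps"
      and sm: "summable (\<lambda>r::nat. 1 / eps (2 ^ (2 ^ r)))" and t: "t > 0"
      and f: "f \<in> borel_measurable lebesgue" "\<exists>B. \<forall>x. norm (f x) \<le> B"
      and S: "\<exists>S. compact S \<and> (\<forall>x. x \<notin> S \<longrightarrow> f x = 0)"
    define be where "be = enn2real (bmo_norm b)"
    let ?I = "\<integral>\<^sup>+ x. ennreal (Phi m (be ^ m * norm (f x) / t)) * M_eps eps (Phi m) (m + 1) w x \<partial>lebesgue"
    let ?k = "ennreal (C * max (\<Sum>r. 1 / eps (2 ^ (2 ^ r))) 1)"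
    obtain B where B: "\<And>x. norm (f x) \<le> B" using f(2) by blast
    obtain S where S: "compact S" "\<And>x. x \<notin> S \<Longrightarrow> f x = 0" using S by blast
    obtain r where r: "\<And>x. x \<in> S \<Longrightarrow> norm x \<le> r" using compact_imp_bounded[OF S(1)] unfolding bounded_iff by blast
    obtain N0 where N0: "r < real N0" using reals_Archimedean2 by blast
    have fN: "norm x < real (Suc N0)" if "f x \<noteq> 0" for x
    proof -
      have "x \<in> S" using S(2) that by blast
      then show ?thesis using r[of x] N0 by linarith
    qed
    have "(\<integral>\<^sup>+ x \<in> {x. norm (iter_comm T b m f x) > t}. ennreal (w x) \<partial>lebesgue) \<le> ?k * ?I"
    proof (cases "be = 0")
      case True
      have "AE x in lebesgue. iter_comm T b m f x = 0"
        using b True assms(1) f(1) B fN unfolding be_def by (rule iter_comm_zero_norm)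
      then have "(\<integral>\<^sup>+ x \<in> {x. norm (iter_comm T b m f x) > t}. ennreal (w x) \<partial>lebesgue) = (\<integral>\<^sup>+(x::'a). 0 \<partial>lebesgue)"
        by (intro nn_integral_cong_AE, eventually_elim) (use t in \<open>auto split: split_indicator\<close>)
      then show ?thesis by simp
    next
      case False
      then have be: "be > 0" by (simp add: be_def less_le)
      define b' where "b' = (\<lambda>x. 1 / be * b x)"
      have b1: "bmo1 b'" unfolding b'_def using b be by (intro bmo1_normalize) (auto simp: be_def)
      define f' where "f' = (\<lambda>x. complex_of_real (be ^ m / t) * f x)"
      note fm [measurable] = f(1)
      have f'm [measurable]: "f' \<in> borel_measurable lebesgue" unfolding f'_def by measurable
      have nf': "norm (f' x) = be ^ m * norm (f x) / t" for x
        using be t by (simp add: f'_def norm_mult norm_divide norm_power)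
      have B': "\<forall>x. norm (f' x) \<le> be ^ m * B / t"
        using B be t unfolding nf' by (intro allI divide_right_mono mult_left_mono) auto
      have f'0: "f' x = 0" if "x \<notin> hcube (centred N)" "N \<ge> N0" for x N
      proof (rule ccontr)
        assume "f' x \<noteq> 0"
        then have "f x \<noteq> 0" by (auto simp: f'_def)
        then have "norm x < real (Suc N)" using fN[of x] that(2) by linarith
        then show False using norm_less_centred that(1) by blast
      qed
      have mom: "moments b' f'"
      proof (rule moments_bmo1[OF b1 f'm B'[rule_format] cube_ccube[OF snd_centred]])
        show "f' x = 0" if "x \<notin> ccube (centred N0)" for x
          using that f'0[of x N0] box_hcube_cbox(2) by blast
      qed
      define g where "g x = norm (iter_comm T b' m f' x)" for x
      have gm: "g \<in> borel_measurable lebesgue"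
        unfolding g_def using iter_comm_measurable[OF bmo1_measurable[OF b1] mom, of m] by measurable
      \<comment> \<open>Homogeneity of \<open>T\<close> holds only almost everywhere, which the
        integral over the superlevel set tolerates.\<close>
      have sc: "AE x in lebesgue. iter_comm T b m f x = of_real t * iter_comm T b' m f' x"
      proof -
        have "AE x in lebesgue. iter_comm T (\<lambda>x. be * b' x) m (\<lambda>y. complex_of_real (t / be ^ m) * f' y) x =
            of_real be ^ m * complex_of_real (t / be ^ m) * iter_comm T b' m f' x"
          by (rule iter_scale[OF mom])
        moreover have "(\<lambda>x. be * b' x) = b" using be by (simp add: b'_def)
        moreover have "(\<lambda>y. complex_of_real (t / be ^ m) * f' y) = f" using be t by (simp add: f'_def)
        moreover have "of_real be ^ m * complex_of_real (t / be ^ m) = of_real t" using be by simp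
        ultimately show ?thesis by (simp only:)
      qed
      have "(\<integral>\<^sup>+ x \<in> {x. norm (iter_comm T b m f x) > t}. ennreal (w x) \<partial>lebesgue) = (\<integral>\<^sup>+ x. ennreal (w x) * indicator {x. 1 < g x} x \<partial>lebesgue)"
      proof (rule nn_integral_cong_AE, use sc in eventually_elim)
        case (elim x)
        have "t < norm (iter_comm T b m f x) \<longleftrightarrow> 1 < g x" unfolding elim g_def using t by (simp add: norm_mult)
        then show ?case by (simp add: indicator_def)
      qed
      \<comment> \<open>The cubes start at \<open>N0\<close>, so each of them contains the support
        of \<open>f'\<close> and is admissible in the local estimate; their increasing union is the
        whole space.\<close>
      also have "\<dots> = (\<integral>\<^sup>+ x. (SUP N. ennreal (w x) * indicator {x \<in> hcube (centred (N0 + N)). 1 < g x} x) \<partial>lebesgue)"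
      proof (rule nn_integral_cong)
        fix x :: 'a
        obtain N where "norm x < real N" using reals_Archimedean2 by blast
        then have xN: "x \<in> hcube (centred (N0 + N))" by (intro norm_less_centred) simp
        show "ennreal (w x) * indicator {x. 1 < g x} x = (SUP N. ennreal (w x) * indicator {x \<in> hcube (centred (N0 + N)). 1 < g x} x)"
        proof (rule antisym)
          show "ennreal (w x) * indicator {x. 1 < g x} x \<le> (SUP N. ennreal (w x) * indicator {x \<in> hcube (centred (N0 + N)). 1 < g x} x)"
            using xN by (intro SUP_upper2[of N]) (auto split: split_indicator)
          show "(SUP N. ennreal (w x) * indicator {x \<in> hcube (centred (N0 + N)). 1 < g x} x) \<le> ennreal (w x) * indicator {x. 1 < g x} x"
            by (intro SUP_least) (auto split: split_indicator)
        qed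
      qed
      also have "\<dots> = (SUP N. \<integral>\<^sup>+ x. ennreal (w x) * indicator {x \<in> hcube (centred (N0 + N)). 1 < g x} x \<partial>lebesgue)"
      proof (rule nn_integral_monotone_convergence_SUP)
        show "incseq (\<lambda>N x. ennreal (w x) * indicator {x \<in> hcube (centred (N0 + N)). 1 < g x} x)"
        proof (intro incseq_SucI le_funI mult_left_mono)
          fix N :: nat and x :: 'a
          have "hcube (centred (N0 + N)) \<subseteq> hcube (centred (N0 + Suc N) :: 'a \<times> real)" by (intro centred_mono) simp
          then show "indicator {x \<in> hcube (centred (N0 + N)). 1 < g x} x \<le> (indicator {x \<in> hcube (centred (N0 + Suc N)). 1 < g x} x :: ennreal)"
            by (auto split: split_indicator)
        qed simp
        fix N
        have "hcube (centred (N0 + N)) \<inter> {x. 1 < g x} \<in> sets lebesgue"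
          using sets_Collect_gt_lebesgue[OF gm, of 1] by auto
        moreover have "hcube (centred (N0 + N)) \<inter> {x. 1 < g x} = {x \<in> hcube (centred (N0 + N)). 1 < g x}" by auto
        ultimately have "{x \<in> hcube (centred (N0 + N)). 1 < g x} \<in> sets lebesgue" by (simp only:)
        then show "(\<lambda>x. ennreal (w x) * indicator {x \<in> hcube (centred (N0 + N)). 1 < g x} x) \<in> borel_measurable lebesgue"
          using weightD(2)[OF w] by (intro borel_measurable_times_ennreal borel_measurable_indicator measurable_compose[OF _ measurable_ennreal])
      qed
      also have "\<dots> \<le> ?k * ?I"
      proof (rule SUP_least)
        fix N
        have "\<forall>x. x \<notin> dcube (centred (N0 + N)) \<longrightarrow> f' x = 0"
          using f'0[of _ "N0 + N"] hcube_subset_dcube[OF snd_centred, of "N0 + N"] by auto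
        from C(2)[OF b1 w e1 mono sm f'm B' snd_centred this]
        show "(\<integral>\<^sup>+ x. ennreal (w x) * indicator {x \<in> hcube (centred (N0 + N)). 1 < g x} x \<partial>lebesgue) \<le> ?k * ?I"
          by (simp only: nf' g_def)
      qed
      finally show ?thesis .
    qed
    then show "(\<integral>\<^sup>+ x \<in> {x. norm (iter_comm T b m f x) > t}. ennreal (w x) \<partial>lebesgue)
       \<le> ennreal (C * max (\<Sum>r. 1 / eps (2 ^ (2 ^ r))) 1) *
          (\<integral>\<^sup>+ x. ennreal (Phi m (enn2real (bmo_norm b) ^ m * norm (f x) / t))
                  * M_eps eps (Phi m) (m + 1) w x \<partial>lebesgue)"
      by (simp only: be_def)
  qed
qed

end
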